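(* Let $s\in(0,1)$ and $n\ge2s$ ($n$ a positive integer). The Hilbert space $\mathbb L^2_\ddag=\mathbb L^2_\ddag(s)$ has a complete (orthonormal) basis $\{\omega_k^{(s)}\}_{k\in\mathbb N}$ of eigenfunctions of $L_s^*$, that is, $$L_s^*\,\omega_k^{(s)}=\nu_k\,\omega_k^{(s)},\qquad \nu_k=k\in\mathbb N,$$ where, up to a multiplicative constant, $$\omega_k^{(s)}(r)=\Phi_s^*\left\{\frac{2s}{\Gamma(k+\frac n2)}L_k^{(\frac{n-2}2)}\big(\tfrac{r^{2s}}4\big)\right\},\qquad k\in\mathbb N.$$
   Context: $\mathbb N$ includes $0$; $L_k^{(\alpha)}$ is the generalized Laguerre polynomial, orthogonal on $(0,\infty)$ for the weight $x^\alpha e^{-x}$. All functions are radial on $\mathbb R^n$, $r=|x|$. Fourier transform: $\widehat u(\xi)=(2\pi)^{-n/2}\int_{\mathbb R^n} e^{-ix\cdot\xi}u(x)\,dx$, written $\widehat u(\zeta)$, $\zeta=|\xi|$, for radial $u$. $(-\Delta)^s$ has symbol $|\xi|^{2s}$. Let $L_su=(-\Delta)^su-\frac1{2s}r\partial_ru-\frac n{2s}u$; its formal $L^2(\mathbb R^n)$-adjoint is $L_s^*w=(-\Delta)^sw+\frac1{2s}r\partial_rw$. For radial $u$, $u^\dag(\rho)$ is the radial function on $\mathbb R^n$ whose Fourier transform in the radial variable $\vartheta$ is $\widehat u(\vartheta^{1/s})$. $\mathbb L^2_\dag$ is the Hilbert space of radial (tempered distributions) $u$ whose Fourier transform is a function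 and with $u^\dag\in L^2_r(\mathbb R^n,e^{|x|^2/4})$, with scalar product $\int_0^\infty u_1^\dag\overline{u_2^\dag}e^{\rho^2/4}\rho^{n-1}d\rho$. Put $\Phi_s^{-1}u(r)=\big(\frac{r^{2s}}4\big)^{\frac n2-\frac n{2s}}u^\dag(r^s)$. $\Phi_s^*$ is the operator with Mellin multiplier $\Lambda_s^*(z)=2^z\frac{\Gamma(\frac z2)}{\Gamma(\frac n2-\frac z2)}2^{-\frac zs}\frac{\Gamma(\frac n2-\frac z{2s})}{\Gamma(\frac z{2s})}$, i.e. $\mathcal M\{\Phi_s^*W\}(z)=\Lambda^*_s(z)\mathcal MW(z)$, $\mathcal Mf(z)=\int_0^\infty r^zf(r)\frac{dr}r$, for nice $W$. Equivalently it is defined by duality: for $W\in L^2((0,\infty),e^{-r^{2s}/4}r^{sn-1}dr)$, $w=\Phi_s^*W$ is the functional on $\mathbb L^2_\dag$ given by $$\int_0^\infty u\,w\,r^{n-1}dr:=2^{n-\frac ns}\int_0^\infty\Phi_s^{-1}u(r)\,W(r)\,r^{n-1}\,dr .$$ $\mathbb L^2_\ddag$ is the $L^2$-dual of $\mathbb L^2_\dag$, i.e. the space of all such $w=\Phi_s^*W$, with $(\Phi_s^* )^{-1}w=W$ and scalar product $$\langle w_1,w_2\rangle_\ddag=\int_0^\infty(\Phi_s^* )^{-1}w_1(r)\,\overline{(\Phi_s^* )^{-1}w_2(r)}\,e^{-\frac{r^{2s}}4}r^{sn-1}\,dr.$$ $L_s^*$ acts on $\mathbb L^2_\ddag$ by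 duality with $L_s$ on $\mathbb L^2_\dag$ through the pairing $(u,w)\mapsto\int_0^\infty u\,w\,r^{n-1}dr=2^{n-\frac ns}\int_0^\infty\Phi_s^{-1}u(r)\,(\Phi_s^* )^{-1}w(r)\,r^{n-1}\,dr$ of $u\in\mathbb L^2_\dag$ with $w\in\mathbb L^2_\ddag$, i.e. $\int_0^\infty u\,(L_s^*w)\,r^{n-1}dr=\int_0^\infty (L_su)\,w\,r^{n-1}dr$ for all $u$ in the domain of $L_s$ in $\mathbb L^2_\dag$. *)

theory Defs
  imports "HOL-Analysis.Analysis"
begin

section \<open>Schwartz functions and tempered distributions on \<open>real^'n\<close>\<close>

definition partial_deriv :: "'n \<Rightarrow> (real^'n::finite \<Rightarrow> complex) \<Rightarrow> real^'n \<Rightarrow> complex" where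
  "partial_deriv i \<phi> x = frechet_derivative \<phi> (at x) (axis i 1)"

text \<open>A multi-index is a list of coordinates; \<open>foldr partial_deriv is \<phi>\<close> is the iterated derivative.\<close>

definition schwartz :: "(real^'n::finite \<Rightarrow> complex) set" where
  "schwartz = {\<phi>. \<forall>is.
     (\<forall>x. foldr partial_deriv is \<phi> differentiable (at x)) \<and>
     (\<forall>N. \<exists>C. \<forall>x. (1 + norm x) ^ N * norm (foldr partial_deriv is \<phi> x) \<le> C)}"

definition schwartz_norm :: "nat \<Rightarrow> (real^'n::finite \<Rightarrow> complex) \<Rightarrow> real" where
  "schwartz_norm N \<phi> =
     (SUP (is, x) \<in> {is. length is \<le> N} \<times> UNIV. (1 + norm x) ^ N * norm (foldr partial_deriv is \<phi> x))"

type_synonym 'n dist = "(real^'n \<Rightarrow> complex) \<Rightarrow> complex"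

text \<open>Functionals are total functions in HOL; every distribution is set to \<open>0\<close> off \<^const>\<open>schwartz\<close>,
  so that HOL equality is equality of distributions.\<close>

definition tempered :: "'n::finite dist \<Rightarrow> bool" where
  "tempered T \<longleftrightarrow>
     (\<forall>\<phi>\<in>schwartz. \<forall>\<psi>\<in>schwartz. T (\<lambda>x. \<phi> x + \<psi> x) = T \<phi> + T \<psi>) \<and>
     (\<forall>\<phi>\<in>schwartz. \<forall>c. T (\<lambda>x. c * \<phi> x) = c * T \<phi>) \<and>
     (\<exists>C N. \<forall>\<phi>\<in>schwartz. norm (T \<phi>) \<le> C * schwartz_norm N \<phi>) \<and>
     (\<forall>\<phi>. \<phi> \<notin> schwartz \<longrightarrow> T \<phi> = 0)"

definition radial_dist :: "'n::finite dist \<Rightarrow> bool" where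
  "radial_dist T \<longleftrightarrow> (\<forall>A. orthogonal_transformation A \<longrightarrow> (\<forall>\<phi>\<in>schwartz. T (\<phi> \<circ> A) = T \<phi>))"

definition tempered_fun :: "(real^'n::finite \<Rightarrow> complex) \<Rightarrow> bool" where
  "tempered_fun g \<longleftrightarrow> g \<in> borel_measurable borel \<and> (\<forall>\<phi>\<in>schwartz. integrable lborel (\<lambda>x. g x * \<phi> x))"

definition dist_of :: "(real^'n::finite \<Rightarrow> complex) \<Rightarrow> 'n dist" where
  "dist_of g = (\<lambda>\<phi>. if \<phi> \<in> schwartz then LINT x|lborel. g x * \<phi> x else 0)"

definition fourier :: "(real^'n::finite \<Rightarrow> complex) \<Rightarrow> real^'n \<Rightarrow> complex" where
  "fourier \<phi> \<xi> =
     of_real ((2 * pi) powr (- real CARD('n) / 2)) * (LINT x|lborel. cis (- (x \<bullet> \<xi>)) * \<phi> x)"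

definition dist_fourier :: "'n::finite dist \<Rightarrow> 'n dist" where
  "dist_fourier T = (\<lambda>\<phi>. if \<phi> \<in> schwartz then T (fourier \<phi>) else 0)"

text \<open>The Fourier transform of \<open>T\<close> is the function \<open>g\<close> (which is then determined almost everywhere).\<close>

definition has_fourier_fun :: "'n::finite dist \<Rightarrow> (real^'n \<Rightarrow> complex) \<Rightarrow> bool" where
  "has_fourier_fun T g \<longleftrightarrow> tempered_fun g \<and> dist_fourier T = dist_of g"

definition dist_deriv :: "'n \<Rightarrow> 'n::finite dist \<Rightarrow> 'n dist" where
  "dist_deriv i T = (\<lambda>\<phi>. if \<phi> \<in> schwartz then - T (partial_deriv i \<phi>) else 0)"

definition dist_coord_mult :: "'n \<Rightarrow> 'n::finite dist \<Rightarrow> 'n dist" where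
  "dist_coord_mult i T = (\<lambda>\<phi>. if \<phi> \<in> schwartz then T (\<lambda>x. of_real (x $ i) * \<phi> x) else 0)"

text \<open>\<open>r \<partial>\<^sub>r = x \<cdot> \<nabla>\<close>.\<close>

definition euler_deriv :: "'n::finite dist \<Rightarrow> 'n dist" where
  "euler_deriv T = (\<lambda>\<phi>. \<Sum>i\<in>UNIV. dist_coord_mult i (dist_deriv i T) \<phi>)"

text \<open>The operator \<open>(-\<Delta>)\<^sup>s\<close>, on distributions whose Fourier transform is a function.\<close>

definition frac_laplace :: "real \<Rightarrow> 'n::finite dist \<Rightarrow> 'n dist" where
  "frac_laplace s u = (THE v. tempered v \<and>
     (\<exists>g. has_fourier_fun u g \<and> has_fourier_fun v (\<lambda>\<xi>. of_real (norm \<xi> powr (2 * s)) * g \<xi>)))"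


section \<open>The space \<open>L\<^sup>2\<^sub>\<dagger>\<close> and the operator \<open>L\<^sub>s\<close>\<close>

text \<open>\<open>f\<close> is (the radial profile of) \<open>u\<^sup>\<dagger>\<close>; \<open>h\<close> is the radial profile of the Fourier transform of \<open>u\<close>.\<close>

definition is_dagger :: "real \<Rightarrow> 'n::finite dist \<Rightarrow> (real \<Rightarrow> complex) \<Rightarrow> bool" where
  "is_dagger s u f \<longleftrightarrow>
     tempered_fun (\<lambda>x::real^'n. f (norm x)) \<and>
     (\<exists>h. has_fourier_fun u (\<lambda>\<xi>. h (norm \<xi>)) \<and>
          has_fourier_fun (dist_of (\<lambda>x::real^'n. f (norm x))) (\<lambda>\<xi>. h (norm \<xi> powr (1 / s))))"

text \<open>\<open>u\<^sup>\<dagger>\<close> is determined almost everywhere on \<open>(0,\<infinity>)\<close>; a representative is chosen.\<close>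

definition dagger :: "real \<Rightarrow> 'n::finite dist \<Rightarrow> real \<Rightarrow> complex" where
  "dagger s u = (SOME f. is_dagger s u f)"

definition L2dag :: "real \<Rightarrow> 'n::finite dist set" where
  "L2dag s = {u. tempered u \<and> radial_dist u \<and>
     (\<exists>f. is_dagger s u f \<and>
        integrable lborel (\<lambda>x::real^'n. (norm (f (norm x)))\<^sup>2 * exp ((norm x)\<^sup>2 / 4)))}"

definition L_op :: "real \<Rightarrow> 'n::finite dist \<Rightarrow> 'n dist" where
  "L_op s u = (\<lambda>\<phi>. frac_laplace s u \<phi> - of_real (1 / (2 * s)) * euler_deriv u \<phi>
                     - of_real (real CARD('n) / (2 * s)) * u \<phi>)"

definition dom_L :: "real \<Rightarrow> 'n::finite dist set" where
  "dom_L s = {u \<in> L2dag s. L_op s u \<in> L2dag s}"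

definition Phi_inv :: "real \<Rightarrow> 'n::finite dist \<Rightarrow> real \<Rightarrow> complex" where
  "Phi_inv s u r =
     of_real ((r powr (2 * s) / 4) powr (real CARD('n) / 2 - real CARD('n) / (2 * s))) * dagger s u (r powr s)"


section \<open>The dual space \<open>L\<^sup>2\<^sub>\<ddagger>\<close> and the operator \<open>L\<^sub>s\<^sup>*\<close>\<close>

definition L2_weight :: "nat \<Rightarrow> real \<Rightarrow> real \<Rightarrow> real" where
  "L2_weight n s r = exp (- (r powr (2 * s) / 4)) * r powr (s * real n - 1)"

definition weighted_L2 :: "nat \<Rightarrow> real \<Rightarrow> (real \<Rightarrow> complex) set" where
  "weighted_L2 n s = {W. set_borel_measurable borel {0<..} W \<and>
     set_integrable lborel {0<..} (\<lambda>r. (norm (W r))\<^sup>2 * L2_weight n s r)}"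

text \<open>The value at \<open>u\<close> of the functional \<open>w = \<Phi>\<^sub>s\<^sup>* W\<close> is the (bilinear) pairing
  \<open>\<integral> u w r\<^sup>n\<^sup>-\<^sup>1 dr\<close>. Functionals on \<^const>\<open>L2dag\<close> are set to \<open>0\<close> elsewhere.\<close>

definition Phi_star :: "real \<Rightarrow> (real \<Rightarrow> complex) \<Rightarrow> 'n::finite dist \<Rightarrow> complex" where
  "Phi_star s W = (\<lambda>u::'n dist. if u \<in> L2dag s
     then of_real (2 powr (real CARD('n) - real CARD('n) / s)) *
          (LINT r:{0<..}|lborel. Phi_inv s u r * W r * of_real (r ^ (CARD('n) - 1)))
     else 0)"

definition L2ddag :: "real \<Rightarrow> ('n::finite dist \<Rightarrow> complex) set" where
  "L2ddag s = Phi_star s ` weighted_L2 CARD('n) s"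

text \<open>Elements of \<^const>\<open>weighted_L2\<close> are functions rather than classes modulo null sets;
  a representative of \<open>(\<Phi>\<^sub>s\<^sup>*)\<^sup>-\<^sup>1 w\<close> is chosen.\<close>

definition Phi_star_inv :: "real \<Rightarrow> ('n::finite dist \<Rightarrow> complex) \<Rightarrow> real \<Rightarrow> complex" where
  "Phi_star_inv s w = (SOME W. W \<in> weighted_L2 CARD('n) s \<and> Phi_star s W = w)"

definition inner_ddag ::
    "real \<Rightarrow> ('n::finite dist \<Rightarrow> complex) \<Rightarrow> ('n dist \<Rightarrow> complex) \<Rightarrow> complex" where
  "inner_ddag s w1 w2 = (LINT r:{0<..}|lborel.
     Phi_star_inv s w1 r * cnj (Phi_star_inv s w2 r) * of_real (L2_weight CARD('n) s r))"

definition is_L_star :: "real \<Rightarrow> ('n::finite dist \<Rightarrow> complex) \<Rightarrow> ('n dist \<Rightarrow> complex) \<Rightarrow> bool" where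
  "is_L_star s w v \<longleftrightarrow> v \<in> L2ddag s \<and> (\<forall>u\<in>dom_L s. v u = w (L_op s u))"

definition dom_L_star :: "real \<Rightarrow> ('n::finite dist \<Rightarrow> complex) set" where
  "dom_L_star s = {w \<in> L2ddag s. \<exists>v. is_L_star s w v}"

definition L_star :: "real \<Rightarrow> ('n::finite dist \<Rightarrow> complex) \<Rightarrow> 'n dist \<Rightarrow> complex" where
  "L_star s w = (THE v. is_L_star s w v)"


section \<open>Orthonormal bases and Laguerre polynomials\<close>

definition orthonormal_basis ::
    "('a \<Rightarrow> complex) set \<Rightarrow> (('a \<Rightarrow> complex) \<Rightarrow> ('a \<Rightarrow> complex) \<Rightarrow> complex) \<Rightarrow> (nat \<Rightarrow> 'a \<Rightarrow> complex) \<Rightarrow> bool"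
  where
  "orthonormal_basis V ip e \<longleftrightarrow>
     (\<forall>k. e k \<in> V) \<and>
     (\<forall>j k. ip (e j) (e k) = (if j = k then 1 else 0)) \<and>
     (\<forall>w\<in>V. \<forall>\<epsilon>>0. \<exists>N a. let d = (\<lambda>u. w u - (\<Sum>k<N. a k * e k u)) in sqrt (Re (ip d d)) < \<epsilon>)"

definition laguerre :: "nat \<Rightarrow> real \<Rightarrow> real \<Rightarrow> real" where
  "laguerre k \<alpha> x = (\<Sum>i\<le>k. (-1) ^ i * ((real k + \<alpha>) gchoose (k - i)) * x ^ i / fact i)"

end

theory Submission
  imports Defs
begin

text \<open>In the variable \<open>\<rho> = r\<^sup>s\<close> the functional \<open>\<Phi>\<^sub>s\<^sup>* W\<close> is, up to a constant, integration of \<open>u\<^sup>\<dagger>(\<rho>)\<close> against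
  \<open>W(\<rho>\<^bsup>1/s\<^esup>) \<rho>\<^bsup>n-1\<^esup>\<close>, and the weight of the dual space becomes \<open>e\<^bsup>-\<rho>\<^sup>2/4\<^esup> \<rho>\<^bsup>n-1\<^esup>\<close>. Orthogonality and completeness are
  therefore those of the Laguerre polynomials in \<open>\<rho>\<^sup>2/4\<close>.

  For the eigenvalue equation, let \<open>g(\<theta>)\<close> be the Fourier transform of \<open>u\<^sup>\<dagger>\<close>. The Gaussian decay of \<open>u\<^sup>\<dagger>\<close> makes its
  even moments proportional to the Taylor coefficients \<open>\<alpha>\<^sub>j\<close> of \<open>g\<close> at \<open>\<theta>\<^bsup>2j\<^esup>\<close>, and the pairing of \<open>u\<close> with the
  \<open>k\<close>-th Laguerre functional is a multiple of \<open>\<Sum>\<^sub>i \<alpha>\<^sub>i / (k - i)!\<close>. On the Fourier side \<open>L\<^sub>s\<close> is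
  \<open>\<theta>\<^sup>2 + \<theta> \<partial>\<^sub>\<theta> / 2\<close>, so it maps \<open>\<alpha>\<^sub>j\<close> to \<open>j \<alpha>\<^sub>j + \<alpha>\<^bsub>j-1\<^esub>\<close> and multiplies that sum by \<open>k\<close>. As \<open>L\<^sub>s u\<close> is defined in the
  sense of distributions, the relation between the coefficients is read off from the pairings with
  \<open>e\<^bsup>-a|\<xi>|\<^sup>2\<^esup>\<close> as \<open>a \<rightarrow> \<infinity>\<close>. Finally \<open>L\<^sub>s\<^sup>* w\<close> is unique because the \<open>u\<close> with Gaussian \<open>u\<^sup>\<dagger>\<close> lie in the
  domain of \<open>L\<^sub>s\<close> and separate the functionals.\<close>

section \<open>Radial integration\<close>

text \<open>Why the eigenvalue is \<open>k\<close>: for \<open>g = e^{-\<theta>^2} v\<close> the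
  operator \<open>\<theta>^2 + \<theta> d/d\<theta> / 2\<close> becomes
  \<open>\<theta> v' / 2\<close>, and the sum of \<open>\<alpha>_i / (k - i)!\<close> is the
  coefficient of \<open>\<theta>^{2k}\<close> in \<open>v = e^{\<theta>^2} g\<close>. The Laguerre
  functionals are thus Taylor coefficients of \<open>v\<close> at the origin. The obstacle is that
  \<open>\<theta> = |\<xi>|^s\<close> is not smooth at \<open>\<xi> = 0\<close>. Functions Gaussian
  in \<open>\<theta>\<close> are not Schwartz functions of \<open>\<xi>\<close>, so the weak
  equation cannot be tested directly in the variable \<open>\<theta>\<close>. Gaussians in
  \<open>\<xi>\<close> are admissible, and they turn \<open>\<theta>^{2j}\<close> into a multiple of
  \<open>a^{-sj}\<close> times a common power of \<open>a\<close>. Comparing such expansions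
  replaces any differentiation of \<open>g\<close>. Separation and density live on a half-line with
  Gaussian weights. Both are transported to \<open>[0,1]\<close> by \<open>exp (- c x^2)\<close>,
  where polynomials approximate everything. The objects \<open>dagger\<close> and
  \<open>Phi_star_inv\<close> are choices modulo null sets, so each needs its own uniqueness almost
  everywhere.\<close>

definition pow_meas :: "real \<Rightarrow> real measure" where
  "pow_meas p = density lborel (\<lambda>x. ennreal (indicator {0<..} x * (p * x powr (p - 1))))"

lemma sets_pow_meas [simp, measurable_cong]: "sets (pow_meas p) = sets borel"
  by (simp add: pow_meas_def)

lemma space_pow_meas [simp]: "space (pow_meas p) = UNIV"
  by (simp add: pow_meas_def)

lemma AE_pow_meas_iff:
  assumes "p > 0"
  shows "(AE x in pow_meas p. P x) \<longleftrightarrow> (AE x in lborel. x > 0 \<longrightarrow> P x)"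
proof -
  have "(AE x in pow_meas p. P x) \<longleftrightarrow> (AE x in lborel. 0 < ennreal (indicator {0<..} x * (p * x powr (p - 1))) \<longrightarrow> P x)"
    unfolding pow_meas_def by (subst AE_density) auto
  also have "(\<lambda>x. 0 < ennreal (indicator {0<..} x * (p * x powr (p - 1)))) = (\<lambda>x. x > 0)"
    using assms by (auto simp: indicator_def fun_eq_iff)
  finally show ?thesis by (simp add: fun_eq_iff)
qed

lemma AE_pow_meas_pos: "p > 0 \<Longrightarrow> AE x in pow_meas p. x > 0"
  by (simp add: AE_pow_meas_iff)

lemma emeasure_pow_meas_atMost:
  assumes "p > 0" "x \<ge> 0"
  shows "emeasure (pow_meas p) {..x} = ennreal (x powr p)"
proof -
  have "((\<lambda>y. p * y powr (p - 1)) has_integral p * (x powr (p - 1 + 1) / (p - 1 + 1))) {0..x}"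
    using assms by (intro has_integral_mult_right has_integral_powr_from_0) auto
  then have "((\<lambda>y. p * y powr (p - 1)) has_integral (x powr p)) {0..x}"
    using assms by simp
  from nn_integral_has_integral_lebesgue[OF _ this] assms
  have *: "(\<integral>\<^sup>+ y. indicator {0..x} y * (p * y powr (p - 1)) \<partial>lborel) = ennreal (x powr p)" by simp
  have "emeasure (pow_meas p) {..x} = (\<integral>\<^sup>+ y. ennreal (indicator {0<..} y * (p * y powr (p - 1))) * indicator {..x} y \<partial>lborel)"
    unfolding pow_meas_def by (simp add: emeasure_density)
  also have "\<dots> = (\<integral>\<^sup>+ y. indicator {0..x} y * (p * y powr (p - 1)) \<partial>lborel)"
    by (rule nn_integral_cong) (auto simp: indicator_def)
  finally show ?thesis using * by simp
qed

text \<open>The half-lines \<open>{..x}\<close> are stable under intersection and generate the Borel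
  sets, so a measure is determined by their masses. Every change of variables below reduces to
  computing the mass of one half-line.\<close>

lemma pow_meas_eqI:
  assumes p: "p > 0" "c \<ge> 0" and sets: "sets M = sets borel"
    and em: "\<And>x. x \<ge> 0 \<Longrightarrow> emeasure M {..x} = ennreal (c * x powr p)"
  shows "M = density (pow_meas p) (\<lambda>_. ennreal c)"
proof (rule measure_eqI_generator_eq[where E = "range atMost" and \<Omega> = UNIV and A = "\<lambda>i. {..real i}"])
  show "Int_stable (range (atMost :: real \<Rightarrow> _))"
    by (auto simp: Int_stable_def)
  have emD: "emeasure (density (pow_meas p) (\<lambda>_. ennreal c)) {..x} = ennreal (c * x powr p)" if "x \<ge> 0" for x
    using that p by (simp add: emeasure_density_const emeasure_pow_meas_atMost ennreal_mult')
  have neg: "emeasure N {..x} = 0" if "x < 0" "sets N = sets borel" "emeasure N {..0} = 0" for x :: real and N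
    by (rule emeasure_eq_0[OF _ that(3)]) (use that in auto)
  show "emeasure M X = emeasure (density (pow_meas p) (\<lambda>_. ennreal c)) X" if X: "X \<in> range atMost" for X
  proof -
    from X obtain x where x: "X = {..x}" by auto
    show ?thesis
    proof (cases "x \<ge> 0")
      case True then show ?thesis using em emD x by simp
    next
      case False
      then show ?thesis using neg[of x M] neg[of x "density (pow_meas p) (\<lambda>_. ennreal c)"] em[of 0] emD[of 0] sets p x
        by simp
    qed
  qed
  show "sets M = sigma_sets UNIV (range atMost)"
    using sets by (simp add: borel_eq_atMost)
  show "sets (density (pow_meas p) (\<lambda>_. ennreal c)) = sigma_sets UNIV (range atMost)"
    by (simp add: borel_eq_atMost)
  show "(\<Union>i. {..real i}) = UNIV" by (auto simp: real_arch_simple)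
  show "emeasure M {..real i} \<noteq> \<infinity>" for i using em[of "real i"] by simp
qed auto

text \<open>Polar coordinates without a surface measure: the preimage of a half-line under the norm
  is a ball, whose volume is known.\<close>

lemma distr_norm_lborel:
  "distr lborel borel (norm :: real^'n \<Rightarrow> real)
     = density (pow_meas (real CARD('n::finite))) (\<lambda>_. ennreal (unit_ball_vol (real CARD('n))))"
proof (rule pow_meas_eqI)
  fix x :: real assume "x \<ge> 0"
  have "norm -` {..x} \<inter> space lborel = cball (0::real^'n) x" by auto
  then have "emeasure (distr lborel borel (norm :: real^'n \<Rightarrow> real)) {..x} = emeasure lborel (cball (0::real^'n) x)"
    by (subst emeasure_distr) auto
  also have "\<dots> = ennreal (unit_ball_vol (real CARD('n)) * x powr real CARD('n))"
    using \<open>x \<ge> 0\<close> by (subst emeasure_cball) (auto simp: powr_realpow')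
  finally show "emeasure (distr lborel borel (norm :: real^'n \<Rightarrow> real)) {..x} = \<dots>" .
qed auto

text \<open>\<open>pow_meas p\<close> is normalised to give \<open>{..x}\<close> the mass
  \<open>x powr p\<close>, so that for \<open>a = 1\<close> a power substitution only rescales the
  exponent and produces no constant. In particular \<open>r powr s\<close> carries
  \<open>pow_meas (s * n)\<close> to \<open>pow_meas n\<close>.\<close>

lemma distr_powr_pow_meas:
  assumes "p > 0" "a > 0" "q > 0"
  shows "distr (pow_meas p) borel (\<lambda>x. a * x powr q) = density (pow_meas (p / q)) (\<lambda>_. ennreal (a powr (- p / q)))"
proof (rule pow_meas_eqI)
  fix y :: real assume y: "y \<ge> 0"
  have eq: "a * x powr q \<le> y \<longleftrightarrow> x \<le> (y / a) powr (1 / q)" if "x > 0" for x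
  proof -
    have "a * x powr q \<le> y \<longleftrightarrow> x powr q \<le> y / a" using assms by (simp add: field_simps)
    also have "y / a = ((y / a) powr (1 / q)) powr q" using y assms by (simp add: powr_powr)
    also have "x powr q \<le> ((y / a) powr (1 / q)) powr q \<longleftrightarrow> x \<le> (y / a) powr (1 / q)"
      using assms that powr_mono2[of q x "(y / a) powr (1 / q)"] powr_less_mono2[of q "(y / a) powr (1 / q)" x]
      by fastforce
    finally show ?thesis .
  qed
  have "emeasure (distr (pow_meas p) borel (\<lambda>x. a * x powr q)) {..y} = emeasure (pow_meas p) ((\<lambda>x. a * x powr q) -` {..y})"
    by (subst emeasure_distr) auto
  also have "\<dots> = emeasure (pow_meas p) {..(y / a) powr (1 / q)}"
  proof (rule emeasure_eq_AE)
    show "AE x in pow_meas p. x \<in> (\<lambda>x. a * x powr q) -` {..y} \<longleftrightarrow> x \<in> {..(y / a) powr (1 / q)}"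
      using AE_pow_meas_pos[OF assms(1)] by eventually_elim (simp add: eq)
    show "(\<lambda>x. a * x powr q) -` {..y} \<in> sets (pow_meas p)"
      using measurable_sets_borel[of "\<lambda>x. a * x powr q" borel "{..y}"] by simp
  qed auto
  also have "\<dots> = ennreal (((y / a) powr (1 / q)) powr p)" using assms by (simp add: emeasure_pow_meas_atMost)
  also have "((y / a) powr (1 / q)) powr p = (y / a) powr (p / q)" by (simp add: powr_powr)
  also have "(y / a) powr (p / q) = a powr (- p / q) * y powr (p / q)"
    using assms y by (simp add: powr_divide powr_minus field_simps)
  finally show "emeasure (distr (pow_meas p) borel (\<lambda>x. a * x powr q)) {..y} = ennreal (a powr (- p / q) * y powr (p / q))" .
qed (use assms in auto)

lemma
  fixes g :: "real \<Rightarrow> 'b :: {banach, second_countable_topology}"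
  assumes [measurable]: "g \<in> borel_measurable borel" and c: "c > 0" and
     T [measurable]: "T \<in> borel_measurable M" and D: "distr M borel T = density N (\<lambda>_. ennreal c)" and N: "sets N = sets borel"
  shows integrable_distr_const: "integrable M (\<lambda>x. g (T x)) \<longleftrightarrow> integrable N g"
    and integral_distr_const: "integral\<^sup>L M (\<lambda>x. g (T x)) = c *\<^sub>R integral\<^sup>L N g"
proof -
  have m [measurable]: "g \<in> borel_measurable N"
    using assms(1) N by (simp cong: measurable_cong_sets)
  have "integrable M (\<lambda>x. g (T x)) \<longleftrightarrow> integrable (density N (\<lambda>_. ennreal c)) g"
    unfolding D[symmetric] by (subst integrable_distr_eq) auto
  also have "\<dots> \<longleftrightarrow> integrable N (\<lambda>x. c *\<^sub>R g x)"
    using c by (subst integrable_density) auto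
  also have "\<dots> \<longleftrightarrow> integrable N g"
    using c integrable_scaleR_right[of "1 / c" N "\<lambda>x. c *\<^sub>R g x"] integrable_scaleR_right[of c N g] by auto
  finally show "integrable M (\<lambda>x. g (T x)) \<longleftrightarrow> integrable N g" .
  have "integral\<^sup>L M (\<lambda>x. g (T x)) = integral\<^sup>L (density N (\<lambda>_. ennreal c)) g"
    unfolding D[symmetric] by (subst integral_distr) auto
  also have "\<dots> = (\<integral>x. c *\<^sub>R g x \<partial>N)" using c by (subst integral_density) auto
  finally show "integral\<^sup>L M (\<lambda>x. g (T x)) = c *\<^sub>R integral\<^sup>L N g" by simp
qed

lemma
  fixes g :: "real \<Rightarrow> 'b :: {banach, second_countable_topology}"
  assumes "g \<in> borel_measurable borel"
  shows integrable_radial_iff: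
      "integrable lborel (\<lambda>x::real^'n. g (norm x)) \<longleftrightarrow> integrable (pow_meas (real CARD('n::finite))) g"
    and integral_radial:
      "(LINT x::real^'n|lborel. g (norm x)) = unit_ball_vol (real CARD('n)) *\<^sub>R integral\<^sup>L (pow_meas (real CARD('n))) g"
  using integrable_distr_const[OF assms _ _ distr_norm_lborel[where 'n='n]]
        integral_distr_const[OF assms _ _ distr_norm_lborel[where 'n='n]] by auto

lemma
  fixes g :: "real \<Rightarrow> 'b :: {banach, second_countable_topology}"
  assumes "g \<in> borel_measurable borel" and pos: "p > 0" "a > 0" "q > 0"
  shows integrable_pow_meas_powr:
      "integrable (pow_meas p) (\<lambda>x. g (a * x powr q)) \<longleftrightarrow> integrable (pow_meas (p / q)) g"
    and integral_pow_meas_powr: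
      "integral\<^sup>L (pow_meas p) (\<lambda>x. g (a * x powr q)) = a powr (- p / q) *\<^sub>R integral\<^sup>L (pow_meas (p / q)) g"
  using integrable_distr_const[OF assms(1) _ _ distr_powr_pow_meas[OF pos]]
        integral_distr_const[OF assms(1) _ _ distr_powr_pow_meas[OF pos]] pos by auto

lemma AE_distr_const:
  assumes c: "c > 0" and T [measurable]: "T \<in> borel_measurable M" 
    and D: "distr M borel T = density N (\<lambda>_. ennreal c)" 
    and P: "{x. P x} \<in> sets borel"
  shows "(AE x in M. P (T x)) \<longleftrightarrow> (AE x in N. P x)"
proof -
  have "(AE x in M. P (T x)) \<longleftrightarrow> (AE x in distr M borel T. P x)"
    by (subst AE_distr_iff[OF T]) (use P in auto)
  also have "\<dots> \<longleftrightarrow> (AE x in N. P x)"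
    unfolding D using c by (subst AE_density) auto
  finally show ?thesis .
qed

lemma AE_radial_iff:
  assumes "{r. P r} \<in> sets borel"
  shows "(AE x::real^'n in lborel. P (norm x)) \<longleftrightarrow> (AE r in pow_meas (real CARD('n::finite)). P r)"
  by (rule AE_distr_const[OF _ _ distr_norm_lborel]) (use assms in auto)

lemma AE_pow_meas_powr:
  assumes "{r. P r} \<in> sets borel" "p > 0" "q > 0"
  shows "(AE x in pow_meas p. P (x powr q)) \<longleftrightarrow> (AE r in pow_meas (p / q). P r)"
  using AE_distr_const[OF _ _ distr_powr_pow_meas[of p 1 q], of P] assms by simp

lemma
  assumes "p > 0" "m + p > 0"
  shows integrable_pow_meas_Gamma: "integrable (pow_meas p) (\<lambda>x. x powr m * exp (- x))"
    and integral_pow_meas_Gamma: "integral\<^sup>L (pow_meas p) (\<lambda>x. x powr m * exp (- x)) = p * Gamma (m + p)"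
proof -
  have "has_bochner_integral (pow_meas p) (\<lambda>x. x powr m * exp (- x)) (p * Gamma (m + p))"
  proof (rule has_bochner_integral_nn_integral)
    have "(\<integral>\<^sup>+ x. ennreal (x powr m * exp (- x)) \<partial>pow_meas p) =
        (\<integral>\<^sup>+ x. ennreal (indicator {0<..} x * (p * x powr (p - 1))) * ennreal (x powr m * exp (- x)) \<partial>lborel)"
      unfolding pow_meas_def by (subst nn_integral_density) auto
    also have "\<dots> = (\<integral>\<^sup>+ t. ennreal p * ennreal (indicator {0..} t * t powr (m + p - 1) / exp t) \<partial>lborel)"
      using assms by (intro nn_integral_cong)
        (auto simp: indicator_def ennreal_mult'[symmetric] exp_minus field_simps powr_add[symmetric])
    also have "\<dots> = ennreal p * ennreal (Gamma (m + p))"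
      using assms by (subst nn_integral_cmult) (auto simp: Gamma_conv_nn_integral_real)
    also have "\<dots> = ennreal (p * Gamma (m + p))" using assms by (simp add: ennreal_mult')
    finally show "(\<integral>\<^sup>+ x. ennreal (x powr m * exp (- x)) \<partial>pow_meas p) = ennreal (p * Gamma (m + p))" .
  qed (use assms Gamma_real_pos[of "m+p"] in auto)
  then show "integrable (pow_meas p) (\<lambda>x. x powr m * exp (- x))"
     "integral\<^sup>L (pow_meas p) (\<lambda>x. x powr m * exp (- x)) = p * Gamma (m + p)"
    by (auto simp: has_bochner_integral_iff)
qed

text \<open>The substitution \<open>x \<mapsto> a x\<^sup>2\<close>.\<close>

lemma
  assumes "p > 0" "m + p > 0" "a > 0"
  shows integrable_pow_meas_gauss: "integrable (pow_meas p) (\<lambda>x. x powr m * exp (- (a * x\<^sup>2)))"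
    and integral_pow_meas_gauss: "integral\<^sup>L (pow_meas p) (\<lambda>x. x powr m * exp (- (a * x\<^sup>2)))
       = p / 2 * Gamma ((m + p) / 2) * a powr (- (m + p) / 2)"
proof -
  let ?g = "\<lambda>y::real. a powr (- m / 2) * (y powr (m / 2) * exp (- y))"
  have eq: "x powr m * exp (- (a * x\<^sup>2)) = ?g (a * x powr 2)" if "x > 0" for x
  proof -
    have "(x\<^sup>2) powr (m / 2) = x powr m" using that powr_powr[of x 2 "m/2"] by simp
    then show ?thesis using that assms by (simp add: powr_mult powr_minus field_simps)
  qed
  have AE: "AE x in pow_meas p. x powr m * exp (- (a * x\<^sup>2)) = ?g (a * x powr 2)"
    using AE_pow_meas_pos[OF assms(1)] by eventually_elim (rule eq)
  have i: "integrable (pow_meas (p / 2)) ?g"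
    using integrable_pow_meas_Gamma[of "p/2" "m/2"] assms by (intro integrable_mult_right) (auto simp: field_simps)
  have "integrable (pow_meas p) (\<lambda>x. ?g (a * x powr 2))"
    by (subst integrable_pow_meas_powr[where g = ?g]) (use assms i in auto)
  then show "integrable (pow_meas p) (\<lambda>x. x powr m * exp (- (a * x\<^sup>2)))"
    by (subst integrable_cong_AE[OF _ _ AE]) auto
  have "integral\<^sup>L (pow_meas p) (\<lambda>x. x powr m * exp (- (a * x\<^sup>2))) = integral\<^sup>L (pow_meas p) (\<lambda>x. ?g (a * x powr 2))"
    by (rule integral_cong_AE[OF _ _ AE]) auto
  also have "\<dots> = a powr (- p / 2) *\<^sub>R integral\<^sup>L (pow_meas (p / 2)) ?g"
    by (rule integral_pow_meas_powr[where g = ?g]) (use assms in auto)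
  also have "\<dots> = a powr (- p / 2) * (a powr (- m / 2) * (p / 2 * Gamma (m / 2 + p / 2)))"
    using integral_pow_meas_Gamma[of "p/2" "m/2"] assms by simp
  also have "\<dots> = p / 2 * Gamma ((m + p) / 2) * a powr (- (m + p) / 2)"
  proof -
    have 1: "a powr (- p / 2) * a powr (- m / 2) = a powr (- (m + p) / 2)"
      by (subst powr_add[symmetric], rule arg_cong[where f = "\<lambda>e. a powr e"]) (simp add: field_simps)
    have 2: "m / 2 + p / 2 = (m + p) / 2" by (simp add: field_simps)
    show ?thesis unfolding 1[symmetric] 2 by (simp only: ac_simps)
  qed
  finally show "integral\<^sup>L (pow_meas p) (\<lambda>x. x powr m * exp (- (a * x\<^sup>2)))
       = p / 2 * Gamma ((m + p) / 2) * a powr (- (m + p) / 2)" .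
qed

section \<open>Moment problems and density of polynomials\<close>

lemma sum_closed_under_lincomb:
  fixes P :: "('a \<Rightarrow> 'b::comm_semiring_1) \<Rightarrow> bool"
  assumes lin: "\<And>f g a b. P f \<Longrightarrow> P g \<Longrightarrow> P (\<lambda>x. a * f x + b * g x)" and zero: "P (\<lambda>x. 0)"
    and A: "finite A" "\<And>i. i \<in> A \<Longrightarrow> P (F i)"
  shows "P (\<lambda>x. \<Sum>i\<in>A. c i * F i x)"
  using A
proof (induction A)
  case (insert i A)
  then have "P (\<lambda>x. c i * F i x + 1 * (\<Sum>i\<in>A. c i * F i x))" by (intro lin) auto
  with insert show ?case by simp
qed (use zero in simp)

text \<open>A functional monotone class theorem on \<open>[0,1]\<close>, in the order polynomials,
  continuous functions, indicators of rays, indicators of Borel sets, simple functions, bounded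
  functions. Bounds and convergence are asked on \<open>[0,1]\<close> only, since Bernstein
  polynomials are controlled nowhere else.\<close>

lemma bounded_monotone_class:
  fixes P :: "(real \<Rightarrow> real) \<Rightarrow> bool" and f :: "real \<Rightarrow> real"
  assumes lin: "\<And>f g a b. P f \<Longrightarrow> P g \<Longrightarrow> P (\<lambda>x. a * f x + b * g x)"
    and pow: "\<And>j. P (\<lambda>x. x ^ j)"
    and lim: "\<And>F f B. (\<And>i::nat. F i \<in> borel_measurable borel) \<Longrightarrow> f \<in> borel_measurable borel \<Longrightarrow> (\<And>i. P (F i)) \<Longrightarrow>
        (\<And>i x. x \<in> {0..1} \<Longrightarrow> \<bar>F i x\<bar> \<le> B) \<Longrightarrow> (\<And>x. x \<in> {0..1} \<Longrightarrow> (\<lambda>i. F i x) \<longlonglongrightarrow> f x) \<Longrightarrow> P f"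
    and f: "f \<in> borel_measurable borel" and B: "\<And>x. x \<in> {0..1} \<Longrightarrow> \<bar>f x\<bar> \<le> B"
  shows "P f"
proof -
  have zero: "P (\<lambda>x. 0)" using lin[OF pow pow, of 0 0 0 0] by simp
  note sum = sum_closed_under_lincomb[of P, OF lin zero]
  have poly: "P (poly p)" for p
    unfolding poly_altdef[abs_def] by (rule sum) (auto intro: pow)
  have cont: "P g" if g: "continuous_on UNIV g" for g
  proof -
    have gc: "continuous_on {0..1} g" using g continuous_on_subset by blast
    have "bounded (g ` {0..1})"
      using compact_continuous_image[OF gc] compact_imp_bounded by blast
    then obtain C where C: "\<And>x. x \<in> {0..1} \<Longrightarrow> \<bar>g x\<bar> \<le> C"
      by (force simp: bounded_iff)
    \<comment> \<open>Bernstein polynomials of \<open>g\<close>. Their basis functions are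
      nonnegative on \<open>[0,1]\<close> with sum 1, so each \<open>F n\<close> inherits the bound
      \<open>C\<close> of \<open>g\<close>.\<close>
    define F where "F n x = (\<Sum>k\<le>n. g (real k / real n) * Bernstein n k x)" for n x
    have FP: "P (F n)" for n
    proof -
      have eq: "F n = poly (\<Sum>k\<le>n. smult (g (real k / real n) * real (n choose k)) (monom 1 k * [:1, -1:] ^ (n - k)))"
        by (rule ext) (simp add: F_def Bernstein_def poly_sum poly_monom mult.assoc)
      show ?thesis unfolding eq by (rule poly)
    qed
    show ?thesis
    proof (rule lim[where F = F and B = C])
      show "F i \<in> borel_measurable borel" for i
        unfolding F_def Bernstein_def by measurable
      show "g \<in> borel_measurable borel" using g by (rule borel_measurable_continuous_onI)
      show "P (F i)" for i by (rule FP)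
      show "\<bar>F i x\<bar> \<le> C" if x: "x \<in> {0..1}" for i x
      proof -
        have "\<bar>F i x\<bar> \<le> (\<Sum>k\<le>i. \<bar>g (real k / real i) * Bernstein i k x\<bar>)"
          unfolding F_def by (rule sum_abs)
        also have "\<dots> \<le> (\<Sum>k\<le>i. C * Bernstein i k x)"
        proof (rule sum_mono)
          fix k assume "k \<in> {..i}"
          then have "real k / real i \<in> {0..1}" by (cases "i = 0") (auto simp: divide_le_eq)
          with C[of "real k / real i"] x show "\<bar>g (real k / real i) * Bernstein i k x\<bar> \<le> C * Bernstein i k x"
            by (simp add: abs_mult mult_right_mono Bernstein_nonneg)
        qed
        also have "\<dots> = C" using sum_Bernstein[of i x] by (simp add: sum_distrib_left[symmetric])
        finally show ?thesis .
      qed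
      show "(\<lambda>i. F i x) \<longlonglongrightarrow> g x" if x: "x \<in> {0..1}" for x
      proof (rule LIMSEQ_I)
        fix r :: real assume "0 < r"
        from Bernstein_Weierstrass[OF gc this] obtain N where
          "\<And>n x. N \<le> n \<Longrightarrow> x \<in> {0..1} \<Longrightarrow> \<bar>g x - F n x\<bar> < r" unfolding F_def by blast
        then show "\<exists>no. \<forall>n\<ge>no. norm (F n x - g x) < r" using x by (force simp: abs_minus_commute)
      qed
    qed
  qed
  have ind: "P (indicator A)" if A: "A \<in> sets borel" for A :: "real set"
  proof -
    \<comment> \<open>Open rays are stable under intersection, so the pi-lambda induction applies:
      rays, complements and disjoint countable unions suffice.\<close>
    have gen: "A \<in> sigma_sets UNIV (range greaterThan)" using A by (simp add: borel_Ioi)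
    have st: "Int_stable (range (greaterThan :: real \<Rightarrow> _))"
    proof -
      have "{a<..} \<inter> {b<..} = {max a b<..}" for a b :: real by auto
      then show ?thesis by (auto simp: Int_stable_def)
    qed
    have sub: "range (greaterThan :: real \<Rightarrow> _) \<subseteq> Pow UNIV" by simp
    from st sub gen show ?thesis
    proof (induction rule: sigma_sets_induct_disjoint)
      case (basic A)
      then obtain a where a: "A = {a<..}" by auto
      \<comment> \<open>Continuous ramps, clipped to \<open>[0,1]\<close> and of slope
        \<open>i\<close>, converge pointwise to the indicator of the ray.\<close>
      show ?case unfolding a
      proof (rule lim[where F = "\<lambda>i x. min 1 (max 0 (real i * (x - a)))" and B = 1])
        show "P (\<lambda>x. min 1 (max 0 (real i * (x - a))))" for i
          by (rule cont) (intro continuous_intros)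
        show "(\<lambda>i. min 1 (max 0 (real i * (x - a)))) \<longlonglongrightarrow> indicator {a<..} x" for x
        proof (cases "x > a")
          case True
          have "eventually (\<lambda>i. real i \<ge> 1 / (x - a)) sequentially"
            using filterlim_real_sequentially by (simp add: filterlim_at_top)
          then have "eventually (\<lambda>i. min 1 (max 0 (real i * (x - a))) = 1) sequentially"
            by eventually_elim (use True in \<open>auto simp: field_simps min_def max_def\<close>)
          then show ?thesis using True by (simp add: tendsto_eventually)
        next
          case False
          then have "real i * (x - a) \<le> 0" for i by (simp add: mult_nonneg_nonpos)
          then have "min 1 (max 0 (real i * (x - a))) = 0" for i by (simp add: max_absorb1)
          then show ?thesis using False by simp
        qed
      qed auto
    next
      case empty
      then show ?case using zero by (simp add: indicator_def)
    next
      case (compl A)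
      have "indicator (UNIV - A) = (\<lambda>x::real. 1 * x ^ 0 + (-1) * (indicator A x :: real))"
        by (auto simp: fun_eq_iff indicator_def)
      then show ?case using lin[OF pow compl(2), of 1 0 "-1"] by metis
    next
      case (union A)
      have m: "A i \<in> sets borel" for i using union(2) unfolding borel_Ioi by auto
      show ?case
      proof (rule lim[where F = "\<lambda>n x. \<Sum>i<n. 1 * indicator (A i) x" and B = 1])
        have eq: "(\<Sum>i<n. 1 * indicator (A i) x) = (indicator (\<Union>i<n. A i) x :: real)" for n x
        proof -
          have "disjoint_family_on A {..<n}" using union(1) by (rule disjoint_family_on_mono[rotated]) simp
          then show ?thesis by (simp add: indicator_UN_disjoint)
        qed
        show "\<bar>\<Sum>i<n. 1 * indicator (A i) x\<bar> \<le> (1::real)" for n x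
          unfolding eq by (simp add: indicator_def)
        show "P (\<lambda>x. \<Sum>i<n. 1 * indicator (A i) x)" for n
          by (rule sum) (use union in auto)
        show "(\<lambda>n. \<Sum>i<n. 1 * indicator (A i) x) \<longlonglongrightarrow> (indicator (\<Union>i. A i) x :: real)" for x
          unfolding eq by (rule LIMSEQ_indicator_UN)
      qed (use m in auto)
    qed
  qed
  have simple: "P g" if "simple_function borel g" for g :: "real \<Rightarrow> real"
  proof -
    have "g = (\<lambda>x. \<Sum>y\<in>range g. y * indicator (g -` {y}) x)"
    proof
      fix x
      show "g x = (\<Sum>y\<in>range g. y * indicator (g -` {y}) x)"
        using simple_function_indicator_representation_banach[OF that, of x] by (simp only: mult.commute real_scaleR_def space_borel UNIV_I Int_UNIV_right simp_thms)
    qed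
    moreover have "P (\<lambda>x. \<Sum>y\<in>range g. y * indicator (g -` {y}) x)"
    proof (rule sum)
      show "finite (range g)" using simple_functionD(1)[OF that] by simp
      show "P (indicator (g -` {y}))" for y using simple_functionD(2)[OF that, of "{y}"] by (intro ind) simp
    qed
    ultimately show ?thesis by simp
  qed
  have "\<exists>F. (\<forall>i. simple_function borel (F i)) \<and> (\<forall>x. (\<lambda>i. F i x) \<longlonglongrightarrow> f x) \<and> (\<forall>i x. \<bar>F i x\<bar> \<le> 2 * \<bar>f x\<bar>)"
    using borel_measurable_implies_sequence_metric[OF f, of 0] by (simp add: dist_real_def)
  then obtain F where
    F: "\<And>i. simple_function borel (F i)" "\<And>x. (\<lambda>i. F i x) \<longlonglongrightarrow> f x" "\<And>i x. \<bar>F i x\<bar> \<le> 2 * \<bar>f x\<bar>"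
    by blast
  show "P f"
  proof (rule lim[where F = F and B = "2 * B"])
    show "\<bar>F i x\<bar> \<le> 2 * B" if "x \<in> {0..1}" for i x using F(3)[of i x] B[OF that] by simp
  qed (use F f simple in \<open>auto intro: borel_measurable_simple_function\<close>)
qed

text \<open>A Hausdorff moment problem: the image of the complex measure \<open>G dM\<close> under
  \<open>K\<close> lives on \<open>[0,1]\<close> and has vanishing moments, so it integrates every
  bounded Borel function to 0. Integrability of \<open>G\<close> supplies the dominating function
  for the monotone class.\<close>

lemma integral_powers_zero_imp:
  fixes G :: "'a \<Rightarrow> complex"
  assumes G: "integrable M G" and K[measurable]: "K \<in> borel_measurable M" and K01: "\<And>x. x \<in> space M \<Longrightarrow> K x \<in> {0..1}"
    and z: "\<And>j. (LINT x|M. G x * of_real (K x ^ j)) = 0"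
    and f[measurable]: "f \<in> borel_measurable borel" and B: "\<And>x. x \<in> {0..1} \<Longrightarrow> \<bar>f x\<bar> \<le> B"
  shows "(LINT x|M. G x * of_real (f (K x))) = 0"
proof -
  \<comment> \<open>Integrability is made part of \<open>P\<close> so that the integral is additive
    on the linear combinations required by the monotone class.\<close>
  define P where "P f \<longleftrightarrow> integrable M (\<lambda>x. G x * of_real (f (K x))) \<and> (LINT x|M. G x * of_real (f (K x))) = 0"
    for f :: "real \<Rightarrow> real"
  have Gm [measurable]: "G \<in> borel_measurable M" using G by auto
  have int: "integrable M (\<lambda>x. G x * of_real (h (K x)))"
    if [measurable]: "h \<in> borel_measurable borel" and b: "\<And>x. x \<in> {0..1} \<Longrightarrow> \<bar>h x\<bar> \<le> C" for h :: "real \<Rightarrow> real" and C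
  proof (rule Bochner_Integration.integrable_bound)
    show "integrable M (\<lambda>x. C * norm (G x))" using G by auto
    show "AE x in M. norm (G x * complex_of_real (h (K x))) \<le> norm (C * norm (G x))"
    proof (rule AE_I2)
      fix x assume "x \<in> space M"
      with b[OF K01[OF this]] show "norm (G x * complex_of_real (h (K x))) \<le> norm (C * norm (G x))"
        by (auto simp: norm_mult abs_mult mult.commute[of C] intro!: mult_left_mono)
    qed
  qed auto
  have "P f"
  proof (rule bounded_monotone_class[of P])
    fix f g :: "real \<Rightarrow> real" and a b assume "P f" "P g"
    moreover have "G x * of_real (a * f (K x) + b * g (K x))
        = of_real a * (G x * of_real (f (K x))) + of_real b * (G x * of_real (g (K x)))" for x
      by (simp add: algebra_simps)
    ultimately show "P (\<lambda>x. a * f x + b * g x)" unfolding P_def by simp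
  next
    show "P (\<lambda>x. x ^ j)" for j unfolding P_def using z[of j] int[of "\<lambda>x. x ^ j" 1]
      by (auto simp: power_le_one)
  next
    fix F :: "nat \<Rightarrow> real \<Rightarrow> real" and f B
    assume m [measurable]: "\<And>i. F i \<in> borel_measurable borel" "f \<in> borel_measurable borel"
      and P: "\<And>i. P (F i)" and b: "\<And>i x. x \<in> {0..1} \<Longrightarrow> \<bar>F i x\<bar> \<le> B"
      and l: "\<And>x. x \<in> {0..1} \<Longrightarrow> (\<lambda>i. F i x) \<longlonglongrightarrow> f x"
    have fB: "\<bar>f x\<bar> \<le> B" if "x \<in> {0..1}" for x
      using b[OF that] l[OF that] by (intro LIMSEQ_le_const2[OF tendsto_rabs]) auto
    have "(\<lambda>i. LINT x|M. G x * of_real (F i (K x))) \<longlonglongrightarrow> (LINT x|M. G x * of_real (f (K x)))"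
    proof (rule integral_dominated_convergence[where w = "\<lambda>x. B * norm (G x)"])
      show "AE x in M. (\<lambda>i. G x * complex_of_real (F i (K x))) \<longlonglongrightarrow> G x * complex_of_real (f (K x))"
        by (rule AE_I2) (intro tendsto_intros l K01)
      show "AE x in M. norm (G x * complex_of_real (F i (K x))) \<le> B * norm (G x)" for i
      proof (rule AE_I2)
        fix x assume "x \<in> space M"
        with b[OF K01[OF this], of i] show "norm (G x * complex_of_real (F i (K x))) \<le> B * norm (G x)"
          by (auto simp: norm_mult mult.commute[of B] intro!: mult_left_mono)
      qed
    qed (use G in auto)
    moreover have "(LINT x|M. G x * of_real (F i (K x))) = 0" for i using P unfolding P_def by auto
    ultimately have "(LINT x|M. G x * of_real (f (K x))) = 0" using LIMSEQ_unique[OF _ tendsto_const] by simp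
    then show "P f" unfolding P_def using int[OF m(2) fB] by simp
  next
    show "f \<in> borel_measurable borel" "\<And>x. x \<in> {0..1} \<Longrightarrow> \<bar>f x\<bar> \<le> B" by fact+
  qed
  then show ?thesis by (simp add: P_def)
qed

text \<open>Any bounded function of a positive variable is a bounded function of \<open>exp (- c x\<^sup>2)\<close>.\<close>

lemma integral_gaussian_powers_zero_imp_AE:
  fixes G :: "real \<Rightarrow> complex"
  assumes G: "integrable M G" and M: "sets M = sets borel" and pos: "AE x in M. x > 0" and c: "c > 0"
    and z: "\<And>j. (LINT x|M. G x * of_real (exp (- (c * x\<^sup>2)) ^ j)) = 0"
  shows "AE x in M. G x = 0"
proof -
  note [measurable_cong] = M
  have [measurable]: "G \<in> borel_measurable borel" using G M by (metis borel_measurable_integrable measurable_cong_sets)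
  have bdd: "(LINT x|M. G x * of_real (g x)) = 0"
    if g [measurable]: "g \<in> borel_measurable borel" and B: "\<And>x. \<bar>g x\<bar> \<le> B" for g :: "real \<Rightarrow> real" and B
  proof -
    \<comment> \<open>On \<open>x > 0\<close> the map \<open>y \<mapsto> sqrt (- ln y / c)\<close>
      inverts \<open>exp (- (c * x^2))\<close>, so \<open>g\<close> is almost everywhere a bounded
      function of a variable in \<open>[0,1]\<close>.\<close>
    have "(LINT x|M. G x * of_real (g x)) = (LINT x|M. G x * of_real ((\<lambda>y. g (sqrt (- ln y / c))) (exp (- (c * x\<^sup>2)))))"
    proof (rule integral_cong_AE)
      show "AE x in M. G x * complex_of_real (g x) = G x * complex_of_real (g (sqrt (- ln (exp (- (c * x\<^sup>2))) / c)))"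
        using pos by eventually_elim (use c in simp)
    qed (auto simp: measurable_cong_sets[OF M refl])
    also have "\<dots> = 0"
      by (rule integral_powers_zero_imp[OF G _ _ z, where B = B])
         (use B c in \<open>auto simp: measurable_cong_sets[OF M refl]\<close>)
    finally show ?thesis .
  qed
  \<comment> \<open>The test function is the conjugate of \<open>sgn (G x)\<close>, whose product
    with \<open>G x\<close> is \<open>|G x|\<close>. It is split into real and imaginary parts
    because \<open>bdd\<close> admits real test functions only.\<close>
  have b1: "\<bar>Re (cnj (sgn (G x)))\<bar> \<le> 1" "\<bar>Im (cnj (sgn (G x)))\<bar> \<le> 1" for x
    using abs_Re_le_cmod[of "sgn (G x)"] abs_Im_le_cmod[of "sgn (G x)"] by (auto simp: norm_sgn split: if_splits)
  have i: "integrable M (\<lambda>x. G x * of_real (g x))"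
    if [measurable]: "g \<in> borel_measurable borel" and "\<And>x. \<bar>g x\<bar> \<le> 1" for g :: "real \<Rightarrow> real"
    by (rule Bochner_Integration.integrable_bound[OF G])
       (use that in \<open>auto simp: norm_mult mult_left_le measurable_cong_sets[OF M refl]\<close>)
  have "(LINT x|M. of_real (norm (G x)) :: complex) =
     (LINT x|M. G x * of_real (Re (cnj (sgn (G x)))) + \<i> * (G x * of_real (Im (cnj (sgn (G x))))))"
  proof (rule Bochner_Integration.integral_cong[OF refl])
    fix x
    have "of_real (norm (G x)) = G x * cnj (sgn (G x))"
    proof -
      have "cnj (sgn (G x)) = cnj (G x) / of_real (norm (G x))"
        by (simp add: sgn_div_norm scaleR_conv_of_real field_simps)
      then have "G x * cnj (sgn (G x)) = (of_real (norm (G x)))\<^sup>2 / of_real (norm (G x))"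
        by (metis complex_norm_square of_real_power times_divide_eq_right)
      then show ?thesis by (simp add: power2_eq_square)
    qed
    also have "\<dots> = G x * (of_real (Re (cnj (sgn (G x)))) + \<i> * of_real (Im (cnj (sgn (G x)))))"
      using complex_eq[of "cnj (sgn (G x))"] by simp
    finally show "of_real (norm (G x)) = G x * of_real (Re (cnj (sgn (G x)))) + \<i> * (G x * of_real (Im (cnj (sgn (G x)))))"
      by (simp add: algebra_simps)
  qed
  also have "\<dots> = (LINT x|M. G x * of_real (Re (cnj (sgn (G x))))) + \<i> * (LINT x|M. G x * of_real (Im (cnj (sgn (G x)))))"
  proof (subst Bochner_Integration.integral_add)
    show "integrable M (\<lambda>x. G x * of_real (Re (cnj (sgn (G x)))))" by (rule i) (use b1 in auto)
    have "integrable M (\<lambda>x. G x * of_real (Im (cnj (sgn (G x)))))" by (rule i) (use b1 in auto)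
    then show "integrable M (\<lambda>x. \<i> * (G x * of_real (Im (cnj (sgn (G x))))))" by (rule integrable_mult_right)
    show "(LINT x|M. G x * of_real (Re (cnj (sgn (G x))))) + (LINT x|M. \<i> * (G x * of_real (Im (cnj (sgn (G x)))))) =
      (LINT x|M. G x * of_real (Re (cnj (sgn (G x))))) + \<i> * (LINT x|M. G x * of_real (Im (cnj (sgn (G x)))))"
      by (simp only: integral_mult_right_zero)
  qed
  also have "\<dots> = 0"
    using bdd[of "\<lambda>x. Re (cnj (sgn (G x)))" 1] bdd[of "\<lambda>x. Im (cnj (sgn (G x)))" 1] b1 by auto
  finally have "(LINT x|M. norm (G x)) = 0"
    by (metis integral_complex_of_real of_real_eq_0_iff)
  then have "AE x in M. norm (G x) = 0"
    using integral_nonneg_eq_0_iff_AE[of M "\<lambda>x. norm (G x)"] G by auto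
  then show ?thesis by simp
qed

section \<open>Closures of sets of functions in L2\<close>

definition sq_integrable :: "'a measure \<Rightarrow> ('a \<Rightarrow> complex) \<Rightarrow> bool" where
  "sq_integrable M f \<longleftrightarrow> f \<in> borel_measurable M \<and> integrable M (\<lambda>x. (norm (f x))\<^sup>2)"

lemma norm_lincomb_sq_le:
  fixes u v a b :: complex
  shows "(norm (a * u + b * v))\<^sup>2 \<le> 2 * (norm a)\<^sup>2 * (norm u)\<^sup>2 + 2 * (norm b)\<^sup>2 * (norm v)\<^sup>2"
proof -
  have "(norm (a * u + b * v))\<^sup>2 \<le> (norm (a * u) + norm (b * v))\<^sup>2"
    by (intro power_mono norm_triangle_ineq) auto
  also have "\<dots> \<le> 2 * (norm (a * u))\<^sup>2 + 2 * (norm (b * v))\<^sup>2"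
    using sum_squares_bound[of "norm (a * u)" "norm (b * v)"] by (simp add: power2_sum)
  finally show ?thesis by (simp add: norm_mult power_mult_distrib)
qed

lemma
  assumes f: "sq_integrable M f" and g: "sq_integrable M g"
  shows sq_integrable_lincomb: "sq_integrable M (\<lambda>x. a * f x + b * g x)"
    and integral_norm_lincomb_sq_le: "(LINT x|M. (norm (a * f x + b * g x))\<^sup>2) \<le>
       2 * (norm a)\<^sup>2 * (LINT x|M. (norm (f x))\<^sup>2) + 2 * (norm b)\<^sup>2 * (LINT x|M. (norm (g x))\<^sup>2)"
proof -
  have [measurable]: "f \<in> borel_measurable M" "g \<in> borel_measurable M"
    using f g by (auto simp: sq_integrable_def)
  have i: "integrable M (\<lambda>x. 2 * (norm a)\<^sup>2 * (norm (f x))\<^sup>2 + 2 * (norm b)\<^sup>2 * (norm (g x))\<^sup>2)"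
    using f g by (auto simp: sq_integrable_def)
  have j: "integrable M (\<lambda>x. (norm (a * f x + b * g x))\<^sup>2)"
    by (rule Bochner_Integration.integrable_bound[OF i]) (auto intro!: AE_I2 order_trans[OF norm_lincomb_sq_le])
  then show "sq_integrable M (\<lambda>x. a * f x + b * g x)" by (simp add: sq_integrable_def)
  have "(LINT x|M. (norm (a * f x + b * g x))\<^sup>2) \<le> (LINT x|M. 2 * (norm a)\<^sup>2 * (norm (f x))\<^sup>2 + 2 * (norm b)\<^sup>2 * (norm (g x))\<^sup>2)"
    by (intro integral_mono i j norm_lincomb_sq_le)
  also have "\<dots> = 2 * (norm a)\<^sup>2 * (LINT x|M. (norm (f x))\<^sup>2) + 2 * (norm b)\<^sup>2 * (LINT x|M. (norm (g x))\<^sup>2)"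
    using f g by (subst Bochner_Integration.integral_add) (auto simp: sq_integrable_def)
  finally show "(LINT x|M. (norm (a * f x + b * g x))\<^sup>2) \<le>
       2 * (norm a)\<^sup>2 * (LINT x|M. (norm (f x))\<^sup>2) + 2 * (norm b)\<^sup>2 * (LINT x|M. (norm (g x))\<^sup>2)" .
qed

lemma sq_integrable_cong_AE:
  assumes "sq_integrable M f" "g \<in> borel_measurable M" "AE x in M. f x = g x"
  shows "sq_integrable M g"
  unfolding sq_integrable_def
proof
  have "integrable M (\<lambda>x. (norm (f x))\<^sup>2) \<longleftrightarrow> integrable M (\<lambda>x. (norm (g x))\<^sup>2)"
    using assms by (intro integrable_cong_AE) (auto simp: sq_integrable_def)
  with assms show "integrable M (\<lambda>x. (norm (g x))\<^sup>2)" by (simp add: sq_integrable_def)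
qed fact

lemma sq_integrable_diff: "sq_integrable M f \<Longrightarrow> sq_integrable M g \<Longrightarrow> sq_integrable M (\<lambda>x. f x - g x)"
  using sq_integrable_lincomb[of M f g 1 "-1"] by simp

lemma integrable_mult_sq_integrable:
  assumes "sq_integrable M f" "sq_integrable M g"
  shows "integrable M (\<lambda>x. f x * g x)"
proof (rule Bochner_Integration.integrable_bound)
  show "integrable M (\<lambda>x. (norm (f x))\<^sup>2 + (norm (g x))\<^sup>2)" using assms by (auto simp: sq_integrable_def)
  have "norm (f x) * norm (g x) \<le> (norm (f x))\<^sup>2 + (norm (g x))\<^sup>2" for x
  proof -
    have "0 \<le> norm (f x) * norm (g x)" by simp
    with sum_squares_bound[of "norm (f x)" "norm (g x)"] show ?thesis by linarith
  qed
  then show "AE x in M. norm (f x * g x) \<le> norm ((norm (f x))\<^sup>2 + (norm (g x))\<^sup>2)"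
    by (auto simp: norm_mult)
  show "(\<lambda>x. f x * g x) \<in> borel_measurable M" using assms by (auto simp: sq_integrable_def)
qed

text \<open>Works with functions rather than classes, and measures distance by the squared L2 norm.
  Only members of \<open>V\<close> that are themselves square integrable count as
  approximants.\<close>

definition L2_closure :: "'a measure \<Rightarrow> ('a \<Rightarrow> complex) set \<Rightarrow> ('a \<Rightarrow> complex) set" where
  "L2_closure M V = {f. sq_integrable M f \<and> (\<forall>\<epsilon>>0. \<exists>p\<in>V. sq_integrable M p \<and> (LINT x|M. (norm (f x - p x))\<^sup>2) < \<epsilon>)}"

lemma subset_L2_closure: "p \<in> V \<Longrightarrow> sq_integrable M p \<Longrightarrow> p \<in> L2_closure M V"
  unfolding L2_closure_def by force

lemma L2_closure_closed:
  assumes f: "sq_integrable M f" and a: "\<And>\<epsilon>. \<epsilon> > 0 \<Longrightarrow> \<exists>g\<in>L2_closure M V. (LINT x|M. (norm (f x - g x))\<^sup>2) < \<epsilon>"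
  shows "f \<in> L2_closure M V"
  unfolding L2_closure_def
proof (intro CollectI conjI allI impI f)
  fix \<epsilon> :: real assume "\<epsilon> > 0"
  then obtain g where g: "g \<in> L2_closure M V" "(LINT x|M. (norm (f x - g x))\<^sup>2) < \<epsilon> / 4" using a[of "\<epsilon> / 4"] by auto
  moreover have "\<epsilon> / 4 > 0" using \<open>\<epsilon> > 0\<close> by simp
  ultimately obtain p where p: "p \<in> V" "sq_integrable M p" "(LINT x|M. (norm (g x - p x))\<^sup>2) < \<epsilon> / 4"
    unfolding L2_closure_def by blast
  have gs: "sq_integrable M g" using g by (simp add: L2_closure_def)
  have "(LINT x|M. (norm (f x - p x))\<^sup>2) = (LINT x|M. (norm (1 * (f x - g x) + 1 * (g x - p x)))\<^sup>2)" by simp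
  also have "\<dots> \<le> 2 * (norm (1::complex))\<^sup>2 * (LINT x|M. (norm (f x - g x))\<^sup>2) + 2 * (norm (1::complex))\<^sup>2 * (LINT x|M. (norm (g x - p x))\<^sup>2)"
    by (intro integral_norm_lincomb_sq_le sq_integrable_diff f gs p)
  also have "\<dots> < \<epsilon>" using g p by simp
  finally show "\<exists>p\<in>V. sq_integrable M p \<and> (LINT x|M. (norm (f x - p x))\<^sup>2) < \<epsilon>" using p by auto
qed

lemma L2_closure_lincomb:
  assumes V: "\<And>p q a b. p \<in> V \<Longrightarrow> q \<in> V \<Longrightarrow> (\<lambda>x. a * p x + b * q x) \<in> V"
    and f: "f \<in> L2_closure M V" and g: "g \<in> L2_closure M V"
  shows "(\<lambda>x. a * f x + b * g x) \<in> L2_closure M V"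
  unfolding L2_closure_def
proof (intro CollectI conjI allI impI)
  have fs: "sq_integrable M f" and gs: "sq_integrable M g" using f g by (auto simp: L2_closure_def)
  show "sq_integrable M (\<lambda>x. a * f x + b * g x)" using fs gs by (rule sq_integrable_lincomb)
  fix \<epsilon> :: real assume "\<epsilon> > 0"
  define C where "C = 4 * (1 + (norm a)\<^sup>2 + (norm b)\<^sup>2)"
  have C: "C > 0" "2 * (norm a)\<^sup>2 \<le> C / 2" "2 * (norm b)\<^sup>2 \<le> C / 2" by (auto simp: C_def add_pos_nonneg)
  have "\<epsilon> / C > 0" using C \<open>\<epsilon> > 0\<close> by simp
  then obtain p q where p: "p \<in> V" "sq_integrable M p" "(LINT x|M. (norm (f x - p x))\<^sup>2) < \<epsilon> / C"
    and q: "q \<in> V" "sq_integrable M q" "(LINT x|M. (norm (g x - q x))\<^sup>2) < \<epsilon> / C"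
    using f g unfolding L2_closure_def by blast
  have "(LINT x|M. (norm (a * f x + b * g x - (a * p x + b * q x)))\<^sup>2) = (LINT x|M. (norm (a * (f x - p x) + b * (g x - q x)))\<^sup>2)"
    by (simp add: algebra_simps)
  also have "\<dots> \<le> 2 * (norm a)\<^sup>2 * (LINT x|M. (norm (f x - p x))\<^sup>2) + 2 * (norm b)\<^sup>2 * (LINT x|M. (norm (g x - q x))\<^sup>2)"
    by (intro integral_norm_lincomb_sq_le sq_integrable_diff fs gs p q)
  also have "\<dots> \<le> C / 2 * (LINT x|M. (norm (f x - p x))\<^sup>2) + C / 2 * (LINT x|M. (norm (g x - q x))\<^sup>2)"
    by (intro add_mono mult_right_mono C) auto
  also have "\<dots> < C / 2 * (\<epsilon> / C) + C / 2 * (\<epsilon> / C)"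
    by (intro add_strict_mono mult_strict_left_mono p q) (use C in auto)
  also have "\<dots> = \<epsilon>" using C by simp
  finally have "(LINT x|M. (norm (a * f x + b * g x - (a * p x + b * q x)))\<^sup>2) < \<epsilon>" .
  then show "\<exists>p\<in>V. sq_integrable M p \<and> (LINT x|M. (norm (a * f x + b * g x - p x))\<^sup>2) < \<epsilon>"
    using V[OF p(1) q(1), of a b] sq_integrable_lincomb[OF p(2) q(2), of a b] by (intro bexI[of _ "\<lambda>x. a * p x + b * q x"]) auto
qed

text \<open>With an envelope \<open>w\<close> that is square integrable, pointwise convergence is L2
  convergence: the squared differences are bounded by \<open>4 * w^2\<close>. This is the L2
  counterpart of the limit clause of the monotone class.\<close>

lemma L2_closure_dominated:
  assumes F: "\<And>i::nat. F i \<in> L2_closure M V" and [measurable]: "f \<in> borel_measurable M"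
    and w: "integrable M (\<lambda>x. (w x)\<^sup>2)" and b: "\<And>i. AE x in M. norm (F i x) \<le> w x"
    and l: "AE x in M. (\<lambda>i. F i x) \<longlonglongrightarrow> f x"
  shows "f \<in> L2_closure M V"
proof -
  have [measurable]: "F i \<in> borel_measurable M" for i using F by (auto simp: L2_closure_def sq_integrable_def)
  have fw: "AE x in M. norm (f x) \<le> w x"
  proof -
    have "AE x in M. \<forall>i. norm (F i x) \<le> w x" using b by (simp add: AE_all_countable)
    with l show ?thesis by eventually_elim (rule LIMSEQ_le_const2[OF tendsto_norm], auto)
  qed
  have fs: "sq_integrable M f" unfolding sq_integrable_def
  proof (intro conjI)
    show "integrable M (\<lambda>x. (norm (f x))\<^sup>2)"
    proof (rule Bochner_Integration.integrable_bound[OF w])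
      show "AE x in M. norm ((norm (f x))\<^sup>2) \<le> norm ((w x)\<^sup>2)"
        using fw by eventually_elim (auto intro: power_mono)
    qed auto
  qed simp
  show ?thesis
  proof (rule L2_closure_closed[OF fs])
    fix \<epsilon> :: real assume "\<epsilon> > 0"
    have "(\<lambda>i. LINT x|M. (norm (f x - F i x))\<^sup>2) \<longlonglongrightarrow> (LINT x|M. 0)"
    proof (rule integral_dominated_convergence[where w = "\<lambda>x. 4 * (w x)\<^sup>2"])
      show "integrable M (\<lambda>x. 4 * (w x)\<^sup>2)" using w by simp
      show "AE x in M. (\<lambda>i. (norm (f x - F i x))\<^sup>2) \<longlonglongrightarrow> 0"
        using l
      proof eventually_elim
        case (elim x)
        have "(\<lambda>i. (norm (f x - F i x))\<^sup>2) \<longlonglongrightarrow> (norm (f x - f x))\<^sup>2" by (intro tendsto_intros elim)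
        then show ?case by simp
      qed
      show "AE x in M. norm ((norm (f x - F i x))\<^sup>2) \<le> 4 * (w x)\<^sup>2" for i
        using b[of i] fw
      proof eventually_elim
        case (elim x)
        have "norm (f x - F i x) \<le> 2 * w x" using elim norm_triangle_ineq4[of "f x" "F i x"] by simp
        then have "(norm (f x - F i x))\<^sup>2 \<le> (2 * w x)\<^sup>2" by (intro power_mono) auto
        then show ?case by (simp add: power_mult_distrib)
      qed
    qed auto
    then have "eventually (\<lambda>i. (LINT x|M. (norm (f x - F i x))\<^sup>2) < \<epsilon>) sequentially"
      using \<open>\<epsilon> > 0\<close> by (intro order_tendstoD) auto
    then obtain i where "(LINT x|M. (norm (f x - F i x))\<^sup>2) < \<epsilon>" using eventually_happens' by force
    then show "\<exists>g\<in>L2_closure M V. (LINT x|M. (norm (f x - g x))\<^sup>2) < \<epsilon>" using F by blast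
  qed
qed

lemma L2_closure_cong_AE:
  assumes "f \<in> L2_closure M V" "AE x in M. f x = g x" "g \<in> borel_measurable M"
  shows "g \<in> L2_closure M V"
proof (rule L2_closure_dominated[where F = "\<lambda>_. f" and w = "\<lambda>x. norm (f x)"])
  show "AE x in M. (\<lambda>i. f x) \<longlonglongrightarrow> g x" using assms(2) by eventually_elim simp
qed (use assms in \<open>auto simp: L2_closure_def sq_integrable_def\<close>)

text \<open>Multiplication by \<open>exp (- d x\<^sup>2)\<close> with \<open>d\<close> small preserves the closure of the polynomials, because its
  Taylor polynomials are dominated; hence the closure contains all powers of this function.\<close>

lemma even_polynomials_dense:
  fixes M :: "real measure" and d :: real
  assumes M: "sets M = sets borel" and pos: "AE x in M. x > 0" and d: "d > 0"
    and int: "\<And>m. integrable M (\<lambda>x. x ^ (2 * m) * exp (2 * d * x\<^sup>2))"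
    and f: "sq_integrable M f"
  defines "V \<equiv> range (\<lambda>p :: complex poly. \<lambda>x::real. poly p (of_real (x\<^sup>2)))"
  shows "f \<in> L2_closure M V"
proof -
  note [measurable_cong] = M
  have Vlin: "(\<lambda>x. a * p x + b * q x) \<in> V" if "p \<in> V" "q \<in> V" for p q a b
  proof -
    from that obtain P Q where "p = (\<lambda>x. poly P (of_real (x\<^sup>2)))" "q = (\<lambda>x. poly Q (of_real (x\<^sup>2)))" by (auto simp: V_def)
    then have "(\<lambda>x. a * p x + b * q x) = (\<lambda>x. poly (smult a P + smult b Q) (of_real (x\<^sup>2)))" by auto
    then show ?thesis unfolding V_def by blast
  qed
  have lin: "(\<lambda>x. a * f x + b * g x) \<in> L2_closure M V" if "f \<in> L2_closure M V" "g \<in> L2_closure M V" for f g a b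
    by (rule L2_closure_lincomb) (fact Vlin that)+
  have Vm [measurable]: "(\<lambda>x. poly p (complex_of_real (x\<^sup>2))) \<in> borel_measurable borel" for p
    by (intro borel_measurable_continuous_onI continuous_intros)
  have Vm2 [measurable]: "(\<lambda>x. poly p ((complex_of_real x)\<^sup>2)) \<in> borel_measurable borel" for p
    by (intro borel_measurable_continuous_onI continuous_intros)
  \<comment> \<open>The factor 2 in \<open>exp (2 * d * x^2)\<close> of the hypothesis is what
    squaring \<open>exp (d * x^2)\<close> requires.\<close>
  have sqm: "sq_integrable M (\<lambda>x. of_real (exp (d * x\<^sup>2)) * of_real (x\<^sup>2) ^ m)" for m
    unfolding sq_integrable_def
  proof
    have "(norm (of_real (exp (d * x\<^sup>2)) * of_real (x\<^sup>2) ^ m :: complex))\<^sup>2 = x ^ (2 * (2 * m)) * exp (2 * d * x\<^sup>2)" for x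
    proof -
      have "(norm (of_real (exp (d * x\<^sup>2)) * of_real (x\<^sup>2) ^ m :: complex)) = exp (d * x\<^sup>2) * x ^ (2 * m)"
        by (simp add: norm_mult norm_power power_mult)
      moreover have "(exp (d * x\<^sup>2))\<^sup>2 = exp (2 * d * x\<^sup>2)" by (simp add: exp_double[symmetric] mult.assoc)
      moreover have "(x ^ (2 * m))\<^sup>2 = x ^ (2 * (2 * m))" by (simp add: power_mult[symmetric] mult_ac)
      ultimately show ?thesis by (simp add: power_mult_distrib)
    qed
    with int[of "2 * m"] show "integrable M (\<lambda>x. (norm (of_real (exp (d * x\<^sup>2)) * of_real (x\<^sup>2) ^ m :: complex))\<^sup>2)" by simp
  qed simp
  have sq0: "sq_integrable M (\<lambda>x. 0)" by (simp add: sq_integrable_def)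
  have sqe: "sq_integrable M (\<lambda>x. of_real (exp (d * x\<^sup>2)) * poly p (of_real (x\<^sup>2)))" for p
  proof -
    have "sq_integrable M (\<lambda>x. \<Sum>i\<in>A. coeff p i * (of_real (exp (d * x\<^sup>2)) * of_real (x\<^sup>2) ^ i))" if "finite A" for A
      using that
    proof (induction A)
      case (insert i A)
      then have "sq_integrable M (\<lambda>x. coeff p i * (of_real (exp (d * x\<^sup>2)) * of_real (x\<^sup>2) ^ i) +
          1 * (\<Sum>i\<in>A. coeff p i * (of_real (exp (d * x\<^sup>2)) * of_real (x\<^sup>2) ^ i)))"
        by (intro sq_integrable_lincomb sqm) auto
      with insert show ?case by simp
    qed (use sq0 in simp)
    from this[of "{..degree p}"] show ?thesis
      by (simp add: poly_altdef sum_distrib_left mult_ac)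
  qed
  have sqp: "sq_integrable M (\<lambda>x. poly p (of_real (x\<^sup>2)))" for p
    unfolding sq_integrable_def
  proof
    show "integrable M (\<lambda>x. (norm (poly p (complex_of_real (x\<^sup>2))))\<^sup>2)"
    proof (rule Bochner_Integration.integrable_bound)
      show "integrable M (\<lambda>x. (norm (of_real (exp (d * x\<^sup>2)) * poly p (of_real (x\<^sup>2))))\<^sup>2)"
        using sqe[of p] by (simp add: sq_integrable_def)
      have "norm z \<le> norm (complex_of_real (exp (d * x\<^sup>2)) * z)" for x z
        using d by (simp add: norm_mult mult_le_cancel_right1)
      then show "AE x in M. norm ((norm (poly p (complex_of_real (x\<^sup>2))))\<^sup>2)
          \<le> norm ((norm (of_real (exp (d * x\<^sup>2)) * poly p (of_real (x\<^sup>2))))\<^sup>2)"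
        by (simp add: power_mono)
    qed simp
  qed simp
  have VL: "p \<in> L2_closure M V" if "p \<in> V" for p
    using that sqp by (intro subset_L2_closure) (auto simp: V_def)
  have step1: "(\<lambda>x. of_real (exp (- (d * x\<^sup>2))) * poly p (of_real (x\<^sup>2))) \<in> L2_closure M V" for p
  proof (rule L2_closure_dominated)
    let ?F = "\<lambda>N (x::real). (\<Sum>k<N. of_real ((- d) ^ k / fact k) * of_real (x\<^sup>2) ^ k) * poly p (of_real (x\<^sup>2))"
    have Feq: "?F N x = of_real (\<Sum>k<N. (- (d * x\<^sup>2)) ^ k /\<^sub>R fact k) * poly p (of_real (x\<^sup>2))" for N x
    proof -
      have "(- (d * x\<^sup>2)) ^ k /\<^sub>R fact k = ((- d) ^ k / fact k) * (x\<^sup>2) ^ k" for k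
        using power_mult_distrib[of "- d" "x\<^sup>2" k] by (simp add: field_simps)
      then show ?thesis by simp
    qed
    show "?F N \<in> L2_closure M V" for N
    proof (rule VL)
      have "?F N = (\<lambda>x. poly ((\<Sum>k<N. monom (of_real ((- d) ^ k / fact k)) k) * p) (of_real (x\<^sup>2)))"
        by (auto simp: poly_sum poly_monom)
      then show "?F N \<in> V" unfolding V_def by blast
    qed
    show "AE x in M. norm (?F N x) \<le> norm (of_real (exp (d * x\<^sup>2)) * poly p (of_real (x\<^sup>2)))" for N
    proof (rule AE_I2)
      fix x
      have "\<bar>\<Sum>k<N. (- (d * x\<^sup>2)) ^ k /\<^sub>R fact k\<bar> \<le> (\<Sum>k<N. (d * x\<^sup>2) ^ k /\<^sub>R fact k)"
        using d by (intro order_trans[OF sum_abs] sum_mono) (auto simp: abs_mult power_abs)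
      also have "\<dots> \<le> exp (d * x\<^sup>2)"
        unfolding exp_def using d summable_exp_generic[of "d * x\<^sup>2"] by (intro sum_le_suminf) auto
      finally show "norm (?F N x) \<le> norm (of_real (exp (d * x\<^sup>2)) * poly p (of_real (x\<^sup>2)))"
        unfolding Feq norm_mult norm_of_real by (intro mult_right_mono) auto
    qed
    show "AE x in M. (\<lambda>N. ?F N x) \<longlonglongrightarrow> of_real (exp (- (d * x\<^sup>2))) * poly p (of_real (x\<^sup>2))"
    proof -
      have "(\<lambda>N. \<Sum>k<N. (- (d * x\<^sup>2)) ^ k /\<^sub>R fact k) \<longlonglongrightarrow> exp (- (d * x\<^sup>2))" for x
        using summable_LIMSEQ[OF summable_exp_generic[of "- (d * x\<^sup>2)"]] unfolding exp_def .
      then show ?thesis unfolding Feq by (intro AE_I2 tendsto_intros)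
    qed
    show "integrable M (\<lambda>x. (norm (of_real (exp (d * x\<^sup>2)) * poly p (of_real (x\<^sup>2))))\<^sup>2)"
      using sqe[of p] by (simp add: sq_integrable_def)
  qed simp
  \<comment> \<open>Multiplication by \<open>exp (- (d * x^2))\<close> contracts the L2 norm, so it
    carries an approximation of \<open>g\<close> by a polynomial \<open>q\<close> to one by the
    product with \<open>q\<close>, which \<open>step1\<close> places in the closure.\<close>
  have step2: "(\<lambda>x. of_real (exp (- (d * x\<^sup>2))) * g x) \<in> L2_closure M V" if g: "g \<in> L2_closure M V" for g
  proof (rule L2_closure_closed)
    have gs: "sq_integrable M g" using g by (simp add: L2_closure_def)
    have contr: "(norm (of_real (exp (- (d * x\<^sup>2))) * z))\<^sup>2 \<le> (norm z)\<^sup>2" for x :: real and z :: complex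
      using d by (intro power_mono) (auto simp: norm_mult mult_left_le_one_le)
    have sqc: "sq_integrable M (\<lambda>x. of_real (exp (- (d * x\<^sup>2))) * h x)" if h: "sq_integrable M h" for h
      unfolding sq_integrable_def
    proof
      have [measurable]: "h \<in> borel_measurable M" using h by (simp add: sq_integrable_def)
      show "(\<lambda>x. of_real (exp (- (d * x\<^sup>2))) * h x) \<in> borel_measurable M" by measurable
      show "integrable M (\<lambda>x. (norm (of_real (exp (- (d * x\<^sup>2))) * h x))\<^sup>2)"
      proof (rule Bochner_Integration.integrable_bound)
        show "integrable M (\<lambda>x. (norm (h x))\<^sup>2)" using h by (simp add: sq_integrable_def)
        show "AE x in M. norm ((norm (of_real (exp (- (d * x\<^sup>2))) * h x))\<^sup>2) \<le> norm ((norm (h x))\<^sup>2)"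
          using contr by (intro AE_I2) (simp del: norm_mult)
      qed measurable
    qed
    show "sq_integrable M (\<lambda>x. of_real (exp (- (d * x\<^sup>2))) * g x)" by (rule sqc[OF gs])
    fix \<epsilon> :: real assume "\<epsilon> > 0"
    then obtain q where q: "q \<in> V" "sq_integrable M q" "(LINT x|M. (norm (g x - q x))\<^sup>2) < \<epsilon>"
      using g unfolding L2_closure_def by blast
    have "(LINT x|M. (norm (of_real (exp (- (d * x\<^sup>2))) * g x - of_real (exp (- (d * x\<^sup>2))) * q x))\<^sup>2) \<le> (LINT x|M. (norm (g x - q x))\<^sup>2)"
      unfolding right_diff_distrib[symmetric]
      using sqc[OF sq_integrable_diff[OF gs q(2)]] sq_integrable_diff[OF gs q(2)]
      by (intro integral_mono contr) (auto simp: sq_integrable_def)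
    moreover obtain p where "q = (\<lambda>x. poly p (of_real (x\<^sup>2)))" using q by (auto simp: V_def)
    ultimately show "\<exists>h\<in>L2_closure M V. (LINT x|M. (norm (of_real (exp (- (d * x\<^sup>2))) * g x - h x))\<^sup>2) < \<epsilon>"
      using step1[of p] q by (intro bexI[of _ "\<lambda>x. of_real (exp (- (d * x\<^sup>2))) * q x"]) auto
  qed
  have pow: "(\<lambda>x. of_real (exp (- (d * x\<^sup>2)) ^ j)) \<in> L2_closure M V" for j
  proof (induction j)
    case 0
    have "(\<lambda>x. poly 1 (of_real (x\<^sup>2))) \<in> L2_closure M V" by (rule VL) (unfold V_def, rule rangeI)
    then show ?case by simp
  next
    case (Suc j)
    from step2[OF this] show ?case by simp
  qed
  have fin: "integrable M (\<lambda>x. C)" for C :: real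
    using sqp[of "1"] integrable_mult_right[of C M "\<lambda>x. 1"] by (simp add: sq_integrable_def)
  have bdd: "(\<lambda>x. of_real (h x)) \<in> L2_closure M V"
    if h [measurable]: "h \<in> borel_measurable borel" and B: "\<And>x. \<bar>h x\<bar> \<le> B" for h :: "real \<Rightarrow> real" and B
  proof -
    \<comment> \<open>The monotone class argument is run for functions of
      \<open>exp (- (d * x^2))\<close>, all powers of which are in the closure by
      \<open>pow\<close>.\<close>
    define P where "P k \<longleftrightarrow> (\<lambda>x. complex_of_real (k (exp (- (d * x\<^sup>2))))) \<in> L2_closure M V" for k :: "real \<Rightarrow> real"
    have "P (\<lambda>y. h (sqrt (- ln y / d)))"
    proof (rule bounded_monotone_class[of P])
      fix f g :: "real \<Rightarrow> real" and a b assume "P f" "P g"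
      from lin[OF this[unfolded P_def], of "of_real a" "of_real b"]
      show "P (\<lambda>x. a * f x + b * g x)" by (simp add: P_def)
    next
      show "P (\<lambda>x. x ^ j)" for j unfolding P_def by (rule pow)
    next
      fix F :: "nat \<Rightarrow> real \<Rightarrow> real" and f B
      assume m [measurable]: "\<And>i. F i \<in> borel_measurable borel" "f \<in> borel_measurable borel"
        and P: "\<And>i. P (F i)" and b: "\<And>i x. x \<in> {0..1} \<Longrightarrow> \<bar>F i x\<bar> \<le> B"
        and l: "\<And>x. x \<in> {0..1} \<Longrightarrow> (\<lambda>i. F i x) \<longlonglongrightarrow> f x"
      show "P f" unfolding P_def
      proof (rule L2_closure_dominated)
        show "(\<lambda>x. complex_of_real (F i (exp (- (d * x\<^sup>2))))) \<in> L2_closure M V" for i using P[of i] by (simp add: P_def)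
        show "AE x in M. (\<lambda>i. complex_of_real (F i (exp (- (d * x\<^sup>2))))) \<longlonglongrightarrow> complex_of_real (f (exp (- (d * x\<^sup>2))))"
          using d by (intro AE_I2 tendsto_intros l) auto
        show "AE x in M. cmod (complex_of_real (F i (exp (- (d * x\<^sup>2))))) \<le> B" for i
          using d b by (intro AE_I2) auto
        show "integrable M (\<lambda>x. B\<^sup>2)" by (rule fin)
      qed simp
    next
      show "\<bar>h (sqrt (- ln y / d))\<bar> \<le> B" for y by (rule B)
    qed simp
    then have "(\<lambda>x. complex_of_real (h (sqrt (- ln (exp (- (d * x\<^sup>2))) / d)))) \<in> L2_closure M V" by (simp add: P_def)
    then show ?thesis
    proof (rule L2_closure_cong_AE)
      show "AE x in M. complex_of_real (h (sqrt (- ln (exp (- (d * x\<^sup>2))) / d))) = complex_of_real (h x)"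
        using pos by eventually_elim (use d in simp)
    qed simp
  qed
  have [measurable]: "f \<in> borel_measurable M" using f by (simp add: sq_integrable_def)
  have sp: "space M = UNIV" using sets_eq_imp_space_eq[OF M] by simp
  \<comment> \<open>From bounded functions to all of L2: simple functions have finite range and are
    therefore bounded, and \<open>2 * norm (f x)\<close> is a square integrable envelope.\<close>
  have "\<exists>F. (\<forall>i. simple_function M (F i)) \<and> (\<forall>x. (\<lambda>i. F i x) \<longlonglongrightarrow> f x) \<and> (\<forall>i x. norm (F i x) \<le> 2 * norm (f x))"
    using borel_measurable_implies_sequence_metric[of f M 0] sp by simp
  then obtain F where F: "\<And>i. simple_function M (F i)" "\<And>x. (\<lambda>i. F i x) \<longlonglongrightarrow> f x" "\<And>i x. norm (F i x) \<le> 2 * norm (f x)"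
    by blast
  show ?thesis
  proof (rule L2_closure_dominated)
    fix i
    have "F i \<in> borel_measurable M" using F(1) by (rule borel_measurable_simple_function)
    then have [measurable]: "F i \<in> borel_measurable borel" using M by (metis measurable_cong_sets)
    have "finite (F i ` UNIV)" using simple_functionD(1)[OF F(1)[of i]] sp by simp
    then obtain B where B: "\<And>x. norm (F i x) \<le> B" using bounded_iff finite_imp_bounded by (metis rangeI)
    have r: "(\<lambda>x. of_real (Re (F i x))) \<in> L2_closure M V"
      by (rule bdd[of _ B]) (use order_trans[OF abs_Re_le_cmod B] in auto)
    have m: "(\<lambda>x. of_real (Im (F i x))) \<in> L2_closure M V"
      by (rule bdd[of _ B]) (use order_trans[OF abs_Im_le_cmod B] in auto)
    show "F i \<in> L2_closure M V" using lin[OF r m, of 1 \<i>] by (simp add: complex_eq[symmetric])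
    show "AE x in M. norm (F i x) \<le> 2 * norm (f x)" using F(3) by simp
  next
    show "AE x in M. (\<lambda>i. F i x) \<longlonglongrightarrow> f x" using F by simp
    show "integrable M (\<lambda>x. (2 * norm (f x))\<^sup>2)" using f by (simp add: sq_integrable_def power_mult_distrib)
  qed simp
qed

section \<open>Schwartz functions\<close>

definition rapid :: "(real^'n::finite \<Rightarrow> complex) \<Rightarrow> bool" where
  "rapid f \<longleftrightarrow> (\<forall>N. \<exists>C. \<forall>x. (1 + norm x) ^ N * norm (f x) \<le> C)"

lemma rapidD:
  assumes "rapid f" obtains C where "C \<ge> 0" "\<And>x. (1 + norm x) ^ N * norm (f x) \<le> C"
proof -
  obtain C where C: "\<And>x. (1 + norm x) ^ N * norm (f x) \<le> C" using assms unfolding rapid_def by blast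
  have "0 \<le> (1 + norm (0::real^'a)) ^ N * norm (f 0)" by simp
  also have "\<dots> \<le> C" by (rule C)
  finally show thesis using C that by blast
qed

lemma rapid_zero [simp]: "rapid (\<lambda>x. 0)"
  by (auto simp: rapid_def intro!: exI[of _ 0])

lemma rapid_add: assumes "rapid f" "rapid g" shows "rapid (\<lambda>x. f x + g x)"
  unfolding rapid_def
proof
  fix N
  obtain C where C: "\<And>x. (1 + norm x) ^ N * norm (f x) \<le> C" using assms(1) unfolding rapid_def by blast
  obtain D where D: "\<And>x. (1 + norm x) ^ N * norm (g x) \<le> D" using assms(2) unfolding rapid_def by blast
  have "(1 + norm x) ^ N * norm (f x + g x) \<le> C + D" for x
  proof -
    have "(1 + norm x) ^ N * norm (f x + g x) \<le> (1 + norm x) ^ N * (norm (f x) + norm (g x))"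
      by (intro mult_left_mono norm_triangle_ineq) auto
    then show ?thesis using C[of x] D[of x] by (simp add: distrib_left)
  qed
  then show "\<exists>C. \<forall>x. (1 + norm x) ^ N * norm (f x + g x) \<le> C" by blast
qed

lemma rapid_dominated:
  assumes f: "rapid f" and b: "\<And>x. norm (g x) \<le> K * (1 + norm x) ^ m * norm (f (A x))"
    and A: "\<And>x. norm (A x) = norm x" and K: "K \<ge> 0"
  shows "rapid g"
  unfolding rapid_def
proof
  fix N
  obtain C where C: "\<And>x. (1 + norm x) ^ (N + m) * norm (f x) \<le> C" using f unfolding rapid_def by blast
  have "(1 + norm x) ^ N * norm (g x) \<le> K * C" for x
  proof -
    have "(1 + norm x) ^ N * norm (g x) \<le> (1 + norm x) ^ N * (K * (1 + norm x) ^ m * norm (f (A x)))"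
      by (intro mult_left_mono b) auto
    also have "\<dots> = K * ((1 + norm (A x)) ^ (N + m) * norm (f (A x)))" by (simp add: power_add A mult_ac)
    also have "\<dots> \<le> K * C" by (intro mult_left_mono C K)
    finally show ?thesis .
  qed
  then show "\<exists>C. \<forall>x. (1 + norm x) ^ N * norm (g x) \<le> C" by blast
qed

section \<open>Partial derivatives and a closure principle for Schwartz functions\<close>

lemma partial_deriv_eq: "(f has_derivative D) (at x) \<Longrightarrow> partial_deriv i f x = D (axis i 1)"
  by (simp add: partial_deriv_def frechet_derivative_at[symmetric])

lemma has_derivative_partial_deriv:
  assumes "f differentiable (at x)"
  shows "(f has_derivative (\<lambda>h. \<Sum>i\<in>UNIV. of_real (h $ i) * partial_deriv i f x)) (at x)"
proof -
  have d: "(f has_derivative frechet_derivative f (at x)) (at x)" using assms by (simp add: frechet_derivative_works)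
  then have lin: "linear (frechet_derivative f (at x))" by (rule has_derivative_linear)
  have "frechet_derivative f (at x) h = (\<Sum>i\<in>UNIV. of_real (h $ i) * partial_deriv i f x)" for h
  proof -
    have "h = (\<Sum>i\<in>UNIV. (h $ i) *\<^sub>R axis i 1)" by (simp add: vec_eq_iff axis_def if_distrib cong: if_cong)
    then have "frechet_derivative f (at x) h = frechet_derivative f (at x) (\<Sum>i\<in>UNIV. (h $ i) *\<^sub>R axis i 1)" by simp
    also have "\<dots> = (\<Sum>i\<in>UNIV. (h $ i) *\<^sub>R frechet_derivative f (at x) (axis i 1))"
      by (simp add: linear_sum[OF lin] linear_scale[OF lin])
    finally show ?thesis by (simp add: partial_deriv_def scaleR_conv_of_real)
  qed
  then have "frechet_derivative f (at x) = (\<lambda>h. \<Sum>i\<in>UNIV. of_real (h $ i) * partial_deriv i f x)" by (rule ext)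
  with d show ?thesis by simp
qed

lemma partial_deriv_add:
  assumes "\<And>x. f differentiable (at x)" "\<And>x. g differentiable (at x)"
  shows "partial_deriv i (\<lambda>x. f x + g x) = (\<lambda>x. partial_deriv i f x + partial_deriv i g x)"
proof
  fix x
  have "((\<lambda>x. f x + g x) has_derivative (\<lambda>h. frechet_derivative f (at x) h + frechet_derivative g (at x) h)) (at x)"
    using assms by (intro has_derivative_add) (auto simp: frechet_derivative_works[symmetric])
  from partial_deriv_eq[OF this] show "partial_deriv i (\<lambda>x. f x + g x) x = partial_deriv i f x + partial_deriv i g x"
    by (simp add: partial_deriv_def)
qed

lemma partial_deriv_mult:
  assumes "f differentiable (at x)" "g differentiable (at x)"
  shows "partial_deriv i (\<lambda>x. f x * g x) x = f x * partial_deriv i g x + partial_deriv i f x * g x"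
proof -
  have "((\<lambda>x. f x * g x) has_derivative (\<lambda>h. f x * frechet_derivative g (at x) h + frechet_derivative f (at x) h * g x)) (at x)"
    using assms by (intro has_derivative_mult) (auto simp: frechet_derivative_works[symmetric])
  from partial_deriv_eq[OF this] show ?thesis
    by (simp add: partial_deriv_def)
qed

lemma differentiable_const_mult: "f differentiable (at x) \<Longrightarrow> (\<lambda>x. c * f x :: complex) differentiable (at x)"
  by (intro derivative_intros)

lemma partial_deriv_const [simp]: "partial_deriv i (\<lambda>x. c) x = 0"
  by (simp add: partial_deriv_def frechet_derivative_const)

lemma has_derivative_coord: "((\<lambda>x::real^'n::finite. complex_of_real (x $ j)) has_derivative (\<lambda>h. complex_of_real (h $ j))) (at x)"
  by (intro has_derivative_of_real bounded_linear_imp_has_derivative bounded_linear_vec_nth)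

lemma differentiable_coord [simp]: "(\<lambda>x::real^'n::finite. complex_of_real (x $ j)) differentiable (at x)"
  using has_derivative_coord differentiable_def by blast

lemma partial_deriv_coord [simp]: "partial_deriv i (\<lambda>x::real^'n::finite. complex_of_real (x $ j)) x = (if i = j then 1 else 0)"
  by (simp add: partial_deriv_eq[OF has_derivative_coord] axis_def)

text \<open>Differentiation usually takes a member of a natural class only to a finite sum of
  members, by the product or chain rule. Closing under sums alone is enough, since scalar factors
  can be absorbed into the class.\<close>

inductive_set fun_sums :: "('a \<Rightarrow> complex) set \<Rightarrow> ('a \<Rightarrow> complex) set" for S where
  zero: "(\<lambda>x. 0) \<in> fun_sums S"
| base: "f \<in> S \<Longrightarrow> f \<in> fun_sums S"
| add: "f \<in> fun_sums S \<Longrightarrow> g \<in> fun_sums S \<Longrightarrow> (\<lambda>x. f x + g x) \<in> fun_sums S"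

lemma fun_sums_sum:
  assumes "finite A" "\<And>i. i \<in> A \<Longrightarrow> f i \<in> fun_sums S"
  shows "(\<lambda>x. \<Sum>i\<in>A. f i x) \<in> fun_sums S"
  using assms by (induction A) (auto intro: fun_sums.intros)

text \<open>Coinduction: iterated derivatives of \<open>f\<close> never leave
  \<open>fun_sums S\<close>, and all members there are differentiable and decay rapidly. Each
  closure property of Schwartz functions then needs first derivatives only.\<close>

lemma schwartz_coinduct:
  assumes S: "\<And>f. f \<in> S \<Longrightarrow> (\<forall>x. f differentiable (at x)) \<and> rapid f \<and> (\<forall>i. partial_deriv i f \<in> fun_sums S)"
    and f: "f \<in> fun_sums S"
  shows "f \<in> schwartz"
proof -
  have X: "(\<forall>x. f differentiable (at x)) \<and> rapid f \<and> (\<forall>i. partial_deriv i f \<in> fun_sums S)" if "f \<in> fun_sums S" for f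
    using that
  proof induction
    case zero
    have "partial_deriv i (\<lambda>x. 0) = (\<lambda>x. 0)" for i by (rule ext) simp
    then show ?case by (auto intro: fun_sums.zero)
  next
    case (add f g)
    then show ?case by (auto simp: partial_deriv_add intro!: rapid_add fun_sums.add)
  qed (use S in auto)
  have "foldr partial_deriv is f \<in> fun_sums S" for "is"
    by (induction "is") (use f X in auto)
  then show ?thesis using X unfolding schwartz_def rapid_def by auto
qed

lemma schwartz_foldr: "\<phi> \<in> schwartz \<Longrightarrow> foldr partial_deriv js \<phi> \<in> schwartz"
  unfolding schwartz_def by (auto simp flip: foldr_append comp_apply[of "foldr partial_deriv _"])

lemma schwartz_partial_deriv: "\<phi> \<in> schwartz \<Longrightarrow> partial_deriv i \<phi> \<in> schwartz"
  using schwartz_foldr[of \<phi> "[i]"] by simp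

lemma schwartz_differentiable: "\<phi> \<in> schwartz \<Longrightarrow> \<phi> differentiable (at x)"
  unfolding schwartz_def by (auto dest!: spec[of _ "[]"])

lemma schwartz_rapid: "\<phi> \<in> schwartz \<Longrightarrow> rapid \<phi>"
  unfolding schwartz_def rapid_def by (auto dest!: spec[of _ "[]"])

lemma schwartz_continuous: "\<phi> \<in> schwartz \<Longrightarrow> continuous_on UNIV \<phi>"
  by (intro continuous_at_imp_continuous_on ballI differentiable_imp_continuous_within) (auto intro: schwartz_differentiable)

lemma schwartz_measurable [measurable]: "\<phi> \<in> schwartz \<Longrightarrow> \<phi> \<in> borel_measurable borel"
  by (intro borel_measurable_continuous_onI schwartz_continuous)

lemma schwartz_add: assumes "f \<in> schwartz" "g \<in> schwartz" shows "(\<lambda>x. f x + g x) \<in> schwartz"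
proof (rule schwartz_coinduct[of schwartz])
  show "(\<lambda>x. f x + g x) \<in> fun_sums schwartz" using assms by (auto intro: fun_sums.intros)
qed (auto intro: schwartz_differentiable schwartz_rapid schwartz_partial_deriv fun_sums.base)

lemma schwartz_zero: "(\<lambda>x. 0) \<in> schwartz"
  by (rule schwartz_coinduct[of "{}"]) (auto intro: fun_sums.zero)

lemma schwartz_sum: "finite A \<Longrightarrow> (\<And>i. i \<in> A \<Longrightarrow> f i \<in> schwartz) \<Longrightarrow> (\<lambda>x. \<Sum>i\<in>A. f i x) \<in> schwartz"
  by (induction A rule: finite_induct) (auto intro: schwartz_add schwartz_zero)

lemma schwartz_mult:
  fixes f g :: "real^'n::finite \<Rightarrow> complex"
  assumes "f \<in> schwartz" "g \<in> schwartz" shows "(\<lambda>x. f x * g x) \<in> schwartz"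
proof -
  define S :: "(real^'n \<Rightarrow> complex) set" where "S = {h. \<exists>f\<in>schwartz. \<exists>g\<in>schwartz. h = (\<lambda>x. f x * g x)}"
  show ?thesis
  proof (rule schwartz_coinduct[of S])
    show "(\<lambda>x. f x * g x) \<in> fun_sums S" using assms by (auto simp: S_def intro: fun_sums.base)
    fix h assume "h \<in> S"
    then obtain f g where f: "f \<in> schwartz" and g: "g \<in> schwartz" and h: "h = (\<lambda>x. f x * g x)" by (auto simp: S_def)
    have d: "h differentiable (at x)" for x unfolding h
      using f g by (intro differentiable_mult schwartz_differentiable)
    obtain C where C: "C \<ge> 0" "\<And>x. norm (f x) \<le> C" using rapidD[OF schwartz_rapid[OF f], of 0] by auto
    have r: "rapid h" unfolding h
      by (rule rapid_dominated[OF schwartz_rapid[OF g], of _ C 0 "\<lambda>x. x"]) (auto simp: norm_mult C intro!: mult_right_mono)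
    have "partial_deriv i h = (\<lambda>x. f x * partial_deriv i g x + partial_deriv i f x * g x)" for i
      unfolding h using f g by (auto simp: partial_deriv_mult schwartz_differentiable)
    moreover have "(\<lambda>x. f x * partial_deriv i g x + partial_deriv i f x * g x) \<in> fun_sums S" for i
      using f g by (intro fun_sums.add fun_sums.base) (auto simp: S_def intro: schwartz_partial_deriv)
    ultimately show "(\<forall>x. h differentiable (at x)) \<and> rapid h \<and> (\<forall>i. partial_deriv i h \<in> fun_sums S)" using d r by simp
  qed
qed

lemma norm_coord_mult_le: "norm (complex_of_real (x $ i) * z) \<le> (1 + norm x) * norm z"
  using component_le_norm_cart[of x i] by (auto simp: norm_mult intro!: mult_right_mono)

lemma schwartz_coord:
  fixes \<phi> :: "real^'n::finite \<Rightarrow> complex"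
  assumes "\<phi> \<in> schwartz" shows "(\<lambda>x. of_real (x $ i) * \<phi> x) \<in> schwartz"
proof -
  \<comment> \<open>The Schwartz functions themselves are included because differentiating the
    coordinate leaves \<open>f\<close> without its factor.\<close>
  define S :: "(real^'n \<Rightarrow> complex) set" where "S = schwartz \<union> {h. \<exists>f\<in>schwartz. h = (\<lambda>x. of_real (x $ i) * f x)}"
  show ?thesis
  proof (rule schwartz_coinduct[of S])
    show "(\<lambda>x. of_real (x $ i) * \<phi> x) \<in> fun_sums S" using assms by (auto simp: S_def intro: fun_sums.base)
    fix h assume "h \<in> S"
    then consider "h \<in> schwartz" | f where "f \<in> schwartz" "h = (\<lambda>x. of_real (x $ i) * f x)" by (auto simp: S_def)
    then show "(\<forall>x. h differentiable (at x)) \<and> rapid h \<and> (\<forall>i. partial_deriv i h \<in> fun_sums S)"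
    proof cases
      case 1
      then show ?thesis
        by (auto simp: S_def intro: schwartz_differentiable schwartz_rapid schwartz_partial_deriv fun_sums.base)
    next
      case (2 f)
      have d: "h differentiable (at x)" for x unfolding 2
        by (intro differentiable_mult schwartz_differentiable 2 differentiable_coord)
      have r: "rapid h" unfolding 2
        by (rule rapid_dominated[OF schwartz_rapid[OF 2(1)], of _ 1 1 "\<lambda>x. x"]) (auto simp: norm_coord_mult_le)
      have "partial_deriv j h = (\<lambda>x. of_real (x $ i) * partial_deriv j f x + (if j = i then f x else 0))" for j
        unfolding 2 by (auto simp: partial_deriv_mult schwartz_differentiable 2)
      moreover have "(\<lambda>x. of_real (x $ i) * partial_deriv j f x + (if j = i then f x else 0)) \<in> fun_sums S" for j
        using 2 by (cases "j = i"; intro fun_sums.add) (auto simp: S_def intro: schwartz_partial_deriv fun_sums.base fun_sums.zero)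
      ultimately show ?thesis using d r by simp
    qed
  qed
qed

lemma schwartz_cmult:
  fixes \<phi> :: "real^'n::finite \<Rightarrow> complex"
  assumes "\<phi> \<in> schwartz" shows "(\<lambda>x. c * \<phi> x) \<in> schwartz"
proof -
  define S :: "(real^'n \<Rightarrow> complex) set" where "S = {h. \<exists>f\<in>schwartz. h = (\<lambda>x. c * f x)}"
  show ?thesis
  proof (rule schwartz_coinduct[of S])
    show "(\<lambda>x. c * \<phi> x) \<in> fun_sums S" using assms by (auto simp: S_def intro: fun_sums.base)
    fix h assume "h \<in> S"
    then obtain f where f: "f \<in> schwartz" and h: "h = (\<lambda>x. c * f x)" by (auto simp: S_def)
    have d: "h differentiable (at x)" for x unfolding h by (intro differentiable_const_mult schwartz_differentiable f)
    have r: "rapid h" unfolding h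
      by (rule rapid_dominated[OF schwartz_rapid[OF f], of _ "norm c" 0 "\<lambda>x. x"]) (auto simp: norm_mult)
    have "partial_deriv i h = (\<lambda>x. c * partial_deriv i f x)" for i
      unfolding h by (auto simp: partial_deriv_mult[of "\<lambda>x. c"] schwartz_differentiable f)
    then show "(\<forall>x. h differentiable (at x)) \<and> rapid h \<and> (\<forall>i. partial_deriv i h \<in> fun_sums S)"
      using d r f by (auto simp: S_def intro!: fun_sums.base schwartz_partial_deriv)
  qed
qed

lemma schwartz_orthogonal:
  assumes A: "orthogonal_transformation (A :: real^'n \<Rightarrow> real^'n::finite)" and \<phi>: "\<phi> \<in> schwartz"
  shows "\<phi> \<circ> A \<in> schwartz"
proof -
  define S :: "(real^'n \<Rightarrow> complex) set" where "S = {h. \<exists>f\<in>schwartz. h = (\<lambda>x. f (A x))}"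
  have lin: "bounded_linear A" using orthogonal_transformation_linear[OF A] linear_conv_bounded_linear by blast
  have "(\<lambda>x. \<phi> (A x)) \<in> schwartz"
  proof (rule schwartz_coinduct[of S])
    show "(\<lambda>x. \<phi> (A x)) \<in> fun_sums S" using \<phi> by (auto simp: S_def intro: fun_sums.base)
    fix h assume "h \<in> S"
    then obtain f where f: "f \<in> schwartz" and h: "h = (\<lambda>x. f (A x))" by (auto simp: S_def)
    have D: "(h has_derivative (\<lambda>y. \<Sum>i\<in>UNIV. of_real (A y $ i) * partial_deriv i f (A x))) (at x)" for x
      unfolding h
      by (rule has_derivative_compose[OF bounded_linear_imp_has_derivative[OF lin]
            has_derivative_partial_deriv[OF schwartz_differentiable[OF f]]])
    have r: "rapid h" unfolding h
      by (rule rapid_dominated[OF schwartz_rapid[OF f], of _ 1 0 A]) (auto simp: orthogonal_transformation_norm[OF A])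
    have "partial_deriv j h = (\<lambda>x. \<Sum>i\<in>UNIV. of_real (A (axis j 1) $ i) * partial_deriv i f (A x))" for j
      by (rule ext) (rule partial_deriv_eq[OF D])
    moreover have "(\<lambda>x. \<Sum>i\<in>UNIV. of_real (A (axis j 1) $ i) * partial_deriv i f (A x)) \<in> fun_sums S" for j
    proof (rule fun_sums_sum)
      show "(\<lambda>x. of_real (A (axis j 1) $ i) * partial_deriv i f (A x)) \<in> fun_sums S" for i
        by (rule fun_sums.base, unfold S_def, rule CollectI,
            rule bexI[of _ "\<lambda>x. of_real (A (axis j 1) $ i) * partial_deriv i f x"])
           (intro refl schwartz_cmult schwartz_partial_deriv f)+
    qed simp
    ultimately show "(\<forall>x. h differentiable (at x)) \<and> rapid h \<and> (\<forall>i. partial_deriv i h \<in> fun_sums S)"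
      using D r by (auto simp: differentiable_def)
  qed
  then show ?thesis by (simp add: comp_def)
qed

section \<open>Gaussians as Schwartz functions\<close>

definition gauss :: "real \<Rightarrow> real^'n::finite \<Rightarrow> complex" where
  "gauss a x = of_real (exp (- (a * (norm x)\<^sup>2)))"

lemma has_derivative_norm_sq: "((\<lambda>x::real^'n::finite. (norm x)\<^sup>2) has_derivative (\<lambda>h. 2 * (x \<bullet> h))) (at x)"
  unfolding power2_norm_eq_inner by (auto intro!: derivative_eq_intros simp: inner_commute)

lemma has_derivative_gauss:
  "(gauss a has_derivative (\<lambda>h. - 2 * of_real a * of_real (x \<bullet> h) * gauss a x)) (at x)"
  unfolding gauss_def[abs_def]
  by (rule has_derivative_eq_rhs[OF has_derivative_of_real[OF has_derivative_exp[OF has_derivative_minus[OF has_derivative_mult_right[OF has_derivative_norm_sq]]]]])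
     (auto simp: fun_eq_iff)

lemma partial_deriv_gauss: "partial_deriv i (gauss a) x = of_real (x $ i) * (- 2 * of_real a * gauss a x)"
  by (simp add: partial_deriv_eq[OF has_derivative_gauss] inner_axis)

text \<open>One term of the exponential series bounds the power by
  \<open>fact N * exp (1 + r)\<close>. Completing the square bounds \<open>1 + r - a * r^2\<close>
  by its value at \<open>r = 1 / (2 * a)\<close>.\<close>

lemma rapid_gauss: assumes "a > 0" shows "rapid (gauss a)"
  unfolding rapid_def
proof
  fix N
  have "(1 + norm x) ^ N * norm (gauss a x) \<le> fact N * exp (1 + 1 / (4 * a))" for x
  proof -
    have "(1 + norm x) ^ N / fact N \<le> exp (1 + norm x)"
    proof -
      have "(1 + norm x) ^ N /\<^sub>R fact N \<le> (\<Sum>k. (1 + norm x) ^ k /\<^sub>R fact k)"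
        using sum_le_suminf[OF summable_exp_generic[of "1 + norm x"], of "{N}"] by (simp add: add_nonneg_nonneg)
      then show ?thesis by (simp add: exp_def divide_inverse mult.commute)
    qed
    then have "(1 + norm x) ^ N \<le> fact N * exp (1 + norm x)" by (simp add: field_simps)
    then have "(1 + norm x) ^ N * norm (gauss a x) \<le> fact N * exp (1 + norm x) * exp (- (a * (norm x)\<^sup>2))"
      by (auto simp: gauss_def intro!: mult_right_mono)
    also have "\<dots> = fact N * exp (1 + norm x - a * (norm x)\<^sup>2)" by (simp add: exp_diff exp_minus field_simps)
    also have "1 + norm x - a * (norm x)\<^sup>2 \<le> 1 + 1 / (4 * a)"
    proof -
      have "0 \<le> (2 * a * norm x - 1)\<^sup>2 / (4 * a)" using assms by simp
      also have "\<dots> = a * (norm x)\<^sup>2 - norm x + 1 / (4 * a)" using assms by (simp add: power2_eq_square field_simps)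
      finally show ?thesis by simp
    qed
    finally show ?thesis by (simp add: mult_left_mono)
  qed
  then show "\<exists>C. \<forall>x. (1 + norm x) ^ N * norm (gauss a x) \<le> C" by blast
qed

text \<open>Polynomials in the coordinates, needed because the derivatives of a Gaussian are such
  polynomials times the same Gaussian.\<close>

inductive_set coord_poly :: "(real^'n::finite \<Rightarrow> complex) set" where
  const: "(\<lambda>x. c) \<in> coord_poly"
| coord: "q \<in> coord_poly \<Longrightarrow> (\<lambda>x. of_real (x $ i) * q x) \<in> coord_poly"
| add: "p \<in> coord_poly \<Longrightarrow> q \<in> coord_poly \<Longrightarrow> (\<lambda>x. p x + q x) \<in> coord_poly"

lemma coord_poly_cmult: "q \<in> coord_poly \<Longrightarrow> (\<lambda>x. c * q x) \<in> coord_poly"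
proof (induction rule: coord_poly.induct)
  case (coord q i)
  from coord_poly.coord[OF coord(2), of i] show ?case by (simp add: mult.left_commute)
next
  case (add p q)
  from coord_poly.add[OF add(3,4)] show ?case by (simp add: distrib_left)
qed (auto intro: coord_poly.const)

lemma coord_poly_differentiable: "q \<in> coord_poly \<Longrightarrow> q differentiable (at x)"
  by (induction rule: coord_poly.induct) (auto intro!: derivative_intros)

lemma coord_poly_partial_deriv: "q \<in> coord_poly \<Longrightarrow> partial_deriv i q \<in> coord_poly"
proof (induction rule: coord_poly.induct)
  case (const c)
  have "partial_deriv i (\<lambda>x. c) = (\<lambda>x. 0)" by (rule ext) simp
  then show ?case by (simp add: coord_poly.const)
next
  case (coord q j)
  have "partial_deriv i (\<lambda>x. of_real (x $ j) * q x) = (\<lambda>x. of_real (x $ j) * partial_deriv i q x + (if i = j then 1 else 0) * q x)"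
    using coord by (auto simp: partial_deriv_mult coord_poly_differentiable)
  moreover have "\<dots> \<in> coord_poly" using coord by (intro coord_poly.add coord_poly.coord coord_poly_cmult)
  ultimately show ?case by simp
next
  case (add p q)
  then show ?case by (auto simp: partial_deriv_add coord_poly_differentiable intro: coord_poly.add)
qed

lemma rapid_coord_poly: assumes "q \<in> coord_poly" "rapid f" shows "rapid (\<lambda>x. q x * f x)"
  using assms
proof (induction arbitrary: f rule: coord_poly.induct)
  case (const c)
  then show ?case by (intro rapid_dominated[OF const, of _ "norm c" 0 "\<lambda>x. x"]) (auto simp: norm_mult)
next
  case (coord q i)
  have "rapid (\<lambda>x. of_real (x $ i) * (q x * f x))"
    by (intro rapid_dominated[OF coord(2)[OF coord(3)], of _ 1 1 "\<lambda>x. x"]) (auto simp del: norm_mult simp: norm_coord_mult_le)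
  then show ?case by (simp add: mult.assoc)
next
  case (add p q)
  from rapid_add[OF add(3,4)[OF add(5)]] show ?case by (simp add: distrib_right)
qed

lemma schwartz_gauss:
  assumes "a > 0"
  shows "(gauss a :: real^'n::finite \<Rightarrow> complex) \<in> schwartz"
proof -
  define S :: "(real^'n \<Rightarrow> complex) set" where "S = {h. \<exists>q\<in>coord_poly. h = (\<lambda>x. q x * gauss a x)}"
  show ?thesis
  proof (rule schwartz_coinduct[of S])
    have "(gauss a :: real^'n \<Rightarrow> complex) \<in> S" unfolding S_def by (auto intro!: bexI[OF _ coord_poly.const[of 1]])
    then show "(gauss a :: real^'n \<Rightarrow> complex) \<in> fun_sums S" by (rule fun_sums.base)
    fix h assume "h \<in> S"
    then obtain q where q: "q \<in> coord_poly" and h: "h = (\<lambda>x. q x * gauss a x)" by (auto simp: S_def)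
    have dg: "gauss a differentiable (at x)" for x using has_derivative_gauss differentiable_def by blast
    have d: "h differentiable (at x)" for x unfolding h by (intro differentiable_mult coord_poly_differentiable q dg)
    have r: "rapid h" unfolding h by (intro rapid_coord_poly q rapid_gauss assms)
    have "partial_deriv i h = (\<lambda>x. (of_real (x $ i) * (- 2 * of_real a * q x) + partial_deriv i q x) * gauss a x)" for i
      unfolding h by (auto simp: partial_deriv_mult dg coord_poly_differentiable q partial_deriv_gauss algebra_simps)
    moreover have "(\<lambda>x. (of_real (x $ i) * (- 2 * of_real a * q x) + partial_deriv i q x)) \<in> coord_poly" for i
      by (intro coord_poly.add coord_poly.coord coord_poly_cmult coord_poly_partial_deriv q)
    ultimately have "partial_deriv i h \<in> fun_sums S" for i
      unfolding S_def by (intro fun_sums.base) auto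
    with d r show "(\<forall>x. h differentiable (at x)) \<and> rapid h \<and> (\<forall>i. partial_deriv i h \<in> fun_sums S)" by simp
  qed
qed

text \<open>A supremum of reals dominates its terms only if the set is bounded above. It is bounded
  here because multi-indices of length at most \<open>N\<close> over a finite type are finite in
  number and each has its own bound.\<close>

lemma schwartz_norm_bound:
  assumes \<phi>: "\<phi> \<in> schwartz" and l: "length is \<le> N"
  shows "(1 + norm x) ^ N * norm (foldr partial_deriv is \<phi> x) \<le> schwartz_norm N \<phi>"
proof -
  let ?f = "\<lambda>(is, x). (1 + norm x) ^ N * norm (foldr partial_deriv is \<phi> x)"
  let ?A = "{is :: 'a list. length is \<le> N}"
  have fin: "finite ?A" using finite_lists_length_le[of "UNIV :: 'a set" N] by simp
  have "\<forall>is. \<exists>C. \<forall>x. (1 + norm x) ^ N * norm (foldr partial_deriv is \<phi> x) \<le> C" using \<phi> by (auto simp: schwartz_def)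
  then obtain C where C: "\<And>is x. (1 + norm x) ^ N * norm (foldr partial_deriv is \<phi> x) \<le> C is" by metis
  have bdd: "bdd_above (?f ` (?A \<times> UNIV))"
  proof (rule bdd_aboveI)
    fix y assume "y \<in> ?f ` (?A \<times> UNIV)"
    then obtain "is" x where "is \<in> ?A" "y = ?f (is, x)" by auto
    then show "y \<le> Max (C ` ?A)" using C[of x "is"] fin by (auto intro: order_trans Max_ge)
  qed
  show ?thesis unfolding schwartz_norm_def using cSUP_upper[OF _ bdd, of "(is, x)"] l by auto
qed

section \<open>Integrals of functions with polynomial decay\<close>

lemma integrable_inverse_power:
  "integrable lborel (\<lambda>x::real^'n::finite. 1 / (1 + norm x) ^ (CARD('n) + 1))"
proof -
  let ?n = "CARD('n)"
  have "integrable (pow_meas (real ?n)) (\<lambda>r. 1 / (1 + \<bar>r\<bar>) ^ (?n + 1))"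
  proof (rule integrableI_bounded)
    have "(\<integral>\<^sup>+ r. ennreal (norm (1 / (1 + \<bar>r\<bar>) ^ (?n + 1))) \<partial>pow_meas (real ?n)) =
       (\<integral>\<^sup>+ r. ennreal (indicator {0<..} r * (real ?n * r powr (real ?n - 1))) * ennreal (norm (1 / (1 + \<bar>r\<bar>) ^ (?n + 1))) \<partial>lborel)"
      unfolding pow_meas_def by (subst nn_integral_density) auto
    also have "\<dots> \<le> (\<integral>\<^sup>+ r. ennreal (real ?n / (1 + r)\<^sup>2) * indicator {0..} r \<partial>lborel)"
    proof (rule nn_integral_mono)
      fix r :: real
      \<comment> \<open>Two powers beyond the radial factor \<open>r^{n-1}\<close> remain, which
        leaves the integrable function \<open>1 / (1 + r)^2\<close>.\<close>
      have key: "r powr (real ?n - 1) * (1 / (1 + r) ^ (?n + 1)) \<le> 1 / (1 + r)\<^sup>2" if r: "r > 0"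
      proof -
        have "r powr (real ?n - 1) \<le> (1 + r) powr (real ?n - 1)" using r by (intro powr_mono2) auto
        also have "(1 + r) powr (real ?n - 1) = (1 + r) ^ (?n - 1)"
          using r by (simp add: powr_realpow[symmetric] of_nat_diff)
        finally have "r powr (real ?n - 1) / (1 + r) ^ (?n + 1) \<le> (1 + r) ^ (?n - 1) / (1 + r) ^ (?n + 1)"
          using r by (intro divide_right_mono) auto
        also have "\<dots> = 1 / (1 + r)\<^sup>2"
        proof -
          have "?n + 1 = (?n - 1) + 2" using zero_less_card_finite[where 'a='n] by linarith
          then have "(1 + r) ^ (?n + 1) = (1 + r) ^ (?n - 1) * (1 + r)\<^sup>2" by (metis power_add)
          then show ?thesis using r by simp
        qed
        finally show ?thesis by simp
      qed
      show "ennreal (indicator {0<..} r * (real ?n * r powr (real ?n - 1))) * ennreal (norm (1 / (1 + \<bar>r\<bar>) ^ (?n + 1)))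
          \<le> ennreal (real ?n / (1 + r)\<^sup>2) * indicator {0..} r"
      proof (cases "r > 0")
        case True
        have "real ?n * r powr (real ?n - 1) * (1 / (1 + r) ^ (?n + 1)) \<le> real ?n / (1 + r)\<^sup>2"
          using mult_left_mono[OF key[OF True], of "real ?n"] by (simp add: mult.assoc)
        moreover have "ennreal (indicator {0<..} r * (real ?n * r powr (real ?n - 1))) * ennreal (norm (1 / (1 + \<bar>r\<bar>) ^ (?n + 1)))
            = ennreal (real ?n * r powr (real ?n - 1) * (1 / (1 + r) ^ (?n + 1)))"
          using True by (subst ennreal_mult'[symmetric]) auto
        ultimately show ?thesis using True by (simp add: ennreal_leI)
      qed simp
    qed
    also have "\<dots> = ennreal (0 - (- (real ?n / (1 + 0))))"
    proof (rule nn_integral_FTC_atLeast)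
      show "((\<lambda>x. - (real ?n / (1 + x))) has_real_derivative real ?n / (1 + x)\<^sup>2) (at x)" if "0 \<le> x" for x :: real
        using that by (auto intro!: derivative_eq_intros simp: power2_eq_square)
      show "((\<lambda>x::real. - (real ?n / (1 + x))) \<longlongrightarrow> 0) at_top"
        by (rule tendsto_eq_intros tendsto_divide_0 filterlim_at_top_imp_at_infinity filterlim_tendsto_add_at_top filterlim_ident | simp)+
    qed auto
    finally show "(\<integral>\<^sup>+ r. ennreal (norm (1 / (1 + \<bar>r\<bar>) ^ (?n + 1))) \<partial>pow_meas (real ?n)) < \<infinity>"
      by (rule order_le_less_trans) simp
  qed simp
  then have "integrable lborel (\<lambda>x::real^'n. (\<lambda>r. 1 / (1 + \<bar>r\<bar>) ^ (?n + 1)) (norm x))"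
    by (subst integrable_radial_iff) auto
  then show ?thesis by simp
qed

definition decay_const :: "'n::finite itself \<Rightarrow> real" where
  "decay_const _ = (LINT x::real^'n|lborel. 1 / (1 + norm x) ^ (CARD('n) + 1))"

lemma
  fixes f :: "real^'n::finite \<Rightarrow> complex"
  assumes [measurable]: "f \<in> borel_measurable borel" and b: "\<And>x. (1 + norm x) ^ (CARD('n) + 1) * norm (f x) \<le> C"
  shows integrable_decay: "integrable lborel f"
    and integral_decay_le: "(LINT x|lborel. norm (f x)) \<le> C * decay_const TYPE('n)"
proof -
  have i: "integrable lborel (\<lambda>x::real^'n. C * (1 / (1 + norm x) ^ (CARD('n) + 1)))"
    by (intro integrable_mult_right integrable_inverse_power)
  have le: "norm (f x) \<le> C * (1 / (1 + norm x) ^ (CARD('n) + 1))" for x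
    using b[of x] by (simp add: field_simps add_pos_nonneg)
  show *: "integrable lborel f"
  proof (rule Bochner_Integration.integrable_bound[OF i])
    show "AE x in lborel. norm (f x) \<le> norm (C * (1 / (1 + norm x) ^ (CARD('n) + 1)))"
    proof (rule AE_I2)
      show "norm (f x) \<le> norm (C * (1 / (1 + norm x) ^ (CARD('n) + 1)))" for x
        using le[of x] abs_ge_self[of "C * (1 / (1 + norm x) ^ (CARD('n) + 1))"] unfolding real_norm_def by linarith
    qed
  qed simp
  have "(LINT x|lborel. norm (f x)) \<le> (LINT x|lborel. C * (1 / (1 + norm (x::real^'n)) ^ (CARD('n) + 1)))"
    using * i le by (intro integral_mono) auto
  also have "\<dots> = C * decay_const TYPE('n)" unfolding decay_const_def by (rule integral_mult_right_zero)
  finally show "(LINT x|lborel. norm (f x)) \<le> C * decay_const TYPE('n)" .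
qed

lemma integrable_rapid:
  assumes "f \<in> borel_measurable borel" "rapid f"
  shows "integrable lborel f"
  using rapidD[OF assms(2)] integrable_decay[OF assms(1)] by metis

lemma schwartz_integrable: "\<phi> \<in> schwartz \<Longrightarrow> integrable lborel \<phi>"
  by (intro integrable_rapid schwartz_measurable schwartz_rapid)

lemma lborel_translate:
  fixes f :: "real^'n::finite \<Rightarrow> complex"
  shows "f \<in> borel_measurable borel \<Longrightarrow> (LINT x|lborel. f (t + x)) = (LINT x|lborel. f x)"
    and "f \<in> borel_measurable borel \<Longrightarrow> integrable lborel (\<lambda>x. f (t + x)) \<longleftrightarrow> integrable lborel f"
  by (subst (2) lborel_distr_plus[symmetric, of t], simp add: integral_distr)
     (subst (2) lborel_distr_plus[symmetric, of t], simp add: integrable_distr_eq)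

lemma add_norm_shift_le: "a \<le> b + c \<Longrightarrow> c \<le> 1 \<Longrightarrow> 0 \<le> b \<Longrightarrow> 1 + a \<le> 2 * (1 + b)" for a b c :: real
  by simp

text \<open>Difference quotients of \<open>\<psi>\<close> integrate to 0 by translation invariance,
  and they converge to \<open>D\<close> under a dominating function. Only the derivative along one
  axis is assumed, so that the lemma also applies to products with \<open>stretched_exp\<close>,
  which need not be smooth at the origin.\<close>

lemma
  fixes \<psi> D :: "real^'n::finite \<Rightarrow> complex"
  assumes \<psi>: "integrable lborel \<psi>" and Dm [measurable]: "D \<in> borel_measurable borel"
    and D: "\<And>x. ((\<lambda>t. \<psi> (x + t *\<^sub>R axis i 1)) has_vector_derivative D x) (at 0)"
    and b: "\<And>x. (1 + norm x) ^ (CARD('n) + 1) * norm (D x) \<le> C"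
  shows integral_partial_zero: "(LINT x|lborel. D x) = 0"
proof -
  let ?n = "CARD('n) + 1" and ?e = "axis i 1 :: real^'n"
  have [measurable]: "\<psi> \<in> borel_measurable borel" using \<psi> by auto
  have D': "((\<lambda>t. \<psi> (x + t *\<^sub>R ?e)) has_vector_derivative D (x + s *\<^sub>R ?e)) (at s)" for x s
  proof -
    have "((\<lambda>t. \<psi> ((x + s *\<^sub>R ?e) + t *\<^sub>R ?e)) has_vector_derivative D (x + s *\<^sub>R ?e)) (at (s - s))"
      using D[of "x + s *\<^sub>R ?e"] by simp
    moreover have "((\<lambda>t. t - s) has_vector_derivative 1) (at s)"
      by (auto simp: has_vector_derivative_def intro!: derivative_eq_intros)
    ultimately have "((\<lambda>t. \<psi> ((x + s *\<^sub>R ?e) + t *\<^sub>R ?e)) \<circ> (\<lambda>t. t - s) has_vector_derivative 1 *\<^sub>R D (x + s *\<^sub>R ?e)) (at s)"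
      by (intro vector_diff_chain_at)
    then show ?thesis by (simp add: o_def algebra_simps)
  qed
  define q where "q m x = (\<psi> (x + (1 / real (Suc m)) *\<^sub>R ?e) - \<psi> x) /\<^sub>R (1 / real (Suc m))" for m x
  have "(\<lambda>m. LINT x|lborel. q m x) \<longlonglongrightarrow> (LINT x|lborel. D x)"
  proof (rule integral_dominated_convergence[where w = "\<lambda>x. C * 2 ^ ?n * (1 / (1 + norm x) ^ ?n)"])
    show "integrable lborel (\<lambda>x::real^'n. C * 2 ^ ?n * (1 / (1 + norm x) ^ ?n))"
      by (intro integrable_mult_right integrable_inverse_power)
    show "AE x in lborel. (\<lambda>m. q m x) \<longlonglongrightarrow> D x"
    proof (rule AE_I2)
      fix x
      have "((\<lambda>y. norm (\<psi> (x + y *\<^sub>R ?e) - (\<psi> x + y *\<^sub>R D x)) / \<bar>y\<bar>) \<longlongrightarrow> 0) (at 0)"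
        using D[of x] unfolding has_vector_derivative_def has_derivative_at by simp (simp add: algebra_simps)
      moreover have "filterlim (\<lambda>m. 1 / real (Suc m)) (at 0) sequentially"
        unfolding filterlim_at using LIMSEQ_inverse_real_of_nat by (auto simp: inverse_eq_divide)
      ultimately have "(\<lambda>m. norm (\<psi> (x + (1 / real (Suc m)) *\<^sub>R ?e) - (\<psi> x + (1 / real (Suc m)) *\<^sub>R D x)) / \<bar>1 / real (Suc m)\<bar>) \<longlonglongrightarrow> 0"
        by (rule filterlim_compose)
      moreover have "norm (\<psi> (x + (1 / real (Suc m)) *\<^sub>R ?e) - (\<psi> x + (1 / real (Suc m)) *\<^sub>R D x)) / \<bar>1 / real (Suc m)\<bar> = norm (q m x - D x)" for m
      proof -
        define h where "h = 1 / real (Suc m)"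
        have h: "h > 0" by (simp add: h_def)
        have "q m x - D x = (\<psi> (x + h *\<^sub>R ?e) - (\<psi> x + h *\<^sub>R D x)) /\<^sub>R h"
          unfolding q_def h_def[symmetric] using h by (simp add: scaleR_diff_right scaleR_add_right)
        then show ?thesis unfolding h_def[symmetric] using h by (simp add: divide_inverse mult.commute)
      qed
      ultimately have "(\<lambda>m. norm (q m x - D x)) \<longlonglongrightarrow> 0" by simp
      then have "(\<lambda>m. q m x - D x) \<longlonglongrightarrow> 0" by (rule tendsto_norm_zero_cancel)
      then show "(\<lambda>m. q m x) \<longlonglongrightarrow> D x" by (simp add: LIM_zero_iff)
    qed
    show "AE x in lborel. norm (q m x) \<le> C * 2 ^ ?n * (1 / (1 + norm x) ^ ?n)" for m
    proof (rule AE_I2)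
      fix x :: "real^'n"
      define h where "h = 1 / real (Suc m)"
      have h: "0 < h" "h \<le> 1" by (auto simp: h_def)
      define B where "B = C * 2 ^ ?n * (1 / (1 + norm x) ^ ?n)"
      \<comment> \<open>A displacement of length at most 1 changes \<open>1 + norm x\<close> by a
        factor of at most 2, hence the constant \<open>2 ^ (n + 1)\<close> in the bound. The mean
        value inequality on the segment then bounds the difference quotient.\<close>
      have B: "norm (D (x + s *\<^sub>R ?e)) \<le> B" if "s \<in> {0..h}" for s
      proof -
        have 1: "norm x \<le> norm (x + s *\<^sub>R ?e) + norm (s *\<^sub>R ?e)" using norm_triangle_ineq4[of "x + s *\<^sub>R ?e" "s *\<^sub>R ?e"] by simp
        have 2: "norm (s *\<^sub>R ?e) \<le> 1" using that h by simp
        have "1 + norm x \<le> 2 * (1 + norm (x + s *\<^sub>R ?e))" 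
          by (intro add_norm_shift_le[OF 1 2 norm_ge_zero])
        then have "(1 + norm x) ^ ?n \<le> (2 * (1 + norm (x + s *\<^sub>R ?e))) ^ ?n" by (intro power_mono) auto
        then have "(1 + norm x) ^ ?n * norm (D (x + s *\<^sub>R ?e)) \<le> 2 ^ ?n * ((1 + norm (x + s *\<^sub>R ?e)) ^ ?n * norm (D (x + s *\<^sub>R ?e)))"
          by (simp only: power_mult_distrib mult.assoc[symmetric]) (intro mult_right_mono, auto)
        also have "\<dots> \<le> 2 ^ ?n * C" by (intro mult_left_mono b) auto
        finally show ?thesis unfolding B_def by (simp add: field_simps add_pos_nonneg)
      qed
      have "norm (\<psi> (x + h *\<^sub>R ?e) - \<psi> (x + 0 *\<^sub>R ?e)) \<le> B * h - B * 0"
      proof (rule differentiable_bound_general[where f = "\<lambda>t. \<psi> (x + t *\<^sub>R ?e)" and \<phi> = "\<lambda>t. B * t" and f' = "\<lambda>t. D (x + t *\<^sub>R ?e)" and \<phi>' = "\<lambda>t. B"])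
        show "continuous_on {0..h} (\<lambda>t. \<psi> (x + t *\<^sub>R ?e))"
          by (intro continuous_at_imp_continuous_on ballI has_vector_derivative_continuous[OF D'])
        show "((*) B has_vector_derivative B) (at t)" for t
          by (auto simp: has_vector_derivative_def intro!: derivative_eq_intros)
      qed (use h D' B in \<open>auto intro!: continuous_intros\<close>)
      then have "norm (\<psi> (x + h *\<^sub>R ?e) - \<psi> x) / h \<le> B" using h by (simp add: field_simps)
      then show "norm (q m x) \<le> C * 2 ^ ?n * (1 / (1 + norm x) ^ ?n)"
        unfolding q_def h_def[symmetric] B_def[symmetric] using h by (simp add: divide_inverse mult.commute)
    qed
    show "q m \<in> borel_measurable lborel" for m unfolding q_def by measurable
  qed simp
  moreover have "(LINT x|lborel. q m x) = 0" for m
  proof -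
    have eq: "x + (1 / real (Suc m)) *\<^sub>R ?e = (1 / real (Suc m)) *\<^sub>R ?e + x" for x by simp
    have i: "integrable lborel (\<lambda>x. \<psi> ((1 / real (Suc m)) *\<^sub>R ?e + x))"
      using lborel_translate(2)[of \<psi>] \<psi> by simp
    show ?thesis unfolding q_def eq using i \<psi> lborel_translate(1)[of \<psi>] by simp
  qed
  ultimately have "(\<lambda>m. 0) \<longlonglongrightarrow> (LINT x|lborel. D x)" by simp
  then show ?thesis using LIMSEQ_unique[OF tendsto_const] by metis
qed

section \<open>The Fourier transform\<close>

lemma norm_exp_ii_taylor:
  "norm (cis y - (\<Sum>k\<le>m. (\<i> * of_real y) ^ k / fact k)) \<le> \<bar>y\<bar> ^ Suc m / fact m"
  using Taylor_exp[of "\<i> * of_real y" m] by (simp add: cis_conv_exp norm_mult)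

lemma cis_inner_add: "cis (- (x \<bullet> (\<xi> + \<eta>))) = cis (- (x \<bullet> \<xi>)) * cis (- (x \<bullet> \<eta>))"
  by (simp add: inner_add_right cis_mult)

lemma measurable_cis_inner [measurable]: "(\<lambda>x::real^'n::finite. cis (- (x \<bullet> \<xi>))) \<in> borel_measurable borel"
  by (intro borel_measurable_continuous_onI continuous_intros)

lemma integrable_cis_mult:
  fixes f :: "real^'n::finite \<Rightarrow> complex"
  shows "integrable lborel f \<Longrightarrow> integrable lborel (\<lambda>x. cis (- (x \<bullet> \<xi>)) * f x)"
  by (rule Bochner_Integration.integrable_bound[of lborel f]) (auto simp: norm_mult)

lemma norm_fourier_le:
  fixes f :: "real^'n::finite \<Rightarrow> complex"
  shows "norm (fourier f \<xi>) \<le> (2 * pi) powr (- real CARD('n) / 2) * (LINT x|lborel. norm (f x))"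
proof -
  have "norm (LINT x|lborel. cis (- (x \<bullet> \<xi>)) * f x) \<le> (LINT x|lborel. norm (cis (- (x \<bullet> \<xi>)) * f x))"
    by (rule integral_norm_bound)
  also have "\<dots> = (LINT x|lborel. norm (f x))" by (simp add: norm_mult)
  finally show ?thesis by (simp add: fourier_def norm_mult mult_left_mono)
qed

lemma fourier_cmult: "fourier (\<lambda>x. c * f x) \<xi> = c * fourier f \<xi>"
proof -
  have "(\<lambda>x. cis (- (x \<bullet> \<xi>)) * (c * f x)) = (\<lambda>x. c * (cis (- (x \<bullet> \<xi>)) * f x))" by (simp add: mult_ac)
  then show ?thesis by (simp add: fourier_def)
qed

lemma fourier_add:
  "integrable lborel f \<Longrightarrow> integrable lborel g \<Longrightarrow> fourier (\<lambda>x. f x + g x) \<xi> = fourier f \<xi> + fourier g \<xi>"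
  by (simp add: fourier_def distrib_left integrable_cis_mult)

lemma fourier_zero [simp]: "fourier (\<lambda>x. 0) \<xi> = 0"
  by (simp add: fourier_def)

lemma fourier_sum:
  "finite A \<Longrightarrow> (\<And>i. i \<in> A \<Longrightarrow> integrable lborel (f i)) \<Longrightarrow> fourier (\<lambda>x. \<Sum>i\<in>A. f i x) \<xi> = (\<Sum>i\<in>A. fourier (f i) \<xi>)"
  by (induction A rule: finite_induct) (auto simp: fourier_add)

text \<open>The character satisfies \<open>|exp (-i x.h) - 1 + i x.h| \<le> |x|^2 |h|^2\<close>. The
  linearisation error is therefore at most \<open>K * |h|^2\<close>, with \<open>K\<close> a second
  absolute moment of \<open>\<phi>\<close>.\<close>

lemma fourier_has_derivative:
  fixes \<phi> :: "real^'n::finite \<Rightarrow> complex"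
  assumes \<phi>: "\<phi> \<in> schwartz"
  shows "(fourier \<phi> has_derivative (\<lambda>h. \<Sum>i\<in>UNIV. of_real (h $ i) * fourier (\<lambda>x. - \<i> * (of_real (x $ i) * \<phi> x)) \<xi>)) (at \<xi>)"
proof -
  let ?c = "(2 * pi) powr (- real CARD('n) / 2)"
  let ?L = "\<lambda>h. \<Sum>i\<in>UNIV. of_real (h $ i) * fourier (\<lambda>x. - \<i> * (of_real (x $ i) * \<phi> x)) \<xi>"
  have i\<phi>: "integrable lborel \<phi>" by (rule schwartz_integrable[OF \<phi>])
  have ic: "integrable lborel (\<lambda>x. - \<i> * (of_real (x $ i) * \<phi> x))" for i
    by (intro integrable_mult_right schwartz_integrable schwartz_coord \<phi>)
  have [measurable]: "\<phi> \<in> borel_measurable borel" by (rule schwartz_measurable[OF \<phi>])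
  have i2: "integrable lborel (\<lambda>x. of_real ((norm x)\<^sup>2) * \<phi> x)"
  proof (rule integrable_rapid)
    show "rapid (\<lambda>x. of_real ((norm x)\<^sup>2) * \<phi> x)"
      by (rule rapid_dominated[OF schwartz_rapid[OF \<phi>], of _ 1 2 "\<lambda>x. x"])
         (auto simp: norm_mult norm_power intro!: mult_right_mono power_mono)
  qed measurable
  define K where "K = ?c * (LINT x|lborel. norm (of_real ((norm x)\<^sup>2) * \<phi> x))"
  have err: "norm (fourier \<phi> (\<xi> + h) - fourier \<phi> \<xi> - ?L h) \<le> K * (norm h)\<^sup>2" for h
  proof -
    have Lh: "?L h = of_real ?c * (LINT x|lborel. cis (- (x \<bullet> \<xi>)) * (- \<i> * of_real (x \<bullet> h) * \<phi> x))"
    proof -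
      have "?L h = fourier (\<lambda>x. \<Sum>i\<in>UNIV. of_real (h $ i) * (- \<i> * (of_real (x $ i) * \<phi> x))) \<xi>"
      proof -
        have "fourier (\<lambda>x. \<Sum>i\<in>UNIV. of_real (h $ i) * (- \<i> * (of_real (x $ i) * \<phi> x))) \<xi>
            = (\<Sum>i\<in>UNIV. fourier (\<lambda>x. of_real (h $ i) * (- \<i> * (of_real (x $ i) * \<phi> x))) \<xi>)"
          by (rule fourier_sum) (intro integrable_mult_right ic finite)+
        then show ?thesis by (simp only: fourier_cmult)
      qed
      also have "(\<lambda>x. \<Sum>i\<in>UNIV. of_real (h $ i) * (- \<i> * (of_real (x $ i) * \<phi> x))) = (\<lambda>x. - \<i> * of_real (x \<bullet> h) * \<phi> x)"
        by (rule ext) (simp add: inner_vec_def sum_distrib_left sum_distrib_right mult_ac sum_negf)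
      finally show ?thesis by (simp add: fourier_def)
    qed
    have ih: "integrable lborel (\<lambda>x. cis (- (x \<bullet> \<xi>)) * (- \<i> * of_real (x \<bullet> h) * \<phi> x))"
    proof (rule integrable_cis_mult)
      have "integrable lborel (\<lambda>x. \<Sum>i\<in>UNIV. of_real (h $ i) * (- \<i> * (of_real (x $ i) * \<phi> x)))"
        by (intro Bochner_Integration.integrable_sum integrable_mult_right ic)
      moreover have "(\<lambda>x. \<Sum>i\<in>UNIV. of_real (h $ i) * (- \<i> * (of_real (x $ i) * \<phi> x))) = (\<lambda>x. - \<i> * of_real (x \<bullet> h) * \<phi> x)"
        by (rule ext) (simp add: inner_vec_def sum_distrib_left sum_distrib_right mult_ac sum_negf)
      ultimately show "integrable lborel (\<lambda>x. - \<i> * of_real (x \<bullet> h) * \<phi> x)" by simp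
    qed
    have pt: "cis (- (x \<bullet> (\<xi> + h))) * \<phi> x - cis (- (x \<bullet> \<xi>)) * \<phi> x - cis (- (x \<bullet> \<xi>)) * (- \<i> * of_real (x \<bullet> h) * \<phi> x)
        = cis (- (x \<bullet> \<xi>)) * (cis (- (x \<bullet> h)) - (1 - \<i> * of_real (x \<bullet> h))) * \<phi> x" for x
      unfolding cis_inner_add by (simp add: algebra_simps)
    have "fourier \<phi> (\<xi> + h) - fourier \<phi> \<xi> - ?L h = of_real ?c *
       (LINT x|lborel. cis (- (x \<bullet> \<xi>)) * (cis (- (x \<bullet> h)) - (1 - \<i> * of_real (x \<bullet> h))) * \<phi> x)"
      unfolding Lh unfolding pt[symmetric] unfolding fourier_def using ih integrable_cis_mult[OF i\<phi>]
      by (simp add: right_diff_distrib distrib_left)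
    also have "norm \<dots> \<le> ?c * (LINT x|lborel. norm (cis (- (x \<bullet> \<xi>)) * (cis (- (x \<bullet> h)) - (1 - \<i> * of_real (x \<bullet> h))) * \<phi> x))"
      unfolding norm_mult[of "of_real ?c"] norm_of_real by (intro mult_mono integral_norm_bound) auto
    also have "\<dots> \<le> ?c * (LINT x|lborel. (norm h)\<^sup>2 * norm (of_real ((norm x)\<^sup>2) * \<phi> x))"
    proof (intro mult_left_mono integral_mono)
      show "integrable lborel (\<lambda>x. (norm h)\<^sup>2 * norm (of_real ((norm x)\<^sup>2) * \<phi> x))" using i2 by simp
      show "integrable lborel (\<lambda>x. norm (cis (- (x \<bullet> \<xi>)) * (cis (- (x \<bullet> h)) - (1 - \<i> * of_real (x \<bullet> h))) * \<phi> x))"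
        unfolding pt[symmetric]
        by (intro integrable_norm Bochner_Integration.integrable_diff integrable_cis_mult[OF i\<phi>] ih)
      fix x
      have "norm (cis (- (x \<bullet> h)) - (1 - \<i> * of_real (x \<bullet> h))) \<le> \<bar>x \<bullet> h\<bar>\<^sup>2"
        using norm_exp_ii_taylor[of "- (x \<bullet> h)" 1] by (simp add: power2_eq_square)
      also have "\<dots> \<le> (norm x * norm h)\<^sup>2" by (intro power_mono Cauchy_Schwarz_ineq2) auto
      finally show "norm (cis (- (x \<bullet> \<xi>)) * (cis (- (x \<bullet> h)) - (1 - \<i> * of_real (x \<bullet> h))) * \<phi> x)
         \<le> (norm h)\<^sup>2 * norm (of_real ((norm x)\<^sup>2) * \<phi> x)"
        unfolding norm_mult[of _ "\<phi> x"] norm_mult[of "cis _"] norm_cis norm_of_real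
        by (simp add: power_mult_distrib mult.assoc[symmetric] mult.commute[of "(norm h)\<^sup>2"] mult_right_mono)
    qed auto
    also have "\<dots> = K * (norm h)\<^sup>2" by (simp add: K_def)
    finally show ?thesis .
  qed
  show ?thesis
  proof (rule has_derivativeI_sandwich[of 1])
    have "linear ?L"
    proof (rule linearI)
      show "?L (x + y) = ?L x + ?L y" for x y by (simp add: sum.distrib distrib_right)
      show "?L (r *\<^sub>R x) = r *\<^sub>R ?L x" for r x by (simp add: scaleR_sum_right) (simp add: scaleR_conv_of_real mult.assoc)
    qed
    then show "bounded_linear ?L" by (simp add: linear_conv_bounded_linear)
    show "((\<lambda>y. K * norm (y - \<xi>)) \<longlongrightarrow> 0) (at \<xi>)"
      by (rule tendsto_eq_intros refl | simp)+
    fix y assume "y \<noteq> \<xi>"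
    then show "norm (fourier \<phi> y - fourier \<phi> \<xi> - ?L (y - \<xi>)) / norm (y - \<xi>) \<le> K * norm (y - \<xi>)"
      using err[of "y - \<xi>"] by (simp add: divide_le_eq power2_eq_square mult.assoc)
  qed simp
qed

lemma partial_deriv_fourier:
  assumes "\<phi> \<in> schwartz"
  shows "partial_deriv i (fourier \<phi>) = fourier (\<lambda>x. - \<i> * (of_real (x $ i) * \<phi> x))"
proof
  fix \<xi>
  have "(\<Sum>j\<in>UNIV. complex_of_real (axis i 1 $ j) * F j) = (\<Sum>j\<in>UNIV. if j = i then F j else 0)" for F
    by (intro sum.cong) (auto simp: axis_def)
  then show "partial_deriv i (fourier \<phi>) \<xi> = fourier (\<lambda>x. - \<i> * (of_real (x $ i) * \<phi> x)) \<xi>"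
    using partial_deriv_eq[OF fourier_has_derivative[OF assms], of i \<xi>] by simp
qed

text \<open>Integration by parts: the integral of the \<open>i\<close>-th partial derivative of
  character times \<open>\<phi>\<close> vanishes by \<open>integral_partial_zero\<close>.\<close>

lemma fourier_partial_deriv:
  fixes \<phi> :: "real^'n::finite \<Rightarrow> complex"
  assumes \<phi>: "\<phi> \<in> schwartz"
  shows "fourier (partial_deriv i \<phi>) \<xi> = \<i> * of_real (\<xi> $ i) * fourier \<phi> \<xi>"
proof -
  let ?D = "\<lambda>x. cis (- (x \<bullet> \<xi>)) * partial_deriv i \<phi> x + (- \<i> * of_real (\<xi> $ i)) * (cis (- (x \<bullet> \<xi>)) * \<phi> x)"
  note \<phi>' = schwartz_partial_deriv[OF \<phi>, of i]
  have [measurable]: "\<phi> \<in> borel_measurable borel" "partial_deriv i \<phi> \<in> borel_measurable borel"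
    using \<phi> \<phi>' by (auto intro: schwartz_measurable)
  have r1: "rapid (\<lambda>x. cis (- (x \<bullet> \<xi>)) * partial_deriv i \<phi> x)"
    by (rule rapid_dominated[OF schwartz_rapid[OF \<phi>'], of _ 1 0 "\<lambda>x. x"]) (auto simp: norm_mult)
  have r2: "rapid (\<lambda>x. (- \<i> * of_real (\<xi> $ i)) * (cis (- (x \<bullet> \<xi>)) * \<phi> x))"
    by (rule rapid_dominated[OF schwartz_rapid[OF \<phi>], of _ "\<bar>\<xi> $ i\<bar>" 0 "\<lambda>x. x"]) (auto simp: norm_mult)
  obtain C where C: "\<And>x. (1 + norm x) ^ (CARD('n) + 1) * norm (?D x) \<le> C"
    using rapidD[OF rapid_add[OF r1 r2]] by metis
  have "(LINT x|lborel. ?D x) = 0"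
  proof (rule integral_partial_zero[where i = i and \<psi> = "\<lambda>x. cis (- (x \<bullet> \<xi>)) * \<phi> x", OF _ _ _ C])
    show "integrable lborel (\<lambda>x. cis (- (x \<bullet> \<xi>)) * \<phi> x)" by (intro integrable_cis_mult schwartz_integrable \<phi>)
    fix x
    have d\<phi>: "((\<lambda>t. \<phi> (x + t *\<^sub>R axis i 1)) has_vector_derivative partial_deriv i \<phi> x) (at 0)"
    proof -
      have l: "((\<lambda>t. x + t *\<^sub>R axis i 1) has_derivative (\<lambda>t. t *\<^sub>R axis i 1)) (at 0)"
        by (auto intro!: derivative_eq_intros)
      have "(\<phi> has_derivative frechet_derivative \<phi> (at x)) (at (x + 0 *\<^sub>R axis i 1))"
        using schwartz_differentiable[OF \<phi>] by (simp add: frechet_derivative_works)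
      from has_derivative_compose[OF l this]
      have "((\<lambda>t. \<phi> (x + t *\<^sub>R axis i 1)) has_derivative (\<lambda>t. frechet_derivative \<phi> (at x) (t *\<^sub>R axis i 1))) (at 0)" .
      moreover have "frechet_derivative \<phi> (at x) (t *\<^sub>R axis i 1) = t *\<^sub>R partial_deriv i \<phi> x" for t
        unfolding partial_deriv_def using linear_frechet_derivative[OF schwartz_differentiable[OF \<phi>]]
        by (rule linear_scale)
      ultimately show ?thesis by (simp add: has_vector_derivative_def)
    qed
    have dc: "((\<lambda>t. cis (- ((x + t *\<^sub>R axis i 1) \<bullet> \<xi>))) has_vector_derivative (- \<i> * of_real (\<xi> $ i)) * cis (- (x \<bullet> \<xi>))) (at 0)"
    proof -
      have "((\<lambda>z. exp (\<i> * (- of_real (x \<bullet> \<xi>) - z * of_real (\<xi> $ i)))) has_field_derivative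
          (- \<i> * of_real (\<xi> $ i)) * exp (\<i> * (- of_real (x \<bullet> \<xi>)))) (at (of_real 0))"
        by (auto intro!: derivative_eq_intros)
      from has_vector_derivative_real_field[OF this]
      show ?thesis by (simp add: cis_conv_exp inner_add_left inner_axis' algebra_simps)
    qed
    show "((\<lambda>t. cis (- ((x + t *\<^sub>R axis i 1) \<bullet> \<xi>)) * \<phi> (x + t *\<^sub>R axis i 1)) has_vector_derivative ?D x) (at 0)"
      using has_vector_derivative_mult[OF dc d\<phi>] by (simp add: mult_ac)
  qed measurable
  moreover have "(LINT x|lborel. ?D x) = (LINT x|lborel. cis (- (x \<bullet> \<xi>)) * partial_deriv i \<phi> x)
       + (- \<i> * of_real (\<xi> $ i)) * (LINT x|lborel. cis (- (x \<bullet> \<xi>)) * \<phi> x)"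
    using integrable_cis_mult[OF schwartz_integrable[OF \<phi>'], of \<xi>] integrable_cis_mult[OF schwartz_integrable[OF \<phi>], of \<xi>]
    by (subst Bochner_Integration.integral_add) auto
  ultimately have "(LINT x|lborel. cis (- (x \<bullet> \<xi>)) * partial_deriv i \<phi> x) = \<i> * of_real (\<xi> $ i) * (LINT x|lborel. cis (- (x \<bullet> \<xi>)) * \<phi> x)"
    by (simp add: add_eq_0_iff)
  then show ?thesis by (simp add: fourier_def)
qed

lemma fourier_foldr_replicate:
  "\<phi> \<in> schwartz \<Longrightarrow> fourier (foldr partial_deriv (replicate m i) \<phi>) \<xi> = (\<i> * of_real (\<xi> $ i)) ^ m * fourier \<phi> \<xi>"
proof (induction m)
  case (Suc m)
  then show ?case using schwartz_foldr[of \<phi> "replicate m i"] by (simp add: fourier_partial_deriv mult.assoc del: foldr_replicate)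
qed simp

text \<open>Reduces decay in the norm to pure powers of single coordinates, so that repeated
  derivatives in one direction suffice on the Fourier side.\<close>

lemma one_plus_norm_power_le:
  "(1 + norm x) ^ N \<le> real (CARD('n) + 1) ^ N * (1 + (\<Sum>i\<in>UNIV. \<bar>x $ i\<bar> ^ N))" for x :: "real^'n::finite"
proof -
  define M where "M = Max (insert 1 ((\<lambda>i. \<bar>x $ i\<bar>) ` UNIV))"
  have M1: "1 \<le> M" unfolding M_def by (rule Max_ge) auto
  have Mi: "\<bar>x $ i\<bar> \<le> M" for i unfolding M_def by (rule Max_ge) auto
  have "norm x \<le> (\<Sum>i\<in>UNIV. \<bar>x $ i\<bar>)" by (rule norm_le_l1_cart)
  also have "\<dots> \<le> (\<Sum>i\<in>(UNIV::'n set). M)" by (intro sum_mono Mi)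
  finally have "1 + norm x \<le> real (CARD('n) + 1) * M" using M1 by (simp add: algebra_simps)
  then have "(1 + norm x) ^ N \<le> (real (CARD('n) + 1) * M) ^ N" by (intro power_mono) auto
  also have "\<dots> = real (CARD('n) + 1) ^ N * M ^ N" by (rule power_mult_distrib)
  also have "M ^ N \<le> 1 + (\<Sum>i\<in>UNIV. \<bar>x $ i\<bar> ^ N)"
  proof -
    have "M \<in> insert 1 ((\<lambda>i. \<bar>x $ i\<bar>) ` UNIV)" unfolding M_def by (rule Max_in) auto
    then consider "M = 1" | i where "M = \<bar>x $ i\<bar>" by auto
    then show ?thesis
    proof cases
      case 1 then show ?thesis by (simp add: sum_nonneg)
    next
      case (2 i)
      have "\<bar>x $ i\<bar> ^ N \<le> (\<Sum>i\<in>UNIV. \<bar>x $ i\<bar> ^ N)" by (rule member_le_sum) auto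
      then show ?thesis using 2 by simp
    qed
  qed
  finally show ?thesis by (simp add: mult_left_mono)
qed

text \<open>A power \<open>\<xi>_i^N\<close> is traded for \<open>N\<close> derivatives of
  \<open>\<phi>\<close>, and \<open>n + 1\<close> further powers of \<open>1 + norm x\<close> make
  the integral converge. \<open>K\<close> is uniform in \<open>\<phi>\<close>; continuity of
  distributions defined through the transform rests on this.\<close>

lemma fourier_decay:
  "\<exists>K\<ge>0. \<forall>\<phi>\<in>schwartz. \<forall>\<xi>::real^'n::finite.
     (1 + norm \<xi>) ^ N * norm (fourier \<phi> \<xi>) \<le> K * schwartz_norm (N + CARD('n) + 1) \<phi>"
proof -
  let ?c = "(2 * pi) powr (- real CARD('n) / 2)"
  let ?d = "decay_const TYPE('n)"
  let ?n = "CARD('n)"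
  have d0: "?d \<ge> 0" unfolding decay_const_def by (intro integral_nonneg_AE AE_I2) auto
  define K where "K = real (?n + 1) ^ N * (real (?n + 1) * (?c * ?d))"
  have "(1 + norm \<xi>) ^ N * norm (fourier \<phi> \<xi>) \<le> K * schwartz_norm (N + ?n + 1) \<phi>" if \<phi>: "\<phi> \<in> schwartz"
    for \<phi> :: "real^'n \<Rightarrow> complex" and \<xi>
  proof -
    let ?S = "schwartz_norm (N + ?n + 1) \<phi>"
    have *: "norm (fourier (foldr partial_deriv is \<phi>) \<xi>) \<le> ?c * ?d * ?S" if l: "length is \<le> N" for "is"
    proof -
      have "(LINT x|lborel. norm (foldr partial_deriv is \<phi> x)) \<le> ?S * ?d"
      proof (rule integral_decay_le)
        fix x
        have "(1 + norm x) ^ (?n + 1) * norm (foldr partial_deriv is \<phi> x) \<le> (1 + norm x) ^ (N + ?n + 1) * norm (foldr partial_deriv is \<phi> x)"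
          by (intro mult_right_mono power_increasing) auto
        also have "\<dots> \<le> ?S" by (rule schwartz_norm_bound[OF \<phi>]) (use l in simp)
        finally show "(1 + norm x) ^ (?n + 1) * norm (foldr partial_deriv is \<phi> x) \<le> ?S" .
      qed (intro schwartz_measurable schwartz_foldr \<phi>)
      then have "?c * (LINT x|lborel. norm (foldr partial_deriv is \<phi> x)) \<le> ?c * (?S * ?d)" by (intro mult_left_mono) auto
      also have "?c * (?S * ?d) = ?c * ?d * ?S" by (simp only: mult_ac)
      finally show ?thesis by (rule order_trans[OF norm_fourier_le])
    qed
    have "(1 + norm \<xi>) ^ N * norm (fourier \<phi> \<xi>) \<le> real (?n + 1) ^ N * (1 + (\<Sum>i\<in>UNIV. \<bar>\<xi> $ i\<bar> ^ N)) * norm (fourier \<phi> \<xi>)"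
      by (intro mult_right_mono one_plus_norm_power_le) auto
    also have "\<dots> = real (?n + 1) ^ N * (norm (fourier \<phi> \<xi>) + (\<Sum>i\<in>UNIV. norm (fourier (foldr partial_deriv (replicate N i) \<phi>) \<xi>)))"
      by (simp add: fourier_foldr_replicate[OF \<phi>] norm_mult norm_power sum_distrib_right distrib_right del: foldr_replicate)
    also have "\<dots> \<le> real (?n + 1) ^ N * (?c * ?d * ?S + (\<Sum>i\<in>(UNIV::'n set). ?c * ?d * ?S))"
      using *[of "[]"] by (intro mult_left_mono add_mono sum_mono *) auto
    also have "\<dots> = K * ?S" by (simp add: K_def algebra_simps)
    finally show ?thesis .
  qed
  moreover have "K \<ge> 0" unfolding K_def using d0 by simp
  ultimately show ?thesis by blast
qed

lemma schwartz_fourier: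
  fixes \<phi> :: "real^'n::finite \<Rightarrow> complex"
  assumes \<phi>: "\<phi> \<in> schwartz"
  shows "fourier \<phi> \<in> schwartz"
proof -
  define S :: "(real^'n \<Rightarrow> complex) set" where "S = fourier ` schwartz"
  show ?thesis
  proof (rule schwartz_coinduct[of S])
    show "fourier \<phi> \<in> fun_sums S" using \<phi> by (auto simp: S_def intro: fun_sums.base)
    fix f assume "f \<in> S"
    then obtain \<psi> where \<psi>: "\<psi> \<in> schwartz" and f: "f = fourier \<psi>" by (auto simp: S_def)
    have "f differentiable (at x)" for x
      unfolding f using fourier_has_derivative[OF \<psi>] differentiable_def by blast
    moreover have "rapid f" unfolding rapid_def
    proof
      fix N
      from fourier_decay[of N, where 'n='n] \<psi> show "\<exists>C. \<forall>x. (1 + norm x) ^ N * norm (f x) \<le> C" unfolding f by blast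
    qed
    moreover have "partial_deriv i f \<in> fun_sums S" for i
      unfolding f partial_deriv_fourier[OF \<psi>] S_def
      by (intro fun_sums.base imageI schwartz_cmult schwartz_coord \<psi>)
    ultimately show "(\<forall>x. f differentiable (at x)) \<and> rapid f \<and> (\<forall>i. partial_deriv i f \<in> fun_sums S)" by simp
  qed
qed

text \<open>Fubini for the absolutely integrable function
  \<open>cis (- (x \<bullet> y)) * f x * g y\<close>, whose kernel is symmetric.\<close>

lemma fourier_mult_formula:
  fixes f g :: "real^'n::finite \<Rightarrow> complex"
  assumes f: "integrable lborel f" and g: "integrable lborel g"
  shows "(LINT x|lborel. fourier f x * g x) = (LINT x|lborel. f x * fourier g x)"
proof -
  have [measurable]: "f \<in> borel_measurable borel" "g \<in> borel_measurable borel" using f g by auto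
  have "(\<lambda>(x::real^'n, y). cis (- (x \<bullet> y))) \<in> borel_measurable borel"
    by (intro borel_measurable_continuous_onI) (auto simp: case_prod_unfold intro!: continuous_intros)
  then have [measurable]: "(\<lambda>(x::real^'n, y). cis (- (x \<bullet> y))) \<in> borel_measurable (borel \<Otimes>\<^sub>M borel)"
    by (simp add: borel_prod)
  have i: "integrable (lborel \<Otimes>\<^sub>M lborel) (case_prod (\<lambda>x y. (case (x, y) of (x, y) \<Rightarrow> cis (- (x \<bullet> y))) * f x * g y))"
  proof (rule lborel_pair.Fubini_integrable)
    show "(\<lambda>(x, y). (case (x, y) of (x, y) \<Rightarrow> cis (- (x \<bullet> y))) * f x * g y) \<in> borel_measurable (lborel \<Otimes>\<^sub>M lborel)"
      by measurable
    have "integrable lborel (\<lambda>x. norm (f x) * (LINT y|lborel. norm (g y)))" using f by simp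
    then show "integrable lborel (\<lambda>x. LINT y|lborel. norm (case (x, y) of (x, y) \<Rightarrow> (case (x, y) of (x, y) \<Rightarrow> cis (- (x \<bullet> y))) * f x * g y))"
      by (simp add: norm_mult)
    show "AE x in lborel. integrable lborel (\<lambda>y. case (x, y) of (x, y) \<Rightarrow> (case (x, y) of (x, y) \<Rightarrow> cis (- (x \<bullet> y))) * f x * g y)"
    proof (rule AE_I2)
      fix x
      have "integrable lborel (\<lambda>y. f x * (cis (- (y \<bullet> x)) * g y))"
        by (intro integrable_mult_right integrable_cis_mult g)
      then show "integrable lborel (\<lambda>y. case (x, y) of (x, y) \<Rightarrow> (case (x, y) of (x, y) \<Rightarrow> cis (- (x \<bullet> y))) * f x * g y)"
        by (simp add: mult_ac inner_commute)
    qed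
  qed
  from lborel_pair.Fubini_integral[OF i]
  have "(LINT y|lborel. (LINT x|lborel. cis (- (x \<bullet> y)) * f x) * g y) = (LINT x|lborel. f x * (LINT y|lborel. cis (- (y \<bullet> x)) * g y))"
    by (simp add: mult_ac inner_commute flip: integral_mult_right_zero integral_mult_left_zero)
  then show ?thesis
    unfolding fourier_def by (simp add: mult.assoc mult.left_commute[of "f _"])
qed

lemma integral_gauss:
  assumes "a > 0"
  shows "(LINT x|lborel. gauss a (x::real^'n::finite)) = of_real ((pi / a) powr (real CARD('n) / 2))"
proof -
  let ?n = "real CARD('n)"
  have n: "?n > 0" by simp
  have "(LINT x|lborel. exp (- (a * (norm (x::real^'n))\<^sup>2))) = unit_ball_vol ?n * integral\<^sup>L (pow_meas ?n) (\<lambda>r. exp (- (a * r\<^sup>2)))"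
    using integral_radial[of "\<lambda>r. exp (- (a * r\<^sup>2))", where 'n='n] by simp
  also have "integral\<^sup>L (pow_meas ?n) (\<lambda>r. exp (- (a * r\<^sup>2))) = integral\<^sup>L (pow_meas ?n) (\<lambda>r. r powr 0 * exp (- (a * r\<^sup>2)))"
  proof (rule integral_cong_AE)
    show "AE r in pow_meas ?n. exp (- (a * r\<^sup>2)) = r powr 0 * exp (- (a * r\<^sup>2))"
      using AE_pow_meas_pos[OF n] by eventually_elim simp
  qed auto
  also have "\<dots> = ?n / 2 * Gamma (?n / 2) * a powr (- ?n / 2)"
    using integral_pow_meas_gauss[of ?n 0 a] assms n by simp
  also have "unit_ball_vol ?n * (?n / 2 * Gamma (?n / 2) * a powr (- ?n / 2)) = (pi / a) powr (?n / 2)"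
  proof -
    have "?n / 2 \<notin> \<int>\<^sub>\<le>\<^sub>0" using nonpos_Ints_nonpos[of "?n / 2"] n by auto
    then have "Gamma (?n / 2 + 1) = ?n / 2 * Gamma (?n / 2)" using Gamma_plus1[of "?n / 2"] by (simp add: add.commute)
    moreover have "0 < G \<Longrightarrow> pi powr (?n / 2) / (?n / 2 * G) * (?n / 2 * G * a powr (- ?n / 2)) = (pi / a) powr (?n / 2)" for G
      using n assms by (simp add: powr_divide powr_minus field_simps)
    moreover have "Gamma (?n / 2) > 0" by (intro Gamma_real_pos) simp
    ultimately show ?thesis unfolding unit_ball_vol_def by metis
  qed
  finally have "(LINT x|lborel. exp (- (a * (norm (x::real^'n))\<^sup>2))) = (pi / a) powr (?n / 2)" .
  then show ?thesis unfolding gauss_def by simp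
qed

text \<open>The quotient of the transform by the expected Gaussian has zero derivative.\<close>

lemma fourier_gauss:
  assumes a: "a > 0"
  shows "fourier (gauss a) \<xi> = of_real ((2 * a) powr (- real CARD('n) / 2)) * gauss (1 / (4 * a)) (\<xi> :: real^'n::finite)"
proof -
  let ?g = "gauss a :: real^'n \<Rightarrow> complex"
  have g: "?g \<in> schwartz" by (rule schwartz_gauss[OF a])
  have F: "fourier (\<lambda>x. - \<i> * (of_real (x $ i) * ?g x)) x = - (of_real (x $ i) / (2 * of_real a)) * fourier ?g x" for i x
  proof -
    have e: "(\<lambda>x. - \<i> * (of_real (x $ i) * ?g x)) = (\<lambda>x. \<i> / (2 * of_real a) * partial_deriv i ?g x)"
      using a by (auto simp: partial_deriv_gauss field_simps)
    show ?thesis unfolding e fourier_cmult fourier_partial_deriv[OF g] using a by (simp add: field_simps)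
  qed
  have D: "(fourier ?g has_derivative (\<lambda>h. - (of_real (x \<bullet> h) / (2 * of_real a)) * fourier ?g x)) (at x)" for x
  proof -
    have "(\<Sum>i\<in>UNIV. of_real (h $ i) * (- (of_real (x $ i) / (2 * of_real a)) * fourier ?g x)) = - (of_real (x \<bullet> h) / (2 * of_real a)) * fourier ?g x" for h
    proof -
      have e: "complex_of_real (x \<bullet> h) = (\<Sum>i\<in>UNIV. of_real (h $ i) * of_real (x $ i))" by (simp add: inner_vec_def mult.commute)
      show ?thesis unfolding e sum_divide_distrib sum_negf[symmetric] sum_distrib_right by (intro sum.cong refl) (simp add: field_simps)
    qed
    then show ?thesis using fourier_has_derivative[OF g, of x] unfolding F by simp
  qed
  let ?h = "\<lambda>x. fourier ?g x * gauss (- (1 / (4 * a))) x"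
  have "(?h has_derivative (\<lambda>h. 0)) (at x)" for x
    by (rule has_derivative_eq_rhs[OF has_derivative_mult[OF D has_derivative_gauss]]) (use a in \<open>auto simp: field_simps\<close>)
  then have "?h \<xi> = ?h 0" by (intro has_derivative_zero_unique[of UNIV]) auto
  also have "?h 0 = fourier ?g 0" by (simp add: gauss_def)
  also have "\<dots> = of_real ((2 * pi) powr (- real CARD('n) / 2) * (pi / a) powr (real CARD('n) / 2))"
    by (simp add: fourier_def integral_gauss[OF a])
  also have "(2 * pi) powr (- real CARD('n) / 2) * (pi / a) powr (real CARD('n) / 2) = (2 * a) powr (- real CARD('n) / 2)"
    using a by (simp add: powr_mult powr_divide powr_minus field_simps)
  finally have "fourier ?g \<xi> * gauss (- (1 / (4 * a))) \<xi> = of_real ((2 * a) powr (- real CARD('n) / 2))" .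
  then have "fourier ?g \<xi> * (gauss (- (1 / (4 * a))) \<xi> * gauss (1 / (4 * a)) \<xi>) = of_real ((2 * a) powr (- real CARD('n) / 2)) * gauss (1 / (4 * a)) \<xi>"
    by (simp only: mult.assoc[symmetric])
  moreover have "gauss (- (1 / (4 * a))) \<xi> * gauss (1 / (4 * a)) \<xi> = 1"
    unfolding gauss_def of_real_mult[symmetric] exp_add[symmetric] by simp
  ultimately show ?thesis by simp
qed

lemma lborel_dilate:
  fixes f :: "real^'n::finite \<Rightarrow> complex"
  assumes [measurable]: "f \<in> borel_measurable borel" and c: "c > 0"
  shows "(LINT x|lborel. f x) = of_real (c ^ CARD('n)) * (LINT x|lborel. f (t + c *\<^sub>R x))"
proof -
  have "(LINT x|lborel. f x) = (LINT x|density (distr lborel borel (\<lambda>x. t + c *\<^sub>R x)) (\<lambda>_. ennreal (\<bar>c\<bar> ^ DIM(real^'n))). f x)"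
    using lborel_affine[of c t] c by (simp add: ennreal_power)
  also have "\<dots> = (LINT x|distr lborel borel (\<lambda>x. t + c *\<^sub>R x). (\<bar>c\<bar> ^ DIM(real^'n)) *\<^sub>R f x)"
    by (subst integral_density) auto
  also have "\<dots> = (LINT x|lborel. (\<bar>c\<bar> ^ DIM(real^'n)) *\<^sub>R f (t + c *\<^sub>R x))"
    by (subst integral_distr) auto
  also have "\<dots> = of_real (c ^ CARD('n)) * (LINT x|lborel. f (t + c *\<^sub>R x))"
    using c by (simp add: scaleR_conv_of_real)
  finally show ?thesis .
qed

text \<open>Inversion, by inserting the convergence factor \<open>exp (- (\<epsilon> |\<xi>|)\<^sup>2 / 2)\<close>.\<close>

lemma fourier_inversion:
  fixes \<phi> :: "real^'n::finite \<Rightarrow> complex"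
  assumes \<phi>: "\<phi> \<in> schwartz"
  shows "fourier (fourier \<phi>) x = \<phi> (- x)"
proof -
  let ?c = "(2 * pi) powr (- real CARD('n) / 2)"
  define \<epsilon> where "\<epsilon> m = 1 / real (Suc m)" for m
  have \<epsilon>: "\<epsilon> m > 0" "\<epsilon> m \<le> 1" for m by (auto simp: \<epsilon>_def)
  have \<epsilon>0: "\<epsilon> \<longlonglongrightarrow> 0" unfolding \<epsilon>_def using LIMSEQ_inverse_real_of_nat by (simp add: inverse_eq_divide)
  let ?g = "\<lambda>m. gauss ((\<epsilon> m)\<^sup>2 / 2) :: real^'n \<Rightarrow> complex"
  note F\<phi> = schwartz_fourier[OF \<phi>]
  have [measurable]: "\<phi> \<in> borel_measurable borel" "fourier \<phi> \<in> borel_measurable borel"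
    using \<phi> F\<phi> by (auto intro: schwartz_measurable)
  have gm [measurable]: "gauss a \<in> borel_measurable borel" for a
    unfolding gauss_def[abs_def] by (intro borel_measurable_continuous_onI continuous_intros)
  have g1: "norm (gauss a y) \<le> 1" if "a > 0" for a and y :: "real^'n" using that by (simp add: gauss_def)
  have gi: "integrable lborel (gauss a :: real^'n \<Rightarrow> complex)" if "a > 0" for a by (intro schwartz_integrable schwartz_gauss that)
  have lim1: "(\<lambda>m. LINT \<xi>|lborel. fourier \<phi> \<xi> * (cis (- (\<xi> \<bullet> x)) * ?g m \<xi>)) \<longlonglongrightarrow> (LINT \<xi>|lborel. cis (- (\<xi> \<bullet> x)) * fourier \<phi> \<xi>)"
  proof (rule integral_dominated_convergence[where w = "\<lambda>\<xi>. norm (fourier \<phi> \<xi>)"])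
    show "integrable lborel (\<lambda>\<xi>. norm (fourier \<phi> \<xi>))" by (intro integrable_norm schwartz_integrable F\<phi>)
    show "AE \<xi> in lborel. norm (fourier \<phi> \<xi> * (cis (- (\<xi> \<bullet> x)) * ?g m \<xi>)) \<le> norm (fourier \<phi> \<xi>)" for m
      using g1[of "(\<epsilon> m)\<^sup>2 / 2"] \<epsilon>[of m] by (auto simp: norm_mult mult_left_le)
    show "AE \<xi> in lborel. (\<lambda>m. fourier \<phi> \<xi> * (cis (- (\<xi> \<bullet> x)) * ?g m \<xi>)) \<longlonglongrightarrow> cis (- (\<xi> \<bullet> x)) * fourier \<phi> \<xi>"
    proof (rule AE_I2)
      fix \<xi> :: "real^'n"
      have "(\<lambda>m. ?g m \<xi>) \<longlonglongrightarrow> of_real (exp (- (0\<^sup>2 / 2 * (norm \<xi>)\<^sup>2)))"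
        unfolding gauss_def by (intro tendsto_intros \<epsilon>0) auto
      then have "(\<lambda>m. fourier \<phi> \<xi> * (cis (- (\<xi> \<bullet> x)) * ?g m \<xi>)) \<longlonglongrightarrow> fourier \<phi> \<xi> * (cis (- (\<xi> \<bullet> x)) * 1)"
        by (intro tendsto_intros) simp
      then show "(\<lambda>m. fourier \<phi> \<xi> * (cis (- (\<xi> \<bullet> x)) * ?g m \<xi>)) \<longlonglongrightarrow> cis (- (\<xi> \<bullet> x)) * fourier \<phi> \<xi>" by (simp add: mult.commute)
    qed
  qed measurable
  \<comment> \<open>The multiplication formula moves the transform onto the Gaussian, which becomes
    a narrow Gaussian centred at \<open>- x\<close>. The substitution
    \<open>y = - x + \<epsilon> m *R z\<close> makes its shape fixed, and the Jacobian
    \<open>(\<epsilon> m)^n\<close> cancels the normalising constant.\<close>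
  have eq: "(LINT \<xi>|lborel. fourier \<phi> \<xi> * (cis (- (\<xi> \<bullet> x)) * ?g m \<xi>)) = (LINT z|lborel. \<phi> (- x + \<epsilon> m *\<^sub>R z) * gauss (1/2) z)" for m
  proof -
    have F: "fourier (\<lambda>\<xi>. cis (- (\<xi> \<bullet> x)) * ?g m \<xi>) y = of_real (((\<epsilon> m)\<^sup>2) powr (- real CARD('n) / 2)) * gauss (1 / (2 * (\<epsilon> m)\<^sup>2)) (x + y)" for y
    proof -
      have "fourier (\<lambda>\<xi>. cis (- (\<xi> \<bullet> x)) * ?g m \<xi>) y = fourier (?g m) (x + y)"
      proof -
        have "cis (- (\<xi> \<bullet> y)) * (cis (- (\<xi> \<bullet> x)) * ?g m \<xi>) = cis (- (\<xi> \<bullet> (x + y))) * ?g m \<xi>" for \<xi>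
          unfolding cis_inner_add by (simp only: mult_ac)
        then show ?thesis unfolding fourier_def by (simp only:)
      qed
      also have "\<dots> = of_real (((\<epsilon> m)\<^sup>2) powr (- real CARD('n) / 2)) * gauss (1 / (2 * (\<epsilon> m)\<^sup>2)) (x + y)"
        using fourier_gauss[of "(\<epsilon> m)\<^sup>2 / 2" "x + y"] \<epsilon>[of m] by simp
      finally show ?thesis .
    qed
    have gz: "gauss (1 / (2 * (\<epsilon> m)\<^sup>2)) (\<epsilon> m *\<^sub>R z) = gauss (1/2) z" for z :: "real^'n"
      using \<epsilon>[of m] by (simp add: gauss_def power_mult_distrib)
    have "(LINT \<xi>|lborel. fourier \<phi> \<xi> * (cis (- (\<xi> \<bullet> x)) * ?g m \<xi>)) = (LINT y|lborel. \<phi> y * fourier (\<lambda>\<xi>. cis (- (\<xi> \<bullet> x)) * ?g m \<xi>) y)"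
      using \<epsilon>[of m] by (intro fourier_mult_formula schwartz_integrable \<phi> integrable_cis_mult gi) simp
    also have "\<dots> = (LINT y|lborel. \<phi> y * (of_real (((\<epsilon> m)\<^sup>2) powr (- real CARD('n) / 2)) * gauss (1 / (2 * (\<epsilon> m)\<^sup>2)) (x + y)))"
      by (simp only: F)
    also have "\<dots> = of_real (\<epsilon> m ^ CARD('n)) * (LINT z|lborel. \<phi> (- x + \<epsilon> m *\<^sub>R z) * (of_real (((\<epsilon> m)\<^sup>2) powr (- real CARD('n) / 2)) * gauss (1 / (2 * (\<epsilon> m)\<^sup>2)) (x + (- x + \<epsilon> m *\<^sub>R z))))"
      by (rule lborel_dilate) (use \<epsilon> in auto)
    also have "\<dots> = (LINT z|lborel. (of_real (\<epsilon> m ^ CARD('n)) * of_real (((\<epsilon> m)\<^sup>2) powr (- real CARD('n) / 2))) * (\<phi> (- x + \<epsilon> m *\<^sub>R z) * gauss (1 / (2 * (\<epsilon> m)\<^sup>2)) (\<epsilon> m *\<^sub>R z)))"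
      by (simp add: mult_ac flip: integral_mult_right_zero)
    also have "\<epsilon> m ^ CARD('n) * ((\<epsilon> m)\<^sup>2) powr (- real CARD('n) / 2) = 1"
    proof -
      have "((\<epsilon> m)\<^sup>2) powr (- real CARD('n) / 2) = (\<epsilon> m) powr (- real CARD('n))"
        using \<epsilon>(1)[of m] powr_powr[of "\<epsilon> m" 2 "- real CARD('n) / 2"] by simp
      then show ?thesis using \<epsilon>(1)[of m] by (simp add: powr_minus powr_realpow)
    qed
    then have "of_real (\<epsilon> m ^ CARD('n)) * complex_of_real (((\<epsilon> m)\<^sup>2) powr (- real CARD('n) / 2)) = 1" by (metis of_real_1 of_real_mult)
    finally show ?thesis by (simp only: gz mult_1)
  qed
  obtain B where B: "\<And>y. norm (\<phi> y) \<le> B" using rapidD[OF schwartz_rapid[OF \<phi>], of 0] by auto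
  have lim2: "(\<lambda>m. LINT z|lborel. \<phi> (- x + \<epsilon> m *\<^sub>R z) * gauss (1/2) z) \<longlonglongrightarrow> (LINT z|lborel. \<phi> (- x) * gauss (1/2) (z :: real^'n))"
  proof (rule integral_dominated_convergence[where w = "\<lambda>z. B * norm (gauss (1/2) z)"])
    show "integrable lborel (\<lambda>z :: real^'n. B * norm (gauss (1 / 2) z))" using gi[of "1/2"] by auto
    show "AE z in lborel. norm (\<phi> (- x + \<epsilon> m *\<^sub>R z) * gauss (1 / 2) z) \<le> B * norm (gauss (1 / 2) z)" for m
      using B by (auto simp: norm_mult intro!: mult_right_mono)
    show "AE z in lborel. (\<lambda>m. \<phi> (- x + \<epsilon> m *\<^sub>R z) * gauss (1/2) z) \<longlonglongrightarrow> \<phi> (- x) * gauss (1/2) z"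
    proof (rule AE_I2)
      fix z
      have "(\<lambda>m. - x + \<epsilon> m *\<^sub>R z) \<longlonglongrightarrow> - x + 0 *\<^sub>R z" by (intro tendsto_intros \<epsilon>0)
      then have "(\<lambda>m. \<phi> (- x + \<epsilon> m *\<^sub>R z)) \<longlonglongrightarrow> \<phi> (- x)"
        using schwartz_continuous[OF \<phi>] by (intro continuous_on_tendsto_compose[where f = \<phi> and s = UNIV]) auto
      then show "(\<lambda>m. \<phi> (- x + \<epsilon> m *\<^sub>R z) * gauss (1/2) z) \<longlonglongrightarrow> \<phi> (- x) * gauss (1/2) z" by (intro tendsto_intros)
    qed
  qed measurable
  have "(LINT \<xi>|lborel. cis (- (\<xi> \<bullet> x)) * fourier \<phi> \<xi>) = (LINT z|lborel. \<phi> (- x) * gauss (1/2) (z :: real^'n))"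
    using LIMSEQ_unique[OF lim1] lim2 unfolding eq by blast
  also have "\<dots> = \<phi> (- x) * of_real ((2 * pi) powr (real CARD('n) / 2))"
    using integral_gauss[of "1/2", where 'n='n] by (simp add: mult.commute)
  finally have "fourier (fourier \<phi>) x = \<phi> (- x) * of_real (?c * (2 * pi) powr (real CARD('n) / 2))"
    by (simp add: fourier_def[of "fourier \<phi>"] mult_ac)
  then show ?thesis by (simp add: powr_minus)
qed

section \<open>Distributions with a given radial Fourier transform\<close>

lemma measurable_gauss [measurable]: "gauss a \<in> borel_measurable borel"
  unfolding gauss_def[abs_def] by (intro borel_measurable_continuous_onI continuous_intros)

lemma nn_integral_lborel_translate:
  fixes f :: "real^'n::finite \<Rightarrow> ennreal"
  assumes [measurable]: "f \<in> borel_measurable borel"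
  shows "(\<integral>\<^sup>+ x. f (x + t) \<partial>lborel) = (\<integral>\<^sup>+ x. f x \<partial>lborel)"
proof -
  have "(\<integral>\<^sup>+ x. f x \<partial>lborel) = (\<integral>\<^sup>+ x. f x \<partial>distr lborel borel ((+) t))" by (simp add: lborel_distr_plus)
  also have "\<dots> = (\<integral>\<^sup>+ x. f (x + t) \<partial>lborel)" by (subst nn_integral_distr) (auto simp: add.commute)
  finally show ?thesis ..
qed

lemma nn_integral_lborel_reflect:
  fixes f :: "real^'n::finite \<Rightarrow> ennreal"
  assumes [measurable]: "f \<in> borel_measurable borel"
  shows "(\<integral>\<^sup>+ x. f (t - x) \<partial>lborel) = (\<integral>\<^sup>+ x. f x \<partial>lborel)"
proof -
  have e: "(lborel :: (real^'n) measure) = density (distr lborel borel (\<lambda>x. t - x)) (\<lambda>_. 1)"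
    using lborel_affine[of "- 1" t] by simp
  have "(\<integral>\<^sup>+ x. f x \<partial>lborel) = (\<integral>\<^sup>+ x. f x \<partial>density (distr lborel borel (\<lambda>x. t - x)) (\<lambda>_. 1))"
    by (rule arg_cong[OF e])
  also have "\<dots> = (\<integral>\<^sup>+ x. f (t - x) \<partial>lborel)" by (simp add: nn_integral_density nn_integral_distr)
  finally show ?thesis ..
qed

text \<open>The change-of-variables theorems of the library need a well-ordered index type. The invariance follows
  instead from the uniqueness argument for translation-invariant measures, with a Gaussian as the test function.\<close>

lemma nn_integral_orthogonal:
  fixes f :: "real^'n::finite \<Rightarrow> ennreal"
  assumes A: "orthogonal_transformation (A :: real^'n \<Rightarrow> real^'n)" and f [measurable]: "f \<in> borel_measurable borel"
  shows "(\<integral>\<^sup>+ x. f (A x) \<partial>lborel) = (\<integral>\<^sup>+ x. f x \<partial>lborel)"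
proof -
  have lin: "linear A" using A by (rule orthogonal_transformation_linear)
  have [measurable]: "A \<in> borel_measurable borel"
    by (intro borel_measurable_continuous_onI linear_continuous_on) (use lin linear_conv_bounded_linear in blast)
  define g where "g x = ennreal (exp (- (norm x)\<^sup>2))" for x :: "real^'n"
  have [measurable]: "g \<in> borel_measurable borel" unfolding g_def by measurable
  have gA: "g (A x) = g x" for x by (simp add: g_def orthogonal_transformation_norm[OF A])
  have surj: "A (inv A y) = y" for y using orthogonal_transformation_surj[OF A] by (rule surj_f_inv_f)
  let ?G = "\<integral>\<^sup>+ x. g x \<partial>lborel"
  have G: "?G \<noteq> 0" "?G \<noteq> \<infinity>"
  proof -
    have i: "integrable lborel (\<lambda>x::real^'n. exp (- (norm x)\<^sup>2))"
    proof -
      have "(gauss 1 :: real^'n \<Rightarrow> complex) \<in> schwartz" by (rule schwartz_gauss) simp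
      from integrable_norm[OF schwartz_integrable[OF this]] show ?thesis by (simp add: gauss_def)
    qed
    have "(LINT x::real^'n|lborel. exp (- (norm x)\<^sup>2)) = pi powr (real CARD('n) / 2)"
    proof -
      have "(LINT x::real^'n|lborel. complex_of_real (exp (- (norm x)\<^sup>2))) = complex_of_real (pi powr (real CARD('n) / 2))"
        using integral_gauss[of 1, where 'n='n] by (simp add: gauss_def)
      then show ?thesis unfolding integral_complex_of_real of_real_eq_iff .
    qed
    with i have "?G = ennreal (pi powr (real CARD('n) / 2))"
      unfolding g_def by (subst nn_integral_eq_integral) auto
    then show "?G \<noteq> 0" "?G \<noteq> \<infinity>" by auto
  qed
  \<comment> \<open>The constant \<open>?G\<close> is inserted as the integral of a translate of
    \<open>g\<close> by \<open>A x\<close>, which is legitimate for every \<open>x\<close>.\<close>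
  have "(\<integral>\<^sup>+ x. f (A x) \<partial>lborel) * ?G = (\<integral>\<^sup>+ x. f (A x) * (\<integral>\<^sup>+ y. g (y + A x) \<partial>lborel) \<partial>lborel)"
    by (simp add: nn_integral_lborel_translate nn_integral_multc)
  also have "\<dots> = (\<integral>\<^sup>+ x. \<integral>\<^sup>+ y. f (A x) * g (A x + y) \<partial>lborel \<partial>lborel)"
    by (simp add: nn_integral_cmult add.commute)
  also have "\<dots> = (\<integral>\<^sup>+ y. \<integral>\<^sup>+ x. f (A x) * g (A x + y) \<partial>lborel \<partial>lborel)"
    by (rule lborel_pair.Fubini'[symmetric]) simp
  \<comment> \<open>Shifting \<open>x\<close> by a preimage of \<open>- y\<close> moves
    \<open>y\<close> from the argument of \<open>g\<close> to that of \<open>f\<close>. After a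
    second exchange the inner integral over \<open>y\<close> is a reflected translate of
    \<open>f\<close> and no longer sees \<open>A\<close>, while
    \<open>g (A x) = g x\<close>.\<close>
  also have "\<dots> = (\<integral>\<^sup>+ y. \<integral>\<^sup>+ x. f (A x - y) * g (A x) \<partial>lborel \<partial>lborel)"
  proof (rule nn_integral_cong)
    fix y
    have "(\<integral>\<^sup>+ x. f (A x) * g (A x + y) \<partial>lborel) = (\<integral>\<^sup>+ x. f (A (x + inv A (- y))) * g (A (x + inv A (- y)) + y) \<partial>lborel)"
      by (rule nn_integral_lborel_translate[symmetric]) simp
    then show "(\<integral>\<^sup>+ x. f (A x) * g (A x + y) \<partial>lborel) = (\<integral>\<^sup>+ x. f (A x - y) * g (A x) \<partial>lborel)"
      by (simp add: linear_add[OF lin] surj)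
  qed
  also have "\<dots> = (\<integral>\<^sup>+ x. \<integral>\<^sup>+ y. f (A x - y) * g (A x) \<partial>lborel \<partial>lborel)"
    by (rule lborel_pair.Fubini') simp
  also have "\<dots> = (\<integral>\<^sup>+ x. f x \<partial>lborel) * ?G"
    by (simp add: nn_integral_multc nn_integral_lborel_reflect gA nn_integral_cmult)
  finally have "?G * (\<integral>\<^sup>+ x. f (A x) \<partial>lborel) = ?G * (\<integral>\<^sup>+ x. f x \<partial>lborel)" by (simp only: mult.commute)
  then show ?thesis using G unfolding ennreal_mult_cancel_left by simp
qed

lemma lborel_orthogonal:
  assumes A: "orthogonal_transformation (A :: real^'n::finite \<Rightarrow> real^'n)"
  shows "distr lborel borel A = lborel" and "A \<in> borel_measurable borel"
proof -
  have lin: "linear A" using A by (rule orthogonal_transformation_linear)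
  show m [measurable]: "A \<in> borel_measurable borel"
    by (intro borel_measurable_continuous_onI linear_continuous_on) (use lin linear_conv_bounded_linear in blast)
  show "distr lborel borel A = lborel"
  proof (rule measure_eqI)
    fix X assume "X \<in> sets (distr lborel borel A)"
    then have [measurable]: "X \<in> sets borel" by simp
    have "emeasure (distr lborel borel A) X = (\<integral>\<^sup>+ x. indicator X x \<partial>distr lborel borel A)" by simp
    also have "\<dots> = (\<integral>\<^sup>+ x. indicator X (A x) \<partial>lborel)" by (rule nn_integral_distr) auto
    also have "\<dots> = (\<integral>\<^sup>+ x. indicator X x \<partial>lborel)" by (rule nn_integral_orthogonal[OF A]) simp
    finally show "emeasure (distr lborel borel A) X = emeasure lborel X" by simp
  qed simp
qed

lemma integral_orthogonal:
  fixes f :: "real^'n::finite \<Rightarrow> complex"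
  assumes A: "orthogonal_transformation (A :: real^'n \<Rightarrow> real^'n)" and [measurable]: "f \<in> borel_measurable borel"
  shows "(LINT x|lborel. f (A x)) = (LINT x|lborel. f x)"
proof -
  note [measurable] = lborel_orthogonal(2)[OF A]
  have "(LINT x|lborel. f x) = (LINT x|distr lborel borel A. f x)" by (simp add: lborel_orthogonal(1)[OF A])
  also have "\<dots> = (LINT x|lborel. f (A x))" by (subst integral_distr) auto
  finally show ?thesis ..
qed

lemma orthogonal_transformation_uminus: "orthogonal_transformation (uminus :: real^'n::finite \<Rightarrow> real^'n)"
  using orthogonal_transformation_neg[of "\<lambda>x::real^'n. x"] by (simp add: orthogonal_transformation_id)

lemma fourier_orthogonal:
  fixes f :: "real^'n::finite \<Rightarrow> complex"
  assumes A: "orthogonal_transformation (A :: real^'n \<Rightarrow> real^'n)" and [measurable]: "f \<in> borel_measurable borel"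
  shows "fourier (f \<circ> A) \<xi> = fourier f (A \<xi>)"
proof -
  have "A x \<bullet> A \<xi> = x \<bullet> \<xi>" for x using A by (simp add: orthogonal_transformation_def)
  then have "(LINT x|lborel. cis (- (x \<bullet> \<xi>)) * f (A x)) = (LINT x|lborel. cis (- (A x \<bullet> A \<xi>)) * f (A x))" by simp
  also have "\<dots> = (LINT x|lborel. cis (- (x \<bullet> A \<xi>)) * f x)"
    by (rule integral_orthogonal[OF A]) simp
  finally show ?thesis by (simp add: fourier_def)
qed

section \<open>Distributions prescribed by their Fourier transform\<close>

definition poly_bounded :: "(real^'n::finite \<Rightarrow> complex) \<Rightarrow> bool" where
  "poly_bounded g \<longleftrightarrow> g \<in> borel_measurable borel \<and> (\<exists>C\<ge>0. \<exists>m. \<forall>\<xi>. norm (g \<xi>) \<le> C * (1 + norm \<xi>) ^ m)"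

lemma poly_bounded_mult_schwartz:
  assumes g: "poly_bounded g" and \<phi>: "\<phi> \<in> schwartz"
  shows "integrable lborel (\<lambda>x. g x * \<phi> x)"
proof (rule integrable_rapid)
  obtain C m where C: "C \<ge> 0" "\<And>\<xi>. norm (g \<xi>) \<le> C * (1 + norm \<xi>) ^ m" using g by (auto simp: poly_bounded_def)
  show "rapid (\<lambda>x. g x * \<phi> x)"
    by (rule rapid_dominated[OF schwartz_rapid[OF \<phi>], of _ C m "\<lambda>x. x"]) (use C in \<open>auto simp: norm_mult intro!: mult_right_mono\<close>)
  show "(\<lambda>x. g x * \<phi> x) \<in> borel_measurable borel"
    using g schwartz_measurable[OF \<phi>] by (intro borel_measurable_times) (auto simp: poly_bounded_def)
qed

lemma poly_bounded_tempered_fun: "poly_bounded g \<Longrightarrow> tempered_fun g"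
  unfolding tempered_fun_def by (auto intro: poly_bounded_mult_schwartz) (auto simp: poly_bounded_def)

text \<open>For even \<open>g\<close> this is the distribution with Fourier transform \<open>g\<close>.\<close>

definition inv_fourier_dist :: "(real^'n::finite \<Rightarrow> complex) \<Rightarrow> 'n dist" where
  "inv_fourier_dist g = (\<lambda>\<phi>. if \<phi> \<in> schwartz then LINT \<xi>|lborel. g \<xi> * fourier \<phi> \<xi> else 0)"

lemma tempered_inv_fourier_dist:
  fixes g :: "real^'n::finite \<Rightarrow> complex"
  assumes g: "poly_bounded g"
  shows "tempered (inv_fourier_dist g)"
  unfolding tempered_def
proof (intro conjI ballI allI impI)
  let ?T = "inv_fourier_dist g"
  have i: "integrable lborel (\<lambda>\<xi>. g \<xi> * fourier \<phi> \<xi>)" if "\<phi> \<in> schwartz" for \<phi>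
    by (intro poly_bounded_mult_schwartz g schwartz_fourier that)
  show "?T (\<lambda>x. \<phi> x + \<psi> x) = ?T \<phi> + ?T \<psi>" if "\<phi> \<in> schwartz" "\<psi> \<in> schwartz" for \<phi> \<psi>
    using that i by (simp add: inv_fourier_dist_def schwartz_add fourier_add schwartz_integrable distrib_left)
  show "?T (\<lambda>x. c * \<phi> x) = c * ?T \<phi>" if "\<phi> \<in> schwartz" for \<phi> c
    using that by (simp add: inv_fourier_dist_def schwartz_cmult fourier_cmult mult.left_commute)
  show "?T \<phi> = 0" if "\<phi> \<notin> schwartz" for \<phi> using that by (simp add: inv_fourier_dist_def)
  obtain C m where C: "C \<ge> 0" "\<And>\<xi>. norm (g \<xi>) \<le> C * (1 + norm \<xi>) ^ m" using g by (auto simp: poly_bounded_def)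
  obtain K where K: "K \<ge> 0" "\<And>\<phi> \<xi>. \<phi> \<in> schwartz \<Longrightarrow> (1 + norm (\<xi>::real^'n)) ^ (m + CARD('n) + 1) * norm (fourier \<phi> \<xi>)
       \<le> K * schwartz_norm (m + CARD('n) + 1 + CARD('n) + 1) \<phi>"
    using fourier_decay[of "m + CARD('n) + 1", where 'n='n] by blast
  let ?N = "m + CARD('n) + 1 + CARD('n) + 1"
  have "norm (?T \<phi>) \<le> C * K * decay_const TYPE('n) * schwartz_norm ?N \<phi>" if \<phi>: "\<phi> \<in> schwartz" for \<phi>
  proof -
    have "norm (?T \<phi>) \<le> (LINT \<xi>|lborel. norm (g \<xi> * fourier \<phi> \<xi>))" using \<phi> by (simp add: inv_fourier_dist_def integral_norm_bound)
    also have "\<dots> \<le> (C * (K * schwartz_norm ?N \<phi>)) * decay_const TYPE('n)"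
    proof (rule integral_decay_le)
      show "(\<lambda>\<xi>. g \<xi> * fourier \<phi> \<xi>) \<in> borel_measurable borel"
        using i[OF \<phi>] by auto
      fix \<xi> :: "real^'n"
      have "(1 + norm \<xi>) ^ (CARD('n) + 1) * norm (g \<xi> * fourier \<phi> \<xi>) \<le> (1 + norm \<xi>) ^ (CARD('n) + 1) * (C * (1 + norm \<xi>) ^ m * norm (fourier \<phi> \<xi>))"
        unfolding norm_mult by (intro mult_left_mono mult_right_mono C) auto
      also have "\<dots> = C * ((1 + norm \<xi>) ^ (m + CARD('n) + 1) * norm (fourier \<phi> \<xi>))" by (simp add: power_add mult_ac)
      also have "\<dots> \<le> C * (K * schwartz_norm ?N \<phi>)" by (intro mult_left_mono K \<phi> C)
      finally show "(1 + norm \<xi>) ^ (CARD('n) + 1) * norm (g \<xi> * fourier \<phi> \<xi>) \<le> C * (K * schwartz_norm ?N \<phi>)" .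
    qed
    finally show ?thesis by (simp add: mult_ac)
  qed
  then show "\<exists>C N. \<forall>\<phi>\<in>schwartz. norm (?T \<phi>) \<le> C * schwartz_norm N \<phi>" by blast
qed

text \<open>Two transforms reflect the argument, and evenness of \<open>g\<close> absorbs the
  reflection. Radial functions, the only ones used below, are even.\<close>

lemma has_fourier_fun_inv_fourier_dist:
  fixes g :: "real^'n::finite \<Rightarrow> complex"
  assumes g: "poly_bounded g" and even: "\<And>\<xi>. g (- \<xi>) = g \<xi>"
  shows "has_fourier_fun (inv_fourier_dist g) g"
  unfolding has_fourier_fun_def
proof
  show "tempered_fun g" using g by (rule poly_bounded_tempered_fun)
  have [measurable]: "g \<in> borel_measurable borel" using g by (simp add: poly_bounded_def)
  show "dist_fourier (inv_fourier_dist g) = dist_of g"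
  proof
    fix \<phi> :: "real^'n \<Rightarrow> complex"
    show "dist_fourier (inv_fourier_dist g) \<phi> = dist_of g \<phi>"
    proof (cases "\<phi> \<in> schwartz")
      case True
      have [measurable]: "\<phi> \<in> borel_measurable borel" by (rule schwartz_measurable[OF True])
      have "dist_fourier (inv_fourier_dist g) \<phi> = (LINT \<xi>|lborel. g (- \<xi>) * \<phi> (- \<xi>))"
        using True by (simp add: dist_fourier_def inv_fourier_dist_def schwartz_fourier fourier_inversion even)
      also have "\<dots> = (LINT \<xi>|lborel. g \<xi> * \<phi> \<xi>)"
        by (rule integral_orthogonal[OF orthogonal_transformation_uminus, of "\<lambda>\<xi>. g \<xi> * \<phi> \<xi>"]) simp
      finally show ?thesis using True by (simp add: dist_of_def)
    qed (simp add: dist_fourier_def dist_of_def)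
  qed
qed

lemma radial_inv_fourier_dist:
  fixes h :: "real \<Rightarrow> complex"
  assumes [measurable]: "(\<lambda>\<xi>::real^'n::finite. h (norm \<xi>)) \<in> borel_measurable borel"
  shows "radial_dist (inv_fourier_dist (\<lambda>\<xi>::real^'n. h (norm \<xi>)))"
  unfolding radial_dist_def
proof (intro allI impI ballI)
  fix A :: "real^'n \<Rightarrow> real^'n" and \<phi> :: "real^'n \<Rightarrow> complex"
  assume A: "orthogonal_transformation A" and \<phi>: "\<phi> \<in> schwartz"
  have [measurable]: "fourier \<phi> \<in> borel_measurable borel" by (intro schwartz_measurable schwartz_fourier \<phi>)
  have "(LINT \<xi>|lborel. h (norm \<xi>) * fourier (\<phi> \<circ> A) \<xi>) = (LINT \<xi>|lborel. h (norm (A \<xi>)) * fourier \<phi> (A \<xi>))"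
    using fourier_orthogonal[OF A schwartz_measurable[OF \<phi>]] orthogonal_transformation_norm[OF A] by simp
  also have "\<dots> = (LINT \<xi>|lborel. h (norm \<xi>) * fourier \<phi> \<xi>)"
    by (rule integral_orthogonal[OF A, of "\<lambda>\<xi>. h (norm \<xi>) * fourier \<phi> \<xi>"]) simp
  finally show "inv_fourier_dist (\<lambda>\<xi>. h (norm \<xi>)) (\<phi> \<circ> A) = inv_fourier_dist (\<lambda>\<xi>. h (norm \<xi>)) \<phi>"
    using schwartz_orthogonal[OF A \<phi>] \<phi> by (simp add: inv_fourier_dist_def)
qed

text \<open>Lets an identity of distributions be checked on transforms \<open>fourier \<phi>\<close>
  only. The preimage is the reflected transform, by inversion.\<close>

lemma schwartz_fourier_surj:
  assumes "\<psi> \<in> schwartz"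
  obtains \<phi> :: "real^'n::finite \<Rightarrow> complex" where "\<phi> \<in> schwartz" "\<psi> = fourier \<phi>"
proof
  note F = schwartz_fourier[OF assms]
  show "fourier \<psi> \<circ> uminus \<in> schwartz" by (rule schwartz_orthogonal[OF orthogonal_transformation_uminus F])
  show "\<psi> = fourier (fourier \<psi> \<circ> uminus)"
    by (rule ext) (simp add: fourier_orthogonal[OF orthogonal_transformation_uminus schwartz_measurable[OF F]] fourier_inversion[OF assms])
qed

lemma gauss_mult: "gauss a x * gauss b x = gauss (a + b) x"
  by (simp add: gauss_def exp_add[symmetric] algebra_simps flip: of_real_mult)

lemma gauss_power: "of_real (exp (- ((norm x)\<^sup>2)) ^ j) = gauss (real j) x"
  by (simp add: gauss_def exp_of_nat_mult[symmetric])

text \<open>Restriction to a coordinate axis recovers the profile. The values of \<open>g\<close> at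
  negative arguments are not controlled by the function on space, hence the absolute value.\<close>

lemma measurable_radial_profile:
  assumes [measurable]: "(\<lambda>x::real^'n::finite. g (norm x)) \<in> borel_measurable borel"
  shows "(\<lambda>r. g \<bar>r\<bar> :: complex) \<in> borel_measurable borel"
proof -
  have [measurable]: "(\<lambda>r::real. r *\<^sub>R (axis undefined 1 :: real^'n)) \<in> borel_measurable borel" by measurable
  have "(\<lambda>r. (\<lambda>x::real^'n. g (norm x)) (r *\<^sub>R axis undefined 1)) \<in> borel_measurable borel"
    by (rule measurable_compose[OF _ assms]) measurable
  then show ?thesis by simp
qed

text \<open>Gaussians determine a radial function. After multiplication by
  \<open>exp (- (a0 * r^2))\<close>, which secures integrability, pairing with wider exponents
  \<open>a0 + j\<close> yields all moments in the variable \<open>exp (- r^2)\<close>.\<close>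

lemma radial_AE_eqI:
  fixes g1 g2 :: "real \<Rightarrow> complex"
  assumes m: "(\<lambda>x::real^'n::finite. g1 (norm x)) \<in> borel_measurable borel" "(\<lambda>x::real^'n. g2 (norm x)) \<in> borel_measurable borel"
    and i: "integrable lborel (\<lambda>x::real^'n. g1 (norm x) * gauss a0 x)" "integrable lborel (\<lambda>x::real^'n. g2 (norm x) * gauss a0 x)"
    and eq: "\<And>a. a \<ge> a0 \<Longrightarrow> (LINT x::real^'n|lborel. g1 (norm x) * gauss a x) = (LINT x::real^'n|lborel. g2 (norm x) * gauss a x)"
  shows "AE r in pow_meas (real CARD('n)). g1 r = g2 r"
proof -
  let ?n = "real CARD('n)"
  note [measurable] = measurable_radial_profile[OF m(1)] measurable_radial_profile[OF m(2)]
  define G where "G r = (g1 \<bar>r\<bar> - g2 \<bar>r\<bar>) * of_real (exp (- (a0 * r\<^sup>2)))" for r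
  have [measurable]: "G \<in> borel_measurable borel" unfolding G_def[abs_def] by measurable
  have Gi: "integrable lborel (\<lambda>x::real^'n. G (norm x))"
    using Bochner_Integration.integrable_diff[OF i] by (simp add: G_def gauss_def left_diff_distrib)
  have "AE r in pow_meas ?n. G r = 0"
  proof (rule integral_gaussian_powers_zero_imp_AE[where c = 1])
    show "integrable (pow_meas ?n) G" using Gi by (subst integrable_radial_iff[symmetric, where 'n='n]) auto
    show "AE x in pow_meas ?n. x > 0" by (rule AE_pow_meas_pos) simp
    fix j
    have "(LINT x::real^'n|lborel. G (norm x) * of_real (exp (- (1 * (norm x)\<^sup>2)) ^ j))
        = (LINT x::real^'n|lborel. g1 (norm x) * gauss (a0 + real j) x - g2 (norm x) * gauss (a0 + real j) x)"
      by (simp add: G_def gauss_mult[symmetric] gauss_power[symmetric] left_diff_distrib mult.assoc) (simp add: gauss_def)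
    also have "\<dots> = 0"
    proof -
      have "norm (gauss (a0 + real j) x) \<le> norm (gauss a0 x)" for x :: "real^'n"
        by (simp add: gauss_def distrib_right)
      then have b: "norm (g * gauss (a0 + real j) x) \<le> norm (g * gauss a0 x)" for x :: "real^'n" and g
        by (simp add: norm_mult mult_left_mono)
      note [measurable] = m
      have "integrable lborel (\<lambda>x::real^'n. g1 (norm x) * gauss (a0 + real j) x)"
        by (rule Bochner_Integration.integrable_bound[OF i(1)]) (use b in auto)
      moreover have "integrable lborel (\<lambda>x::real^'n. g2 (norm x) * gauss (a0 + real j) x)"
        by (rule Bochner_Integration.integrable_bound[OF i(2)]) (use b in auto)
      ultimately show ?thesis using eq[of "a0 + real j"] by simp
    qed
    finally have "(LINT x::real^'n|lborel. (\<lambda>r. G r * of_real (exp (- (1 * r\<^sup>2)) ^ j)) (norm x)) = 0" .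
    then show "(LINT x|pow_meas ?n. G x * complex_of_real (exp (- (1 * x\<^sup>2)) ^ j)) = 0"
    proof (subst (asm) integral_radial)
      have "unit_ball_vol ?n \<noteq> 0" by (rule less_imp_neq[symmetric], rule unit_ball_vol_pos) simp
      then show "unit_ball_vol ?n *\<^sub>R (LINT r|pow_meas ?n. G r * of_real (exp (- (1 * r\<^sup>2)) ^ j)) = 0 \<Longrightarrow> ?thesis" by simp
    qed measurable
  qed auto
  with AE_pow_meas_pos[of ?n] show ?thesis by (auto simp: G_def elim!: eventually_elim2)
qed

lemma has_fourier_funD: "has_fourier_fun u g \<Longrightarrow> \<phi> \<in> schwartz \<Longrightarrow> u (fourier \<phi>) = (LINT x|lborel. g x * \<phi> x)"
  unfolding has_fourier_fun_def by (auto simp: dist_fourier_def dist_of_def fun_eq_iff split: if_splits)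

lemma has_fourier_fun_tempered: "has_fourier_fun u g \<Longrightarrow> tempered_fun g"
  by (simp add: has_fourier_fun_def)

lemma tempered_fun_integrable: "tempered_fun g \<Longrightarrow> \<phi> \<in> schwartz \<Longrightarrow> integrable lborel (\<lambda>x. g x * \<phi> x)"
  by (simp add: tempered_fun_def)

lemma has_fourier_fun_radial_unique:
  assumes "has_fourier_fun u (\<lambda>\<xi>::real^'n::finite. h1 (norm \<xi>))" "has_fourier_fun u (\<lambda>\<xi>::real^'n. h2 (norm \<xi>))"
  shows "AE r in pow_meas (real CARD('n)). h1 r = h2 r"
proof (rule radial_AE_eqI[where 'n='n and ?a0.0 = 1])
  note t = assms[THEN has_fourier_fun_tempered]
  show "integrable lborel (\<lambda>x::real^'n. h1 (norm x) * gauss 1 x)" "integrable lborel (\<lambda>x::real^'n. h2 (norm x) * gauss 1 x)"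
    using t by (auto intro!: tempered_fun_integrable schwartz_gauss)
  show "(\<lambda>x::real^'n. h1 (norm x)) \<in> borel_measurable borel" "(\<lambda>x::real^'n. h2 (norm x)) \<in> borel_measurable borel"
    using t by (auto simp: tempered_fun_def)
  show "(LINT x::real^'n|lborel. h1 (norm x) * gauss a x) = (LINT x::real^'n|lborel. h2 (norm x) * gauss a x)" if "1 \<le> a" for a
  proof -
    have g: "(gauss a :: real^'n \<Rightarrow> complex) \<in> schwartz" using that by (intro schwartz_gauss) simp
    show ?thesis by (rule trans[OF has_fourier_funD[OF assms(1) g, symmetric] has_fourier_funD[OF assms(2) g]])
  qed
qed

lemma has_fourier_fun_cong_AE:
  assumes u: "has_fourier_fun u g1" and m [measurable]: "g2 \<in> borel_measurable borel" and ae: "AE x in lborel. g1 x = g2 x"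
  shows "has_fourier_fun u g2"
proof -
  have [measurable]: "g1 \<in> borel_measurable borel" using u by (simp add: has_fourier_fun_def tempered_fun_def)
  have e: "integrable lborel (\<lambda>x. g1 x * \<phi> x) \<longleftrightarrow> integrable lborel (\<lambda>x. g2 x * \<phi> x)"
     "(LINT x|lborel. g1 x * \<phi> x) = (LINT x|lborel. g2 x * \<phi> x)" if "\<phi> \<in> schwartz" for \<phi>
  proof -
    have [measurable]: "\<phi> \<in> borel_measurable borel" using that by (rule schwartz_measurable)
    show "integrable lborel (\<lambda>x. g1 x * \<phi> x) \<longleftrightarrow> integrable lborel (\<lambda>x. g2 x * \<phi> x)"
      using ae by (intro integrable_cong_AE) auto
    show "(LINT x|lborel. g1 x * \<phi> x) = (LINT x|lborel. g2 x * \<phi> x)"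
      using ae by (intro integral_cong_AE) auto
  qed
  then have "dist_of g1 = dist_of g2" by (auto simp: dist_of_def)
  with u e show ?thesis by (auto simp: has_fourier_fun_def tempered_fun_def)
qed

text \<open>The weight \<open>|\<xi>|\<^bsup>2s\<^esup>\<close> is a limit of bounded functions of \<open>exp (- |\<xi>|\<^sup>2)\<close>, and multiplication by the
  latter preserves Schwartz functions. So the weighted transform is determined by the transform.\<close>

lemma has_fourier_fun_weight_unique:
  fixes g1 g2 :: "real^'n::finite \<Rightarrow> complex"
  assumes u: "has_fourier_fun u g1" "has_fourier_fun u g2"
    and t: "tempered_fun (\<lambda>\<xi>. of_real (norm \<xi> powr q) * g1 \<xi>)" "tempered_fun (\<lambda>\<xi>. of_real (norm \<xi> powr q) * g2 \<xi>)"
    and \<phi>: "\<phi> \<in> schwartz"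
  shows "(LINT \<xi>|lborel. of_real (norm \<xi> powr q) * g1 \<xi> * \<phi> \<xi>) = (LINT \<xi>|lborel. of_real (norm \<xi> powr q) * g2 \<xi> * \<phi> \<xi>)"
proof -
  note tu = u[THEN has_fourier_fun_tempered]
  have [measurable]: "g1 \<in> borel_measurable borel" "g2 \<in> borel_measurable borel" "\<phi> \<in> borel_measurable borel"
    using tu \<phi> by (auto simp: tempered_fun_def intro: schwartz_measurable)
  let ?G = "\<lambda>\<xi>. (g1 \<xi> - g2 \<xi>) * \<phi> \<xi>"
  have G: "integrable lborel ?G"
    using tu[THEN tempered_fun_integrable, OF \<phi>] by (simp add: left_diff_distrib)
  have zero: "(LINT \<xi>|lborel. ?G \<xi> * of_real (exp (- ((norm \<xi>)\<^sup>2)) ^ j)) = 0" for j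
  proof -
    have s: "(\<lambda>\<xi>. \<phi> \<xi> * gauss (real j) \<xi>) \<in> schwartz"
    proof (cases "j = 0")
      case True then show ?thesis using \<phi> by (simp add: gauss_def)
    qed (use \<phi> in \<open>auto intro!: schwartz_mult schwartz_gauss\<close>)
    have "(LINT \<xi>|lborel. ?G \<xi> * of_real (exp (- ((norm \<xi>)\<^sup>2)) ^ j)) =
        (LINT \<xi>|lborel. g1 \<xi> * (\<phi> \<xi> * gauss (real j) \<xi>) - g2 \<xi> * (\<phi> \<xi> * gauss (real j) \<xi>))"
      unfolding gauss_power by (simp only: left_diff_distrib mult.assoc)
    also have "\<dots> = 0"
      using has_fourier_funD[OF u(1) s] has_fourier_funD[OF u(2) s] tu[THEN tempered_fun_integrable, OF s] by simp
    finally show ?thesis .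
  qed
  have trunc: "(LINT \<xi>|lborel. ?G \<xi> * of_real (min (real m) (norm \<xi> powr q))) = 0" for m
  proof -
    have "(LINT \<xi>|lborel. ?G \<xi> * of_real ((\<lambda>y. min (real m) (sqrt (- ln y) powr q)) (exp (- ((norm \<xi>)\<^sup>2))))) = 0"
      by (rule integral_powers_zero_imp[OF G _ _ zero, where B = "real m"]) auto
    then show ?thesis by simp
  qed
  have "(\<lambda>m. LINT \<xi>|lborel. ?G \<xi> * of_real (min (real m) (norm \<xi> powr q))) \<longlonglongrightarrow> (LINT \<xi>|lborel. ?G \<xi> * of_real (norm \<xi> powr q))"
  proof (rule integral_dominated_convergence[where w = "\<lambda>\<xi>. norm (?G \<xi> * of_real (norm \<xi> powr q))"])
    have "integrable lborel (\<lambda>\<xi>. of_real (norm \<xi> powr q) * g1 \<xi> * \<phi> \<xi> - of_real (norm \<xi> powr q) * g2 \<xi> * \<phi> \<xi>)"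
      using t[THEN tempered_fun_integrable, OF \<phi>] by simp
    moreover have "of_real (norm \<xi> powr q) * g1 \<xi> * \<phi> \<xi> - of_real (norm \<xi> powr q) * g2 \<xi> * \<phi> \<xi> = ?G \<xi> * of_real (norm \<xi> powr q)" for \<xi>
      by (simp only: left_diff_distrib right_diff_distrib mult_ac)
    ultimately have "integrable lborel (\<lambda>\<xi>. ?G \<xi> * of_real (norm \<xi> powr q))" by (simp only:)
    then show "integrable lborel (\<lambda>\<xi>. norm (?G \<xi> * of_real (norm \<xi> powr q)))" by (rule integrable_norm)
    show "AE \<xi> in lborel. norm (?G \<xi> * of_real (min (real m) (norm \<xi> powr q))) \<le> norm (?G \<xi> * of_real (norm \<xi> powr q))" for m
      by (intro AE_I2) (auto simp: norm_mult intro!: mult_left_mono)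
    show "AE \<xi> in lborel. (\<lambda>m. ?G \<xi> * of_real (min (real m) (norm \<xi> powr q))) \<longlonglongrightarrow> ?G \<xi> * of_real (norm \<xi> powr q)"
    proof (rule AE_I2)
      fix \<xi> :: "real^'n"
      have "eventually (\<lambda>m. norm \<xi> powr q \<le> real m) sequentially"
        using filterlim_real_sequentially by (simp add: filterlim_at_top)
      then have "eventually (\<lambda>m. ?G \<xi> * of_real (min (real m) (norm \<xi> powr q)) = ?G \<xi> * of_real (norm \<xi> powr q)) sequentially"
        by eventually_elim (simp add: min_absorb2)
      then show "(\<lambda>m. ?G \<xi> * of_real (min (real m) (norm \<xi> powr q))) \<longlonglongrightarrow> ?G \<xi> * of_real (norm \<xi> powr q)"
        by (rule tendsto_eventually)
    qed
  qed measurable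
  then have "(LINT \<xi>|lborel. ?G \<xi> * of_real (norm \<xi> powr q)) = 0"
    unfolding trunc LIMSEQ_const_iff by (rule sym)
  moreover have "(LINT \<xi>|lborel. ?G \<xi> * of_real (norm \<xi> powr q)) =
     (LINT \<xi>|lborel. of_real (norm \<xi> powr q) * g1 \<xi> * \<phi> \<xi> - of_real (norm \<xi> powr q) * g2 \<xi> * \<phi> \<xi>)"
    by (simp only: left_diff_distrib right_diff_distrib mult_ac)
  ultimately show ?thesis using t[THEN tempered_fun_integrable, OF \<phi>] by simp
qed

text \<open>The definite description in \<open>frac_laplace\<close> hides an existential over the
  representative \<open>g\<close>. It denotes \<open>v\<close> because two representatives give the
  same weighted pairings, and pairings with transforms exhaust all Schwartz functions.\<close>

lemma frac_laplace_eqI: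
  assumes v: "tempered v" and u: "has_fourier_fun u g" and vg: "has_fourier_fun v (\<lambda>\<xi>. of_real (norm \<xi> powr (2 * s)) * g \<xi>)"
  shows "frac_laplace s u = v"
  unfolding frac_laplace_def
proof (rule the_equality)
  show "tempered v \<and> (\<exists>g. has_fourier_fun u g \<and> has_fourier_fun v (\<lambda>\<xi>. of_real (norm \<xi> powr (2 * s)) * g \<xi>))"
    using assms by blast
  fix v' assume "tempered v' \<and> (\<exists>g. has_fourier_fun u g \<and> has_fourier_fun v' (\<lambda>\<xi>. of_real (norm \<xi> powr (2 * s)) * g \<xi>))"
  then obtain g' where v': "tempered v'" and u': "has_fourier_fun u g'"
    and vg': "has_fourier_fun v' (\<lambda>\<xi>. of_real (norm \<xi> powr (2 * s)) * g' \<xi>)" by blast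
  show "v' = v"
  proof
    fix \<psi> :: "real^'a \<Rightarrow> complex"
    show "v' \<psi> = v \<psi>"
    proof (cases "\<psi> \<in> schwartz")
      case True
      then obtain \<phi> where \<phi>: "\<phi> \<in> schwartz" "\<psi> = fourier \<phi>" by (rule schwartz_fourier_surj)
      show ?thesis unfolding \<phi>(2) has_fourier_funD[OF vg \<phi>(1)] has_fourier_funD[OF vg' \<phi>(1)]
        by (rule has_fourier_fun_weight_unique[OF u' u has_fourier_fun_tempered[OF vg'] has_fourier_fun_tempered[OF vg] \<phi>(1)])
    next
      case False
      then show ?thesis using v v' by (simp add: tempered_def)
    qed
  qed
qed

lemma frac_laplace_radial:
  fixes h :: "real \<Rightarrow> complex" and u :: "'n::finite dist"
  assumes u: "has_fourier_fun u (\<lambda>\<xi>. h (norm \<xi>))" and h: "poly_bounded (\<lambda>\<xi>::real^'n. of_real (norm \<xi> powr (2 * s)) * h (norm \<xi>))"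
  shows "frac_laplace s u = inv_fourier_dist (\<lambda>\<xi>. of_real (norm \<xi> powr (2 * s)) * h (norm \<xi>))"
  by (rule frac_laplace_eqI[OF tempered_inv_fourier_dist[OF h] u has_fourier_fun_inv_fourier_dist[OF h]]) simp

section \<open>The operator \<open>L_op\<close> on the Fourier side\<close>

lemma has_fourier_fun_schwartz:
  assumes f: "f \<in> schwartz"
  shows "has_fourier_fun (dist_of f) (fourier f)"
  unfolding has_fourier_fun_def
proof
  show "tempered_fun (fourier f)"
    unfolding tempered_fun_def
    using f by (auto intro!: schwartz_measurable schwartz_integrable schwartz_mult schwartz_fourier)
  show "dist_fourier (dist_of f) = dist_of (fourier f)"
    by (rule ext) (auto simp: dist_fourier_def dist_of_def schwartz_fourier fourier_mult_formula[symmetric] schwartz_integrable f)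
qed

text \<open>The transform turns \<open>x . grad\<close> into \<open>- div (\<xi> ...)\<close>, whose
  transpose \<open>\<xi> . grad\<close> acts on the test function. The two factors
  \<open>- \<i>\<close> and the sign of the distributional derivative cancel. No differentiability
  of \<open>g\<close> is involved.\<close>

lemma euler_deriv_fourier:
  fixes u :: "'n::finite dist"
  assumes u: "has_fourier_fun u g" and \<phi>: "\<phi> \<in> schwartz"
  shows "euler_deriv u (fourier \<phi>) = (\<Sum>i\<in>UNIV. LINT \<xi>|lborel. g \<xi> * (of_real (\<xi> $ i) * partial_deriv i \<phi> \<xi>))"
  unfolding euler_deriv_def
proof (rule sum.cong[OF refl])
  fix i :: 'n
  note F\<phi> = schwartz_fourier[OF \<phi>]
  have x: "(\<lambda>x. of_real (x $ i) * fourier \<phi> x) = fourier (\<lambda>x. - \<i> * partial_deriv i \<phi> x)"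
    by (rule ext) (simp only: fourier_cmult fourier_partial_deriv[OF \<phi>] mult.assoc[symmetric], simp)
  have "dist_coord_mult i (dist_deriv i u) (fourier \<phi>) = - u (partial_deriv i (\<lambda>x. of_real (x $ i) * fourier \<phi> x))"
    using F\<phi> schwartz_coord[OF F\<phi>, of i] by (simp add: dist_coord_mult_def dist_deriv_def)
  also have "partial_deriv i (\<lambda>x. of_real (x $ i) * fourier \<phi> x) = fourier (\<lambda>x. - \<i> * (of_real (x $ i) * (- \<i> * partial_deriv i \<phi> x)))"
    unfolding x by (rule partial_deriv_fourier) (intro schwartz_cmult schwartz_partial_deriv \<phi>)
  also have "- u \<dots> = - (LINT \<xi>|lborel. g \<xi> * (- \<i> * (of_real (\<xi> $ i) * (- \<i> * partial_deriv i \<phi> \<xi>))))"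
    by (subst has_fourier_funD[OF u]) (intro schwartz_cmult schwartz_coord schwartz_partial_deriv \<phi>, simp)
  also have "\<dots> = (LINT \<xi>|lborel. g \<xi> * (of_real (\<xi> $ i) * partial_deriv i \<phi> \<xi>))"
  proof -
    have "g \<xi> * (- \<i> * (of_real (\<xi> $ i) * (- \<i> * partial_deriv i \<phi> \<xi>))) = - (g \<xi> * (of_real (\<xi> $ i) * partial_deriv i \<phi> \<xi>))" for \<xi>
      by (simp add: mult.left_commute)
    then show ?thesis by simp
  qed
  finally show "dist_coord_mult i (dist_deriv i u) (fourier \<phi>) = \<dots>" .
qed

lemma L_op_fourier:
  fixes u :: "'n::finite dist"
  assumes u: "has_fourier_fun u g" and fu: "has_fourier_fun (frac_laplace s u) (\<lambda>\<xi>. of_real (norm \<xi> powr (2 * s)) * g \<xi>)"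
    and \<phi>: "\<phi> \<in> schwartz"
  shows "L_op s u (fourier \<phi>) = (LINT \<xi>|lborel. of_real (norm \<xi> powr (2 * s)) * g \<xi> * \<phi> \<xi>)
     - of_real (1 / (2 * s)) * (\<Sum>i\<in>UNIV. LINT \<xi>|lborel. g \<xi> * (of_real (\<xi> $ i) * partial_deriv i \<phi> \<xi>))
     - of_real (real CARD('n) / (2 * s)) * (LINT \<xi>|lborel. g \<xi> * \<phi> \<xi>)"
  unfolding L_op_def has_fourier_funD[OF u \<phi>] has_fourier_funD[OF fu \<phi>] euler_deriv_fourier[OF u \<phi>] ..

lemma L_op_nonschwartz:
  assumes "tempered u" "tempered (frac_laplace s u)" "\<psi> \<notin> schwartz"
  shows "L_op s u \<psi> = 0"
  using assms by (simp add: L_op_def tempered_def euler_deriv_def dist_coord_mult_def)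

text \<open>At \<open>r = norm \<xi>\<close> and \<open>q = 2 * s\<close> this is a Gaussian in
  \<open>\<theta> = |\<xi>|^s\<close>, hence the transform of an element \<open>u\<close> whose
  \<open>dagger\<close> is Gaussian.\<close>

definition stretched_exp :: "real \<Rightarrow> real \<Rightarrow> real \<Rightarrow> complex" where
  "stretched_exp b q r = of_real (exp (- (b * r powr q)))"

lemma measurable_stretched_exp [measurable]: "stretched_exp b q \<in> borel_measurable borel"
  unfolding stretched_exp_def[abs_def] by measurable

lemma norm_stretched_exp_le: "b \<ge> 0 \<Longrightarrow> norm (stretched_exp b q r) \<le> 1"
  by (simp add: stretched_exp_def)

lemma powr_le_one_plus_power:
  assumes "r \<ge> 0" "q \<le> real m" "q \<ge> 0"
  shows "r powr q \<le> (1 + r) ^ m"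
proof -
  have "r powr q \<le> (1 + r) powr q" using assms by (intro powr_mono2) auto
  also have "\<dots> \<le> (1 + r) powr (real m)" using assms by (intro powr_mono) auto
  also have "\<dots> = (1 + r) ^ m" using assms by (simp add: powr_realpow add_pos_nonneg)
  finally show ?thesis .
qed

lemma poly_bounded_powr_mult:
  fixes g :: "real^'n::finite \<Rightarrow> complex"
  assumes g [measurable]: "g \<in> borel_measurable borel" and b: "\<And>\<xi>. norm (g \<xi>) \<le> B" and q: "q \<ge> 0"
  shows "poly_bounded (\<lambda>\<xi>. of_real (norm \<xi> powr q) * g \<xi>)"
  unfolding poly_bounded_def
proof (intro conjI exI allI)
  have "0 \<le> norm (g 0)" by simp
  also have "\<dots> \<le> B" by (rule b)
  finally show B: "B \<ge> 0" .
  obtain m :: nat where m: "q \<le> real m" using real_arch_simple by blast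
  show "norm (of_real (norm \<xi> powr q) * g \<xi>) \<le> B * (1 + norm \<xi>) ^ nat \<lceil>q\<rceil>" for \<xi>
  proof -
    have "norm \<xi> powr q * norm (g \<xi>) \<le> (1 + norm \<xi>) ^ nat \<lceil>q\<rceil> * B"
      using q B by (intro mult_mono powr_le_one_plus_power b) (auto simp: real_nat_ceiling_ge)
    then show ?thesis by (simp add: norm_mult mult.commute)
  qed
qed measurable

lemma poly_bounded_bounded:
  fixes g :: "real^'n::finite \<Rightarrow> complex"
  assumes "g \<in> borel_measurable borel" "\<And>\<xi>. norm (g \<xi>) \<le> B"
  shows "poly_bounded g"
proof -
  have "0 \<le> norm (g 0)" by simp
  also have "\<dots> \<le> B" by (rule assms)
  finally have "B \<ge> 0" .
  moreover have "\<forall>\<xi>. norm (g \<xi>) \<le> B * (1 + norm \<xi>) ^ 0" using assms(2) by simp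
  ultimately show ?thesis using assms(1) unfolding poly_bounded_def by blast
qed

lemma has_vector_derivative_schwartz_line:
  assumes "\<phi> \<in> schwartz"
  shows "((\<lambda>t. \<phi> (x + t *\<^sub>R axis i 1)) has_vector_derivative partial_deriv i \<phi> x) (at 0)"
proof -
  have l: "((\<lambda>t. x + t *\<^sub>R axis i 1) has_derivative (\<lambda>t. t *\<^sub>R axis i 1)) (at 0)"
    by (auto intro!: derivative_eq_intros)
  have "(\<phi> has_derivative frechet_derivative \<phi> (at x)) (at (x + 0 *\<^sub>R axis i 1))"
    using schwartz_differentiable[OF assms] by (simp add: frechet_derivative_works)
  from has_derivative_compose[OF l this]
  have "((\<lambda>t. \<phi> (x + t *\<^sub>R axis i 1)) has_derivative (\<lambda>t. frechet_derivative \<phi> (at x) (t *\<^sub>R axis i 1))) (at 0)" .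
  moreover have "frechet_derivative \<phi> (at x) (t *\<^sub>R axis i 1) = t *\<^sub>R partial_deriv i \<phi> x" for t
    unfolding partial_deriv_def using linear_frechet_derivative[OF schwartz_differentiable[OF assms]]
    by (rule linear_scale)
  ultimately show ?thesis by (simp add: has_vector_derivative_def)
qed

text \<open>\<open>stretched_exp b q |\<xi>|\<close> need not be differentiable at the origin, but its product with a coordinate is.\<close>

lemma stretched_exp_coord_derivative:
  fixes x :: "real^'n::finite"
  assumes q: "q > 0"
  shows "((\<lambda>t. of_real ((x + t *\<^sub>R axis i 1) $ i) * stretched_exp b q (norm (x + t *\<^sub>R axis i 1))) has_vector_derivative
     stretched_exp b q (norm x) - of_real (b * q * norm x powr (q - 2) * (x $ i)\<^sup>2) * stretched_exp b q (norm x)) (at 0)"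
proof (cases "x = 0")
  case True
  \<comment> \<open>Along the axis through the origin the function is \<open>t * ?F t\<close>, whose
    difference quotient at 0 is \<open>?F t\<close> itself. Continuity of \<open>?F\<close> is all
    that is needed.\<close>
  let ?F = "\<lambda>t::real. exp (- (b * \<bar>t\<bar> powr q))"
  have c: "(?F \<longlongrightarrow> ?F 0) (at 0)"
  proof -
    have "((\<lambda>t. \<bar>t\<bar> powr q) \<longlongrightarrow> 0) (at (0::real))"
      by (rule tendsto_zero_powrI[where b = q]) (use q in \<open>auto intro!: tendsto_rabs_zero tendsto_ident_at\<close>)
    then have "(?F \<longlongrightarrow> exp (- (b * 0))) (at 0)" by (intro tendsto_intros)
    then show ?thesis by simp
  qed
  have "((\<lambda>t. t * ?F t) has_real_derivative ?F 0) (at 0)"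
    unfolding DERIV_def using c by (auto elim!: Lim_transform_eventually simp: eventually_at_filter)
  then have "((\<lambda>t. complex_of_real (t * ?F t)) has_vector_derivative of_real (?F 0)) (at 0)"
    by (intro has_vector_derivative_of_real) (simp add: has_real_derivative_iff_has_vector_derivative)
  then show ?thesis using True by (simp add: stretched_exp_def)
next
  case False
  \<comment> \<open>The squared norm along the line is a polynomial in \<open>t\<close>, positive at
    \<open>t = 0\<close>, so powers of it can be differentiated by the chain rule there.\<close>
  let ?N = "\<lambda>t. (norm x)\<^sup>2 + 2 * t * (x $ i) + t\<^sup>2"
  have N: "(norm (x + t *\<^sub>R axis i 1))\<^sup>2 = ?N t" for t
    unfolding power2_norm_eq_inner by (simp add: inner_add_left inner_add_right inner_axis inner_axis' power2_eq_square algebra_simps)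
  have pw: "norm (x + t *\<^sub>R axis i 1) powr q = ?N t powr (q / 2)" for t
  proof (cases "x + t *\<^sub>R axis i 1 = 0")
    case True
    then have "?N t = 0" using N[of t] by simp
    then show ?thesis using True by simp
  next
    case False
    then have "((norm (x + t *\<^sub>R axis i 1))\<^sup>2) powr (q / 2) = norm (x + t *\<^sub>R axis i 1) powr q"
      using powr_powr[of "norm (x + t *\<^sub>R axis i 1)" 2 "q / 2"] by simp
    then show ?thesis using N by simp
  qed
  have pos: "?N 0 > 0" using False by simp
  have dN: "(?N has_real_derivative 2 * x $ i) (at 0)" by (auto intro!: derivative_eq_intros)
  have dP: "((\<lambda>t. ?N t powr (q / 2)) has_real_derivative q * norm x powr (q - 2) * x $ i) (at 0)"
  proof -
    have "((\<lambda>t. ?N t powr (q / 2)) has_real_derivative q / 2 * ?N 0 powr (q / 2 - 1) * (2 * x $ i)) (at 0)"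
      using DERIV_fun_powr[OF dN pos, of "q / 2"] by simp
    moreover have "?N 0 powr (q / 2 - 1) = norm x powr (q - 2)"
      using False powr_powr[of "norm x" 2 "q / 2 - 1"] by simp
    ultimately show ?thesis by (simp add: mult.assoc)
  qed
  have dE: "((\<lambda>t. (x $ i + t) * exp (- (b * ?N t powr (q / 2)))) has_real_derivative
     exp (- (b * norm x powr q)) + x $ i * (exp (- (b * norm x powr q)) * (- (b * (q * norm x powr (q - 2) * x $ i))))) (at 0)"
  proof -
    have p0: "?N 0 powr (q / 2) = norm x powr q" using pw[of 0] by simp
    show ?thesis
      by (rule derivative_eq_intros dP refl | simp only: p0)+ (simp add: p0)
  qed
  have "((\<lambda>t. complex_of_real ((x $ i + t) * exp (- (b * ?N t powr (q / 2))))) has_vector_derivative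
     of_real (exp (- (b * norm x powr q)) + x $ i * (exp (- (b * norm x powr q)) * (- (b * (q * norm x powr (q - 2) * x $ i)))))) (at 0)"
    using dE by (intro has_vector_derivative_of_real) (simp add: has_real_derivative_iff_has_vector_derivative)
  then show ?thesis
    unfolding stretched_exp_def pw by (simp add: axis_def power2_eq_square algebra_simps)
qed

lemma sum_coord_sq: "(\<Sum>i\<in>UNIV. (x $ i)\<^sup>2) = (norm x)\<^sup>2" for x :: "real^'n::finite"
  unfolding power2_norm_eq_inner inner_vec_def by (simp add: power2_eq_square)

lemma sum_coord_sq_powr: "(\<Sum>i\<in>UNIV. norm x powr (q - 2) * (x $ i)\<^sup>2) = norm x powr q" for x :: "real^'n::finite"
proof (cases "x = 0")
  case False
  have "(\<Sum>i\<in>UNIV. norm x powr (q - 2) * (x $ i)\<^sup>2) = norm x powr (q - 2) * norm x powr 2"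
    using False by (simp add: sum_distrib_left[symmetric] sum_coord_sq)
  also have "\<dots> = norm x powr q" unfolding powr_add[symmetric] by simp
  finally show ?thesis .
qed simp

text \<open>The divergence theorem for the field \<open>\<xi> * g * \<phi>\<close> with
  \<open>g\<close> the stretched exponential, one coordinate at a time. Keeping the factor
  \<open>\<xi>_i\<close> attached to \<open>g\<close> is what makes the derivative exist at the
  origin.\<close>

lemma stretched_exp_euler:
  fixes \<phi> :: "real^'n::finite \<Rightarrow> complex"
  assumes q: "q > 0" and b: "b \<ge> 0" and \<phi>: "\<phi> \<in> schwartz"
  shows "(\<Sum>i\<in>UNIV. LINT \<xi>|lborel. stretched_exp b q (norm \<xi>) * (of_real (\<xi> $ i) * partial_deriv i \<phi> \<xi>)) =
    of_real (b * q) * (LINT \<xi>|lborel. of_real (norm \<xi> powr q) * stretched_exp b q (norm \<xi>) * \<phi> \<xi>)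
     - of_real (real CARD('n)) * (LINT \<xi>|lborel. stretched_exp b q (norm \<xi>) * \<phi> \<xi>)"
proof -
  let ?g = "\<lambda>\<xi>::real^'n. stretched_exp b q (norm \<xi>)"
  have [measurable]: "\<phi> \<in> borel_measurable borel" by (rule schwartz_measurable[OF \<phi>])
  have dm [measurable]: "partial_deriv i \<phi> \<in> borel_measurable borel" for i by (intro schwartz_measurable schwartz_partial_deriv \<phi>)
  have g1: "norm (?g \<xi>) \<le> 1" for \<xi> by (rule norm_stretched_exp_le[OF b])
  let ?A = "\<lambda>\<xi>. ?g \<xi> * \<phi> \<xi>"
  let ?B = "\<lambda>i \<xi>. of_real (norm \<xi> powr (q - 2) * (\<xi> $ i)\<^sup>2) * ?g \<xi> * \<phi> \<xi>"
  let ?C = "\<lambda>i \<xi>. ?g \<xi> * (of_real (\<xi> $ i) * partial_deriv i \<phi> \<xi>)"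
  have rA: "rapid ?A"
    by (rule rapid_dominated[OF schwartz_rapid[OF \<phi>], of _ 1 0 "\<lambda>x. x"]) (use g1 in \<open>auto simp: norm_mult mult_left_le_one_le\<close>)
  have rC: "rapid (?C i)" for i
    by (rule rapid_dominated[OF schwartz_rapid[OF schwartz_coord[OF schwartz_partial_deriv[OF \<phi>, of i], of i]], of _ 1 0 "\<lambda>x. x"])
       (use g1 in \<open>auto simp: norm_mult[of "?g _"] mult_left_le_one_le\<close>)
  have rB: "rapid (?B i)" for i
  proof (rule rapid_dominated[OF schwartz_rapid[OF \<phi>], of _ 1 "nat \<lceil>q\<rceil>" "\<lambda>x. x"])
    fix \<xi> :: "real^'n"
    have "norm \<xi> powr (q - 2) * (\<xi> $ i)\<^sup>2 \<le> (\<Sum>i\<in>UNIV. norm \<xi> powr (q - 2) * (\<xi> $ i)\<^sup>2)"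
      by (rule member_le_sum) auto
    also have "\<dots> = norm \<xi> powr q" by (rule sum_coord_sq_powr)
    also have "\<dots> \<le> (1 + norm \<xi>) ^ nat \<lceil>q\<rceil>" using q by (intro powr_le_one_plus_power) (auto simp: real_nat_ceiling_ge)
    finally have "(norm \<xi> powr (q - 2) * (\<xi> $ i)\<^sup>2) * norm (?g \<xi>) * norm (\<phi> \<xi>) \<le> (1 + norm \<xi>) ^ nat \<lceil>q\<rceil> * 1 * norm (\<phi> \<xi>)"
      using g1 by (intro mult_mono) auto
    then show "norm (?B i \<xi>) \<le> 1 * (1 + norm \<xi>) ^ nat \<lceil>q\<rceil> * norm (\<phi> \<xi>)"
      unfolding norm_mult norm_of_real by (simp add: abs_mult)
  qed auto
  have iA: "integrable lborel ?A" by (intro integrable_rapid rA) measurable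
  have iB: "integrable lborel (?B i)" for i by (intro integrable_rapid rB) measurable
  have iC: "integrable lborel (?C i)" for i by (intro integrable_rapid rC) measurable
  have zero: "(LINT \<xi>|lborel. ?A \<xi> + ((- of_real (b * q)) * ?B i \<xi> + ?C i \<xi>)) = 0" for i
  proof -
    have "rapid (\<lambda>\<xi>. ?A \<xi> + ((- of_real (b * q)) * ?B i \<xi> + ?C i \<xi>))"
      by (intro rapid_add rA rC rapid_dominated[OF rB[of i], of "\<lambda>\<xi>. (- of_real (b * q)) * ?B i \<xi>" "norm (b * q)" 0 "\<lambda>x. x"])
         (simp_all add: norm_mult abs_mult)
    from rapidD[OF this, of "CARD('n) + 1"] obtain K where
      K: "\<And>\<xi>. (1 + norm \<xi>) ^ (CARD('n) + 1) * norm (?A \<xi> + ((- of_real (b * q)) * ?B i \<xi> + ?C i \<xi>)) \<le> K" by metis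
    show ?thesis
    proof (rule integral_partial_zero[where i = i and \<psi> = "\<lambda>\<xi>. of_real (\<xi> $ i) * ?g \<xi> * \<phi> \<xi>", OF _ _ _ K])
      have "rapid (\<lambda>\<xi>. of_real (\<xi> $ i) * ?g \<xi> * \<phi> \<xi>)"
        by (rule rapid_dominated[OF rA, of _ 1 1 "\<lambda>x. x"]) (use norm_coord_mult_le in \<open>auto simp: mult.assoc\<close>)
      then show "integrable lborel (\<lambda>\<xi>. of_real (\<xi> $ i) * ?g \<xi> * \<phi> \<xi>)" by (intro integrable_rapid) measurable
      fix x :: "real^'n"
      have "((\<lambda>t. of_real ((x + t *\<^sub>R axis i 1) $ i) * ?g (x + t *\<^sub>R axis i 1) * \<phi> (x + t *\<^sub>R axis i 1)) has_vector_derivative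
         of_real ((x + 0 *\<^sub>R axis i 1) $ i) * ?g (x + 0 *\<^sub>R axis i 1) * partial_deriv i \<phi> x +
          (?g x - of_real (b * q * norm x powr (q - 2) * (x $ i)\<^sup>2) * ?g x) * \<phi> (x + 0 *\<^sub>R axis i 1)) (at 0)"
        by (rule has_vector_derivative_mult[OF stretched_exp_coord_derivative[OF q] has_vector_derivative_schwartz_line[OF \<phi>]])
      then show "((\<lambda>t. of_real ((x + t *\<^sub>R axis i 1) $ i) * ?g (x + t *\<^sub>R axis i 1) * \<phi> (x + t *\<^sub>R axis i 1)) has_vector_derivative
         ?A x + ((- of_real (b * q)) * ?B i x + ?C i x)) (at 0)"
        by (rule back_subst[where P = "\<lambda>D. (_ has_vector_derivative D) _"]) (simp add: algebra_simps)
    qed measurable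
  qed
  have "(LINT \<xi>|lborel. ?C i \<xi>) = of_real (b * q) * (LINT \<xi>|lborel. ?B i \<xi>) - (LINT \<xi>|lborel. ?A \<xi>)" for i
  proof -
    have "(LINT \<xi>|lborel. ?A \<xi> + ((- of_real (b * q)) * ?B i \<xi> + ?C i \<xi>)) =
       (LINT \<xi>|lborel. ?A \<xi>) + ((- of_real (b * q)) * (LINT \<xi>|lborel. ?B i \<xi>) + (LINT \<xi>|lborel. ?C i \<xi>))"
      by (subst Bochner_Integration.integral_add[OF iA Bochner_Integration.integrable_add[OF integrable_mult_right[OF iB] iC]],
          subst Bochner_Integration.integral_add[OF integrable_mult_right[OF iB] iC], subst integral_mult_right_zero, rule refl)
    with zero[of i] show ?thesis by (simp add: algebra_simps eq_neg_iff_add_eq_0)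
  qed
  then have "(\<Sum>i\<in>UNIV. LINT \<xi>|lborel. ?C i \<xi>) = of_real (b * q) * (\<Sum>i\<in>UNIV. LINT \<xi>|lborel. ?B i \<xi>) - of_real (real CARD('n)) * (LINT \<xi>|lborel. ?A \<xi>)"
    by (simp add: sum_subtractf sum_distrib_left)
  also have "(\<Sum>i\<in>UNIV. LINT \<xi>|lborel. ?B i \<xi>) = (LINT \<xi>|lborel. (\<Sum>i\<in>UNIV. ?B i \<xi>))"
    by (rule Bochner_Integration.integral_sum[symmetric]) (rule iB)
  also have "(\<lambda>\<xi>. \<Sum>i\<in>UNIV. ?B i \<xi>) = (\<lambda>\<xi>. of_real (norm \<xi> powr q) * ?g \<xi> * \<phi> \<xi>)"
    unfolding sum_distrib_right[symmetric] of_real_sum[symmetric] sum_coord_sq_powr ..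
  finally show ?thesis .
qed

text \<open>In the variable \<open>\<theta>\<close> this is \<open>(\<theta>^2 + \<theta>
  d/d\<theta> / 2) exp (- b \<theta>^2) = (1 - b) \<theta>^2 exp (- b \<theta>^2)\<close>. The
  dimension terms of the Euler derivative and of \<open>L_op\<close> cancel.\<close>

lemma L_op_stretched_exp:
  assumes s: "s > 0" and b: "b > 0"
  shows "L_op s (inv_fourier_dist (\<lambda>\<xi>::real^'n::finite. stretched_exp b (2 * s) (norm \<xi>)))
    = inv_fourier_dist (\<lambda>\<xi>. of_real ((1 - b) * norm \<xi> powr (2 * s)) * stretched_exp b (2 * s) (norm \<xi>))"
proof -
  let ?g = "\<lambda>\<xi>::real^'n. stretched_exp b (2 * s) (norm \<xi>)"
  have g1: "norm (?g \<xi>) \<le> 1" for \<xi> by (rule norm_stretched_exp_le) (use b in simp)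
  have pg: "poly_bounded ?g" by (rule poly_bounded_bounded[OF _ g1]) measurable
  have pwg: "poly_bounded (\<lambda>\<xi>::real^'n. of_real (norm \<xi> powr (2 * s)) * ?g \<xi>)"
    by (rule poly_bounded_powr_mult[OF _ g1]) (use s in auto)
  let ?u = "inv_fourier_dist ?g" and ?v = "inv_fourier_dist (\<lambda>\<xi>::real^'n. of_real (norm \<xi> powr (2 * s)) * ?g \<xi>)"
  have u: "has_fourier_fun ?u ?g" by (rule has_fourier_fun_inv_fourier_dist[OF pg]) simp
  have fu: "frac_laplace s ?u = ?v" by (rule frac_laplace_radial[OF u pwg])
  have v: "has_fourier_fun ?v (\<lambda>\<xi>. of_real (norm \<xi> powr (2 * s)) * ?g \<xi>)" by (rule has_fourier_fun_inv_fourier_dist[OF pwg]) simp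
  then have v': "has_fourier_fun (frac_laplace s ?u) (\<lambda>\<xi>. of_real (norm \<xi> powr (2 * s)) * ?g \<xi>)" by (simp only: fu)
  let ?w = "\<lambda>\<xi>::real^'n. of_real ((1 - b) * norm \<xi> powr (2 * s)) * ?g \<xi>"
  have pw: "poly_bounded ?w"
  proof -
    have "poly_bounded (\<lambda>\<xi>::real^'n. of_real (norm \<xi> powr (2 * s)) * (of_real (1 - b) * ?g \<xi>))"
      by (rule poly_bounded_powr_mult[where B = "\<bar>1 - b\<bar>"]) (use s g1 in \<open>auto simp: norm_mult mult_left_le simp del: of_real_diff\<close>)
    then show ?thesis by (simp add: mult_ac)
  qed
  have w: "has_fourier_fun (inv_fourier_dist ?w) ?w" by (rule has_fourier_fun_inv_fourier_dist[OF pw]) simp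
  show ?thesis
  proof
    fix \<psi> :: "real^'n \<Rightarrow> complex"
    show "L_op s ?u \<psi> = inv_fourier_dist ?w \<psi>"
    proof (cases "\<psi> \<in> schwartz")
      case False
      then have "L_op s ?u \<psi> = 0"
        by (intro L_op_nonschwartz[OF tempered_inv_fourier_dist[OF pg]]) (simp only: fu tempered_inv_fourier_dist[OF pwg])
      moreover have "inv_fourier_dist ?w \<psi> = 0" using False by (simp add: inv_fourier_dist_def)
      ultimately show ?thesis by (simp only:)
    next
      case True
      then obtain \<phi> where \<phi>: "\<phi> \<in> schwartz" "\<psi> = fourier \<phi>" by (rule schwartz_fourier_surj)
      let ?I = "LINT \<xi>|lborel. of_real (norm \<xi> powr (2 * s)) * ?g \<xi> * \<phi> \<xi>"
      have "L_op s ?u \<psi> = ?I - of_real (1 / (2 * s)) * (of_real (b * (2 * s)) * ?I - of_real (real CARD('n)) * (LINT \<xi>|lborel. ?g \<xi> * \<phi> \<xi>))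
         - of_real (real CARD('n) / (2 * s)) * (LINT \<xi>|lborel. ?g \<xi> * \<phi> \<xi>)"
        unfolding \<phi>(2) using L_op_fourier[OF u v' \<phi>(1)] stretched_exp_euler[of "2 * s" b \<phi>] s b \<phi>(1) by simp
      also have "\<dots> = of_real (1 - b) * ?I" using s by (simp add: field_simps)
      also have "\<dots> = (LINT \<xi>|lborel. ?w \<xi> * \<phi> \<xi>)"
        unfolding integral_mult_right_zero[symmetric] by (rule Bochner_Integration.integral_cong) (auto simp: mult_ac)
      also have "\<dots> = inv_fourier_dist ?w \<psi>" unfolding \<phi>(2) by (rule has_fourier_funD[OF w \<phi>(1), symmetric])
      finally show ?thesis .
    qed
  qed
qed

lemma L2dagI:
  fixes f h :: "real \<Rightarrow> complex"
  assumes h: "poly_bounded (\<lambda>\<xi>::real^'n::finite. h (norm \<xi>))" and f: "(\<lambda>x::real^'n. f (norm x)) \<in> schwartz"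
    and F: "\<And>\<xi>::real^'n. fourier (\<lambda>x::real^'n. f (norm x)) \<xi> = h (norm \<xi> powr (1 / s))"
    and i: "integrable lborel (\<lambda>x::real^'n. (norm (f (norm x)))\<^sup>2 * exp ((norm x)\<^sup>2 / 4))"
  shows "is_dagger s (inv_fourier_dist (\<lambda>\<xi>::real^'n. h (norm \<xi>))) f"
    and "inv_fourier_dist (\<lambda>\<xi>::real^'n. h (norm \<xi>)) \<in> L2dag s"
proof -
  show *: "is_dagger s (inv_fourier_dist (\<lambda>\<xi>::real^'n. h (norm \<xi>))) f"
    unfolding is_dagger_def
  proof (intro conjI exI)
    show "tempered_fun (\<lambda>x::real^'n. f (norm x))"
      unfolding tempered_fun_def using f by (auto intro!: schwartz_measurable schwartz_integrable schwartz_mult)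
    show "has_fourier_fun (inv_fourier_dist (\<lambda>\<xi>::real^'n. h (norm \<xi>))) (\<lambda>\<xi>. h (norm \<xi>))"
      by (rule has_fourier_fun_inv_fourier_dist[OF h]) simp
    show "has_fourier_fun (dist_of (\<lambda>x::real^'n. f (norm x))) (\<lambda>\<xi>. h (norm \<xi> powr (1 / s)))"
      using has_fourier_fun_schwartz[OF f] F by (metis (no_types, lifting) ext)
  qed
  show "inv_fourier_dist (\<lambda>\<xi>::real^'n. h (norm \<xi>)) \<in> L2dag s"
    unfolding L2dag_def using tempered_inv_fourier_dist[OF h] radial_inv_fourier_dist[of h, where 'n='n] h * i
    by (auto simp: poly_bounded_def)
qed

text \<open>Used to write the \<open>dagger\<close> of \<open>L_op s u\<close> explicitly for
  stretched exponentials: the factor \<open>(1 - b) * \<theta>^2\<close> corresponds to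
  \<open>b - 1\<close> times the Laplacian of a Gaussian.\<close>

lemma fourier_laplace:
  fixes \<phi> :: "real^'n::finite \<Rightarrow> complex"
  assumes \<phi>: "\<phi> \<in> schwartz"
  shows "fourier (\<lambda>x. \<Sum>i\<in>UNIV. partial_deriv i (partial_deriv i \<phi>) x) \<xi> = - of_real ((norm \<xi>)\<^sup>2) * fourier \<phi> \<xi>"
proof -
  have "fourier (\<lambda>x. \<Sum>i\<in>UNIV. partial_deriv i (partial_deriv i \<phi>) x) \<xi> = (\<Sum>i\<in>UNIV. fourier (partial_deriv i (partial_deriv i \<phi>)) \<xi>)"
    by (rule fourier_sum) (auto intro!: schwartz_integrable schwartz_partial_deriv \<phi>)
  also have "\<dots> = (\<Sum>i\<in>UNIV. - of_real ((\<xi> $ i)\<^sup>2) * fourier \<phi> \<xi>)"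
  proof (intro sum.cong refl)
    fix i
    have "\<i> * a * (\<i> * a * b) = - (a * a) * b" for a b :: complex
    proof -
      have "\<i> * a * (\<i> * a * b) = (\<i> * \<i>) * (a * a) * b" by (simp only: mult_ac)
      then show ?thesis by simp
    qed
    then show "fourier (partial_deriv i (partial_deriv i \<phi>)) \<xi> = - of_real ((\<xi> $ i)\<^sup>2) * fourier \<phi> \<xi>"
      by (simp add: fourier_partial_deriv schwartz_partial_deriv \<phi> power2_eq_square)
  qed
  also have "\<dots> = - of_real (\<Sum>i\<in>UNIV. (\<xi> $ i)\<^sup>2) * fourier \<phi> \<xi>" by (simp add: sum_distrib_right sum_negf)
  also have "(\<Sum>i\<in>UNIV. (\<xi> $ i)\<^sup>2) = (norm \<xi>)\<^sup>2" by (rule sum_coord_sq)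
  finally show ?thesis .
qed

lemma laplace_gauss:
  "(\<Sum>i\<in>UNIV. partial_deriv i (partial_deriv i (gauss a)) x) = of_real (4 * a\<^sup>2 * (norm x)\<^sup>2 - 2 * a * real CARD('n)) * gauss a (x :: real^'n::finite)"
proof -
  have d: "gauss a differentiable (at x)" for x :: "real^'n" using has_derivative_gauss differentiable_def by blast
  have "partial_deriv i (partial_deriv i (gauss a)) x = of_real (4 * a\<^sup>2 * (x $ i)\<^sup>2 - 2 * a) * gauss a x" for i
  proof -
    have e: "partial_deriv i (gauss a) = (\<lambda>x::real^'n. of_real (x $ i) * (- 2 * of_real a * gauss a x))" for i
      by (rule ext) (rule partial_deriv_gauss)
    have "partial_deriv i (\<lambda>x::real^'n. - 2 * of_real a * gauss a x) x = - 2 * of_real a * partial_deriv i (gauss a) x"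
      using partial_deriv_mult[of "\<lambda>x. - 2 * of_real a" x "gauss a" i] d by simp
    moreover have dg: "(\<lambda>x::real^'n. - 2 * of_real a * gauss a x) differentiable (at x)" by (intro differentiable_const_mult d)
    ultimately have "partial_deriv i (partial_deriv i (gauss a)) x = of_real (x $ i) * (- 2 * of_real a * partial_deriv i (gauss a) x) + - 2 * of_real a * gauss a x"
      unfolding e[of i] partial_deriv_mult[OF differentiable_coord dg] by (simp add: e)
    then show ?thesis by (simp add: e power2_eq_square algebra_simps)
  qed
  then have "(\<Sum>i\<in>UNIV. partial_deriv i (partial_deriv i (gauss a)) x) = (\<Sum>i\<in>UNIV. of_real (4 * a\<^sup>2 * (x $ i)\<^sup>2 - 2 * a) * gauss a x)"
    by simp
  also have "\<dots> = of_real (\<Sum>i\<in>UNIV. 4 * a\<^sup>2 * (x $ i)\<^sup>2 - 2 * a) * gauss a x" by (simp only: of_real_sum sum_distrib_right)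
  also have "(\<Sum>i\<in>UNIV. 4 * a\<^sup>2 * (x $ i)\<^sup>2 - 2 * a) = 4 * a\<^sup>2 * (norm x)\<^sup>2 - 2 * a * real CARD('n)"
    by (simp add: sum_subtractf sum_distrib_left[symmetric] sum_coord_sq)
  finally show ?thesis .
qed

text \<open>Squaring doubles the exponent to \<open>2 * a\<close>, and the weight takes back
  \<open>1 / 4\<close>. What remains is a decaying Gaussian exactly for
  \<open>a > 1 / 8\<close>.\<close>

lemma weighted_gauss_integrable:
  fixes P :: "real \<Rightarrow> complex"
  assumes P: "poly_bounded (\<lambda>x::real^'n::finite. P (norm x))" and a: "a > 1 / 8"
  shows "integrable lborel (\<lambda>x::real^'n. (norm (P (norm x) * of_real (exp (- (a * (norm x)\<^sup>2)))))\<^sup>2 * exp ((norm x)\<^sup>2 / 4))"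
proof -
  from P obtain C m where C: "C \<ge> 0" "\<And>x::real^'n. norm (P (norm x)) \<le> C * (1 + norm x) ^ m"
    and [measurable]: "(\<lambda>x::real^'n. P (norm x)) \<in> borel_measurable borel" by (auto simp: poly_bounded_def)
  have "poly_bounded (\<lambda>x::real^'n. (P (norm x))\<^sup>2)" unfolding poly_bounded_def
  proof (intro conjI exI allI)
    show "norm ((P (norm x))\<^sup>2) \<le> C\<^sup>2 * (1 + norm x) ^ (2 * m)" for x :: "real^'n"
      using power_mono[OF C(2)[of x], of 2] by (simp add: norm_power power_mult_distrib power_mult[symmetric] mult.commute)
  qed auto
  moreover have "(gauss (2 * a - 1 / 4) :: real^'n \<Rightarrow> complex) \<in> schwartz" using a by (intro schwartz_gauss) simp
  ultimately have "integrable lborel (\<lambda>x::real^'n. norm ((P (norm x))\<^sup>2 * gauss (2 * a - 1 / 4) x))"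
    by (intro integrable_norm poly_bounded_mult_schwartz)
  moreover have "norm ((P (norm x))\<^sup>2 * gauss (2 * a - 1 / 4) x) = (norm (P (norm x) * of_real (exp (- (a * (norm x)\<^sup>2)))))\<^sup>2 * exp ((norm x)\<^sup>2 / 4)" for x :: "real^'n"
    by (simp add: norm_mult norm_power gauss_def power_mult_distrib exp_double[symmetric] mult.assoc exp_add[symmetric] algebra_simps)
  ultimately show ?thesis by simp
qed

text \<open>The radial profile on dimension \<open>n\<close> whose Fourier transform is
  \<open>gauss b\<close>, constant included.\<close>

definition dual_gauss :: "nat \<Rightarrow> real \<Rightarrow> real \<Rightarrow> complex" where
  "dual_gauss n b r = of_real ((2 * b) powr (- real n / 2)) * of_real (exp (- (1 / (4 * b) * r\<^sup>2)))"

lemma dual_gauss_eq: "dual_gauss n b (norm x) = of_real ((2 * b) powr (- real n / 2)) * gauss (1 / (4 * b)) x"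
  by (simp add: dual_gauss_def gauss_def)

lemma fourier_dual_gauss:
  assumes "b > 0"
  shows "fourier (\<lambda>x::real^'n::finite. dual_gauss CARD('n) b (norm x)) \<xi> = gauss b \<xi>"
proof -
  have "fourier (\<lambda>x::real^'n. dual_gauss CARD('n) b (norm x)) \<xi> =
     of_real ((2 * b) powr (- real CARD('n) / 2) * (1 / (2 * b)) powr (- real CARD('n) / 2)) * gauss b \<xi>"
    using fourier_gauss[of "1 / (4 * b)" \<xi>] assms by (simp add: dual_gauss_eq fourier_cmult)
  also have "(2 * b) powr (- real CARD('n) / 2) * (1 / (2 * b)) powr (- real CARD('n) / 2) = 1"
    using assms by (simp add: powr_mult[symmetric])
  finally show ?thesis by simp
qed

lemma stretched_exp_root: "s > 0 \<Longrightarrow> stretched_exp b (2 * s) (norm \<xi> powr (1 / s)) = gauss b \<xi>"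
  by (simp add: stretched_exp_def gauss_def powr_powr powr_numeral)

text \<open>The bound \<open>b < 2\<close> says \<open>1 / (4 * b) > 1 / 8\<close>, the threshold of
  \<open>weighted_gauss_integrable\<close>. Membership in the domain also requires the
  \<open>dagger\<close> of the image under \<open>L_op\<close>, which is a quadratic polynomial
  times the same Gaussian.\<close>

lemma
  assumes s: "s > 0" and b: "0 < b" "b < 2"
  shows is_dagger_stretched_exp: "is_dagger s (inv_fourier_dist (\<lambda>\<xi>::real^'n::finite. stretched_exp b (2 * s) (norm \<xi>))) (dual_gauss CARD('n) b)"
    and stretched_exp_dom_L: "inv_fourier_dist (\<lambda>\<xi>::real^'n::finite. stretched_exp b (2 * s) (norm \<xi>)) \<in> dom_L s"
proof -
  let ?g = "\<lambda>\<xi>::real^'n. stretched_exp b (2 * s) (norm \<xi>)"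
  have g1: "norm (?g \<xi>) \<le> 1" for \<xi> by (rule norm_stretched_exp_le) (use b in simp)
  have pg: "poly_bounded ?g" by (rule poly_bounded_bounded[OF _ g1]) measurable
  have a: "1 / (4 * b) > 1 / 8" using b by (simp add: field_simps)
  have S: "(\<lambda>x::real^'n. dual_gauss CARD('n) b (norm x)) \<in> schwartz"
    unfolding dual_gauss_eq using b by (intro schwartz_cmult schwartz_gauss) simp
  have pc: "poly_bounded (\<lambda>x::real^'n. c)" for c by (rule poly_bounded_bounded[where B = "norm c"]) auto
  note 1 = L2dagI[of "stretched_exp b (2 * s)" "dual_gauss CARD('n) b" s, OF pg S]
  have F: "fourier (\<lambda>x::real^'n. dual_gauss CARD('n) b (norm x)) \<xi> = stretched_exp b (2 * s) (norm \<xi> powr (1 / s))" for \<xi> :: "real^'n"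
    unfolding fourier_dual_gauss[OF b(1)] stretched_exp_root[OF s] ..
  have i: "integrable lborel (\<lambda>x::real^'n. (norm (dual_gauss CARD('n) b (norm x)))\<^sup>2 * exp ((norm x)\<^sup>2 / 4))"
    unfolding dual_gauss_def by (rule weighted_gauss_integrable[OF pc a])
  show "is_dagger s (inv_fourier_dist ?g) (dual_gauss CARD('n) b)" by (rule 1(1)[OF F i])
  have in1: "inv_fourier_dist ?g \<in> L2dag s" by (rule 1(2)[OF F i])
  let ?a = "1 / (4 * b)"
  let ?h = "\<lambda>r. of_real ((1 - b) * r powr (2 * s)) * stretched_exp b (2 * s) r"
  \<comment> \<open>The polynomial factor of \<open>(b - 1)\<close> times the Laplacian of
    \<open>dual_gauss\<close>, read off from \<open>laplace_gauss\<close>.\<close>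
  define P :: "real \<Rightarrow> complex" where "P r = of_real ((b - 1) * (2 * b) powr (- real CARD('n) / 2) * (4 * ?a\<^sup>2 * r\<^sup>2 - 2 * ?a * real CARD('n)))" for r
  let ?f = "\<lambda>r. P r * of_real (exp (- (?a * r\<^sup>2)))"
  have f: "(\<lambda>x::real^'n. ?f (norm x)) = (\<lambda>x. of_real (b - 1) * (\<Sum>i\<in>UNIV. partial_deriv i (partial_deriv i (\<lambda>x. dual_gauss CARD('n) b (norm x))) x))"
  proof
    fix x :: "real^'n"
    let ?c = "complex_of_real ((2 * b) powr (- real CARD('n) / 2))"
    have d: "gauss ?a differentiable (at x)" for x :: "real^'n" using has_derivative_gauss differentiable_def by blast
    have 1: "partial_deriv i (\<lambda>x::real^'n. ?c * gauss ?a x) = (\<lambda>x. ?c * partial_deriv i (gauss ?a) x)" for i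
      using partial_deriv_mult[of "\<lambda>x. ?c" _ "gauss ?a" i] d by (auto simp: fun_eq_iff)
    have "(gauss ?a :: real^'n \<Rightarrow> complex) \<in> schwartz" using b by (intro schwartz_gauss) simp
    then have 2: "partial_deriv i (\<lambda>x::real^'n. ?c * partial_deriv j (gauss ?a) x) = (\<lambda>x. ?c * partial_deriv i (partial_deriv j (gauss ?a)) x)" for i j
      using partial_deriv_mult[of "\<lambda>x. ?c" _ "partial_deriv j (gauss ?a)" i] by (auto simp: fun_eq_iff schwartz_differentiable schwartz_partial_deriv)
    have "(\<Sum>i\<in>UNIV. partial_deriv i (partial_deriv i (\<lambda>x. dual_gauss CARD('n) b (norm x))) x) = ?c * (\<Sum>i\<in>UNIV. partial_deriv i (partial_deriv i (gauss ?a)) x)"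
      unfolding dual_gauss_eq 1 2 sum_distrib_left ..
    also have "\<dots> = ?c * (of_real (4 * ?a\<^sup>2 * (norm x)\<^sup>2 - 2 * ?a * real CARD('n)) * gauss ?a x)" unfolding laplace_gauss ..
    finally show "?f (norm x) = of_real (b - 1) * (\<Sum>i\<in>UNIV. partial_deriv i (partial_deriv i (\<lambda>x. dual_gauss CARD('n) b (norm x))) x)"
      by (simp only: P_def gauss_def of_real_mult mult.assoc)
  qed
  have fS: "(\<lambda>x::real^'n. ?f (norm x)) \<in> schwartz"
    unfolding f by (intro schwartz_cmult schwartz_sum schwartz_partial_deriv S finite)
  have Ff: "fourier (\<lambda>x::real^'n. ?f (norm x)) \<xi> = ?h (norm \<xi> powr (1 / s))" for \<xi> :: "real^'n"
    unfolding f fourier_cmult fourier_laplace[OF S] fourier_dual_gauss[OF b(1)] stretched_exp_root[OF s]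
    using s by (simp add: powr_powr powr_numeral algebra_simps)
  have pP: "poly_bounded (\<lambda>x::real^'n. P (norm x))"
    unfolding poly_bounded_def
  proof (intro conjI exI allI)
    show "(\<lambda>x::real^'n. P (norm x)) \<in> borel_measurable borel" unfolding P_def by measurable
    define K where "K = \<bar>(b - 1) * (2 * b) powr (- real CARD('n) / 2)\<bar>"
    show "0 \<le> K * (4 * ?a\<^sup>2 + 2 * ?a * real CARD('n))" unfolding K_def using b by auto
    fix x :: "real^'n"
    have "\<bar>4 * ?a\<^sup>2 * (norm x)\<^sup>2 - 2 * ?a * real CARD('n)\<bar> \<le> 4 * ?a\<^sup>2 * (norm x)\<^sup>2 + 2 * ?a * real CARD('n) * 1"
      using b by (intro order_trans[OF abs_triangle_ineq4]) auto
    also have "\<dots> \<le> 4 * ?a\<^sup>2 * (1 + norm x) ^ 2 + 2 * ?a * real CARD('n) * (1 + norm x) ^ 2"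
      using b by (intro add_mono mult_left_mono power_mono one_le_power) auto
    finally have "\<bar>4 * ?a\<^sup>2 * (norm x)\<^sup>2 - 2 * ?a * real CARD('n)\<bar> \<le> (4 * ?a\<^sup>2 + 2 * ?a * real CARD('n)) * (1 + norm x) ^ 2"
      by (simp only: distrib_right)
    then have "K * \<bar>4 * ?a\<^sup>2 * (norm x)\<^sup>2 - 2 * ?a * real CARD('n)\<bar> \<le> K * ((4 * ?a\<^sup>2 + 2 * ?a * real CARD('n)) * (1 + norm x) ^ 2)"
      by (intro mult_left_mono) (auto simp: K_def)
    then show "norm (P (norm x)) \<le> K * (4 * ?a\<^sup>2 + 2 * ?a * real CARD('n)) * (1 + norm x) ^ 2"
      unfolding P_def norm_of_real abs_mult[of _ "4 * ?a\<^sup>2 * (norm x)\<^sup>2 - 2 * ?a * real CARD('n)"] K_def by (simp only: mult.assoc)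
  qed
  have ph: "poly_bounded (\<lambda>\<xi>::real^'n. ?h (norm \<xi>))"
  proof -
    have "poly_bounded (\<lambda>\<xi>::real^'n. of_real (norm \<xi> powr (2 * s)) * (of_real (1 - b) * ?g \<xi>))"
      by (rule poly_bounded_powr_mult[where B = "\<bar>1 - b\<bar>"]) (use s g1 in \<open>auto simp: norm_mult mult_left_le simp del: of_real_diff\<close>)
    then show ?thesis by (simp add: mult_ac)
  qed
  have "inv_fourier_dist (\<lambda>\<xi>::real^'n. ?h (norm \<xi>)) \<in> L2dag s"
    by (rule L2dagI(2)[of ?h ?f, OF ph fS Ff weighted_gauss_integrable[OF pP a]])
  then show "inv_fourier_dist ?g \<in> dom_L s"
    using in1 L_op_stretched_exp[OF s b(1), where 'n='n] by (simp add: dom_L_def)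
qed

section \<open>Taylor coefficients and moments\<close>

lemma AE_pow_meas_powr_same:
  assumes "{r. P r} \<in> sets borel" "p > 0" "q > 0"
  shows "(AE r in pow_meas p. P (r powr q)) \<longleftrightarrow> (AE r in pow_meas p. P r)"
  unfolding AE_pow_meas_powr[OF assms] using assms by (simp add: AE_pow_meas_iff)

text \<open>\<open>dagger\<close> is an arbitrary choice, so everything derived from it needs this.
  The radial transform of \<open>u\<close> is unique almost everywhere, the substitution
  \<open>r powr (1 / s)\<close> respects null sets, and Gaussians then identify the function from
  its transform.\<close>

lemma is_dagger_unique:
  fixes u :: "'n::finite dist"
  assumes s: "s > 0" and d1: "is_dagger s u f1" and d2: "is_dagger s u f2"
  shows "AE r in pow_meas (real CARD('n)). f1 r = f2 r"
proof -
  let ?n = "real CARD('n)"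
  obtain h1 where h1: "has_fourier_fun u (\<lambda>\<xi>. h1 (norm \<xi>))" "has_fourier_fun (dist_of (\<lambda>x::real^'n. f1 (norm x))) (\<lambda>\<xi>. h1 (norm \<xi> powr (1 / s)))"
    and t1: "tempered_fun (\<lambda>x::real^'n. f1 (norm x))" using d1 by (auto simp: is_dagger_def)
  obtain h2 where h2: "has_fourier_fun u (\<lambda>\<xi>. h2 (norm \<xi>))" "has_fourier_fun (dist_of (\<lambda>x::real^'n. f2 (norm x))) (\<lambda>\<xi>. h2 (norm \<xi> powr (1 / s)))"
    and t2: "tempered_fun (\<lambda>x::real^'n. f2 (norm x))" using d2 by (auto simp: is_dagger_def)
  have m: "(\<lambda>r. h1 \<bar>r\<bar>) \<in> borel_measurable borel" "(\<lambda>r. h2 \<bar>r\<bar>) \<in> borel_measurable borel"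
    using h1(1) h2(1) by (auto intro!: measurable_radial_profile[where 'n='n] simp: has_fourier_fun_def tempered_fun_def)
  have S: "{r. h1 \<bar>r\<bar> = h2 \<bar>r\<bar>} \<in> sets borel" using m by measurable
  have "AE r in pow_meas ?n. h1 r = h2 r" by (rule has_fourier_fun_radial_unique[OF h1(1) h2(1)])
  with AE_pow_meas_pos[of ?n] have "AE r in pow_meas ?n. h1 \<bar>r\<bar> = h2 \<bar>r\<bar>" by (auto elim: eventually_elim2)
  then have "AE r in pow_meas ?n. h1 \<bar>r powr (1 / s)\<bar> = h2 \<bar>r powr (1 / s)\<bar>"
    using AE_pow_meas_powr_same[OF S, of ?n "1 / s"] s by simp
  then have ae: "AE r in pow_meas ?n. h1 (\<bar>r\<bar> powr (1 / s)) = h2 (\<bar>r\<bar> powr (1 / s))"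
    using AE_pow_meas_pos[of ?n] by (auto elim: eventually_elim2)
  note m1 = measurable_compose[OF _ m(1), of "\<lambda>r. \<bar>r\<bar> powr (1 / s)" borel]
    and m2 = measurable_compose[OF _ m(2), of "\<lambda>r. \<bar>r\<bar> powr (1 / s)" borel]
  have m1': "(\<lambda>r. h1 (\<bar>r\<bar> powr (1 / s))) \<in> borel_measurable borel" using m1 by simp
  have m2': "(\<lambda>r. h2 (\<bar>r\<bar> powr (1 / s))) \<in> borel_measurable borel" using m2 by simp
  have S': "{r. h1 (\<bar>r\<bar> powr (1 / s)) = h2 (\<bar>r\<bar> powr (1 / s))} \<in> sets borel" using m1' m2' by measurable
  have aex: "AE x::real^'n in lborel. h1 (norm x powr (1 / s)) = h2 (norm x powr (1 / s))"
    using ae AE_radial_iff[OF S', where 'n='n] by simp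
  have mx: "(\<lambda>x::real^'n. h1 (norm x powr (1 / s))) \<in> borel_measurable borel" "(\<lambda>x::real^'n. h2 (norm x powr (1 / s))) \<in> borel_measurable borel"
    using measurable_compose[OF borel_measurable_norm m1'] measurable_compose[OF borel_measurable_norm m2'] by simp_all
  \<comment> \<open>Each \<open>gauss a\<close> is a nonzero multiple of the transform of
    \<open>gauss (1 / (4 * a))\<close>, so pairing with it can be evaluated on the transform
    side.\<close>
  have eq: "(LINT x::real^'n|lborel. f1 (norm x) * gauss a x) = (LINT x::real^'n|lborel. f2 (norm x) * gauss a x)" if a: "a \<ge> 1" for a
  proof -
    have g: "(gauss (1 / (4 * a)) :: real^'n \<Rightarrow> complex) \<in> schwartz" "(gauss a :: real^'n \<Rightarrow> complex) \<in> schwartz"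
      using a by (auto intro: schwartz_gauss)
    have Fg: "fourier (gauss (1 / (4 * a))) = (\<lambda>x::real^'n. of_real ((1 / (2 * a)) powr (- real CARD('n) / 2)) * gauss a x)"
      using fourier_gauss[of "1 / (4 * a)", where 'n='n] a by (auto simp: fun_eq_iff)
    let ?c = "complex_of_real ((1 / (2 * a)) powr (- real CARD('n) / 2))"
    have "dist_of (\<lambda>x::real^'n. f1 (norm x)) (fourier (gauss (1 / (4 * a)))) = (LINT x::real^'n|lborel. h1 (norm x powr (1 / s)) * gauss (1 / (4 * a)) x)"
      by (rule has_fourier_funD[OF h1(2) g(1)])
    also have "\<dots> = (LINT x::real^'n|lborel. h2 (norm x powr (1 / s)) * gauss (1 / (4 * a)) x)"
      by (rule integral_cong_AE) (use aex mx in auto)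
    also have "\<dots> = dist_of (\<lambda>x::real^'n. f2 (norm x)) (fourier (gauss (1 / (4 * a))))"
      by (rule has_fourier_funD[OF h2(2) g(1), symmetric])
    finally have "(LINT x::real^'n|lborel. f1 (norm x) * (?c * gauss a x)) = (LINT x::real^'n|lborel. f2 (norm x) * (?c * gauss a x))"
      unfolding Fg using schwartz_cmult[OF g(2), of ?c] by (simp only: dist_of_def if_True)
    then have "?c * (LINT x::real^'n|lborel. f1 (norm x) * gauss a x) = ?c * (LINT x::real^'n|lborel. f2 (norm x) * gauss a x)"
      unfolding integral_mult_right_zero[symmetric] by (simp only: mult.left_commute)
    moreover have "?c \<noteq> 0" using a by simp
    ultimately show ?thesis by simp
  qed
  have g1: "(gauss 1 :: real^'n \<Rightarrow> complex) \<in> schwartz" by (rule schwartz_gauss) simp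
  show ?thesis
    by (rule radial_AE_eqI[where 'n='n and ?a0.0 = 1, OF _ _ tempered_fun_integrable[OF t1 g1] tempered_fun_integrable[OF t2 g1] eq])
       (use t1 t2 in \<open>auto simp: tempered_fun_def\<close>)
qed

text \<open>Starting from the lowest coefficient: once those below \<open>j\<close> vanish, division
  by \<open>y^j\<close> and \<open>y \<rightarrow> 0\<close> isolate \<open>d j\<close>. Uniqueness
  of asymptotic expansions is applied in this form.\<close>

lemma poly_small_imp_zero:
  fixes d :: "nat \<Rightarrow> complex"
  assumes y0: "y0 > 0" and b: "\<And>y. 0 < y \<Longrightarrow> y \<le> y0 \<Longrightarrow> norm (\<Sum>j\<le>K. d j * of_real (y ^ j)) \<le> C * y ^ Suc K"
    and j: "j \<le> K"
  shows "d j = 0"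
  using j
proof (induction j rule: less_induct)
  case (less j)
  have z: "d i = 0" if "i < j" for i using less that by simp
  define R where "R y = (\<Sum>i\<in>{j..K}. d i * of_real (y ^ (i - j)))" for y :: real
  have e: "(\<Sum>i\<le>K. d i * of_real (y ^ i)) = of_real (y ^ j) * R y" for y
  proof -
    have "(\<Sum>i\<le>K. d i * of_real (y ^ i)) = (\<Sum>i\<in>{j..K}. d i * of_real (y ^ i))"
      by (rule sum.mono_neutral_right) (auto simp: z)
    also have "\<dots> = (\<Sum>i\<in>{j..K}. of_real (y ^ j) * (d i * of_real (y ^ (i - j))))"
      by (rule sum.cong) (auto simp: power_add[symmetric] simp flip: of_real_mult of_real_power)
    finally show ?thesis by (simp only: R_def sum_distrib_left)
  qed
  have le: "norm (R y) \<le> C * y ^ (Suc K - j)" if "0 < y" "y \<le> y0" for y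
  proof -
    have "y ^ j * norm (R y) \<le> C * y ^ Suc K" using b[OF that] that unfolding e by (simp add: norm_mult norm_power)
    also have "\<dots> = y ^ j * (C * y ^ (Suc K - j))" using less.prems by (simp add: power_add[symmetric] mult.left_commute del: power_Suc)
    finally show ?thesis using that by simp
  qed
  have lim: "((\<lambda>y. norm (R y)) \<longlongrightarrow> norm (R 0)) (at_right 0)"
    unfolding R_def by (intro tendsto_intros)
  have lim0: "((\<lambda>y. C * y ^ (Suc K - j)) \<longlongrightarrow> C * 0 ^ (Suc K - j)) (at_right 0)"
    by (intro tendsto_intros)
  have ev: "eventually (\<lambda>y. norm (R y) \<le> C * y ^ (Suc K - j)) (at_right 0)"
    using eventually_at_right_real[OF y0] by eventually_elim (auto intro: le)
  have "norm (R 0) \<le> C * 0 ^ (Suc K - j)" by (rule tendsto_le[OF _ lim0 lim ev]) simp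
  then have "R 0 = 0" using less.prems by (simp add: power_0_left)
  moreover have "R 0 = d j"
  proof -
    have "R 0 = (\<Sum>i\<in>{j..K}. if i = j then d i else 0)" unfolding R_def by (rule sum.cong) (auto simp: power_0_left)
    then show ?thesis using less.prems by simp
  qed
  ultimately show ?case by simp
qed

text \<open>\<open>exp (r^2 / 16) = exp (r^2 / 8) * exp (- (r^2 / 16))\<close>, and the product is
  split into two squares, one given by the weighted L2 bound on \<open>f\<close> and one a Gaussian
  moment. The extra factor \<open>exp (r^2 / 16)\<close> absorbs the Taylor remainder of
  \<open>exp (- r^2 / (4 * a))\<close> for \<open>a \<ge> 4\<close>.\<close>

lemma integrable_moment:
  fixes f :: "real \<Rightarrow> complex"
  assumes p: "p > 0" and f [measurable]: "f \<in> borel_measurable borel"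
    and i: "integrable (pow_meas p) (\<lambda>r. (norm (f r))\<^sup>2 * exp (r\<^sup>2 / 4))"
  shows "integrable (pow_meas p) (\<lambda>r. f r * of_real (r ^ m * exp (r\<^sup>2 / 16)))"
proof (rule Bochner_Integration.integrable_bound)
  have "integrable (pow_meas p) (\<lambda>r. r powr real (2 * m) * exp (- (1 / 8 * r\<^sup>2)))"
    using p by (intro integrable_pow_meas_gauss) auto
  then show "integrable (pow_meas p) (\<lambda>r. (norm (f r))\<^sup>2 * exp (r\<^sup>2 / 4) + r powr real (2 * m) * exp (- (1 / 8 * r\<^sup>2)))"
    by (intro Bochner_Integration.integrable_add i)
  show "AE r in pow_meas p. norm (f r * of_real (r ^ m * exp (r\<^sup>2 / 16))) \<le> norm ((norm (f r))\<^sup>2 * exp (r\<^sup>2 / 4) + r powr real (2 * m) * exp (- (1 / 8 * r\<^sup>2)))"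
    using AE_pow_meas_pos[OF p]
  proof eventually_elim
    case (elim r)
    let ?a = "norm (f r) * exp (r\<^sup>2 / 8)" and ?b = "r ^ m * exp (- (r\<^sup>2 / 16))"
    have 1: "norm (f r * of_real (r ^ m * exp (r\<^sup>2 / 16))) = ?a * ?b"
    proof -
      have "exp (r\<^sup>2 / 16) = exp (r\<^sup>2 / 8) * exp (- (r\<^sup>2 / 16))" by (simp add: exp_add[symmetric])
      then show ?thesis using elim by (simp add: norm_mult abs_mult norm_power)
    qed
    have 2: "?a\<^sup>2 = (norm (f r))\<^sup>2 * exp (r\<^sup>2 / 4)" by (simp add: power_mult_distrib exp_double[symmetric])
    have 3: "?b\<^sup>2 = r powr real (2 * m) * exp (- (1 / 8 * r\<^sup>2))"
      using elim by (simp add: power_mult_distrib exp_double[symmetric] powr_realpow power_mult[symmetric] mult.commute del: of_nat_mult)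
    have "0 \<le> ?a * ?b" using elim by simp
    moreover have "2 * (?a * ?b) \<le> ?a\<^sup>2 + ?b\<^sup>2" using sum_squares_bound[of ?a ?b] by (simp only: mult.assoc)
    ultimately have "?a * ?b \<le> ?a\<^sup>2 + ?b\<^sup>2" by linarith
    then show ?case unfolding 1 unfolding 2[symmetric] 3[symmetric] by simp
  qed
qed measurable

lemma integrable_moment':
  fixes f :: "real \<Rightarrow> complex"
  assumes "p > 0" and f [measurable]: "f \<in> borel_measurable borel"
    and "integrable (pow_meas p) (\<lambda>r. (norm (f r))\<^sup>2 * exp (r\<^sup>2 / 4))"
  shows "integrable (pow_meas p) (\<lambda>r. f r * of_real (r ^ m))"
proof (rule Bochner_Integration.integrable_bound[OF integrable_moment[OF assms, of m]])
  show "AE r in pow_meas p. norm (f r * of_real (r ^ m)) \<le> norm (f r * of_real (r ^ m * exp (r\<^sup>2 / 16)))"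
  proof (rule AE_I2)
    fix r :: real
    have "\<bar>r ^ m\<bar> * 1 \<le> \<bar>r ^ m\<bar> * exp (r\<^sup>2 / 16)" by (intro mult_left_mono) auto
    then show "norm (f r * of_real (r ^ m)) \<le> norm (f r * of_real (r ^ m * exp (r\<^sup>2 / 16)))"
      unfolding norm_mult norm_of_real abs_mult by (intro mult_left_mono) auto
  qed
qed measurable

lemma sum_even_odd: "(\<Sum>k\<le>2 * K + 1. F k) = (\<Sum>j\<le>K. F (2 * j) + F (2 * j + 1))" for F :: "nat \<Rightarrow> complex"
  by (induction K) (auto simp: algebra_simps)

lemma fourier_radial_profile:
  fixes f :: "real \<Rightarrow> complex"
  assumes [measurable]: "f \<in> borel_measurable borel"
  shows "fourier (\<lambda>x::real^'n::finite. f (norm x)) \<xi> = fourier (\<lambda>x::real^'n. f (norm x)) (norm \<xi> *\<^sub>R axis k 1)"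
proof -
  have "norm (norm \<xi> *\<^sub>R axis k 1 :: real^'n) = norm \<xi>" by simp
  from orthogonal_transformation_exists[OF this] obtain A :: "real^'n \<Rightarrow> real^'n" where
    A: "orthogonal_transformation A" "A (norm \<xi> *\<^sub>R axis k 1) = \<xi>" by metis
  have "(\<lambda>x::real^'n. f (norm x)) \<circ> A = (\<lambda>x. f (norm x))" using orthogonal_transformation_norm[OF A(1)] by auto
  then show ?thesis using fourier_orthogonal[OF A(1), of "\<lambda>x. f (norm x)" "norm \<xi> *\<^sub>R axis k 1"] A(2) by simp
qed

text \<open>The character \<open>cis (- (r * x $ k))\<close> is expanded to the odd order
  \<open>2 * K + 1\<close>. Odd moments vanish under \<open>x \<mapsto> - x\<close>, so only even
  powers of \<open>r\<close> survive and the error has the next even order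
  \<open>2 * K + 2\<close>.\<close>

lemma fourier_radial_taylor:
  fixes f :: "real \<Rightarrow> complex" and k :: "'n::finite"
  assumes f [measurable]: "f \<in> borel_measurable borel"
    and i: "\<And>m. integrable lborel (\<lambda>x::real^'n. f (norm x) * of_real (norm x ^ m))"
  defines "\<alpha> \<equiv> \<lambda>j. of_real ((2 * pi) powr (- real CARD('n) / 2)) * ((- 1) ^ j / fact (2 * j)) * (LINT x::real^'n|lborel. of_real ((x $ k) ^ (2 * j)) * f (norm x))"
  shows "\<exists>C\<ge>0. \<forall>r\<ge>0. norm (fourier (\<lambda>x::real^'n. f (norm x)) (r *\<^sub>R axis k 1) - (\<Sum>j\<le>K. \<alpha> j * of_real (r ^ (2 * j)))) \<le> C * r ^ (2 * K + 2)"
proof -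
  let ?c = "(2 * pi) powr (- real CARD('n) / 2)"
  have mi: "integrable lborel (\<lambda>x::real^'n. of_real ((x $ k) ^ m) * f (norm x))" for m
  proof (rule Bochner_Integration.integrable_bound[OF i[of m]])
    show "AE x in lborel. norm (of_real ((x $ k) ^ m) * f (norm x)) \<le> norm (f (norm x) * of_real (norm x ^ m))"
      using component_le_norm_cart[of _ k] by (auto simp: norm_mult norm_power power_abs mult.commute[of "norm (f _)"] intro!: mult_right_mono power_mono)
  qed measurable
  have odd: "(LINT x::real^'n|lborel. of_real ((x $ k) ^ m) * f (norm x)) = 0" if "odd m" for m
  proof -
    have "(LINT x::real^'n|lborel. of_real (((- x) $ k) ^ m) * f (norm (- x))) = (LINT x::real^'n|lborel. of_real ((x $ k) ^ m) * f (norm x))"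
      by (rule integral_orthogonal[OF orthogonal_transformation_uminus, of "\<lambda>x. of_real ((x $ k) ^ m) * f (norm x)"]) measurable
    then show ?thesis using that by (simp add: power_minus_odd)
  qed
  have odd': "(LINT x::real^'n|lborel. of_real ((x $ k) ^ (2 * j + 1)) * f (norm x)) = 0" for j by (rule odd) simp
  define C where "C = ?c * (LINT x::real^'n|lborel. norm (f (norm x) * of_real (norm x ^ (2 * K + 2)))) / fact (2 * K + 1)"
  have C0: "C \<ge> 0" unfolding C_def by (intro divide_nonneg_pos mult_nonneg_nonneg integral_nonneg_AE) auto
  have "norm (fourier (\<lambda>x::real^'n. f (norm x)) (r *\<^sub>R axis k 1) - (\<Sum>j\<le>K. \<alpha> j * of_real (r ^ (2 * j)))) \<le> C * r ^ (2 * K + 2)" if r: "r \<ge> 0" for r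
  proof -
    let ?T = "\<lambda>x::real^'n. \<Sum>m\<le>2 * K + 1. (\<i> * of_real (- (r * (x $ k)))) ^ m / fact m"
    have Tm: "(\<i> * of_real (- (r * (x $ k)))) ^ m / fact m * f (norm x) = ((- \<i>) ^ m * of_real (r ^ m) / fact m) * (of_real ((x $ k) ^ m) * f (norm x))" for x :: "real^'n" and m
    proof -
      have e: "\<i> * of_real (- (r * (x $ k))) = (- \<i> * of_real r) * of_real (x $ k)" by simp
      show ?thesis unfolding e power_mult_distrib by simp
    qed
    have iT: "integrable lborel (\<lambda>x. ?T x * f (norm x))"
      unfolding sum_distrib_right Tm by (intro Bochner_Integration.integrable_sum integrable_mult_right mi)
    have "(LINT x|lborel. ?T x * f (norm x)) = (\<Sum>m\<le>2 * K + 1. ((- \<i>) ^ m * of_real (r ^ m) / fact m) * (LINT x::real^'n|lborel. of_real ((x $ k) ^ m) * f (norm x)))"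
      unfolding sum_distrib_right Tm by (subst Bochner_Integration.integral_sum) (intro integrable_mult_right mi, simp only: integral_mult_right_zero)
    also have "\<dots> = (\<Sum>j\<le>K. ((- \<i>) ^ (2 * j) * of_real (r ^ (2 * j)) / fact (2 * j)) * (LINT x::real^'n|lborel. of_real ((x $ k) ^ (2 * j)) * f (norm x)))"
      unfolding sum_even_odd by (simp only: odd' mult_zero_right add_0_right)
    finally have T0: "(LINT x|lborel. ?T x * f (norm x)) =
       (\<Sum>j\<le>K. ((- \<i>) ^ (2 * j) * of_real (r ^ (2 * j)) / fact (2 * j)) * (LINT x::real^'n|lborel. of_real ((x $ k) ^ (2 * j)) * f (norm x)))" .
    have i2: "(- \<i>) ^ (2 * j) = (- 1) ^ j" for j by (simp add: power_mult)
    have T: "of_real ?c * (LINT x|lborel. ?T x * f (norm x)) = (\<Sum>j\<le>K. \<alpha> j * of_real (r ^ (2 * j)))"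
      unfolding T0 sum_distrib_left \<alpha>_def i2 by (intro sum.cong refl) (simp add: mult_ac)
    have i0: "integrable lborel (\<lambda>x::real^'n. f (norm x))" using i[of 0] by simp
    have ic: "integrable lborel (\<lambda>x::real^'n. cis (- (r * (x $ k))) * f (norm x))"
      using integrable_cis_mult[OF i0, of "r *\<^sub>R axis k 1"] by (simp add: inner_axis)
    have "fourier (\<lambda>x::real^'n. f (norm x)) (r *\<^sub>R axis k 1) - (\<Sum>j\<le>K. \<alpha> j * of_real (r ^ (2 * j)))
        = of_real ?c * (LINT x|lborel. (cis (- (r * (x $ k))) - ?T x) * f (norm x))"
      unfolding T[symmetric] left_diff_distrib Bochner_Integration.integral_diff[OF ic iT] right_diff_distrib
      by (simp add: fourier_def inner_axis)
    also have "norm \<dots> \<le> ?c * (LINT x::real^'n|lborel. norm ((cis (- (r * (x $ k))) - ?T x) * f (norm x)))"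
      unfolding norm_mult[of "of_real ?c"] norm_of_real by (intro mult_mono integral_norm_bound) auto
    also have "\<dots> \<le> ?c * (LINT x::real^'n|lborel. r ^ (2 * K + 2) / fact (2 * K + 1) * norm (f (norm x) * of_real (norm x ^ (2 * K + 2))))"
    proof (intro mult_left_mono integral_mono)
      show "integrable lborel (\<lambda>x::real^'n. norm ((cis (- (r * (x $ k))) - ?T x) * f (norm x)))"
        unfolding left_diff_distrib by (intro integrable_norm Bochner_Integration.integrable_diff ic iT)
      show "integrable lborel (\<lambda>x::real^'n. r ^ (2 * K + 2) / fact (2 * K + 1) * norm (f (norm x) * of_real (norm x ^ (2 * K + 2))))"
        by (intro integrable_mult_right integrable_norm i)
      fix x :: "real^'n"
      have "norm (cis (- (r * (x $ k))) - ?T x) \<le> \<bar>- (r * (x $ k))\<bar> ^ Suc (2 * K + 1) / fact (2 * K + 1)"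
        by (rule norm_exp_ii_taylor)
      also have "\<dots> \<le> (r * norm x) ^ (2 * K + 2) / fact (2 * K + 1)"
        using component_le_norm_cart[of x k] r by (intro divide_right_mono) (auto simp: abs_mult intro!: power_mono mult_left_mono simp del: power_Suc)
      also have "\<dots> = r ^ (2 * K + 2) / fact (2 * K + 1) * norm x ^ (2 * K + 2)" by (simp add: power_mult_distrib del: power_Suc)
      finally have "norm (cis (- (r * (x $ k))) - ?T x) * norm (f (norm x)) \<le> r ^ (2 * K + 2) / fact (2 * K + 1) * norm x ^ (2 * K + 2) * norm (f (norm x))"
        by (intro mult_right_mono) auto
      then show "norm ((cis (- (r * (x $ k))) - ?T x) * f (norm x)) \<le> r ^ (2 * K + 2) / fact (2 * K + 1) * norm (f (norm x) * of_real (norm x ^ (2 * K + 2)))"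
        unfolding norm_mult norm_of_real by (simp add: mult_ac del: power_Suc)
    qed auto
    also have "\<dots> = C * r ^ (2 * K + 2)" by (simp add: C_def del: power_Suc)
    finally show ?thesis .
  qed
  with C0 show ?thesis by blast
qed

lemma integral_power_gauss_norm:
  assumes "p > 0" "m + p > 0" "a > 0" "\<And>r. r > 0 \<Longrightarrow> norm (R r :: complex) \<le> C * r powr m" and [measurable]: "R \<in> borel_measurable borel"
  shows "integrable (pow_meas p) (\<lambda>r. R r * of_real (exp (- (a * r\<^sup>2))))"
    and "norm (LINT r|pow_meas p. R r * of_real (exp (- (a * r\<^sup>2)))) \<le> C * (p / 2 * Gamma ((m + p) / 2) * a powr (- (m + p) / 2))"
proof -
  have g: "integrable (pow_meas p) (\<lambda>r. C * (r powr m * exp (- (a * r\<^sup>2))))"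
    using assms by (intro integrable_mult_right integrable_pow_meas_gauss) auto
  have ae: "AE r in pow_meas p. norm (R r * of_real (exp (- (a * r\<^sup>2)))) \<le> C * (r powr m * exp (- (a * r\<^sup>2)))"
    using AE_pow_meas_pos[OF assms(1)]
  proof eventually_elim
    case (elim r)
    then have "norm (R r) * exp (- (a * r\<^sup>2)) \<le> C * r powr m * exp (- (a * r\<^sup>2))" by (intro mult_right_mono assms) auto
    then show ?case by (simp add: norm_mult mult.assoc)
  qed
  show i: "integrable (pow_meas p) (\<lambda>r. R r * of_real (exp (- (a * r\<^sup>2))))"
    by (rule Bochner_Integration.integrable_bound[OF g]) (use ae in \<open>auto elim: eventually_mono\<close>)
  have "norm (LINT r|pow_meas p. R r * of_real (exp (- (a * r\<^sup>2)))) \<le> (LINT r|pow_meas p. norm (R r * of_real (exp (- (a * r\<^sup>2)))))"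
    by (rule integral_norm_bound)
  also have "\<dots> \<le> (LINT r|pow_meas p. C * (r powr m * exp (- (a * r\<^sup>2))))"
    by (intro integral_mono_AE g integrable_norm i ae)
  also have "\<dots> = C * (p / 2 * Gamma ((m + p) / 2) * a powr (- (m + p) / 2))"
    unfolding integral_mult_right_zero by (subst integral_pow_meas_gauss) (use assms in auto)
  finally show "norm (LINT r|pow_meas p. R r * of_real (exp (- (a * r\<^sup>2)))) \<le> C * (p / 2 * Gamma ((m + p) / 2) * a powr (- (m + p) / 2))" .
qed

text \<open>Both sides of the pairing with \<open>exp (- a r\<^sup>2)\<close> are expanded in powers of \<open>1 / a\<close>.\<close>

lemma taylor_coeff_eq_moment:
  fixes f g :: "real \<Rightarrow> complex"
  assumes p: "p > 0" and fm [measurable]: "f \<in> borel_measurable borel" and gm [measurable]: "g \<in> borel_measurable borel"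
    and i: "integrable (pow_meas p) (\<lambda>r. (norm (f r))\<^sup>2 * exp (r\<^sup>2 / 4))"
    and T: "\<And>r. r > 0 \<Longrightarrow> norm (g r - (\<Sum>j\<le>K. \<alpha> j * of_real (r ^ (2 * j)))) \<le> C * r ^ (2 * K + 2)"
    and eq: "\<And>a. a \<ge> 4 \<Longrightarrow> (LINT r|pow_meas p. g r * of_real (exp (- (a * r\<^sup>2)))) =
        of_real ((2 * a) powr (- p / 2)) * (LINT r|pow_meas p. f r * of_real (exp (- (1 / (4 * a) * r\<^sup>2))))"
  shows "\<alpha> K * of_real (p / 2 * Gamma (real K + p / 2)) =
     of_real (2 powr (- p / 2) * ((- 1 / 4) ^ K / fact K)) * (LINT r|pow_meas p. f r * of_real (r ^ (2 * K)))"
proof -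
  let ?\<nu> = "pow_meas p"
  define G where "G j = p / 2 * Gamma (real j + p / 2)" for j
  define m where "m j = (LINT r|?\<nu>. f r * of_real (r ^ (2 * j)))" for j
  \<comment> \<open>The difference of the coefficients of \<open>y^j\<close> on the two sides, after
    division by the common factor \<open>a powr (- p / 2)\<close>. The claim is
    \<open>d K = 0\<close>.\<close>
  define d where "d j = \<alpha> j * of_real (G j) - of_real (2 powr (- p / 2) * ((- 1 / 4) ^ j / fact j)) * m j" for j
  have fi: "integrable ?\<nu> (\<lambda>r. f r * of_real (r ^ k))" for k by (rule integrable_moment'[OF p fm i])
  define D where "D = (LINT r|?\<nu>. norm (f r * of_real (r ^ (2 * K + 2) * exp (r\<^sup>2 / 16))))"
  have main: "norm (\<Sum>j\<le>K. d j * of_real (y ^ j)) \<le> (C * G (Suc K) + 2 powr (- p / 2) * D) * y ^ Suc K"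
    if y: "0 < y" "y \<le> 1 / 4" for y
  proof -
    \<comment> \<open>The small parameter of the expansion is \<open>y = 1 / a\<close>, and
      \<open>y \<le> 1 / 4\<close> is the range \<open>a \<ge> 4\<close> in which the identity is
      assumed.\<close>
    define a where "a = 1 / y"
    have a: "a \<ge> 4" "a > 0" "y = 1 / a" using y by (auto simp: a_def field_simps)
    have J: "integrable ?\<nu> (\<lambda>r. of_real (r ^ (2 * j)) * of_real (exp (- (a * r\<^sup>2))) :: complex)"
      "(LINT r|?\<nu>. of_real (r ^ (2 * j)) * of_real (exp (- (a * r\<^sup>2))) :: complex) = of_real (G j * (y ^ j * a powr (- p / 2)))" for j
    proof -
      have ae: "AE r in ?\<nu>. r powr real (2 * j) * exp (- (a * r\<^sup>2)) = r ^ (2 * j) * exp (- (a * r\<^sup>2))"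
        using AE_pow_meas_pos[OF p] by eventually_elim (simp add: powr_realpow del: of_nat_mult)
      have "integrable ?\<nu> (\<lambda>r. r powr real (2 * j) * exp (- (a * r\<^sup>2)))" using p a by (intro integrable_pow_meas_gauss) auto
      then have "integrable ?\<nu> (\<lambda>r. r ^ (2 * j) * exp (- (a * r\<^sup>2)))" by (subst integrable_cong_AE[OF _ _ ae, symmetric]) auto
      then show "integrable ?\<nu> (\<lambda>r. of_real (r ^ (2 * j)) * of_real (exp (- (a * r\<^sup>2))) :: complex)"
        unfolding of_real_mult[symmetric] by (rule integrable_of_real)
      have "(LINT r|?\<nu>. r ^ (2 * j) * exp (- (a * r\<^sup>2))) = (LINT r|?\<nu>. r powr real (2 * j) * exp (- (a * r\<^sup>2)))"
        by (rule integral_cong_AE[symmetric]) (use ae in auto)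
      also have "\<dots> = p / 2 * Gamma ((real (2 * j) + p) / 2) * a powr (- (real (2 * j) + p) / 2)"
        using p a by (intro integral_pow_meas_gauss) auto
      also have "(real (2 * j) + p) / 2 = real j + p / 2" by (simp add: field_simps)
      also have "a powr (- (real (2 * j) + p) / 2) = y ^ j * a powr (- p / 2)"
      proof -
        have "- (real (2 * j) + p) / 2 = - real j + - p / 2" by (simp add: field_simps)
        then have "a powr (- (real (2 * j) + p) / 2) = a powr (- real j) * a powr (- p / 2)" by (simp only: powr_add)
        also have "a powr (- real j) = y ^ j" using a by (simp add: powr_minus powr_realpow power_one_over inverse_eq_divide)
        finally show ?thesis .
      qed
      finally show "(LINT r|?\<nu>. of_real (r ^ (2 * j)) * of_real (exp (- (a * r\<^sup>2))) :: complex) = of_real (G j * (y ^ j * a powr (- p / 2)))"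
        unfolding of_real_mult[symmetric] integral_complex_of_real G_def by (rule arg_cong)
    qed
    let ?P = "\<lambda>r. \<Sum>j\<le>K. \<alpha> j * of_real (r ^ (2 * j))"
    let ?e = "\<lambda>r. complex_of_real (exp (- (a * r\<^sup>2)))"
    have Pi: "integrable ?\<nu> (\<lambda>r. ?P r * ?e r)"
      unfolding sum_distrib_right mult.assoc by (intro Bochner_Integration.integrable_sum integrable_mult_right J)
    have Pv: "(LINT r|?\<nu>. ?P r * ?e r) = (\<Sum>j\<le>K. \<alpha> j * of_real (G j * (y ^ j * a powr (- p / 2))))"
      unfolding sum_distrib_right mult.assoc
      by (subst Bochner_Integration.integral_sum) (intro integrable_mult_right J, simp only: integral_mult_right_zero J mult.assoc)
    have Tp: "norm (g r - ?P r) \<le> C * r powr real (2 * K + 2)" if "r > 0" for r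
      using T[OF that] that by (simp only: powr_realpow)
    note R = integral_power_gauss_norm[of p "real (2 * K + 2)" a "\<lambda>r. g r - ?P r" C, OF p _ a(2) Tp]
    have Ri: "integrable ?\<nu> (\<lambda>r. (g r - ?P r) * ?e r)" by (rule R(1)) (use p in auto)
    have Rb: "norm (LINT r|?\<nu>. (g r - ?P r) * ?e r) \<le> C * (G (Suc K) * (y ^ Suc K * a powr (- p / 2)))"
    proof -
      have "norm (LINT r|?\<nu>. (g r - ?P r) * ?e r) \<le> C * (p / 2 * Gamma ((real (2 * K + 2) + p) / 2) * a powr (- (real (2 * K + 2) + p) / 2))"
        by (rule R(2)) (use p in auto)
      also have "(real (2 * K + 2) + p) / 2 = real (Suc K) + p / 2" by (simp add: field_simps)
      also have "- (real (2 * K + 2) + p) / 2 = - real (Suc K) + - p / 2" by (simp add: field_simps)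
      also have "a powr (- real (Suc K) + - p / 2) = y ^ Suc K * a powr (- p / 2)"
        unfolding powr_add using a by (simp add: powr_minus powr_realpow power_one_over inverse_eq_divide del: of_nat_Suc power_Suc)
      finally show ?thesis by (simp only: G_def mult.assoc)
    qed
    have gsplit: "(LINT r|?\<nu>. g r * ?e r) = (LINT r|?\<nu>. ?P r * ?e r) + (LINT r|?\<nu>. (g r - ?P r) * ?e r)"
      unfolding Bochner_Integration.integral_add[OF Pi Ri, symmetric] by (rule Bochner_Integration.integral_cong) (auto simp: algebra_simps)
    let ?z = "\<lambda>r. - (1 / (4 * a) * r\<^sup>2) :: real"
    let ?S = "\<lambda>r. \<Sum>j\<le>K. ?z r ^ j / fact j"
    have Sj: "f r * of_real (?z r ^ j / fact j) = of_real ((- 1 / 4) ^ j / fact j * y ^ j) * (f r * of_real (r ^ (2 * j)))" for r j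
    proof -
      have "?z r = ((- 1 / 4) * y) * r\<^sup>2" using a by simp
      then have "?z r ^ j / fact j = (- 1 / 4) ^ j / fact j * y ^ j * r ^ (2 * j)" by (simp only: power_mult_distrib power_mult) simp
      then show ?thesis by (simp only: of_real_mult mult_ac)
    qed
    have Si: "integrable ?\<nu> (\<lambda>r. f r * of_real (?S r))"
      unfolding of_real_sum sum_distrib_left Sj by (intro Bochner_Integration.integrable_sum integrable_mult_right fi)
    have Sv: "(LINT r|?\<nu>. f r * of_real (?S r)) = (\<Sum>j\<le>K. of_real ((- 1 / 4) ^ j / fact j * y ^ j) * m j)"
      unfolding of_real_sum sum_distrib_left Sj m_def
      by (subst Bochner_Integration.integral_sum) (intro integrable_mult_right fi, simp only: integral_mult_right_zero)
    \<comment> \<open>Since \<open>y \<le> 1 / 4\<close>, the exponent is at most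
      \<open>r^2 / 16\<close> in absolute value, so the remainder is \<open>y ^ Suc K\<close> times
      a function integrable by \<open>integrable_moment\<close>.\<close>
    have Eb: "norm (f r * of_real (exp (?z r) - ?S r)) \<le> y ^ Suc K * norm (f r * of_real (r ^ (2 * K + 2) * exp (r\<^sup>2 / 16)))" for r
    proof -
      have z: "\<bar>?z r\<bar> = r\<^sup>2 * y / 4" using a y by (simp add: abs_mult)
      have "\<bar>exp (?z r) - ?S r\<bar> \<le> exp \<bar>?z r\<bar> * \<bar>?z r\<bar> ^ Suc K / fact K"
        using Taylor_exp_field[of "?z r" K] by (simp only: real_norm_def)
      also have "\<dots> \<le> exp (r\<^sup>2 / 16) * (r\<^sup>2 * y) ^ Suc K / 1"
      proof (intro frac_le mult_mono power_mono)
        have "r\<^sup>2 * y \<le> r\<^sup>2 * (1 / 4)" using y by (intro mult_left_mono) auto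
        then show "exp \<bar>?z r\<bar> \<le> exp (r\<^sup>2 / 16)" unfolding z exp_le_cancel_iff by linarith
        show "\<bar>?z r\<bar> \<le> r\<^sup>2 * y" unfolding z using y by simp
      qed (use y in auto)
      also have "\<dots> = y ^ Suc K * (r ^ (2 * K + 2) * exp (r\<^sup>2 / 16))"
        by (simp only: power_mult_distrib power_mult[symmetric] div_by_1) (simp add: mult_ac)
      finally have "\<bar>exp (?z r) - ?S r\<bar> \<le> y ^ Suc K * \<bar>r ^ (2 * K + 2) * exp (r\<^sup>2 / 16)\<bar>" by (simp add: abs_mult)
      then have "norm (f r) * \<bar>exp (?z r) - ?S r\<bar> \<le> norm (f r) * (y ^ Suc K * \<bar>r ^ (2 * K + 2) * exp (r\<^sup>2 / 16)\<bar>)"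
        by (intro mult_left_mono) auto
      then show ?thesis unfolding norm_mult norm_of_real by (simp only: mult_ac)
    qed
    have wi: "integrable ?\<nu> (\<lambda>r. y ^ Suc K * norm (f r * of_real (r ^ (2 * K + 2) * exp (r\<^sup>2 / 16))))"
      by (intro integrable_mult_right integrable_norm integrable_moment[OF p fm i])
    have Ei: "integrable ?\<nu> (\<lambda>r. f r * of_real (exp (?z r) - ?S r))"
    proof (rule Bochner_Integration.integrable_bound[OF wi])
      show "AE r in ?\<nu>. norm (f r * of_real (exp (?z r) - ?S r)) \<le> norm (y ^ Suc K * norm (f r * of_real (r ^ (2 * K + 2) * exp (r\<^sup>2 / 16))))"
        unfolding real_norm_def by (intro AE_I2 order_trans[OF Eb] abs_ge_self)
    qed measurable
    have Ev: "norm (LINT r|?\<nu>. f r * of_real (exp (?z r) - ?S r)) \<le> y ^ Suc K * D"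
    proof -
      have "norm (LINT r|?\<nu>. f r * of_real (exp (?z r) - ?S r)) \<le> (LINT r|?\<nu>. norm (f r * of_real (exp (?z r) - ?S r)))"
        by (rule integral_norm_bound)
      also have "\<dots> \<le> (LINT r|?\<nu>. y ^ Suc K * norm (f r * of_real (r ^ (2 * K + 2) * exp (r\<^sup>2 / 16))))"
        by (intro integral_mono integrable_norm Ei wi Eb)
      finally show ?thesis by (simp only: D_def integral_mult_right_zero)
    qed
    have fsplit: "(LINT r|?\<nu>. f r * of_real (exp (?z r))) = (LINT r|?\<nu>. f r * of_real (?S r)) + (LINT r|?\<nu>. f r * of_real (exp (?z r) - ?S r))"
      unfolding Bochner_Integration.integral_add[OF Si Ei, symmetric] by (rule Bochner_Integration.integral_cong) (auto simp: algebra_simps)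
    define A where "A = complex_of_real (a powr (- p / 2))"
    define ER where "ER = (LINT r|?\<nu>. (g r - ?P r) * ?e r)"
    define EF where "EF = (LINT r|?\<nu>. f r * of_real (exp (?z r) - ?S r))"
    have "(\<Sum>j\<le>K. \<alpha> j * of_real (G j * (y ^ j * a powr (- p / 2)))) + ER = of_real ((2 * a) powr (- p / 2)) * ((\<Sum>j\<le>K. of_real ((- 1 / 4) ^ j / fact j * y ^ j) * m j) + EF)"
      using eq[OF a(1)] unfolding gsplit fsplit Pv Sv ER_def EF_def .
    moreover have "(2 * a) powr (- p / 2) = 2 powr (- p / 2) * a powr (- p / 2)" using a by (simp only: powr_mult)
    ultimately have "A * (\<Sum>j\<le>K. \<alpha> j * of_real (G j) * of_real (y ^ j)) + ER = A * (of_real (2 powr (- p / 2)) * ((\<Sum>j\<le>K. of_real ((- 1 / 4) ^ j / fact j * y ^ j) * m j) + EF))"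
      by (simp only: A_def of_real_mult sum_distrib_left mult_ac)
    then have X: "A * (\<Sum>j\<le>K. \<alpha> j * of_real (G j) * of_real (y ^ j)) + ER =
        A * (of_real (2 powr (- p / 2)) * (\<Sum>j\<le>K. of_real ((- 1 / 4) ^ j / fact j * y ^ j) * m j)) + A * (of_real (2 powr (- p / 2)) * EF)"
      by (simp only: distrib_left)
    have Y: "A * (\<Sum>j\<le>K. d j * of_real (y ^ j)) = A * (\<Sum>j\<le>K. \<alpha> j * of_real (G j) * of_real (y ^ j))
        - A * (of_real (2 powr (- p / 2)) * (\<Sum>j\<le>K. of_real ((- 1 / 4) ^ j / fact j * y ^ j) * m j))"
      unfolding d_def left_diff_distrib sum_subtractf right_diff_distrib by (simp add: sum_distrib_left mult_ac)
    have lin: "u + e = v + w \<Longrightarrow> u - v = w - e" for u v w e :: complex by (simp add: algebra_simps)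
    have Z: "A * (\<Sum>j\<le>K. d j * of_real (y ^ j)) = A * (of_real (2 powr (- p / 2)) * EF) - ER"
      unfolding Y by (rule lin[OF X])
    have "norm A * norm (\<Sum>j\<le>K. d j * of_real (y ^ j)) \<le> norm (A * (of_real (2 powr (- p / 2)) * EF)) + norm ER"
      unfolding norm_mult[of A "\<Sum>j\<le>K. d j * of_real (y ^ j)", symmetric] Z by (rule norm_triangle_ineq4)
    also have "\<dots> \<le> norm A * (2 powr (- p / 2) * (y ^ Suc K * D)) + norm A * (C * (G (Suc K) * y ^ Suc K))"
    proof (intro add_mono)
      show "norm (A * (of_real (2 powr (- p / 2)) * EF)) \<le> norm A * (2 powr (- p / 2) * (y ^ Suc K * D))"
        unfolding norm_mult norm_of_real using Ev by (intro mult_left_mono) (auto simp: EF_def)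
      show "norm ER \<le> norm A * (C * (G (Suc K) * y ^ Suc K))"
        using Rb unfolding ER_def A_def norm_of_real by (simp add: mult_ac del: power_Suc)
    qed
    also have "\<dots> = norm A * ((C * G (Suc K) + 2 powr (- p / 2) * D) * y ^ Suc K)" by (simp add: algebra_simps del: power_Suc)
    finally show ?thesis using a by (simp add: A_def del: power_Suc)
  qed
  have "d K = 0" by (rule poly_small_imp_zero[of "1 / 4", OF _ main]) auto
  then show ?thesis by (simp add: d_def G_def m_def)
qed

text \<open>The functional equation of Gamma, in the role of an integration by parts for Gaussian
  moments. It converts the factor \<open>a * r^2\<close>, created by differentiating the test
  Gaussian, into a number.\<close>

lemma gauss_moment_rec:
  fixes a m p :: real
  assumes "a > 0" "m + p > 0"
  shows "a * (Gamma ((m + 2 + p) / 2) * a powr (- (m + 2 + p) / 2)) = (m + p) / 2 * (Gamma ((m + p) / 2) * a powr (- (m + p) / 2))"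
proof -
  have "(m + p) / 2 \<notin> \<int>\<^sub>\<le>\<^sub>0" using assms nonpos_Ints_nonpos[of "(m + p) / 2"] by auto
  then have "Gamma ((m + p) / 2 + 1) = (m + p) / 2 * Gamma ((m + p) / 2)" using Gamma_plus1[of "(m + p) / 2"] by (simp add: add.commute)
  moreover have "(m + 2 + p) / 2 = (m + p) / 2 + 1" by (simp add: field_simps)
  ultimately have 1: "Gamma ((m + 2 + p) / 2) = (m + p) / 2 * Gamma ((m + p) / 2)" by (simp only:)
  have 2: "a * a powr (- (m + 2 + p) / 2) = a powr (- (m + p) / 2)"
  proof -
    have "- (m + 2 + p) / 2 = - (m + p) / 2 - 1" by (simp add: field_simps)
    then have "a powr (- (m + 2 + p) / 2) = a powr (- (m + p) / 2) / a powr 1" by (simp only: powr_diff)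
    then show ?thesis using assms by simp
  qed
  show ?thesis unfolding 1 2[symmetric] by (simp only: mult_ac)
qed

text \<open>With \<open>y = a\<^bsup>-s\<^esup>\<close>, both sides of the identity are power series in \<open>y\<close> up to a common factor.\<close>

lemma weak_identity_coeffs:
  fixes g G :: "real \<Rightarrow> complex"
  assumes p: "p > 0" and s: "s > 0" and gm [measurable]: "g \<in> borel_measurable borel" and Gm [measurable]: "G \<in> borel_measurable borel"
    and T: "\<And>r. r > 0 \<Longrightarrow> norm (g r - (\<Sum>j\<le>K. \<alpha> j * of_real (r ^ (2 * j)))) \<le> C * r ^ (2 * K + 2)"
    and TG: "\<And>r. r > 0 \<Longrightarrow> norm (G r - (\<Sum>j\<le>K. A j * of_real (r ^ (2 * j)))) \<le> C' * r ^ (2 * K + 2)"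
    and C: "C \<ge> 0" "C' \<ge> 0"
    and eq: "\<And>a. a \<ge> 1 \<Longrightarrow> (LINT r|pow_meas p. G (r powr s) * of_real (exp (- (a * r\<^sup>2)))) =
        (LINT r|pow_meas p. of_real (r powr (2 * s) + a / s * r\<^sup>2 - p / (2 * s)) * g (r powr s) * of_real (exp (- (a * r\<^sup>2))))"
  shows "A K = of_nat K * \<alpha> K + (if K = 0 then 0 else \<alpha> (K - 1))"
proof -
  let ?\<nu> = "pow_meas p"
  define \<gamma> where "\<gamma> j = p / 2 * Gamma ((2 * s * real j + p) / 2)" for j
  have pos: "2 * s * real j + p > 0" for j using p s by (simp add: add_nonneg_pos)
  have \<gamma>0: "\<gamma> j > 0" for j unfolding \<gamma>_def using p pos[of j] by (intro mult_pos_pos Gamma_real_pos) auto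
  \<comment> \<open>The asserted coefficient relation at index \<open>j\<close>, multiplied by the
    positive moment factor \<open>\<gamma> j\<close>.\<close>
  define d where "d j = of_real (\<gamma> j) * (A j - of_nat j * \<alpha> j - (if j = 0 then 0 else \<alpha> (j - 1)))" for j
  \<comment> \<open>Collects all contributions of order \<open>y ^ Suc K\<close>: the top term
    pushed out by multiplication with \<open>r powr (2 * s)\<close>, and the Taylor remainders of
    \<open>G\<close> and of \<open>g\<close> under the three parts of the weight.\<close>
  define B where "B = norm (\<alpha> K) * \<gamma> (Suc K) + C' * \<gamma> (Suc K) + C * (\<gamma> (Suc (Suc K)) + (real (Suc K) + p / (2 * s)) * \<gamma> (Suc K) + p / (2 * s) * \<gamma> (Suc K))"
  have main: "norm (\<Sum>j\<le>K. d j * of_real (y ^ j)) \<le> B * y ^ Suc K" if y: "0 < y" "y \<le> 1" for y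
  proof -
    \<comment> \<open>Chosen so that \<open>a powr (- (s * j)) = y ^ j\<close>: the moment of
      \<open>r powr (2 * s * j)\<close> becomes \<open>\<gamma> j * y ^ j\<close> up to the factor
      \<open>q\<close> common to all \<open>j\<close>.\<close>
    define a where "a = y powr (- 1 / s)"
    have a: "a \<ge> 1" "a > 0" using y s powr_mono2'[of "- 1 / s" y 1] by (auto simp: a_def)
    have yp: "a powr (- (2 * s * real j + p) / 2) = a powr (- p / 2) * y ^ j" for j
    proof -
      have "- (2 * s * real j + p) / 2 = - p / 2 + (- (s * real j))" by (simp add: field_simps)
      then have "a powr (- (2 * s * real j + p) / 2) = a powr (- p / 2) * a powr (- (s * real j))" by (simp only: powr_add)
      also have "a powr (- (s * real j)) = y powr real j" unfolding a_def powr_powr using s by simp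
      finally show ?thesis using y by (simp add: powr_realpow)
    qed
    define q where "q = a powr (- p / 2)"
    have q: "q > 0" using a by (simp add: q_def)
    define J where "J m = p / 2 * Gamma ((m + p) / 2) * a powr (- (m + p) / 2)" for m
    have Js: "J (2 * s * real j) = \<gamma> j * (q * y ^ j)" for j by (simp only: J_def \<gamma>_def yp q_def)
    \<comment> \<open>Consequently the part \<open>a / s * r^2 - p / (2 * s)\<close> of the weight
      multiplies the moment of \<open>r powr (2 * s * j)\<close> by \<open>j\<close>. This is
      \<open>\<theta> d/d\<theta> / 2\<close> acting on \<open>\<theta>^{2j}\<close>, in weak
      form.\<close>
    have Jrec: "a / s * J (2 * s * real j + 2) = (real j + p / (2 * s)) * J (2 * s * real j)" for j
    proof -
      have "a / s * J (2 * s * real j + 2) = p / (2 * s) * (a * (Gamma ((2 * s * real j + 2 + p) / 2) * a powr (- (2 * s * real j + 2 + p) / 2)))"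
        by (simp add: J_def mult_ac)
      also have "\<dots> = (real j + p / (2 * s)) * J (2 * s * real j)"
        unfolding gauss_moment_rec[OF a(2) pos] J_def using s by (simp add: field_simps)
      finally show ?thesis .
    qed
    let ?e = "\<lambda>r. complex_of_real (exp (- (a * r\<^sup>2)))"
    have mono: "integrable ?\<nu> (\<lambda>r. of_real (r powr m) * ?e r)" "(LINT r|?\<nu>. of_real (r powr m) * ?e r) = of_real (J m)" if "m + p > 0" for m
      unfolding of_real_mult[symmetric] integral_complex_of_real J_def
      by (intro integrable_of_real integrable_pow_meas_gauss p that a)
         (subst integral_pow_meas_gauss[OF p that a(2)], rule refl)
    let ?w = "\<lambda>r. of_real (r powr (2 * s) + a / s * r\<^sup>2 - p / (2 * s)) :: complex"
    have wmono: "has_bochner_integral ?\<nu> (\<lambda>r. ?w r * of_real (r powr (2 * s * real j)) * ?e r) (of_real (J (2 * s * real (Suc j)) + real j * J (2 * s * real j)))" for j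
    proof -
      have ae: "AE r in ?\<nu>. (of_real (r powr (2 * s * real (Suc j))) * ?e r + of_real (a / s) * (of_real (r powr (2 * s * real j + 2)) * ?e r))
           - of_real (p / (2 * s)) * (of_real (r powr (2 * s * real j)) * ?e r) = ?w r * of_real (r powr (2 * s * real j)) * ?e r"
        using AE_pow_meas_pos[OF p]
      proof eventually_elim
        case (elim r)
        have 1: "r powr (2 * s * real (Suc j)) = r powr (2 * s) * r powr (2 * s * real j)" by (simp add: powr_add[symmetric] algebra_simps)
        have 2: "r powr (2 * s * real j + 2) = r\<^sup>2 * r powr (2 * s * real j)" using elim by (simp add: powr_add mult.commute)
        show ?case unfolding 1 2 by (simp only: of_real_mult of_real_add of_real_diff ring_distribs mult_ac)
      qed
      have i: "has_bochner_integral ?\<nu> (\<lambda>r. (of_real (r powr (2 * s * real (Suc j))) * ?e r + of_real (a / s) * (of_real (r powr (2 * s * real j + 2)) * ?e r))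
           - of_real (p / (2 * s)) * (of_real (r powr (2 * s * real j)) * ?e r))
           ((of_real (J (2 * s * real (Suc j))) + of_real (a / s) * of_real (J (2 * s * real j + 2))) - of_real (p / (2 * s)) * of_real (J (2 * s * real j)))"
      proof (intro has_bochner_integral_diff has_bochner_integral_add has_bochner_integral_mult_right)
        have m: "2 * s * real (Suc j) + p > 0" "2 * s * real j + 2 + p > 0" "2 * s * real j + p > 0" using pos[of "Suc j"] pos[of j] by auto
        show "has_bochner_integral ?\<nu> (\<lambda>r. of_real (r powr (2 * s * real (Suc j))) * ?e r) (of_real (J (2 * s * real (Suc j))))"
          using mono[OF m(1)] by (simp only: has_bochner_integral_iff simp_thms)
        show "has_bochner_integral ?\<nu> (\<lambda>r. of_real (r powr (2 * s * real j + 2)) * ?e r) (of_real (J (2 * s * real j + 2)))"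
          using mono[OF m(2)] by (simp only: has_bochner_integral_iff simp_thms)
        show "has_bochner_integral ?\<nu> (\<lambda>r. of_real (r powr (2 * s * real j)) * ?e r) (of_real (J (2 * s * real j)))"
          using mono[OF m(3)] by (simp only: has_bochner_integral_iff simp_thms)
      qed
      have v: "(of_real (J (2 * s * real (Suc j))) + of_real (a / s) * of_real (J (2 * s * real j + 2))) - of_real (p / (2 * s)) * of_real (J (2 * s * real j))
          = complex_of_real (J (2 * s * real (Suc j)) + real j * J (2 * s * real j))"
        unfolding of_real_mult[symmetric] of_real_add[symmetric] of_real_diff[symmetric] Jrec by (simp add: algebra_simps del: of_nat_Suc)
      have "has_bochner_integral ?\<nu> (\<lambda>r. ?w r * of_real (r powr (2 * s * real j)) * ?e r) ((of_real (J (2 * s * real (Suc j))) + of_real (a / s) * of_real (J (2 * s * real j + 2))) - of_real (p / (2 * s)) * of_real (J (2 * s * real j)))"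
        by (rule iffD1[OF has_bochner_integral_cong_AE i]) (use ae in measurable)
      then show ?thesis unfolding v .
    qed
    have pw: "(r powr s) ^ (2 * j) = r powr (2 * s * real j)" if "r > 0" for r j
      using that by (simp add: powr_realpow[symmetric] powr_powr mult_ac)
    let ?P = "\<lambda>r. \<Sum>j\<le>K. \<alpha> j * of_real (r powr (2 * s * real j))"
    let ?Q = "\<lambda>r. \<Sum>j\<le>K. A j * of_real (r powr (2 * s * real j))"
    have RP: "norm (g (r powr s) - ?P r) \<le> C * r powr (2 * s * real (Suc K))" if "r > 0" for r
      using T[of "r powr s"] that pw[OF that] by (simp del: of_nat_Suc power_Suc add: pw[OF that, of "Suc K", simplified])
    have RQ: "norm (G (r powr s) - ?Q r) \<le> C' * r powr (2 * s * real (Suc K))" if "r > 0" for r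
      using TG[of "r powr s"] that pw[OF that] by (simp del: of_nat_Suc power_Suc add: pw[OF that, of "Suc K", simplified])
    define m where "m = 2 * s * real (Suc K)"
    have m: "m + p > 0" unfolding m_def by (rule pos)
    have RP1: "norm (of_real (r powr (2 * s)) * (g (r powr s) - ?P r)) \<le> C * r powr (2 * s * real (Suc (Suc K)))" if "r > 0" for r
    proof -
      have "norm (of_real (r powr (2 * s)) * (g (r powr s) - ?P r)) \<le> r powr (2 * s) * (C * r powr (2 * s * real (Suc K)))"
        unfolding norm_mult norm_of_real using RP[OF that] by (intro mult_mono) auto
      also have "\<dots> = C * r powr (2 * s * real (Suc (Suc K)))"
        by (simp add: mult.left_commute powr_add[symmetric] algebra_simps)
      finally show ?thesis .
    qed
    have RP2: "norm (of_real (a / s * r\<^sup>2) * (g (r powr s) - ?P r)) \<le> a / s * C * r powr (m + 2)" if "r > 0" for r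
    proof -
      have "norm (of_real (a / s * r\<^sup>2) * (g (r powr s) - ?P r)) \<le> (a / s * r\<^sup>2) * (C * r powr m)"
        unfolding norm_mult[of "of_real (a / s * r\<^sup>2)"] norm_of_real m_def using RP[OF that] a s by (intro mult_mono) auto
      also have "\<dots> = a / s * C * r powr (m + 2)" using that by (simp add: powr_add)
      finally show ?thesis .
    qed
    have RP3: "norm (of_real (- p / (2 * s)) * (g (r powr s) - ?P r)) \<le> p / (2 * s) * C * r powr m" if "r > 0" for r
    proof -
      have "norm (of_real (- p / (2 * s)) * (g (r powr s) - ?P r)) \<le> p / (2 * s) * (C * r powr m)"
        unfolding norm_mult[of "of_real (- p / (2 * s))"] norm_of_real m_def using RP[OF that] p s by (intro mult_mono) auto
      then show ?thesis by (simp only: mult.assoc)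
    qed
    have m1: "2 * s * real (Suc (Suc K)) + p > 0" by (rule pos)
    have m2: "m + 2 + p > 0" using m by simp
    have meas1: "(\<lambda>r. of_real (r powr (2 * s)) * (g (r powr s) - ?P r)) \<in> borel_measurable borel" by measurable
    have meas2: "(\<lambda>r. of_real (a / s * r\<^sup>2) * (g (r powr s) - ?P r)) \<in> borel_measurable borel" by measurable
    have meas3: "(\<lambda>r. of_real (- p / (2 * s)) * (g (r powr s) - ?P r)) \<in> borel_measurable borel" by measurable
    have meas4: "(\<lambda>r. G (r powr s) - ?Q r) \<in> borel_measurable borel" by measurable
    note B1 = integral_power_gauss_norm[OF p m1 a(2) RP1 meas1]
    note B2 = integral_power_gauss_norm[OF p m2 a(2) RP2 meas2]
    note B3 = integral_power_gauss_norm[OF p m a(2) RP3 meas3]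
    note B4 = integral_power_gauss_norm[OF p m a(2) RQ[folded m_def] meas4]
    define E1 where "E1 = (LINT r|?\<nu>. of_real (r powr (2 * s)) * (g (r powr s) - ?P r) * ?e r)"
    define E2 where "E2 = (LINT r|?\<nu>. of_real (a / s * r\<^sup>2) * (g (r powr s) - ?P r) * ?e r)"
    define E3 where "E3 = (LINT r|?\<nu>. of_real (- p / (2 * s)) * (g (r powr s) - ?P r) * ?e r)"
    define E4 where "E4 = (LINT r|?\<nu>. (G (r powr s) - ?Q r) * ?e r)"
    have n1: "norm E1 \<le> C * J (2 * s * real (Suc (Suc K)))" using B1(2) by (simp only: E1_def J_def)
    have n2: "norm E2 \<le> C * ((real (Suc K) + p / (2 * s)) * J (2 * s * real (Suc K)))"
    proof -
      have "norm E2 \<le> a / s * C * J (m + 2)" using B2(2) by (simp only: E2_def J_def)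
      also have "\<dots> = C * (a / s * J (2 * s * real (Suc K) + 2))" by (simp only: m_def mult_ac)
      finally show ?thesis unfolding Jrec .
    qed
    have n3: "norm E3 \<le> C * (p / (2 * s) * J (2 * s * real (Suc K)))"
      using B3(2) by (simp only: E3_def J_def m_def mult_ac)
    have n4: "norm E4 \<le> C' * J (2 * s * real (Suc K))" using B4(2) by (simp only: E4_def J_def m_def)
    have QI: "has_bochner_integral ?\<nu> (\<lambda>r. ?Q r * ?e r) (\<Sum>j\<le>K. A j * of_real (J (2 * s * real j)))"
    proof -
      have "has_bochner_integral ?\<nu> (\<lambda>r. of_real (r powr (2 * s * real j)) * ?e r) (of_real (J (2 * s * real j)))" for j
        using mono[OF pos[of j]] by (simp only: has_bochner_integral_iff simp_thms)
      then have "has_bochner_integral ?\<nu> (\<lambda>r. \<Sum>j\<le>K. A j * (of_real (r powr (2 * s * real j)) * ?e r)) (\<Sum>j\<le>K. A j * of_real (J (2 * s * real j)))"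
        by (intro has_bochner_integral_sum has_bochner_integral_mult_right)
      moreover have "?Q r * ?e r = (\<Sum>j\<le>K. A j * (of_real (r powr (2 * s * real j)) * ?e r))" for r
        unfolding sum_distrib_right by (rule sum.cong) (simp_all only: mult.assoc)
      ultimately show ?thesis by (simp only:)
    qed
    have PI: "has_bochner_integral ?\<nu> (\<lambda>r. \<Sum>j\<le>K. \<alpha> j * (?w r * of_real (r powr (2 * s * real j)) * ?e r)) (\<Sum>j\<le>K. \<alpha> j * of_real (J (2 * s * real (Suc j)) + real j * J (2 * s * real j)))"
      by (intro has_bochner_integral_sum has_bochner_integral_mult_right wmono)
    have LHS: "(LINT r|?\<nu>. G (r powr s) * ?e r) = (\<Sum>j\<le>K. A j * of_real (J (2 * s * real j))) + E4"
    proof -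
      have "(LINT r|?\<nu>. G (r powr s) * ?e r) = (LINT r|?\<nu>. ?Q r * ?e r + (G (r powr s) - ?Q r) * ?e r)"
        by (rule Bochner_Integration.integral_cong) (auto simp: algebra_simps)
      then show ?thesis using QI B4(1) by (simp add: has_bochner_integral_iff E4_def)
    qed
    have RHS: "(LINT r|?\<nu>. ?w r * g (r powr s) * ?e r) = (\<Sum>j\<le>K. \<alpha> j * of_real (J (2 * s * real (Suc j)) + real j * J (2 * s * real j))) + (E1 + (E2 + E3))"
    proof -
      let ?R = "\<lambda>r. g (r powr s) - ?P r"
      have "?w r * g (r powr s) * ?e r = (\<Sum>j\<le>K. \<alpha> j * (?w r * of_real (r powr (2 * s * real j)) * ?e r)) +
          (of_real (r powr (2 * s)) * ?R r * ?e r + (of_real (a / s * r\<^sup>2) * ?R r * ?e r + of_real (- p / (2 * s)) * ?R r * ?e r))" for r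
      proof -
        have "(\<Sum>j\<le>K. \<alpha> j * (?w r * of_real (r powr (2 * s * real j)) * ?e r)) = ?w r * ?P r * ?e r"
          unfolding sum_distrib_left sum_distrib_right by (rule sum.cong) (simp_all only: mult_ac)
        moreover have "?w r = of_real (r powr (2 * s)) + (of_real (a / s * r\<^sup>2) + of_real (- p / (2 * s)))"
          by simp
        moreover have "w * g * e = w * P * e + (w1 * (g - P) * e + (w2 * (g - P) * e + w3 * (g - P) * e))" if "w = w1 + (w2 + w3)" for w w1 w2 w3 P g e :: complex
          unfolding that by (simp add: algebra_simps)
        ultimately show ?thesis by (simp only:)
      qed
      then have "(LINT r|?\<nu>. ?w r * g (r powr s) * ?e r) = (LINT r|?\<nu>. (\<Sum>j\<le>K. \<alpha> j * (?w r * of_real (r powr (2 * s * real j)) * ?e r)) +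
          (of_real (r powr (2 * s)) * ?R r * ?e r + (of_real (a / s * r\<^sup>2) * ?R r * ?e r + of_real (- p / (2 * s)) * ?R r * ?e r)))"
        by (simp only:)
      also have "\<dots> = (\<Sum>j\<le>K. \<alpha> j * of_real (J (2 * s * real (Suc j)) + real j * J (2 * s * real j))) + (E1 + (E2 + E3))"
      proof -
        have "has_bochner_integral ?\<nu> (\<lambda>r. (\<Sum>j\<le>K. \<alpha> j * (?w r * of_real (r powr (2 * s * real j)) * ?e r)) +
          (of_real (r powr (2 * s)) * ?R r * ?e r + (of_real (a / s * r\<^sup>2) * ?R r * ?e r + of_real (- p / (2 * s)) * ?R r * ?e r)))
          ((\<Sum>j\<le>K. \<alpha> j * of_real (J (2 * s * real (Suc j)) + real j * J (2 * s * real j))) + (E1 + (E2 + E3)))"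
          unfolding E1_def E2_def E3_def
          by (intro has_bochner_integral_add PI has_bochner_integral_integrable B1(1) B2(1) B3(1))
        then show ?thesis by (rule has_bochner_integral_integral_eq)
      qed
      finally show ?thesis .
    qed
    have E: "(\<Sum>j\<le>K. A j * of_real (J (2 * s * real j))) + E4 = (\<Sum>j\<le>K. \<alpha> j * of_real (J (2 * s * real (Suc j)) + real j * J (2 * s * real j))) + (E1 + (E2 + E3))"
      using eq[OF a(1)] unfolding LHS RHS .
    \<comment> \<open>The part \<open>r powr (2 * s)\<close> of the weight raises the index by one,
      hence \<open>\<alpha> (j - 1)\<close> with the value 0 at \<open>j = 0\<close>. The last term
      has order \<open>y ^ Suc K\<close> and joins the error.\<close>
    have shift: "(\<Sum>j\<le>K. \<alpha> j * of_real (J (2 * s * real (Suc j)))) = (\<Sum>j\<le>K. (if j = 0 then 0 else \<alpha> (j - 1)) * of_real (J (2 * s * real j))) + \<alpha> K * of_real (J (2 * s * real (Suc K)))"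
      by (induction K) (auto simp del: of_nat_Suc)
    have dsum: "of_real q * (\<Sum>j\<le>K. d j * of_real (y ^ j)) = (\<Sum>j\<le>K. A j * of_real (J (2 * s * real j))) - (\<Sum>j\<le>K. \<alpha> j * of_real (real j * J (2 * s * real j)))
        - (\<Sum>j\<le>K. (if j = 0 then 0 else \<alpha> (j - 1)) * of_real (J (2 * s * real j)))"
    proof -
      have t: "A j * of_real (J (2 * s * real j)) - \<alpha> j * of_real (real j * J (2 * s * real j)) - (if j = 0 then 0 else \<alpha> (j - 1)) * of_real (J (2 * s * real j))
          = of_real q * (d j * of_real (y ^ j))" for j
        unfolding d_def Js of_real_mult of_real_of_nat_eq by (simp only: left_diff_distrib right_diff_distrib mult_ac)
      show ?thesis unfolding sum_subtractf[symmetric] t sum_distrib_left ..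
    qed
    have ds: "of_real q * (\<Sum>j\<le>K. d j * of_real (y ^ j)) = \<alpha> K * of_real (J (2 * s * real (Suc K))) + (E1 + (E2 + E3)) - E4"
      using E unfolding dsum of_real_add distrib_left sum.distrib shift by (simp add: algebra_simps)
    have "norm (of_real q * (\<Sum>j\<le>K. d j * of_real (y ^ j))) \<le> norm (\<alpha> K) * J (2 * s * real (Suc K)) + (norm E1 + (norm E2 + norm E3)) + norm E4"
    proof -
      have "J (2 * s * real (Suc K)) \<ge> 0" unfolding Js using \<gamma>0[of "Suc K"] q y by (intro mult_nonneg_nonneg) auto
      then have nrm: "norm (\<alpha> K * of_real (J (2 * s * real (Suc K)))) = norm (\<alpha> K) * J (2 * s * real (Suc K))" unfolding norm_mult norm_of_real by simp
      have tri: "norm (x + (e1 + (e2 + e3)) - e4) \<le> norm x + (norm e1 + (norm e2 + norm e3)) + norm e4" for x e1 e2 e3 e4 :: complex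
        using norm_triangle_ineq4[of "x + (e1 + (e2 + e3))" e4] norm_triangle_ineq[of x "e1 + (e2 + e3)"]
          norm_triangle_ineq[of e1 "e2 + e3"] norm_triangle_ineq[of e2 e3] by linarith
      show ?thesis unfolding ds nrm[symmetric] by (rule tri)
    qed
    also have "\<dots> \<le> norm (\<alpha> K) * J (2 * s * real (Suc K)) + (C * J (2 * s * real (Suc (Suc K))) + (C * ((real (Suc K) + p / (2 * s)) * J (2 * s * real (Suc K))) + C * (p / (2 * s) * J (2 * s * real (Suc K))))) + C' * J (2 * s * real (Suc K))"
      by (intro add_mono order.refl n1 n2 n3 n4)
    also have "\<dots> \<le> q * (B * y ^ Suc K)"
    proof -
      have "y ^ Suc (Suc K) \<le> y ^ Suc K" using y by (intro power_decreasing) auto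
      then have "J (2 * s * real (Suc (Suc K))) \<le> \<gamma> (Suc (Suc K)) * (q * y ^ Suc K)"
        unfolding Js using \<gamma>0[of "Suc (Suc K)"] q by (intro mult_left_mono) auto
      then have "C * J (2 * s * real (Suc (Suc K))) \<le> C * (\<gamma> (Suc (Suc K)) * (q * y ^ Suc K))" using C by (intro mult_left_mono)
      then show ?thesis unfolding B_def Js[of "Suc K"] by (simp add: algebra_simps del: power_Suc of_nat_Suc)
    qed
    finally show ?thesis using q by (simp add: norm_mult del: power_Suc)
  qed
  have "d K = 0" by (rule poly_small_imp_zero[of 1, OF _ main]) auto
  then have "A K - of_nat K * \<alpha> K - (if K = 0 then 0 else \<alpha> (K - 1)) = 0" using \<gamma>0[of K] by (simp add: d_def)
  then show ?thesis by (simp add: algebra_simps)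
qed

text \<open>\<open>f\<close> represents \<open>u\<^sup>\<dagger>\<close>, \<open>g\<close> is the radial profile of its Fourier transform and \<open>\<alpha>\<close> lists the Taylor
  coefficients of \<open>g\<close>, which are multiples of the even moments of \<open>f\<close>.\<close>

definition dag_data :: "real \<Rightarrow> 'n::finite dist \<Rightarrow> (real \<Rightarrow> complex) \<Rightarrow> (real \<Rightarrow> complex) \<Rightarrow> (nat \<Rightarrow> complex) \<Rightarrow> bool" where
  "dag_data s u f g \<alpha> \<longleftrightarrow>
     f \<in> borel_measurable borel \<and> integrable (pow_meas (real CARD('n))) (\<lambda>r. (norm (f r))\<^sup>2 * exp (r\<^sup>2 / 4)) \<and>
     (AE r in pow_meas (real CARD('n)). dagger s u r = f r) \<and>
     g \<in> borel_measurable borel \<and> (\<exists>B. \<forall>r. norm (g r) \<le> B) \<and>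
     has_fourier_fun u (\<lambda>\<xi>. g (norm \<xi> powr s)) \<and>
     (\<forall>K. \<exists>C\<ge>0. \<forall>r>0. norm (g r - (\<Sum>j\<le>K. \<alpha> j * of_real (r ^ (2 * j)))) \<le> C * r ^ (2 * K + 2)) \<and>
     (\<forall>j. \<alpha> j * of_real (real CARD('n) / 2 * Gamma (real j + real CARD('n) / 2)) =
        of_real (2 powr (- real CARD('n) / 2) * ((- 1 / 4) ^ j / fact j)) *
        (LINT r|pow_meas (real CARD('n)). f r * of_real (r ^ (2 * j))))"

lemma measurable_cis [measurable]: "cis \<in> borel_measurable borel"
  by (intro borel_measurable_continuous_onI continuous_intros)

text \<open>The profile \<open>h\<close> given by membership is determined only almost everywhere.
  It is replaced by the pointwise Fourier integral \<open>g\<close> of the rapidly decaying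
  \<open>f\<close>, which is bounded and has Taylor expansions of every order at 0.\<close>

lemma L2dag_data:
  fixes u :: "'n::finite dist"
  assumes s: "s > 0" and u: "u \<in> L2dag s"
  shows "\<exists>f g \<alpha>. dag_data s u f g \<alpha>"
proof -
  let ?n = "real CARD('n)"
  let ?k = "undefined :: 'n"
  have n0: "?n > 0" by simp
  from u obtain f0 where d: "is_dagger s u f0"
    and i0: "integrable lborel (\<lambda>x::real^'n. (norm (f0 (norm x)))\<^sup>2 * exp ((norm x)\<^sup>2 / 4))"
    by (auto simp: L2dag_def)
  from d obtain h where t0: "tempered_fun (\<lambda>x::real^'n. f0 (norm x))" and hu: "has_fourier_fun u (\<lambda>\<xi>. h (norm \<xi>))"
    and hf: "has_fourier_fun (dist_of (\<lambda>x::real^'n. f0 (norm x))) (\<lambda>\<xi>. h (norm \<xi> powr (1 / s)))"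
    by (auto simp: is_dagger_def)
  \<comment> \<open>The absolute value makes the representative Borel on the whole line without
    changing it on \<open>(0, \<infinity>)\<close>.\<close>
  define f where "f r = f0 \<bar>r\<bar>" for r
  have fx: "f (norm x) = f0 (norm x)" for x :: "real^'n" by (simp add: f_def)
  have fm [measurable]: "f \<in> borel_measurable borel"
    unfolding f_def using t0 by (intro measurable_radial_profile[where 'n='n]) (simp add: tempered_fun_def)
  have fi: "integrable (pow_meas ?n) (\<lambda>r. (norm (f r))\<^sup>2 * exp (r\<^sup>2 / 4))"
    using i0 by (subst integrable_radial_iff[symmetric, where 'n='n]) (auto simp: fx)
  have mom: "integrable lborel (\<lambda>x::real^'n. f (norm x) * of_real (norm x ^ m))" for m
    using integrable_moment'[OF n0 fm fi, of m] by (subst integrable_radial_iff) auto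
  define F where "F = (\<lambda>x::real^'n. f (norm x))"
  have Fi: "integrable lborel F" using mom[of 0] by (simp add: F_def)
  \<comment> \<open>The transform of a radial function is radial, so evaluation along one axis loses
    nothing; the choice of axis is immaterial.\<close>
  define g where "g r = fourier F (r *\<^sub>R axis ?k 1)" for r
  have Fg: "fourier F \<xi> = g (norm \<xi>)" for \<xi> unfolding g_def F_def by (rule fourier_radial_profile) measurable
  have gm [measurable]: "g \<in> borel_measurable borel"
    unfolding g_def fourier_def F_def by measurable
  have gB: "norm (g r) \<le> (2 * pi) powr (- ?n / 2) * (LINT x|lborel. norm (F x))" for r
    unfolding g_def by (rule norm_fourier_le)
  have pair: "(LINT x::real^'n|lborel. g (norm x) * gauss a x) = (LINT x::real^'n|lborel. f (norm x) * fourier (gauss a) x)" if a: "a > 0" for a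
    using fourier_mult_formula[OF Fi schwartz_integrable[OF schwartz_gauss[OF a]]] by (simp add: Fg) (simp add: F_def)
  \<comment> \<open>Both functions have the same pairings with all Gaussians, the left one by the
    definition of \<open>is_dagger\<close> and the right one by the multiplication formula.\<close>
  have "AE r in pow_meas ?n. h (r powr (1 / s)) = g r"
  proof (rule radial_AE_eqI[where 'n='n and ?a0.0 = 1])
    have t: "tempered_fun (\<lambda>\<xi>::real^'n. h (norm \<xi> powr (1 / s)))" by (rule has_fourier_fun_tempered[OF hf])
    have g1: "(gauss 1 :: real^'n \<Rightarrow> complex) \<in> schwartz" by (rule schwartz_gauss) simp
    show "(\<lambda>x::real^'n. h (norm x powr (1 / s))) \<in> borel_measurable borel" using t by (simp add: tempered_fun_def)
    show "integrable lborel (\<lambda>x::real^'n. h (norm x powr (1 / s)) * gauss 1 x)" by (rule tempered_fun_integrable[OF t g1])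
    have "poly_bounded (\<lambda>x::real^'n. g (norm x))" by (rule poly_bounded_bounded[OF _ gB]) measurable
    then show "integrable lborel (\<lambda>x::real^'n. g (norm x) * gauss 1 x)" by (rule poly_bounded_mult_schwartz[OF _ g1])
    fix a :: real assume "1 \<le> a"
    then have a: "a > 0" by simp
    have S: "(gauss a :: real^'n \<Rightarrow> complex) \<in> schwartz" by (rule schwartz_gauss[OF a])
    have "(LINT x::real^'n|lborel. h (norm x powr (1 / s)) * gauss a x) = dist_of (\<lambda>x::real^'n. f0 (norm x)) (fourier (gauss a))"
      by (rule has_fourier_funD[OF hf S, symmetric])
    also have "\<dots> = (LINT x::real^'n|lborel. f (norm x) * fourier (gauss a) x)"
      using schwartz_fourier[OF S] by (simp add: dist_of_def fx)
    finally show "(LINT x::real^'n|lborel. h (norm x powr (1 / s)) * gauss a x) = (LINT x::real^'n|lborel. g (norm x) * gauss a x)"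
      using pair[OF a] by simp
  qed measurable
  with AE_pow_meas_pos[OF n0] have ae1: "AE r in pow_meas ?n. h \<bar>r powr (1 / s)\<bar> = g ((r powr (1 / s)) powr s)"
    by eventually_elim (use s in \<open>simp add: powr_powr\<close>)
  have hm: "(\<lambda>r. h \<bar>r\<bar>) \<in> borel_measurable borel"
    using hu by (intro measurable_radial_profile[where 'n='n]) (simp add: has_fourier_fun_def tempered_fun_def)
  have S: "{r. h \<bar>r\<bar> = g (r powr s)} \<in> sets borel" using hm by measurable
  have "AE r in pow_meas ?n. h \<bar>r\<bar> = g (r powr s)"
    using ae1 AE_pow_meas_powr_same[OF S n0, of "1 / s"] s by simp
  then have "AE x::real^'n in lborel. h (norm x) = g (norm x powr s)"
    using AE_radial_iff[OF S, where 'n='n] by simp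
  then have ug: "has_fourier_fun u (\<lambda>\<xi>. g (norm \<xi> powr s))"
    by (intro has_fourier_fun_cong_AE[OF hu]) measurable
  have "is_dagger s u (dagger s u)" unfolding dagger_def by (rule someI[of "is_dagger s u", OF d])
  from is_dagger_unique[OF s this d] AE_pow_meas_pos[OF n0] have dag: "AE r in pow_meas ?n. dagger s u r = f r"
    by eventually_elim (simp add: f_def)
  define \<alpha> where "\<alpha> j = of_real ((2 * pi) powr (- real CARD('n) / 2)) * ((- 1) ^ j / fact (2 * j)) * (LINT x::real^'n|lborel. of_real ((x $ ?k) ^ (2 * j)) * f (norm x))" for j
  have T: "\<exists>C\<ge>0. \<forall>r>0. norm (g r - (\<Sum>j\<le>K. \<alpha> j * of_real (r ^ (2 * j)))) \<le> C * r ^ (2 * K + 2)" for K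
    using fourier_radial_taylor[OF fm mom, of ?k K] unfolding \<alpha>_def g_def F_def by (meson less_imp_le)
  have mo: "\<alpha> K * of_real (?n / 2 * Gamma (real K + ?n / 2)) = of_real (2 powr (- ?n / 2) * ((- 1 / 4) ^ K / fact K)) * (LINT r|pow_meas ?n. f r * of_real (r ^ (2 * K)))" for K
  proof -
    obtain C where C: "\<And>r. r > 0 \<Longrightarrow> norm (g r - (\<Sum>j\<le>K. \<alpha> j * of_real (r ^ (2 * j)))) \<le> C * r ^ (2 * K + 2)" using T[of K] by blast
    show ?thesis
    proof (rule taylor_coeff_eq_moment[OF n0 fm gm fi C])
      fix a :: real assume "a \<ge> 4"
      then have a: "a > 0" by simp
      let ?V = "unit_ball_vol ?n"
      have V: "?V \<noteq> 0" by (rule less_imp_neq[symmetric], rule unit_ball_vol_pos) simp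
      have "?V *\<^sub>R (LINT r|pow_meas ?n. g r * of_real (exp (- (a * r\<^sup>2)))) = (LINT x::real^'n|lborel. g (norm x) * gauss a x)"
        unfolding gauss_def by (rule integral_radial[symmetric]) measurable
      also have "\<dots> = (LINT x::real^'n|lborel. f (norm x) * fourier (gauss a) x)" by (rule pair[OF a])
      also have "\<dots> = (LINT x::real^'n|lborel. of_real ((2 * a) powr (- ?n / 2)) * (f (norm x) * gauss (1 / (4 * a)) x))"
        by (simp only: fourier_gauss[OF a] mult.left_commute)
      also have "\<dots> = of_real ((2 * a) powr (- ?n / 2)) * (LINT x::real^'n|lborel. f (norm x) * of_real (exp (- (1 / (4 * a) * (norm x)\<^sup>2))))"
        unfolding integral_mult_right_zero gauss_def ..
      also have "(LINT x::real^'n|lborel. f (norm x) * of_real (exp (- (1 / (4 * a) * (norm x)\<^sup>2)))) = ?V *\<^sub>R (LINT r|pow_meas ?n. f r * of_real (exp (- (1 / (4 * a) * r\<^sup>2))))"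
        by (rule integral_radial) measurable
      finally have "?V *\<^sub>R (LINT r|pow_meas ?n. g r * of_real (exp (- (a * r\<^sup>2)))) =
         ?V *\<^sub>R (of_real ((2 * a) powr (- ?n / 2)) * (LINT r|pow_meas ?n. f r * of_real (exp (- (1 / (4 * a) * r\<^sup>2)))))"
        by (simp only: mult_scaleR_right)
      then show "(LINT r|pow_meas ?n. g r * of_real (exp (- (a * r\<^sup>2)))) =
         of_real ((2 * a) powr (- ?n / 2)) * (LINT r|pow_meas ?n. f r * of_real (exp (- (1 / (4 * a) * r\<^sup>2))))"
        using V by (simp only: scaleR_cancel_left simp_thms)
    qed
  qed
  have "dag_data s u f g \<alpha>" unfolding dag_data_def using fm fi dag gm gB ug T mo by blast
  then show ?thesis by blast
qed

text \<open>The distribution \<open>L_op s u\<close> is evaluated at the transform of a Gaussian and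
  compared with its own transform \<open>G\<close>. In polar coordinates this is the hypothesis of
  \<open>weak_identity_coeffs\<close>.\<close>

lemma dag_data_L_op:
  fixes u :: "'n::finite dist"
  assumes s: "s > 0" and u: "dag_data s u f g \<alpha>" and v: "dag_data s (L_op s u) F G A"
  shows "A K = of_nat K * \<alpha> K + (if K = 0 then 0 else \<alpha> (K - 1))"
proof -
  let ?n = "real CARD('n)"
  have n0: "?n > 0" by simp
  from u obtain B where gm [measurable]: "g \<in> borel_measurable borel" and gB: "\<And>r. norm (g r) \<le> B"
    and ug: "has_fourier_fun u (\<lambda>\<xi>. g (norm \<xi> powr s))" unfolding dag_data_def by blast
  from v have Gm [measurable]: "G \<in> borel_measurable borel" and vG: "has_fourier_fun (L_op s u) (\<lambda>\<xi>. G (norm \<xi> powr s))"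
    unfolding dag_data_def by blast+
  from u obtain C where C: "C \<ge> 0" "\<And>r. r > 0 \<Longrightarrow> norm (g r - (\<Sum>j\<le>K. \<alpha> j * of_real (r ^ (2 * j)))) \<le> C * r ^ (2 * K + 2)"
    unfolding dag_data_def by blast
  from v obtain C' where C': "C' \<ge> 0" "\<And>r. r > 0 \<Longrightarrow> norm (G r - (\<Sum>j\<le>K. A j * of_real (r ^ (2 * j)))) \<le> C' * r ^ (2 * K + 2)"
    unfolding dag_data_def by blast
  let ?g = "\<lambda>\<xi>::real^'n. g (norm \<xi> powr s)"
  have pg: "poly_bounded (\<lambda>\<xi>. of_real (norm \<xi> powr q) * ?g \<xi>)" if "q \<ge> 0" for q
    by (rule poly_bounded_powr_mult[OF _ gB that]) measurable
  have pg0: "poly_bounded ?g" by (rule poly_bounded_bounded[OF _ gB]) measurable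
  have pg2: "poly_bounded (\<lambda>\<xi>. of_real ((norm \<xi>)\<^sup>2) * ?g \<xi>)"
  proof -
    have "norm \<xi> powr 2 = (norm \<xi>)\<^sup>2" for \<xi> :: "real^'n" by (cases "\<xi> = 0") auto
    then show ?thesis using pg[of 2] by simp
  qed
  have fl: "frac_laplace s u = inv_fourier_dist (\<lambda>\<xi>. of_real (norm \<xi> powr (2 * s)) * ?g \<xi>)"
    by (rule frac_laplace_radial[where h = "\<lambda>r. g (r powr s)", OF ug pg]) (use s in simp)
  have fu: "has_fourier_fun (frac_laplace s u) (\<lambda>\<xi>. of_real (norm \<xi> powr (2 * s)) * ?g \<xi>)"
    unfolding fl by (rule has_fourier_fun_inv_fourier_dist[OF pg]) (use s in auto)
  show ?thesis
  proof (rule weak_identity_coeffs[OF n0 s gm Gm C(2) C'(2) C(1) C'(1)])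
    fix a :: real assume "a \<ge> 1"
    then have a: "a > 0" by simp
    have S: "(gauss a :: real^'n \<Rightarrow> complex) \<in> schwartz" by (rule schwartz_gauss[OF a])
    let ?V = "unit_ball_vol ?n"
    have V: "?V \<noteq> 0" by (rule less_imp_neq[symmetric], rule unit_ball_vol_pos) simp
    let ?I = "\<lambda>w. LINT \<xi>::real^'n|lborel. w \<xi> * ?g \<xi> * gauss a \<xi>"
    have i1: "integrable lborel (\<lambda>\<xi>. of_real (norm \<xi> powr (2 * s)) * ?g \<xi> * gauss a \<xi>)"
      by (rule poly_bounded_mult_schwartz[OF pg S]) (use s in simp)
    note i2 = poly_bounded_mult_schwartz[OF pg2 S]
    note i3 = poly_bounded_mult_schwartz[OF pg0 S]
    \<comment> \<open>Here \<open>\<xi> . grad\<close> of the Gaussian is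
      \<open>- 2 * a * |\<xi>|^2\<close> times it. Together with the factor
      \<open>- 1 / (2 * s)\<close> this is the term \<open>a / s * r^2\<close> of the
      weight.\<close>
    have eu: "(\<Sum>i\<in>UNIV. LINT \<xi>::real^'n|lborel. ?g \<xi> * (of_real (\<xi> $ i) * partial_deriv i (gauss a) \<xi>)) = of_real (- 2 * a) * (LINT \<xi>::real^'n|lborel. of_real ((norm \<xi>)\<^sup>2) * ?g \<xi> * gauss a \<xi>)"
    proof -
      have "(\<Sum>i\<in>UNIV. LINT \<xi>::real^'n|lborel. ?g \<xi> * (of_real (\<xi> $ i) * partial_deriv i (gauss a) \<xi>))
          = (LINT \<xi>::real^'n|lborel. (\<Sum>i\<in>UNIV. ?g \<xi> * (of_real (\<xi> $ i) * partial_deriv i (gauss a) \<xi>)))"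
        by (rule Bochner_Integration.integral_sum[symmetric])
           (intro poly_bounded_mult_schwartz[OF pg0] schwartz_coord schwartz_partial_deriv S)
      also have "(\<lambda>\<xi>::real^'n. \<Sum>i\<in>UNIV. ?g \<xi> * (of_real (\<xi> $ i) * partial_deriv i (gauss a) \<xi>)) = (\<lambda>\<xi>. of_real (- 2 * a) * (of_real ((norm \<xi>)\<^sup>2) * ?g \<xi> * gauss a \<xi>))"
      proof
        fix \<xi> :: "real^'n"
        have "?g \<xi> * (of_real (\<xi> $ i) * partial_deriv i (gauss a) \<xi>) = of_real ((\<xi> $ i)\<^sup>2) * (of_real (- 2 * a) * (?g \<xi> * gauss a \<xi>))" for i
          unfolding partial_deriv_gauss by (simp add: power2_eq_square mult_ac)
        then have "(\<Sum>i\<in>UNIV. ?g \<xi> * (of_real (\<xi> $ i) * partial_deriv i (gauss a) \<xi>)) = of_real (\<Sum>i\<in>UNIV. (\<xi> $ i)\<^sup>2) * (of_real (- 2 * a) * (?g \<xi> * gauss a \<xi>))"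
          by (simp only: of_real_sum sum_distrib_right)
        then show "(\<Sum>i\<in>UNIV. ?g \<xi> * (of_real (\<xi> $ i) * partial_deriv i (gauss a) \<xi>)) = of_real (- 2 * a) * (of_real ((norm \<xi>)\<^sup>2) * ?g \<xi> * gauss a \<xi>)"
          unfolding sum_coord_sq by (simp only: mult_ac)
      qed
      finally show ?thesis by (simp only: integral_mult_right_zero)
    qed
    have "(LINT \<xi>::real^'n|lborel. G (norm \<xi> powr s) * gauss a \<xi>) = L_op s u (fourier (gauss a))"
      by (rule has_fourier_funD[OF vG S, symmetric])
    also have "\<dots> = (LINT \<xi>::real^'n|lborel. of_real (norm \<xi> powr (2 * s)) * ?g \<xi> * gauss a \<xi>)
        - of_real (1 / (2 * s)) * (of_real (- 2 * a) * (LINT \<xi>::real^'n|lborel. of_real ((norm \<xi>)\<^sup>2) * ?g \<xi> * gauss a \<xi>))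
        - of_real (?n / (2 * s)) * (LINT \<xi>::real^'n|lborel. ?g \<xi> * gauss a \<xi>)"
      unfolding L_op_fourier[OF ug fu S] eu ..
    also have "\<dots> = (LINT \<xi>::real^'n|lborel. of_real (norm \<xi> powr (2 * s)) * ?g \<xi> * gauss a \<xi>
        + (of_real (a / s) * (of_real ((norm \<xi>)\<^sup>2) * ?g \<xi> * gauss a \<xi>) + of_real (- ?n / (2 * s)) * (?g \<xi> * gauss a \<xi>)))"
    proof -
      have "of_real (1 / (2 * s)) * (of_real (- 2 * a) * z) = - (of_real (a / s) * z)" for z :: complex using s by simp
      moreover have "(LINT \<xi>::real^'n|lborel. of_real (norm \<xi> powr (2 * s)) * ?g \<xi> * gauss a \<xi>
        + (of_real (a / s) * (of_real ((norm \<xi>)\<^sup>2) * ?g \<xi> * gauss a \<xi>) + of_real (- ?n / (2 * s)) * (?g \<xi> * gauss a \<xi>)))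
       = (LINT \<xi>::real^'n|lborel. of_real (norm \<xi> powr (2 * s)) * ?g \<xi> * gauss a \<xi>)
        + (of_real (a / s) * (LINT \<xi>::real^'n|lborel. of_real ((norm \<xi>)\<^sup>2) * ?g \<xi> * gauss a \<xi>) + of_real (- ?n / (2 * s)) * (LINT \<xi>::real^'n|lborel. ?g \<xi> * gauss a \<xi>))"
        by (intro has_bochner_integral_integral_eq has_bochner_integral_add has_bochner_integral_mult_right has_bochner_integral_integrable i1 i2 i3)
      ultimately show ?thesis by simp
    qed
    also have "\<dots> = (LINT \<xi>::real^'n|lborel. of_real (norm \<xi> powr (2 * s) + a / s * (norm \<xi>)\<^sup>2 - ?n / (2 * s)) * ?g \<xi> * gauss a \<xi>)"
      by (rule Bochner_Integration.integral_cong[OF refl]) (simp add: algebra_simps)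
    finally have e: "(LINT \<xi>::real^'n|lborel. (\<lambda>r. G (r powr s) * of_real (exp (- (a * r\<^sup>2)))) (norm \<xi>)) =
       (LINT \<xi>::real^'n|lborel. (\<lambda>r. of_real (r powr (2 * s) + a / s * r\<^sup>2 - ?n / (2 * s)) * g (r powr s) * of_real (exp (- (a * r\<^sup>2)))) (norm \<xi>))"
      by (simp only: gauss_def)
    have m1: "(\<lambda>r. G (r powr s) * of_real (exp (- (a * r\<^sup>2)))) \<in> borel_measurable borel" by measurable
    have m2: "(\<lambda>r. of_real (r powr (2 * s) + a / s * r\<^sup>2 - ?n / (2 * s)) * g (r powr s) * of_real (exp (- (a * r\<^sup>2)))) \<in> borel_measurable borel" by measurable
    show "(LINT r|pow_meas ?n. G (r powr s) * of_real (exp (- (a * r\<^sup>2)))) =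
       (LINT r|pow_meas ?n. of_real (r powr (2 * s) + a / s * r\<^sup>2 - ?n / (2 * s)) * g (r powr s) * of_real (exp (- (a * r\<^sup>2))))"
      using e V unfolding integral_radial[OF m1, where 'n='n] integral_radial[OF m2, where 'n='n] by (simp only: scaleR_cancel_left simp_thms)
  qed
qed

section \<open>Pairing with Laguerre polynomials\<close>

lemma gbinomial_Gamma_shift:
  assumes "i \<le> k" "c > 0"
  shows "((real k + (c - 1)) gchoose (k - i)) * Gamma (real i + c) = Gamma (real k + c) / fact (k - i)"
proof -
  have z: "real i + c \<notin> \<int>\<^sub>\<le>\<^sub>0" using assms nonpos_Ints_nonpos[of "real i + c"] by auto
  have "(real k + (c - 1)) gchoose (k - i) = pochhammer (real i + c) (k - i) / fact (k - i)"
    unfolding gbinomial_pochhammer' using assms by (simp add: of_nat_diff algebra_simps)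
  also have "pochhammer (real i + c) (k - i) = Gamma (real k + c) / Gamma (real i + c)"
    unfolding pochhammer_Gamma[OF z] using assms by (simp add: of_nat_diff algebra_simps)
  finally have "(real k + (c - 1)) gchoose (k - i) = Gamma (real k + c) / Gamma (real i + c) / fact (k - i)" .
  moreover have "Gamma (real i + c) \<noteq> 0" by (rule less_imp_neq[symmetric], rule Gamma_real_pos) (use assms in simp)
  ultimately show ?thesis by simp
qed

text \<open>The moment of order \<open>2 * i\<close> is a multiple of
  \<open>\<alpha> i * Gamma (i + n/2)\<close>. This Gamma factor combines with the binomial in the
  Laguerre coefficient to \<open>Gamma (k + n/2) / (k - i)!\<close>, while the powers of
  \<open>- 1 / 4\<close> and the factorials \<open>i!\<close> cancel.\<close>

lemma laguerre_pairing:
  fixes u :: "'n::finite dist"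
  assumes u: "dag_data s u f g \<alpha>"
  shows "(LINT r|pow_meas (real CARD('n)). f r * of_real (laguerre k ((real CARD('n) - 2) / 2) (r\<^sup>2 / 4))) =
     of_real (real CARD('n) / 2 * 2 powr (real CARD('n) / 2) * Gamma (real k + real CARD('n) / 2)) * (\<Sum>i\<le>k. \<alpha> i / fact (k - i))"
proof -
  let ?n = "real CARD('n)"
  let ?\<nu> = "pow_meas ?n"
  have n0: "?n > 0" by simp
  define m where "m j = (LINT r|?\<nu>. f r * of_real (r ^ (2 * j)))" for j
  from u have fm [measurable]: "f \<in> borel_measurable borel" and fi: "integrable ?\<nu> (\<lambda>r. (norm (f r))\<^sup>2 * exp (r\<^sup>2 / 4))"
    and mo: "\<And>j. \<alpha> j * of_real (?n / 2 * Gamma (real j + ?n / 2)) = of_real (2 powr (- ?n / 2) * ((- 1 / 4) ^ j / fact j)) * m j"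
    unfolding dag_data_def m_def by blast+
  note i = integrable_moment'[OF n0 fm fi]
  let ?c = "\<lambda>i. (real k + (?n - 2) / 2) gchoose (k - i)"
  have L: "f r * of_real (laguerre k ((?n - 2) / 2) (r\<^sup>2 / 4)) = (\<Sum>i\<le>k. of_real (?c i * ((- 1 / 4) ^ i / fact i)) * (f r * of_real (r ^ (2 * i))))" for r
  proof -
    have "(-1) ^ i * ?c i * (r\<^sup>2 / 4) ^ i / fact i = ?c i * ((- 1 / 4) ^ i / fact i) * r ^ (2 * i)" for i
    proof -
      have "(-1) ^ i * (r\<^sup>2 / 4) ^ i = (- 1 / 4) ^ i * r ^ (2 * i)"
        unfolding power_mult power_mult_distrib[symmetric] by simp
      then show ?thesis by (simp add: mult_ac)
    qed
    then show ?thesis unfolding laguerre_def of_real_sum sum_distrib_left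
      by (intro sum.cong refl) (simp only: of_real_mult mult_ac)
  qed
  have t: "of_real (?c i * ((- 1 / 4) ^ i / fact i)) * m i = of_real (?n / 2 * 2 powr (?n / 2) * Gamma (real k + ?n / 2)) * (\<alpha> i / fact (k - i))" if "i \<le> k" for i
  proof -
    have "2 powr (?n / 2) * 2 powr (- ?n / 2) = 1" by (simp add: powr_add[symmetric])
    then have "of_real (?c i * ((- 1 / 4) ^ i / fact i)) * m i = of_real (?c i * 2 powr (?n / 2)) * (of_real (2 powr (- ?n / 2) * ((- 1 / 4) ^ i / fact i)) * m i)"
      by (simp add: mult_ac flip: of_real_mult)
    also have "\<dots> = of_real (?n / 2 * 2 powr (?n / 2)) * (\<alpha> i * of_real (?c i * Gamma (real i + ?n / 2)))"
      unfolding mo[symmetric] by (simp only: of_real_mult mult_ac)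
    also have "?c i * Gamma (real i + ?n / 2) = Gamma (real k + ?n / 2) / fact (k - i)"
    proof -
      have e: "(?n - 2) / 2 = ?n / 2 - 1" by (simp add: field_simps)
      show ?thesis unfolding e by (rule gbinomial_Gamma_shift[OF that]) simp
    qed
    finally show ?thesis by (simp add: mult_ac)
  qed
  have "(LINT r|?\<nu>. f r * of_real (laguerre k ((?n - 2) / 2) (r\<^sup>2 / 4))) = (\<Sum>i\<le>k. of_real (?c i * ((- 1 / 4) ^ i / fact i)) * m i)"
    unfolding L m_def by (subst Bochner_Integration.integral_sum) (intro integrable_mult_right i, simp only: integral_mult_right_zero)
  also have "\<dots> = (\<Sum>i\<le>k. of_real (?n / 2 * 2 powr (?n / 2) * Gamma (real k + ?n / 2)) * (\<alpha> i / fact (k - i)))"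
    by (intro sum.cong refl t) simp
  finally show ?thesis by (simp only: sum_distrib_left)
qed

text \<open>After shifting the index in the second sum, \<open>\<alpha> i\<close> carries
  \<open>i / (k - i)! + (k - i) / (k - i)! = k / (k - i)!\<close>. The summand \<open>i = k\<close>
  of the shifted sum is 0, which matches the missing term.\<close>

lemma laguerre_pairing_L_op:
  fixes u :: "'n::finite dist"
  assumes s: "s > 0" and u: "dag_data s u f g \<alpha>" and v: "dag_data s (L_op s u) F G A"
  shows "(LINT r|pow_meas (real CARD('n)). F r * of_real (laguerre k ((real CARD('n) - 2) / 2) (r\<^sup>2 / 4))) =
     of_nat k * (LINT r|pow_meas (real CARD('n)). f r * of_real (laguerre k ((real CARD('n) - 2) / 2) (r\<^sup>2 / 4)))"
proof -
  have "(\<Sum>i\<le>k. A i / fact (k - i)) = (\<Sum>i\<le>k. of_nat i * \<alpha> i / fact (k - i)) + (\<Sum>i\<le>k. (if i = 0 then 0 else \<alpha> (i - 1)) / fact (k - i))"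
    unfolding dag_data_L_op[OF s u v] add_divide_distrib sum.distrib ..
  also have "(\<Sum>i\<le>k. (if i = 0 then 0 else \<alpha> (i - 1)) / fact (k - i)) = (\<Sum>i\<le>k. of_nat (k - i) * \<alpha> i / fact (k - i))"
  proof (cases k)
    case (Suc l)
    have "(\<Sum>i\<le>k. (if i = 0 then 0 else \<alpha> (i - 1)) / fact (k - i)) = (\<Sum>i\<le>l. \<alpha> i / fact (l - i))"
      unfolding Suc by (subst sum.atMost_Suc_shift) simp
    also have "\<dots> = (\<Sum>i\<le>l. of_nat (k - i) * \<alpha> i / fact (k - i))"
    proof (intro sum.cong refl)
      fix i assume "i \<in> {..l}"
      then have k: "k - i = Suc (l - i)" using Suc by (simp add: Suc_diff_le)
      have "of_nat (Suc (l - i)) \<noteq> (0 :: complex)" by (simp only: of_nat_eq_0_iff)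
      then show "\<alpha> i / fact (l - i) = of_nat (k - i) * \<alpha> i / fact (k - i)" unfolding k fact_Suc by (simp del: of_nat_Suc)
    qed
    also have "\<dots> = (\<Sum>i\<le>k. of_nat (k - i) * \<alpha> i / fact (k - i))" unfolding Suc by simp
    finally show ?thesis .
  qed simp
  also have "(\<Sum>i\<le>k. of_nat i * \<alpha> i / fact (k - i)) + (\<Sum>i\<le>k. of_nat (k - i) * \<alpha> i / fact (k - i)) = of_nat k * (\<Sum>i\<le>k. \<alpha> i / fact (k - i))"
    unfolding sum.distrib[symmetric] sum_distrib_left
  proof (intro sum.cong refl)
    fix i assume "i \<in> {..k}"
    then have "of_nat k = of_nat i + (of_nat (k - i) :: complex)" by (simp flip: of_nat_add)
    then show "of_nat i * \<alpha> i / fact (k - i) + of_nat (k - i) * \<alpha> i / fact (k - i) = of_nat k * (\<alpha> i / fact (k - i))"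
      by (simp add: distrib_right add_divide_distrib)
  qed
  finally have "(\<Sum>i\<le>k. A i / fact (k - i)) = of_nat k * (\<Sum>i\<le>k. \<alpha> i / fact (k - i))" .
  then show ?thesis unfolding laguerre_pairing[OF u] laguerre_pairing[OF v] by (simp only: mult.left_commute)
qed

section \<open>The dual space in the variable \<open>r\<^sup>s\<close>\<close>

text \<open>\<open>W\<close> in the variable \<open>\<rho> = r^s\<close>. The indicator makes the
  composition Borel on the line, although \<open>W\<close> is only known to be measurable on
  \<open>(0, \<infinity>)\<close>.\<close>

definition rho_fun :: "real \<Rightarrow> (real \<Rightarrow> complex) \<Rightarrow> real \<Rightarrow> complex" where
  "rho_fun s W \<rho> = indicator {0<..} (\<rho> powr (1 / s)) *\<^sub>R W (\<rho> powr (1 / s))"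

definition gauss_meas :: "real \<Rightarrow> real measure" where
  "gauss_meas p = density (pow_meas p) (\<lambda>\<rho>. ennreal (exp (- (\<rho>\<^sup>2 / 4))))"

lemma sets_gauss_meas [simp, measurable_cong]: "sets (gauss_meas p) = sets borel"
  by (simp add: gauss_meas_def)

lemma AE_gauss_meas_iff: "(AE x in gauss_meas p. P x) \<longleftrightarrow> (AE x in pow_meas p. P x)"
  unfolding gauss_meas_def by (subst AE_density) auto

lemma
  fixes F :: "real \<Rightarrow> 'b :: {banach, second_countable_topology}"
  assumes [measurable]: "F \<in> borel_measurable borel"
  shows integrable_gauss_meas: "integrable (gauss_meas p) F \<longleftrightarrow> integrable (pow_meas p) (\<lambda>\<rho>. exp (- (\<rho>\<^sup>2 / 4)) *\<^sub>R F \<rho>)"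
    and integral_gauss_meas: "integral\<^sup>L (gauss_meas p) F = (LINT \<rho>|pow_meas p. exp (- (\<rho>\<^sup>2 / 4)) *\<^sub>R F \<rho>)"
  unfolding gauss_meas_def by (subst integrable_density integral_density; auto)+

lemma measurable_rho_fun:
  assumes "set_borel_measurable borel {0<..} W"
  shows "rho_fun s W \<in> borel_measurable borel"
  unfolding rho_fun_def
  by (rule measurable_compose[where f = "\<lambda>\<rho>. \<rho> powr (1 / s)" and g = "\<lambda>r. indicator {0<..} r *\<^sub>R W r"])
     (use assms in \<open>auto simp: set_borel_measurable_def\<close>)

lemma
  fixes F :: "real \<Rightarrow> 'b :: {banach, second_countable_topology}"
  assumes p: "p > 0" and s: "s > 0" and F [measurable]: "F \<in> borel_measurable borel"
  shows integrable_powr_weight: "integrable lborel (\<lambda>r. indicator {0<..} r *\<^sub>R (r powr (s * p - 1)) *\<^sub>R F (r powr s)) \<longleftrightarrow> integrable (pow_meas p) F"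
    and integral_powr_weight: "(LINT r|lborel. indicator {0<..} r *\<^sub>R (r powr (s * p - 1)) *\<^sub>R F (r powr s)) = (1 / (s * p)) *\<^sub>R integral\<^sup>L (pow_meas p) F"
proof -
  have sp: "s * p > 0" using p s by simp
  have e: "indicator {0<..} r *\<^sub>R (r powr (s * p - 1)) *\<^sub>R F (r powr s) = (1 / (s * p)) *\<^sub>R ((indicator {0<..} r * (s * p * r powr (s * p - 1))) *\<^sub>R F (r powr s))" for r
    using sp by (auto simp: indicator_def)
  have q: "s * p / s = p" using s by simp
  have m: "(\<lambda>r. F (r powr s)) \<in> borel_measurable lborel" by measurable
  have "integrable lborel (\<lambda>r. (indicator {0<..} r * (s * p * r powr (s * p - 1))) *\<^sub>R F (r powr s)) \<longleftrightarrow> integrable (pow_meas (s * p)) (\<lambda>r. F (r powr s))"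
    unfolding pow_meas_def by (subst integrable_density[OF m]) (use p s in auto)
  also have "\<dots> \<longleftrightarrow> integrable (pow_meas p) F"
    using integrable_pow_meas_powr[OF F sp _ s, of 1] q by simp
  finally have i: "integrable lborel (\<lambda>r. (indicator {0<..} r * (s * p * r powr (s * p - 1))) *\<^sub>R F (r powr s)) \<longleftrightarrow> integrable (pow_meas p) F" .
  have sc: "integrable lborel (\<lambda>r. c *\<^sub>R h r) \<longleftrightarrow> integrable lborel h" if "c \<noteq> 0" for c and h :: "real \<Rightarrow> 'b"
  proof
    assume "integrable lborel (\<lambda>r. c *\<^sub>R h r)"
    then have "integrable lborel (\<lambda>r. (1 / c) *\<^sub>R c *\<^sub>R h r)" by (rule integrable_scaleR_right)
    then show "integrable lborel h" using that by simp
  qed simp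
  show "integrable lborel (\<lambda>r. indicator {0<..} r *\<^sub>R (r powr (s * p - 1)) *\<^sub>R F (r powr s)) \<longleftrightarrow> integrable (pow_meas p) F"
    unfolding e i[symmetric] by (rule sc) (use p s in simp)
  have "(LINT r|lborel. (indicator {0<..} r * (s * p * r powr (s * p - 1))) *\<^sub>R F (r powr s)) = (LINT r|pow_meas (s * p). F (r powr s))"
    unfolding pow_meas_def by (subst integral_density[OF m]) (use p s in auto)
  also have "\<dots> = integral\<^sup>L (pow_meas p) F"
    using integral_pow_meas_powr[OF F sp _ s, of 1] q by simp
  finally show "(LINT r|lborel. indicator {0<..} r *\<^sub>R (r powr (s * p - 1)) *\<^sub>R F (r powr s)) = (1 / (s * p)) *\<^sub>R integral\<^sup>L (pow_meas p) F"
    unfolding e by (simp only: integral_scaleR_right)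
qed

lemma
  fixes F :: "real \<Rightarrow> 'b :: {banach, second_countable_topology}" and H :: "real \<Rightarrow> 'b"
  assumes n: "n > 0" and s: "s > 0" and F: "F \<in> borel_measurable borel"
    and H: "\<And>r. r > 0 \<Longrightarrow> H r = L2_weight n s r *\<^sub>R F (r powr s)"
  shows set_integrable_L2_weight: "set_integrable lborel {0<..} H \<longleftrightarrow> integrable (gauss_meas (real n)) F"
    and set_integral_L2_weight: "(LINT r:{0<..}|lborel. H r) = (1 / (s * real n)) *\<^sub>R integral\<^sup>L (gauss_meas (real n)) F"
proof -
  have n': "real n > 0" using n by simp
  have e: "indicator {0<..} r *\<^sub>R H r = indicator {0<..} r *\<^sub>R (r powr (s * real n - 1)) *\<^sub>R ((\<lambda>\<rho>. exp (- (\<rho>\<^sup>2 / 4)) *\<^sub>R F \<rho>) (r powr s))" for r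
  proof (cases "r > 0")
    case True
    have "(r powr s)\<^sup>2 = r powr (2 * s)" using True by (simp add: powr_realpow[symmetric] powr_powr mult.commute)
    then show ?thesis using True H[OF True] by (simp add: L2_weight_def)
  qed simp
  have m: "(\<lambda>\<rho>. exp (- (\<rho>\<^sup>2 / 4)) *\<^sub>R F \<rho>) \<in> borel_measurable borel" using F by measurable
  show "set_integrable lborel {0<..} H \<longleftrightarrow> integrable (gauss_meas (real n)) F"
    unfolding set_integrable_def e integrable_powr_weight[OF n' s m] integrable_gauss_meas[OF F] ..
  show "(LINT r:{0<..}|lborel. H r) = (1 / (s * real n)) *\<^sub>R integral\<^sup>L (gauss_meas (real n)) F"
    unfolding set_lebesgue_integral_def e integral_powr_weight[OF n' s m] integral_gauss_meas[OF F] ..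
qed

lemma rho_fun_powr: "s > 0 \<Longrightarrow> r > 0 \<Longrightarrow> rho_fun s W (r powr s) = W r"
  by (simp add: rho_fun_def powr_powr)

lemma weighted_L2_iff:
  assumes n: "n > 0" and s: "s > 0"
  shows "W \<in> weighted_L2 n s \<longleftrightarrow> set_borel_measurable borel {0<..} W \<and> sq_integrable (gauss_meas (real n)) (rho_fun s W)"
proof -
  have "set_integrable lborel {0<..} (\<lambda>r. (norm (W r))\<^sup>2 * L2_weight n s r) \<longleftrightarrow> integrable (gauss_meas (real n)) (\<lambda>\<rho>. (norm (rho_fun s W \<rho>))\<^sup>2)"
    if m: "set_borel_measurable borel {0<..} W"
  proof (rule set_integrable_L2_weight[OF n s])
    show "(\<lambda>\<rho>. (norm (rho_fun s W \<rho>))\<^sup>2) \<in> borel_measurable borel" using measurable_rho_fun[OF m] by measurable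
  qed (use s in \<open>simp add: rho_fun_powr\<close>)
  then show ?thesis
    using measurable_rho_fun[of W s] by (auto simp: weighted_L2_def sq_integrable_def measurable_cong_sets[OF sets_gauss_meas refl])
qed

text \<open>Multiplication by \<open>exp (\<rho>^2 / 4)\<close> takes L2 with the growing weight
  into L2 with the decaying one. The duality pairing thereby becomes a product of two elements of
  one L2 space.\<close>

lemma sq_integrable_gauss_meas_exp:
  fixes f :: "real \<Rightarrow> complex"
  assumes f [measurable]: "f \<in> borel_measurable borel"
    and i: "integrable (pow_meas p) (\<lambda>r. (norm (f r))\<^sup>2 * exp (r\<^sup>2 / 4))"
  shows "sq_integrable (gauss_meas p) (\<lambda>\<rho>. f \<rho> * of_real (exp (\<rho>\<^sup>2 / 4)))"
  unfolding sq_integrable_def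
proof
  have m: "(\<lambda>x. (norm (f x * of_real (exp (x\<^sup>2 / 4))))\<^sup>2) \<in> borel_measurable borel" by measurable
  have "exp (- (r\<^sup>2 / 4)) *\<^sub>R (norm (f r * of_real (exp (r\<^sup>2 / 4))))\<^sup>2 = (norm (f r))\<^sup>2 * exp (r\<^sup>2 / 4)" for r
    by (simp add: norm_mult power_mult_distrib power2_eq_square exp_minus)
  then show "integrable (gauss_meas p) (\<lambda>x. (norm (f x * of_real (exp (x\<^sup>2 / 4))))\<^sup>2)"
    unfolding integrable_gauss_meas[OF m] using i by simp
qed measurable

lemma measurable_dagger:
  assumes "u \<in> L2dag s"
  shows "(\<lambda>r. dagger s (u :: 'n::finite dist) \<bar>r\<bar>) \<in> borel_measurable borel"
proof -
  from assms obtain f where f: "is_dagger s u f" by (auto simp: L2dag_def)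
  have "is_dagger s u (dagger s u)" unfolding dagger_def by (rule someI[of "is_dagger s u", OF f])
  then show ?thesis by (intro measurable_radial_profile[where 'n='n]) (simp add: is_dagger_def tempered_fun_def)
qed

text \<open>The exponent in \<open>Phi_inv\<close> is such that \<open>r^{n-1}\<close> becomes
  \<open>r^{sn-1}\<close>, the density of \<open>\<rho>^{n-1} d\<rho>\<close> up to a constant. The
  remaining power of 4 cancels the prefactor \<open>2 powr (n - n / s)\<close>.\<close>

lemma Phi_star_eq:
  fixes u :: "'n::finite dist"
  assumes s: "s > 0" and u: "u \<in> L2dag s" and W: "set_borel_measurable borel {0<..} W"
    and f [measurable]: "f \<in> borel_measurable borel" and d: "AE r in pow_meas (real CARD('n)). dagger s u r = f r"
  shows "Phi_star s W u = of_real (1 / (s * real CARD('n))) * (LINT \<rho>|pow_meas (real CARD('n)). f \<rho> * rho_fun s W \<rho>)"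
proof -
  let ?n = "real CARD('n)"
  have n0: "?n > 0" by simp
  note [measurable] = measurable_rho_fun[OF W, of s] measurable_dagger[OF u]
  let ?e = "?n / 2 - ?n / (2 * s)"
  let ?F = "\<lambda>\<rho>. of_real (4 powr (- ?e)) * (dagger s u \<bar>\<rho>\<bar> * rho_fun s W \<rho>)"
  have e: "indicator {0<..} r *\<^sub>R (Phi_inv s u r * W r * of_real (r ^ (CARD('n) - 1))) = indicator {0<..} r *\<^sub>R (r powr (s * ?n - 1)) *\<^sub>R ?F (r powr s)" for r
  proof (cases "r > 0")
    case True
    have "(r powr (2 * s) / 4) powr ?e * r ^ (CARD('n) - 1) = 4 powr (- ?e) * r powr (s * ?n - 1)"
    proof -
      have "(r powr (2 * s) / 4) powr ?e = 4 powr (- ?e) * r powr (2 * s * ?e)"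
        using True by (simp add: powr_divide powr_powr powr_minus field_simps)
      moreover have "r ^ (CARD('n) - 1) = r powr (?n - 1)"
        using True by (simp add: powr_realpow[symmetric] of_nat_diff)
      moreover have "r powr (2 * s * ?e) * r powr (?n - 1) = r powr (s * ?n - 1)"
        unfolding powr_add[symmetric] using s by (intro arg_cong[where f = "\<lambda>x. r powr x"]) (simp add: field_simps)
      ultimately show ?thesis by (simp add: mult.assoc)
    qed
    then have "complex_of_real ((r powr (2 * s) / 4) powr ?e) * of_real (r ^ (CARD('n) - 1)) = of_real (4 powr (- ?e)) * of_real (r powr (s * ?n - 1))"
      by (metis of_real_mult)
    then have "Phi_inv s u r * W r * of_real (r ^ (CARD('n) - 1)) = of_real (r powr (s * ?n - 1)) * (of_real (4 powr (- ?e)) * (dagger s u (r powr s) * W r))"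
      unfolding Phi_inv_def by (simp only: mult_ac)
    then show ?thesis using True s by (simp add: rho_fun_powr scaleR_conv_of_real)
  qed simp
  have m: "?F \<in> borel_measurable borel" by measurable
  have "(LINT r:{0<..}|lborel. Phi_inv s u r * W r * of_real (r ^ (CARD('n) - 1))) = (1 / (s * ?n)) *\<^sub>R integral\<^sup>L (pow_meas ?n) ?F"
    unfolding set_lebesgue_integral_def e by (rule integral_powr_weight[OF n0 s m])
  also have "integral\<^sup>L (pow_meas ?n) ?F = of_real (4 powr (- ?e)) * (LINT \<rho>|pow_meas ?n. dagger s u \<bar>\<rho>\<bar> * rho_fun s W \<rho>)"
    by (rule integral_mult_right_zero)
  also have "(LINT \<rho>|pow_meas ?n. dagger s u \<bar>\<rho>\<bar> * rho_fun s W \<rho>) = (LINT \<rho>|pow_meas ?n. f \<rho> * rho_fun s W \<rho>)"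
  proof (rule integral_cong_AE)
    show "AE \<rho> in pow_meas ?n. dagger s u \<bar>\<rho>\<bar> * rho_fun s W \<rho> = f \<rho> * rho_fun s W \<rho>"
      using d AE_pow_meas_pos[OF n0] by eventually_elim simp
  qed measurable
  finally have "Phi_star s W u = of_real (2 powr (?n - ?n / s)) * ((1 / (s * ?n)) *\<^sub>R (of_real (4 powr (- ?e)) * (LINT \<rho>|pow_meas ?n. f \<rho> * rho_fun s W \<rho>)))"
    using u by (simp add: Phi_star_def)
  also have "\<dots> = of_real (2 powr (?n - ?n / s) * 4 powr (- ?e)) * (of_real (1 / (s * ?n)) * (LINT \<rho>|pow_meas ?n. f \<rho> * rho_fun s W \<rho>))"
    by (simp only: scaleR_conv_of_real of_real_mult mult_ac)
  also have "2 powr (?n - ?n / s) * 4 powr (- ?e) = 1"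
  proof -
    have "4 powr (- ?e) = (2 powr 2) powr (- ?e)" by simp
    also have "2 * (- ?e) = - (?n - ?n / s)" using s by (simp add: field_simps)
    then have "(2 powr 2) powr (- ?e) = 2 powr (- (?n - ?n / s))" by (simp only: powr_powr)
    finally have q: "4 powr (- ?e) = 2 powr (- (?n - ?n / s))" .
    show ?thesis unfolding q powr_add[symmetric] by simp
  qed
  finally show ?thesis by simp
qed

lemma Phi_star_eq_gauss_meas:
  fixes u :: "'n::finite dist"
  assumes s: "s > 0" and u: "u \<in> L2dag s" and W: "W \<in> weighted_L2 CARD('n) s" and ud: "dag_data s u f g \<alpha>"
  shows "integrable (gauss_meas (real CARD('n))) (\<lambda>\<rho>. (f \<rho> * of_real (exp (\<rho>\<^sup>2 / 4))) * rho_fun s W \<rho>)"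
    and "Phi_star s W u = of_real (1 / (s * real CARD('n))) * (LINT \<rho>|gauss_meas (real CARD('n)). (f \<rho> * of_real (exp (\<rho>\<^sup>2 / 4))) * rho_fun s W \<rho>)"
proof -
  have n: "CARD('n) > 0" by simp
  from ud have f [measurable]: "f \<in> borel_measurable borel" and d: "AE r in pow_meas (real CARD('n)). dagger s u r = f r"
    and i: "integrable (pow_meas (real CARD('n))) (\<lambda>r. (norm (f r))\<^sup>2 * exp (r\<^sup>2 / 4))" unfolding dag_data_def by blast+
  from W have Wm: "set_borel_measurable borel {0<..} W" and Ws: "sq_integrable (gauss_meas (real CARD('n))) (rho_fun s W)"
    unfolding weighted_L2_iff[OF n s] by blast+
  note [measurable] = measurable_rho_fun[OF Wm, of s]
  show "integrable (gauss_meas (real CARD('n))) (\<lambda>\<rho>. (f \<rho> * of_real (exp (\<rho>\<^sup>2 / 4))) * rho_fun s W \<rho>)"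
    by (rule integrable_mult_sq_integrable[OF sq_integrable_gauss_meas_exp[OF f i] Ws])
  have m: "(\<lambda>\<rho>. (f \<rho> * of_real (exp (\<rho>\<^sup>2 / 4))) * rho_fun s W \<rho>) \<in> borel_measurable borel" by measurable
  have "exp (- (\<rho>\<^sup>2 / 4)) *\<^sub>R ((f \<rho> * of_real (exp (\<rho>\<^sup>2 / 4))) * rho_fun s W \<rho>) = f \<rho> * rho_fun s W \<rho>" for \<rho>
    by (simp add: scaleR_conv_of_real exp_minus field_simps)
  then show "Phi_star s W u = of_real (1 / (s * real CARD('n))) * (LINT \<rho>|gauss_meas (real CARD('n)). (f \<rho> * of_real (exp (\<rho>\<^sup>2 / 4))) * rho_fun s W \<rho>)"
    unfolding Phi_star_eq[OF s u Wm f d] integral_gauss_meas[OF m] by simp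
qed

section \<open>Linearity and injectivity of \<open>Phi_star\<close>, and the scalar product of the
  dual space\<close>

lemma rho_fun_lincomb: "rho_fun s (\<lambda>r. a * W r + b * V r) = (\<lambda>\<rho>. a * rho_fun s W \<rho> + b * rho_fun s V \<rho>)"
  by (simp add: rho_fun_def fun_eq_iff scaleR_add_right)

lemma weighted_L2_lincomb:
  assumes n: "n > 0" and s: "s > 0" and W: "W \<in> weighted_L2 n s" and V: "V \<in> weighted_L2 n s"
  shows "(\<lambda>r. a * W r + b * V r) \<in> weighted_L2 n s"
proof -
  have e: "indicator {0<..} r *\<^sub>R (a * W r + b * V r) = a * (indicator {0<..} r *\<^sub>R W r) + b * (indicator {0<..} r *\<^sub>R V r)" for r :: real
    by (simp add: scaleR_add_right)
  have "set_borel_measurable borel {0<..} (\<lambda>r. a * W r + b * V r)"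
    using W V unfolding weighted_L2_iff[OF n s] set_borel_measurable_def e
    by (intro borel_measurable_add borel_measurable_times borel_measurable_const) blast+
  then show ?thesis using W V unfolding weighted_L2_iff[OF n s] rho_fun_lincomb by (auto intro: sq_integrable_lincomb)
qed

lemma Phi_star_lincomb:
  fixes u :: "'n::finite dist"
  assumes s: "s > 0" and W: "W \<in> weighted_L2 CARD('n) s" and V: "V \<in> weighted_L2 CARD('n) s"
  shows "Phi_star s (\<lambda>r. a * W r + b * V r) u = a * Phi_star s W u + b * Phi_star s V u"
proof (cases "u \<in> L2dag s")
  case True
  obtain f g \<alpha> where ud: "dag_data s u f g \<alpha>" using L2dag_data[OF s True] by blast
  have n: "CARD('n) > 0" by simp
  note P = Phi_star_eq_gauss_meas[OF s True _ ud]
  let ?f = "\<lambda>\<rho>. f \<rho> * of_real (exp (\<rho>\<^sup>2 / 4))"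
  have "(LINT \<rho>|gauss_meas (real CARD('n)). ?f \<rho> * rho_fun s (\<lambda>r. a * W r + b * V r) \<rho>) =
     (LINT \<rho>|gauss_meas (real CARD('n)). a * (?f \<rho> * rho_fun s W \<rho>) + b * (?f \<rho> * rho_fun s V \<rho>))"
    unfolding rho_fun_lincomb by (simp only: distrib_left mult_ac)
  also have "\<dots> = a * (LINT \<rho>|gauss_meas (real CARD('n)). ?f \<rho> * rho_fun s W \<rho>) + b * (LINT \<rho>|gauss_meas (real CARD('n)). ?f \<rho> * rho_fun s V \<rho>)"
    by (intro has_bochner_integral_integral_eq has_bochner_integral_add has_bochner_integral_mult_right has_bochner_integral_integrable P(1) W V)
  finally show ?thesis
    unfolding P(2)[OF weighted_L2_lincomb[OF n s W V]] P(2)[OF W] P(2)[OF V] by (simp add: algebra_simps)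
next
  case False
  then show ?thesis by (simp add: Phi_star_def)
qed

lemma Phi_star_cong_AE:
  assumes s: "s > 0" and W: "W \<in> weighted_L2 CARD('n) s" and V: "V \<in> weighted_L2 CARD('n) s"
    and ae: "AE \<rho> in gauss_meas (real CARD('n)). rho_fun s W \<rho> = rho_fun s V \<rho>"
  shows "Phi_star s W = (Phi_star s V :: 'n::finite dist \<Rightarrow> complex)"
proof
  fix u :: "'n dist"
  show "Phi_star s W u = Phi_star s V u"
  proof (cases "u \<in> L2dag s")
    case True
    obtain f g \<alpha> where ud: "dag_data s u f g \<alpha>" using L2dag_data[OF s True] by blast
    note P = Phi_star_eq_gauss_meas[OF s True _ ud]
    have "(LINT \<rho>|gauss_meas (real CARD('n)). (f \<rho> * of_real (exp (\<rho>\<^sup>2 / 4))) * rho_fun s W \<rho>) =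
       (LINT \<rho>|gauss_meas (real CARD('n)). (f \<rho> * of_real (exp (\<rho>\<^sup>2 / 4))) * rho_fun s V \<rho>)"
      by (rule integral_cong_AE[OF borel_measurable_integrable[OF P(1)[OF W]] borel_measurable_integrable[OF P(1)[OF V]]])
         (use ae in \<open>eventually_elim, simp\<close>)
    then show ?thesis unfolding P(2)[OF W] P(2)[OF V] by simp
  qed (simp add: Phi_star_def)
qed

lemma finite_gauss_meas: "p > 0 \<Longrightarrow> sq_integrable (gauss_meas p) (\<lambda>\<rho>. 1)"
proof -
  assume p: "p > 0"
  have "integrable (pow_meas p) (\<lambda>r. r powr 0 * exp (- (1 / 4 * r\<^sup>2)))" by (rule integrable_pow_meas_gauss) (use p in auto)
  moreover have "AE r in pow_meas p. r powr 0 * exp (- (1 / 4 * r\<^sup>2)) = exp (- (r\<^sup>2 / 4)) *\<^sub>R 1"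
    using AE_pow_meas_pos[OF p] by eventually_elim simp
  ultimately have "integrable (pow_meas p) (\<lambda>r. exp (- (r\<^sup>2 / 4)) *\<^sub>R (1::real))"
    by (subst (asm) integrable_cong_AE) auto
  then have "integrable (gauss_meas p) (\<lambda>r. 1::real)" by (subst integrable_gauss_meas) auto
  then show ?thesis by (simp add: sq_integrable_def)
qed

text \<open>The elements of \<open>dom_L\<close> with Gaussian \<open>u\<^sup>\<dagger>\<close> separate the functionals.\<close>

lemma Phi_star_inj_AE:
  assumes s: "s > 0" and W: "W \<in> weighted_L2 CARD('n) s" and V: "V \<in> weighted_L2 CARD('n) s"
    and eq: "\<And>u :: 'n::finite dist. u \<in> dom_L s \<Longrightarrow> Phi_star s W u = Phi_star s V u"
  shows "AE \<rho> in gauss_meas (real CARD('n)). rho_fun s W \<rho> = rho_fun s V \<rho>"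
proof -
  let ?n = "real CARD('n)"
  let ?\<mu> = "gauss_meas ?n"
  have n: "CARD('n) > 0" and n0: "?n > 0" by simp_all
  from W V have Wm: "set_borel_measurable borel {0<..} W" and Vm: "set_borel_measurable borel {0<..} V"
    and sq: "sq_integrable ?\<mu> (rho_fun s W)" "sq_integrable ?\<mu> (rho_fun s V)"
    unfolding weighted_L2_iff[OF n s] by blast+
  note [measurable] = measurable_rho_fun[OF Wm, of s] measurable_rho_fun[OF Vm, of s]
  let ?G = "\<lambda>\<rho>. rho_fun s W \<rho> - rho_fun s V \<rho>"
  have iW: "integrable ?\<mu> (rho_fun s W)" using integrable_mult_sq_integrable[OF finite_gauss_meas[OF n0] sq(1)] by simp
  have iV: "integrable ?\<mu> (rho_fun s V)" using integrable_mult_sq_integrable[OF finite_gauss_meas[OF n0] sq(2)] by simp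
  have exi: "integrable ?\<mu> (\<lambda>\<rho>. H \<rho> * of_real (exp (- (1 * \<rho>\<^sup>2)) ^ j))" if "integrable ?\<mu> H" for H :: "real \<Rightarrow> complex" and j
  proof (rule Bochner_Integration.integrable_bound[OF that])
    show "AE \<rho> in ?\<mu>. norm (H \<rho> * of_real (exp (- (1 * \<rho>\<^sup>2)) ^ j)) \<le> norm (H \<rho>)"
      by (intro AE_I2) (simp add: norm_mult norm_power mult_left_le power_le_one)
    show "(\<lambda>\<rho>. H \<rho> * of_real (exp (- (1 * \<rho>\<^sup>2)) ^ j)) \<in> borel_measurable ?\<mu>" using that by measurable
  qed
  have "AE \<rho> in ?\<mu>. ?G \<rho> = 0"
  proof (rule integral_gaussian_powers_zero_imp_AE[where c = 1])
    show "integrable ?\<mu> ?G" using iW iV by simp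
    show "AE \<rho> in ?\<mu>. 0 < \<rho>" unfolding AE_gauss_meas_iff by (rule AE_pow_meas_pos[OF n0])
    fix j :: nat
    \<comment> \<open>With this \<open>b\<close> the exponent \<open>1 / (4 * b)\<close> equals
      \<open>1 / 4 + j\<close>: the first part is the density of \<open>gauss_meas\<close>, the
      second the \<open>j\<close>-th power of \<open>exp (- \<rho>^2)\<close>. Moreover
      \<open>0 < b \<le> 1\<close>, inside the admissible range \<open>b < 2\<close>.\<close>
    define b where "b = 1 / (1 + 4 * real j)"
    have b: "0 < b" "b < 2" by (auto simp: b_def field_simps)
    let ?u = "inv_fourier_dist (\<lambda>\<xi>::real^'n. stretched_exp b (2 * s) (norm \<xi>))"
    have u: "?u \<in> dom_L s" by (rule stretched_exp_dom_L[OF s b])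
    then have uL: "?u \<in> L2dag s" by (simp add: dom_L_def)
    have dm: "dual_gauss CARD('n) b \<in> borel_measurable borel" unfolding dual_gauss_def[abs_def] by measurable
    have d1: "is_dagger s ?u (dual_gauss CARD('n) b)" by (rule is_dagger_stretched_exp[OF s b])
    have "is_dagger s ?u (dagger s ?u)" unfolding dagger_def by (rule someI[of "is_dagger s ?u", OF d1])
    from is_dagger_unique[OF s this d1] have d: "AE r in pow_meas ?n. dagger s ?u r = dual_gauss CARD('n) b r" .
    define c where "c = complex_of_real (1 / (s * ?n)) * of_real ((2 * b) powr (- ?n / 2))"
    have c: "c \<noteq> 0" using s b by (simp add: c_def)
    have P: "Phi_star s X ?u = c * (LINT \<rho>|?\<mu>. rho_fun s X \<rho> * of_real (exp (- (1 * \<rho>\<^sup>2)) ^ j))" if X: "set_borel_measurable borel {0<..} X" for X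
    proof -
      note [measurable] = measurable_rho_fun[OF X, of s]
      have m: "(\<lambda>\<rho>. rho_fun s X \<rho> * of_real (exp (- (1 * \<rho>\<^sup>2)) ^ j)) \<in> borel_measurable borel" by measurable
      have "dual_gauss CARD('n) b \<rho> * rho_fun s X \<rho> = of_real ((2 * b) powr (- ?n / 2)) * (exp (- (\<rho>\<^sup>2 / 4)) *\<^sub>R (rho_fun s X \<rho> * of_real (exp (- (1 * \<rho>\<^sup>2)) ^ j)))" for \<rho>
      proof -
        have "1 / (4 * b) * \<rho>\<^sup>2 = \<rho>\<^sup>2 / 4 + real j * \<rho>\<^sup>2" by (simp add: b_def field_simps)
        then have "exp (- (1 / (4 * b) * \<rho>\<^sup>2)) = exp (- (\<rho>\<^sup>2 / 4)) * exp (- (1 * \<rho>\<^sup>2)) ^ j"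
          by (simp add: exp_add[symmetric] exp_of_nat_mult[symmetric])
        then show ?thesis unfolding dual_gauss_def scaleR_conv_of_real by (simp only: of_real_mult mult_ac)
      qed
      then show ?thesis unfolding Phi_star_eq[OF s uL X dm d] integral_gauss_meas[OF m] c_def by (simp only: integral_mult_right_zero mult.assoc)
    qed
    from eq[OF u] have "(LINT \<rho>|?\<mu>. rho_fun s W \<rho> * of_real (exp (- (1 * \<rho>\<^sup>2)) ^ j)) = (LINT \<rho>|?\<mu>. rho_fun s V \<rho> * of_real (exp (- (1 * \<rho>\<^sup>2)) ^ j))"
      unfolding P[OF Wm] P[OF Vm] using c by simp
    then show "(LINT \<rho>|?\<mu>. ?G \<rho> * of_real (exp (- (1 * \<rho>\<^sup>2)) ^ j)) = 0"
      unfolding left_diff_distrib Bochner_Integration.integral_diff[OF exi[OF iW] exi[OF iV]] by simp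
  qed auto
  then show ?thesis by eventually_elim simp
qed

text \<open>The representative chosen in \<open>Phi_star_inv\<close> may differ from
  \<open>W\<close>, but only on a null set by injectivity. Hence \<open>inner_ddag\<close> can be
  computed from any representative.\<close>

lemma Phi_star_inv_AE:
  assumes s: "s > 0" and W: "W \<in> weighted_L2 CARD('n) s"
  defines "V \<equiv> Phi_star_inv s (Phi_star s W :: 'n::finite dist \<Rightarrow> complex)"
  shows "V \<in> weighted_L2 CARD('n) s" and "AE \<rho> in gauss_meas (real CARD('n)). rho_fun s V \<rho> = rho_fun s W \<rho>"
proof -
  have "V \<in> weighted_L2 CARD('n) s \<and> Phi_star s V = (Phi_star s W :: 'n dist \<Rightarrow> complex)"
    unfolding V_def Phi_star_inv_def by (rule someI[of _ W]) (use W in simp)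
  then have V: "V \<in> weighted_L2 CARD('n) s" "Phi_star s V = (Phi_star s W :: 'n dist \<Rightarrow> complex)" by auto
  show "V \<in> weighted_L2 CARD('n) s" by (rule V)
  show "AE \<rho> in gauss_meas (real CARD('n)). rho_fun s V \<rho> = rho_fun s W \<rho>"
    by (rule Phi_star_inj_AE[OF s V(1) W]) (simp only: V(2))
qed

lemma inner_ddag_Phi_star:
  assumes s: "s > 0" and W: "W \<in> weighted_L2 CARD('n) s" and V: "V \<in> weighted_L2 CARD('n) s"
  shows "inner_ddag s (Phi_star s W) (Phi_star s V :: 'n::finite dist \<Rightarrow> complex) =
     of_real (1 / (s * real CARD('n))) * (LINT \<rho>|gauss_meas (real CARD('n)). rho_fun s W \<rho> * cnj (rho_fun s V \<rho>))"
proof -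
  let ?W = "Phi_star_inv s (Phi_star s W :: 'n dist \<Rightarrow> complex)" and ?V = "Phi_star_inv s (Phi_star s V :: 'n dist \<Rightarrow> complex)"
  have n: "CARD('n) > 0" by simp
  note W' = Phi_star_inv_AE[OF s W] and V' = Phi_star_inv_AE[OF s V]
  have m: "rho_fun s W \<in> borel_measurable borel" "rho_fun s V \<in> borel_measurable borel"
     "rho_fun s ?W \<in> borel_measurable borel" "rho_fun s ?V \<in> borel_measurable borel"
    using W V W'(1) V'(1) unfolding weighted_L2_iff[OF n s] by (auto intro: measurable_rho_fun)
  note [measurable] = m
  let ?F = "\<lambda>\<rho>. rho_fun s ?W \<rho> * cnj (rho_fun s ?V \<rho>)"
  have cm [measurable]: "cnj \<in> borel_measurable borel" by (intro borel_measurable_continuous_onI continuous_intros)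
  have Fm: "?F \<in> borel_measurable borel" by measurable
  have "inner_ddag s (Phi_star s W) (Phi_star s V :: 'n dist \<Rightarrow> complex) = (1 / (s * real CARD('n))) *\<^sub>R integral\<^sup>L (gauss_meas (real CARD('n))) ?F"
    unfolding inner_ddag_def
    by (rule set_integral_L2_weight[OF n s Fm]) (simp add: rho_fun_powr[OF s] scaleR_conv_of_real mult.commute)
  also have "integral\<^sup>L (gauss_meas (real CARD('n))) ?F = (LINT \<rho>|gauss_meas (real CARD('n)). rho_fun s W \<rho> * cnj (rho_fun s V \<rho>))"
  proof (rule integral_cong_AE)
    show "AE \<rho> in gauss_meas (real CARD('n)). ?F \<rho> = rho_fun s W \<rho> * cnj (rho_fun s V \<rho>)"
      using W'(2) V'(2) by eventually_elim simp
  qed measurable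
  finally show ?thesis by (simp only: scaleR_conv_of_real)
qed

section \<open>Laguerre polynomials\<close>

text \<open>Pascal's rule writes the alternating sum as one of order \<open>k\<close> over first
  differences, and a first difference in the base point lowers the length of the Pochhammer symbol
  by one.\<close>

lemma alternating_sum_pochhammer_Suc:
  fixes c :: real
  shows "(\<Sum>i\<le>Suc k. (-1) ^ i * real (Suc k choose i) * pochhammer (c + real i) (Suc m)) =
     - real (Suc m) * (\<Sum>i\<le>k. (-1) ^ i * real (k choose i) * pochhammer (c + 1 + real i) m)"
proof -
  let ?f = "\<lambda>i. pochhammer (c + real i) (Suc m)"
  have d: "?f i - ?f (Suc i) = - real (Suc m) * pochhammer (c + 1 + real i) m" for i
  proof -
    have "?f i = (c + real i) * pochhammer (c + real i + 1) m" by (rule pochhammer_rec)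
    moreover have "?f (Suc i) = pochhammer (c + real i + 1) m * (c + real i + 1 + real m)"
      by (simp add: pochhammer_Suc add_ac)
    ultimately show ?thesis by (simp add: algebra_simps)
  qed
  have "(\<Sum>i\<le>Suc k. (-1) ^ i * real (Suc k choose i) * ?f i) =
      ?f 0 + (\<Sum>i\<le>k. (-1) ^ Suc i * real (k choose Suc i) * ?f (Suc i)) - (\<Sum>i\<le>k. (-1) ^ i * real (k choose i) * ?f (Suc i))"
    unfolding sum.atMost_Suc_shift add_diff_eq[symmetric] sum_subtractf[symmetric]
    by (intro arg_cong2[where f = "(+)"] sum.cong refl) (simp_all add: algebra_simps)
  also have "?f 0 + (\<Sum>i\<le>k. (-1) ^ Suc i * real (k choose Suc i) * ?f (Suc i)) = (\<Sum>i\<le>Suc k. (-1) ^ i * real (k choose i) * ?f i)"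
    by (subst sum.atMost_Suc_shift) simp
  also have "\<dots> = (\<Sum>i\<le>k. (-1) ^ i * real (k choose i) * ?f i)" by simp
  also have "\<dots> - (\<Sum>i\<le>k. (-1) ^ i * real (k choose i) * ?f (Suc i)) = (\<Sum>i\<le>k. (-1) ^ i * real (k choose i) * (?f i - ?f (Suc i)))"
    by (simp only: sum_subtractf right_diff_distrib)
  also have "\<dots> = - real (Suc m) * (\<Sum>i\<le>k. (-1) ^ i * real (k choose i) * pochhammer (c + 1 + real i) m)"
    unfolding d sum_distrib_left by (simp only: mult_ac)
  finally show ?thesis .
qed

text \<open>A \<open>k\<close>-th finite difference of a monic polynomial of degree
  \<open>m \<le> k\<close> in \<open>i\<close>: zero below degree \<open>k\<close>, and
  \<open>fact k\<close> up to sign in degree \<open>k\<close>.\<close>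

lemma alternating_sum_pochhammer:
  fixes c :: real
  assumes "m \<le> k"
  shows "(\<Sum>i\<le>k. (-1) ^ i * real (k choose i) * pochhammer (c + real i) m) = (if m = k then (-1) ^ k * fact k else 0)"
  using assms
proof (induction m arbitrary: k c)
  case 0
  have "(\<Sum>i\<le>k. (-1) ^ i * real (k choose i)) = 0" if "k > 0"
    using choose_alternating_sum[OF that, where 'a = real] by simp
  then show ?case by (cases k) simp_all
next
  case (Suc m)
  then obtain k' where k: "k = Suc k'" "m \<le> k'" by (cases k) auto
  show ?case unfolding k(1) alternating_sum_pochhammer_Suc Suc.IH[OF k(2)] by (auto simp: algebra_simps)
qed

lemma
  assumes p: "p > 0"
  shows integrable_gauss_meas_power: "integrable (gauss_meas p) (\<lambda>\<rho>. (\<rho>\<^sup>2 / 4) ^ m)"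
    and integral_gauss_meas_power: "(LINT \<rho>|gauss_meas p. (\<rho>\<^sup>2 / 4) ^ m) = p / 2 * 4 powr (p / 2) * Gamma (real m + p / 2)"
proof -
  have meas: "(\<lambda>\<rho>::real. (\<rho>\<^sup>2 / 4) ^ m) \<in> borel_measurable borel" by measurable
  let ?g = "\<lambda>\<rho>::real. (1 / 4) ^ m * (\<rho> powr (2 * real m) * exp (- (1 / 4 * \<rho>\<^sup>2)))"
  have e: "exp (- (\<rho>\<^sup>2 / 4)) *\<^sub>R (\<rho>\<^sup>2 / 4) ^ m = ?g \<rho>" if "\<rho> > 0" for \<rho> :: real
  proof -
    have "\<rho> powr (2 * real m) = (\<rho>\<^sup>2) ^ m"
      using that powr_realpow[OF that, of "2 * m"] by (simp add: power_mult)
    then show ?thesis by (simp add: power_divide)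
  qed
  have ae: "AE \<rho> in pow_meas p. exp (- (\<rho>\<^sup>2 / 4)) *\<^sub>R (\<rho>\<^sup>2 / 4) ^ m = ?g \<rho>"
    using AE_pow_meas_pos[OF p] by eventually_elim (rule e)
  have g: "integrable (pow_meas p) ?g"
    by (intro integrable_mult_right integrable_pow_meas_gauss) (use p in auto)
  show "integrable (gauss_meas p) (\<lambda>\<rho>. (\<rho>\<^sup>2 / 4) ^ m)"
    unfolding integrable_gauss_meas[OF meas] by (subst integrable_cong_AE[OF _ _ ae]) (use g in auto)
  have "(LINT \<rho>|gauss_meas p. (\<rho>\<^sup>2 / 4) ^ m) = integral\<^sup>L (pow_meas p) ?g"
    unfolding integral_gauss_meas[OF meas] by (rule integral_cong_AE[OF _ _ ae]) auto
  also have "\<dots> = (1 / 4) ^ m * (p / 2 * Gamma ((2 * real m + p) / 2) * (1 / 4) powr (- (2 * real m + p) / 2))"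
    using p by (subst integral_mult_right_zero, subst integral_pow_meas_gauss) auto
  also have "(2 * real m + p) / 2 = real m + p / 2" by (simp add: field_simps)
  also have "(1 / 4 :: real) powr (- (2 * real m + p) / 2) = 4 ^ m * 4 powr (p / 2)"
  proof -
    have "(1 / 4 :: real) powr (- (2 * real m + p) / 2) = 4 powr (real m + p / 2)"
      unfolding powr_divide powr_one_eq_one powr_minus_divide[symmetric]
      by (rule arg_cong[where f = "\<lambda>e. 4 powr e"]) (simp add: field_simps)
    then show ?thesis by (simp add: powr_add powr_realpow)
  qed
  finally show "(LINT \<rho>|gauss_meas p. (\<rho>\<^sup>2 / 4) ^ m) = p / 2 * 4 powr (p / 2) * Gamma (real m + p / 2)"
    by (simp add: power_divide)
qed

text \<open>Term by term the moments give \<open>Gamma (m + i + p/2)\<close>. Dividing out the Gamma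
  factor of the Laguerre coefficient leaves a Pochhammer symbol of length \<open>m\<close>, so
  orthogonality to lower powers is the vanishing of a finite difference.\<close>

lemma
  assumes p: "p > 0"
  shows integrable_power_laguerre: "integrable (gauss_meas p) (\<lambda>\<rho>. (\<rho>\<^sup>2 / 4) ^ m * laguerre k ((p - 2) / 2) (\<rho>\<^sup>2 / 4))"
    and integral_power_laguerre: "m \<le> k \<Longrightarrow> (LINT \<rho>|gauss_meas p. (\<rho>\<^sup>2 / 4) ^ m * laguerre k ((p - 2) / 2) (\<rho>\<^sup>2 / 4)) =
       (if m = k then (-1) ^ k * (p / 2 * 4 powr (p / 2) * Gamma (real k + p / 2)) else 0)"
proof -
  define c where "c = p / 2"
  have c: "c > 0" "(p - 2) / 2 = c - 1" using p by (auto simp: c_def field_simps)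
  let ?a = "\<lambda>i. (-1) ^ i * ((real k + (c - 1)) gchoose (k - i)) / fact i"
  have e: "(\<rho>\<^sup>2 / 4) ^ m * laguerre k ((p - 2) / 2) (\<rho>\<^sup>2 / 4) = (\<Sum>i\<le>k. ?a i * (\<rho>\<^sup>2 / 4) ^ (m + i))" for \<rho> :: real
    unfolding laguerre_def c sum_distrib_left by (intro sum.cong) (auto simp: power_add)
  show "integrable (gauss_meas p) (\<lambda>\<rho>. (\<rho>\<^sup>2 / 4) ^ m * laguerre k ((p - 2) / 2) (\<rho>\<^sup>2 / 4))"
    unfolding e by (intro Bochner_Integration.integrable_sum integrable_mult_right integrable_gauss_meas_power p)
  assume m: "m \<le> k"
  have "(LINT \<rho>|gauss_meas p. (\<rho>\<^sup>2 / 4) ^ m * laguerre k ((p - 2) / 2) (\<rho>\<^sup>2 / 4)) = (\<Sum>i\<le>k. ?a i * (c * 4 powr c * Gamma (real (m + i) + c)))"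
    unfolding e
    by (subst Bochner_Integration.integral_sum)
       (simp_all only: integrable_mult_right integrable_gauss_meas_power[OF p] integral_mult_right_zero integral_gauss_meas_power[OF p] c_def)
  also have "\<dots> = (\<Sum>i\<le>k. c * 4 powr c * Gamma (real k + c) / fact k * ((-1) ^ i * real (k choose i) * pochhammer (c + real i) m))"
  proof (intro sum.cong refl)
    fix i assume "i \<in> {..k}"
    then have i: "i \<le> k" by simp
    have "c + real i > 0" using c by simp
    then have "c + real i \<notin> \<int>\<^sub>\<le>\<^sub>0" using nonpos_Ints_nonpos[of "c + real i"] by auto
    then have "Gamma (real (m + i) + c) = pochhammer (c + real i) m * Gamma (real i + c)"
      using Gamma_eq_zero_iff[of "c + real i"] by (simp add: pochhammer_Gamma add_ac)
    then have "?a i * (c * 4 powr c * Gamma (real (m + i) + c)) =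
       (-1) ^ i / fact i * (c * 4 powr c) * pochhammer (c + real i) m * (((real k + (c - 1)) gchoose (k - i)) * Gamma (real i + c))"
      by simp
    also have "\<dots> = (-1) ^ i / fact i * (c * 4 powr c) * pochhammer (c + real i) m * (Gamma (real k + c) / fact (k - i))"
      unfolding gbinomial_Gamma_shift[OF i c(1)] ..
    also have "\<dots> = c * 4 powr c * Gamma (real k + c) / fact k * ((-1) ^ i * real (k choose i) * pochhammer (c + real i) m)"
      unfolding binomial_fact[OF i] by simp
    finally show "?a i * (c * 4 powr c * Gamma (real (m + i) + c)) = c * 4 powr c * Gamma (real k + c) / fact k * ((-1) ^ i * real (k choose i) * pochhammer (c + real i) m)" .
  qed
  also have "\<dots> = c * 4 powr c * Gamma (real k + c) / fact k * (if m = k then (-1) ^ k * fact k else 0)"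
    unfolding sum_distrib_left[symmetric] alternating_sum_pochhammer[OF m] ..
  finally show "(LINT \<rho>|gauss_meas p. (\<rho>\<^sup>2 / 4) ^ m * laguerre k ((p - 2) / 2) (\<rho>\<^sup>2 / 4)) =
       (if m = k then (-1) ^ k * (p / 2 * 4 powr (p / 2) * Gamma (real k + p / 2)) else 0)"
    by (simp add: c_def)
qed

text \<open>The factor of lower degree is expanded in powers. All but the leading power are
  orthogonal to the other factor, and for \<open>j = k\<close> the leading coefficient
  \<open>(-1) ^ k / fact k\<close> restores the positive sign.\<close>

lemma integral_laguerre_laguerre:
  assumes p: "p > 0"
  shows "(LINT \<rho>|gauss_meas p. laguerre j ((p - 2) / 2) (\<rho>\<^sup>2 / 4) * laguerre k ((p - 2) / 2) (\<rho>\<^sup>2 / 4)) =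
    (if j = k then p / 2 * 4 powr (p / 2) * Gamma (real k + p / 2) / fact k else 0)"
proof -
  have *: "(LINT \<rho>|gauss_meas p. laguerre j ((p - 2) / 2) (\<rho>\<^sup>2 / 4) * laguerre k ((p - 2) / 2) (\<rho>\<^sup>2 / 4)) =
    (if j = k then p / 2 * 4 powr (p / 2) * Gamma (real k + p / 2) / fact k else 0)" if jk: "j \<le> k" for j k
  proof -
    let ?a = "\<lambda>i. (-1) ^ i * ((real j + (p - 2) / 2) gchoose (j - i)) / fact i"
    let ?I = "\<lambda>i \<rho>. (\<rho>\<^sup>2 / 4) ^ i * laguerre k ((p - 2) / 2) (\<rho>\<^sup>2 / 4)"
    have e: "laguerre j ((p - 2) / 2) (\<rho>\<^sup>2 / 4) * laguerre k ((p - 2) / 2) (\<rho>\<^sup>2 / 4) = (\<Sum>i\<le>j. ?a i * ?I i \<rho>)" for \<rho> :: real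
      unfolding laguerre_def[of j] sum_distrib_right by (intro sum.cong) auto
    have "(LINT \<rho>|gauss_meas p. laguerre j ((p - 2) / 2) (\<rho>\<^sup>2 / 4) * laguerre k ((p - 2) / 2) (\<rho>\<^sup>2 / 4)) = (\<Sum>i\<le>j. ?a i * (LINT \<rho>|gauss_meas p. ?I i \<rho>))"
      unfolding e
      by (subst Bochner_Integration.integral_sum)
         (simp_all only: integrable_mult_right integrable_power_laguerre[OF p] integral_mult_right_zero)
    also have "\<dots> = (\<Sum>i\<le>j. if i = k then ?a i * ((-1) ^ k * (p / 2 * 4 powr (p / 2) * Gamma (real k + p / 2))) else 0)"
      using jk by (intro sum.cong refl) (simp add: integral_power_laguerre[OF p])
    also have "\<dots> = (if j = k then p / 2 * 4 powr (p / 2) * Gamma (real k + p / 2) / fact k else 0)"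
      using jk by (auto simp: sum.delta field_simps power2_eq_square[symmetric] power_mult[symmetric] simp flip: power_add)
    finally show ?thesis .
  qed
  show ?thesis
  proof (cases "j \<le> k")
    case True
    then show ?thesis by (rule *)
  next
    case False
    then show ?thesis using *[of k j] by (simp add: mult.commute)
  qed
qed

text \<open>A polynomial in \<open>\<rho>^2\<close>, not in \<open>\<rho>^2 / 4\<close>, to match
  \<open>poly_weight\<close> and the density theorem; hence the factors
  \<open>4 ^ i\<close>.\<close>

definition laguerre_poly :: "nat \<Rightarrow> real \<Rightarrow> complex poly" where
  "laguerre_poly k a = (\<Sum>i\<le>k. monom (of_real ((-1) ^ i * ((real k + a) gchoose (k - i)) / (4 ^ i * fact i))) i)"

lemma poly_laguerre_poly: "poly (laguerre_poly k a) (of_real x) = of_real (laguerre k a (x / 4))"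
  unfolding laguerre_poly_def laguerre_def poly_sum poly_monom of_real_sum
  by (intro sum.cong refl) (simp add: power_divide)

lemma coeff_laguerre_poly:
  "coeff (laguerre_poly k a) i = (if i \<le> k then of_real ((-1) ^ i * ((real k + a) gchoose (k - i)) / (4 ^ i * fact i)) else 0)"
  by (simp add: laguerre_poly_def coeff_sum coeff_monom sum.delta)

text \<open>Triangular elimination from the top degree down, so that approximation by polynomials
  becomes approximation by finite combinations of the basis.\<close>

lemma poly_span:
  fixes Q :: "nat \<Rightarrow> 'a::field poly"
  assumes Q: "\<And>k. degree (Q k) \<le> k" "\<And>k. coeff (Q k) k \<noteq> 0"
  shows "(\<forall>i\<ge>N. coeff P i = 0) \<Longrightarrow> \<exists>a. P = (\<Sum>k<N. smult (a k) (Q k))"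
proof (induction N arbitrary: P)
  case 0
  then show ?case by (simp add: poly_eq_iff)
next
  case (Suc N)
  let ?b = "coeff P N / coeff (Q N) N"
  have "\<forall>i\<ge>N. coeff (P - smult ?b (Q N)) i = 0"
  proof (intro allI impI)
    fix i assume "N \<le> i"
    then consider "i = N" | "Suc N \<le> i" by linarith
    then show "coeff (P - smult ?b (Q N)) i = 0"
    proof cases
      case 2
      then have "coeff (Q N) i = 0" using Q(1)[of N] by (intro coeff_eq_0) linarith
      with 2 Suc.prems show ?thesis by simp
    qed (use Q(2) in simp)
  qed
  from Suc.IH[OF this] obtain a where "P - smult ?b (Q N) = (\<Sum>k<N. smult (a k) (Q k))" by blast
  then have "P = (\<Sum>k<N. smult (a k) (Q k)) + smult ?b (Q N)" by (simp add: diff_eq_eq)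
  also have "\<dots> = (\<Sum>k<Suc N. smult ((a(N := ?b)) k) (Q k))" by simp
  finally show ?case by blast
qed

section \<open>The basis\<close>

lemma sq_integrable_gauss_meas_poly:
  assumes p: "p > 0"
  shows "sq_integrable (gauss_meas p) (\<lambda>\<rho>. poly P (of_real (\<rho>\<^sup>2)))"
proof -
  have mono: "sq_integrable (gauss_meas p) (\<lambda>\<rho>. of_real (\<rho>\<^sup>2) ^ i)" for i
    unfolding sq_integrable_def
  proof
    have "integrable (gauss_meas p) (\<lambda>\<rho>. 16 ^ i * (\<rho>\<^sup>2 / 4) ^ (2 * i))"
      by (intro integrable_mult_right integrable_gauss_meas_power p)
    moreover have "16 ^ i * (\<rho>\<^sup>2 / 4) ^ (2 * i) = (norm (complex_of_real (\<rho>\<^sup>2) ^ i))\<^sup>2" for \<rho> :: real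
    proof -
      have "(norm (complex_of_real (\<rho>\<^sup>2) ^ i))\<^sup>2 = (\<rho>\<^sup>2) ^ (2 * i)"
        by (simp only: norm_power norm_of_real power_mult[symmetric] mult.commute[of i] mult.assoc abs_power2)
      moreover have "(4 :: real) ^ (2 * i) = 16 ^ i" by (simp add: power_mult)
      ultimately show ?thesis by (simp add: power_divide)
    qed
    ultimately show "integrable (gauss_meas p) (\<lambda>\<rho>. (norm (complex_of_real (\<rho>\<^sup>2) ^ i))\<^sup>2)" by simp
  qed measurable
  have "sq_integrable (gauss_meas p) (\<lambda>\<rho>. \<Sum>i<N. coeff P i * of_real (\<rho>\<^sup>2) ^ i)" for N
  proof (induction N)
    case 0
    then show ?case by (simp add: sq_integrable_def)
  next
    case (Suc N)
    from sq_integrable_lincomb[OF this mono, of 1 "coeff P N" N] show ?case by simp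
  qed
  from this[of "Suc (degree P)"] show ?thesis by (simp only: poly_altdef lessThan_Suc_atMost)
qed

definition poly_weight :: "real \<Rightarrow> complex poly \<Rightarrow> real \<Rightarrow> complex" where
  "poly_weight s P r = poly P (of_real (r powr (2 * s)))"

lemma rho_fun_poly_weight: "s > 0 \<Longrightarrow> \<rho> > 0 \<Longrightarrow> rho_fun s (poly_weight s P) \<rho> = poly P (of_real (\<rho>\<^sup>2))"
  by (simp add: rho_fun_def poly_weight_def powr_powr)

lemma AE_rho_fun_poly_weight:
  assumes "s > 0" "p > 0"
  shows "AE \<rho> in gauss_meas p. rho_fun s (poly_weight s P) \<rho> = poly P (of_real (\<rho>\<^sup>2))"
  unfolding AE_gauss_meas_iff using AE_pow_meas_pos[OF assms(2)]
  by eventually_elim (rule rho_fun_poly_weight[OF assms(1)])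

lemma measurable_poly_weight: "poly_weight s P \<in> borel_measurable borel"
  unfolding poly_weight_def[abs_def]
  by (rule measurable_compose[where f = "\<lambda>r. r powr (2 * s)" and N = borel and g = "\<lambda>x. poly P (of_real x)"])
     (measurable, intro borel_measurable_continuous_onI continuous_intros)

lemma poly_weight_weighted_L2:
  assumes n: "n > 0" and s: "s > 0"
  shows "poly_weight s P \<in> weighted_L2 n s"
proof -
  have n': "real n > 0" using n by simp
  have m: "set_borel_measurable borel {0<..} (poly_weight s P)"
    unfolding set_borel_measurable_def using measurable_poly_weight[of s P] by measurable
  have "sq_integrable (gauss_meas (real n)) (rho_fun s (poly_weight s P))"
  proof (rule sq_integrable_cong_AE[OF sq_integrable_gauss_meas_poly])
    show "AE \<rho> in gauss_meas (real n). poly P (of_real (\<rho>\<^sup>2)) = rho_fun s (poly_weight s P) \<rho>"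
      using AE_rho_fun_poly_weight[OF s n', of P] by eventually_elim simp
    show "rho_fun s (poly_weight s P) \<in> borel_measurable (gauss_meas (real n))" using measurable_rho_fun[OF m] by measurable
  qed (rule n')
  with m show ?thesis unfolding weighted_L2_iff[OF n s] by blast
qed

lemma Phi_star_poly_weight_sum:
  fixes Q :: "nat \<Rightarrow> complex poly"
  assumes s: "s > 0"
  shows "Phi_star s (poly_weight s (\<Sum>k<N. smult (a k) (Q k))) (u :: 'n::finite dist) =
    (\<Sum>k<N. a k * Phi_star s (poly_weight s (Q k)) u)"
proof (induction N)
  case 0
  have "poly_weight s 0 = (\<lambda>r. 0)" by (simp add: poly_weight_def fun_eq_iff)
  then show ?case by (simp add: Phi_star_def)
next
  case (Suc N)
  have n: "CARD('n) > 0" by simp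
  have e: "poly_weight s (\<Sum>k<Suc N. smult (a k) (Q k)) = (\<lambda>r. 1 * poly_weight s (\<Sum>k<N. smult (a k) (Q k)) r + a N * poly_weight s (Q N) r)"
    by (simp add: poly_weight_def fun_eq_iff)
  show ?case
    unfolding e Phi_star_lincomb[OF s poly_weight_weighted_L2[OF n s] poly_weight_weighted_L2[OF n s]] Suc.IH by simp
qed

lemma inner_ddag_poly_weight:
  fixes P Q :: "complex poly"
  assumes s: "s > 0"
  shows "inner_ddag s (Phi_star s (poly_weight s P)) (Phi_star s (poly_weight s Q) :: 'n::finite dist \<Rightarrow> complex) =
     of_real (1 / (s * real CARD('n))) * (LINT \<rho>|gauss_meas (real CARD('n)). poly P (of_real (\<rho>\<^sup>2)) * cnj (poly Q (of_real (\<rho>\<^sup>2))))"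
proof -
  have n: "CARD('n) > 0" and n0: "real CARD('n) > 0" by simp_all
  note V = poly_weight_weighted_L2[OF n s]
  have [measurable]: "rho_fun s (poly_weight s P) \<in> borel_measurable borel" for P
    using V[of P] unfolding weighted_L2_iff[OF n s] by (auto intro: measurable_rho_fun)
  have [measurable]: "cnj \<in> borel_measurable borel" "(\<lambda>\<rho>::real. poly P (complex_of_real (\<rho>\<^sup>2))) \<in> borel_measurable borel" for P
    by (intro borel_measurable_continuous_onI continuous_intros)+
  have "(LINT \<rho>|gauss_meas (real CARD('n)). rho_fun s (poly_weight s P) \<rho> * cnj (rho_fun s (poly_weight s Q) \<rho>)) =
     (LINT \<rho>|gauss_meas (real CARD('n)). poly P (of_real (\<rho>\<^sup>2)) * cnj (poly Q (of_real (\<rho>\<^sup>2))))"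
  proof (rule integral_cong_AE)
    show "AE \<rho> in gauss_meas (real CARD('n)). rho_fun s (poly_weight s P) \<rho> * cnj (rho_fun s (poly_weight s Q) \<rho>) = poly P (of_real (\<rho>\<^sup>2)) * cnj (poly Q (of_real (\<rho>\<^sup>2)))"
      using AE_rho_fun_poly_weight[OF s n0, of P] AE_rho_fun_poly_weight[OF s n0, of Q] by eventually_elim simp
  qed measurable
  then show ?thesis unfolding inner_ddag_Phi_star[OF s V V] by simp
qed

lemma Phi_star_poly_weight_dense:
  assumes s: "s > 0" and w: "w \<in> (L2ddag s :: ('n::finite dist \<Rightarrow> complex) set)" and \<epsilon>: "\<epsilon> > 0"
  obtains P where "sqrt (Re (inner_ddag s (\<lambda>u. w u - Phi_star s (poly_weight s P) u) (\<lambda>u. w u - Phi_star s (poly_weight s P) u))) < \<epsilon>"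
proof -
  let ?n = "real CARD('n)"
  let ?\<mu> = "gauss_meas ?n"
  have n: "CARD('n) > 0" and n0: "?n > 0" by simp_all
  from w obtain W where W: "W \<in> weighted_L2 CARD('n) s" and wW: "w = Phi_star s W" by (auto simp: L2ddag_def)
  have sq: "sq_integrable ?\<mu> (rho_fun s W)" using W unfolding weighted_L2_iff[OF n s] by blast
  have "rho_fun s W \<in> L2_closure ?\<mu> (range (\<lambda>p :: complex poly. \<lambda>x::real. poly p (of_real (x\<^sup>2))))"
  \<comment> \<open>With \<open>d = 1 / 16\<close> the required growth
    \<open>exp (2 * d * \<rho>^2)\<close> is \<open>exp (\<rho>^2 / 8)\<close>, which the density
    \<open>exp (- \<rho>^2 / 4)\<close> still dominates.\<close>
  proof (rule even_polynomials_dense[where d = "1 / 16"])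
    show "AE x in ?\<mu>. x > 0" unfolding AE_gauss_meas_iff by (rule AE_pow_meas_pos[OF n0])
    fix m :: nat
    have meas: "(\<lambda>x::real. x ^ (2 * m) * exp (2 * (1 / 16) * x\<^sup>2)) \<in> borel_measurable borel" by measurable
    have ae: "AE x in pow_meas ?n. x powr (2 * real m) * exp (- (1 / 8 * x\<^sup>2)) = exp (- (x\<^sup>2 / 4)) *\<^sub>R (x ^ (2 * m) * exp (2 * (1 / 16) * x\<^sup>2))"
      using AE_pow_meas_pos[OF n0]
    proof eventually_elim
      case (elim x)
      have "x powr (2 * real m) = x ^ (2 * m)" using powr_realpow[OF elim, of "2 * m"] by simp
      moreover have "exp (- (x\<^sup>2 / 4)) * exp (2 * (1 / 16) * x\<^sup>2) = exp (- (1 / 8 * x\<^sup>2))" by (simp add: exp_add[symmetric])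
      ultimately show ?case by simp
    qed
    have i: "integrable (pow_meas ?n) (\<lambda>x. x powr (2 * real m) * exp (- (1 / 8 * x\<^sup>2)))"
      by (rule integrable_pow_meas_gauss) (auto intro: add_nonneg_pos)
    show "integrable ?\<mu> (\<lambda>x. x ^ (2 * m) * exp (2 * (1 / 16) * x\<^sup>2))"
      unfolding integrable_gauss_meas[OF meas] by (rule integrable_cong_AE_imp[OF i _ ae]) measurable
  qed (use sq in auto)
  \<comment> \<open>The factor \<open>s * n\<close> compensates the constant
    \<open>1 / (s * n)\<close> in \<open>inner_ddag_Phi_star\<close>, and the square compensates the
    root in the norm.\<close>
  moreover have "\<epsilon>\<^sup>2 * (s * ?n) > 0" using s \<epsilon> by simp
  ultimately obtain P where P: "(LINT \<rho>|?\<mu>. (norm (rho_fun s W \<rho> - poly P (of_real (\<rho>\<^sup>2))))\<^sup>2) < \<epsilon>\<^sup>2 * (s * ?n)"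
    unfolding L2_closure_def by blast
  let ?D = "\<lambda>r. 1 * W r + (- 1) * poly_weight s P r"
  note V = poly_weight_weighted_L2[OF n s]
  have D: "?D \<in> weighted_L2 CARD('n) s" by (rule weighted_L2_lincomb[OF n s W V])
  have d: "(\<lambda>u. w u - Phi_star s (poly_weight s P) u) = Phi_star s ?D"
    unfolding wW fun_eq_iff Phi_star_lincomb[OF s W V] by simp
  have [measurable]: "rho_fun s ?D \<in> borel_measurable borel" "rho_fun s W \<in> borel_measurable borel"
    using D W unfolding weighted_L2_iff[OF n s] by (auto intro: measurable_rho_fun)
  have [measurable]: "cnj \<in> borel_measurable borel" "(\<lambda>\<rho>::real. poly P (complex_of_real (\<rho>\<^sup>2))) \<in> borel_measurable borel"
    by (intro borel_measurable_continuous_onI continuous_intros)+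
  have rD: "rho_fun s ?D \<rho> = rho_fun s W \<rho> - rho_fun s (poly_weight s P) \<rho>" for \<rho>
    unfolding rho_fun_lincomb by simp
  have "(LINT \<rho>|?\<mu>. rho_fun s ?D \<rho> * cnj (rho_fun s ?D \<rho>)) = (LINT \<rho>|?\<mu>. of_real ((norm (rho_fun s W \<rho> - poly P (of_real (\<rho>\<^sup>2))))\<^sup>2))"
  proof (rule integral_cong_AE)
    show "AE \<rho> in ?\<mu>. rho_fun s ?D \<rho> * cnj (rho_fun s ?D \<rho>) = of_real ((norm (rho_fun s W \<rho> - poly P (of_real (\<rho>\<^sup>2))))\<^sup>2)"
      using AE_rho_fun_poly_weight[OF s n0, of P]
      unfolding rD by eventually_elim (simp only: complex_norm_square)
  qed measurable
  then have "inner_ddag s (Phi_star s ?D) (Phi_star s ?D :: 'n dist \<Rightarrow> complex) =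
     of_real (1 / (s * ?n) * (LINT \<rho>|?\<mu>. (norm (rho_fun s W \<rho> - poly P (of_real (\<rho>\<^sup>2))))\<^sup>2))"
    unfolding inner_ddag_Phi_star[OF s D D] by (simp only: integral_complex_of_real of_real_mult)
  then have "Re (inner_ddag s (Phi_star s ?D) (Phi_star s ?D :: 'n dist \<Rightarrow> complex)) =
     1 / (s * ?n) * (LINT \<rho>|?\<mu>. (norm (rho_fun s W \<rho> - poly P (of_real (\<rho>\<^sup>2))))\<^sup>2)" by (simp only: Re_complex_of_real)
  also have "\<dots> < \<epsilon>\<^sup>2"
    using P s by (simp add: field_simps)
  finally have "sqrt (Re (inner_ddag s (Phi_star s ?D) (Phi_star s ?D :: 'n dist \<Rightarrow> complex))) < \<epsilon>"
    using \<epsilon> real_sqrt_less_mono[of _ "\<epsilon>\<^sup>2"] by fastforce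
  then show ?thesis by (intro that[of P]) (simp only: d)
qed

text \<open>The scalar \<open>q\<close> is carried along so that the statement applies directly to
  the normalised basis elements.\<close>

lemma Phi_star_laguerre_poly_L_op:
  fixes u :: "'n::finite dist"
  assumes s: "s > 0" and u: "u \<in> dom_L s"
  shows "Phi_star s (poly_weight s (smult q (laguerre_poly k ((real CARD('n) - 2) / 2)))) (L_op s u) =
     of_nat k * Phi_star s (poly_weight s (smult q (laguerre_poly k ((real CARD('n) - 2) / 2)))) u"
proof -
  let ?n = "real CARD('n)" and ?P = "smult q (laguerre_poly k ((real CARD('n) - 2) / 2))"
  have n: "CARD('n) > 0" and n0: "?n > 0" by simp_all
  have uL: "u \<in> L2dag s" "L_op s u \<in> L2dag s" using u by (auto simp: dom_L_def)
  obtain f g \<alpha> where ud: "dag_data s u f g \<alpha>" using L2dag_data[OF s uL(1)] by blast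
  obtain F G A where vd: "dag_data s (L_op s u) F G A" using L2dag_data[OF s uL(2)] by blast
  have Vm: "set_borel_measurable borel {0<..} (poly_weight s ?P)"
    using poly_weight_weighted_L2[OF n s, of ?P] unfolding weighted_L2_iff[OF n s] by blast
  note [measurable] = measurable_rho_fun[OF Vm, of s]
  have lm [measurable]: "(\<lambda>r::real. laguerre k ((?n - 2) / 2) (r\<^sup>2 / 4)) \<in> borel_measurable borel"
    unfolding laguerre_def by measurable
  have *: "Phi_star s (poly_weight s ?P) v = of_real (1 / (s * ?n)) * (q * (LINT r|pow_meas ?n. f r * of_real (laguerre k ((?n - 2) / 2) (r\<^sup>2 / 4))))"
    if v: "v \<in> L2dag s" "dag_data s v f g \<alpha>" for v :: "'n dist" and f g \<alpha>
  proof -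
    have f [measurable]: "f \<in> borel_measurable borel" and d: "AE r in pow_meas ?n. dagger s v r = f r"
      using v(2) unfolding dag_data_def by blast+
    have "(LINT r|pow_meas ?n. f r * rho_fun s (poly_weight s ?P) r) = (LINT r|pow_meas ?n. q * (f r * of_real (laguerre k ((?n - 2) / 2) (r\<^sup>2 / 4))))"
    proof (rule integral_cong_AE)
      show "AE r in pow_meas ?n. f r * rho_fun s (poly_weight s ?P) r = q * (f r * of_real (laguerre k ((?n - 2) / 2) (r\<^sup>2 / 4)))"
        using AE_pow_meas_pos[OF n0]
        by eventually_elim (simp only: rho_fun_poly_weight[OF s] poly_smult poly_laguerre_poly mult_ac)
    qed measurable
    then show ?thesis unfolding Phi_star_eq[OF s v(1) Vm f d] by (simp only: integral_mult_right_zero)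
  qed
  show ?thesis
    unfolding *[OF uL(1) ud] *[OF uL(2) vd] laguerre_pairing_L_op[OF s ud vd] by (simp only: mult_ac)
qed

lemma is_L_star_unique:
  fixes w v v' :: "'n::finite dist \<Rightarrow> complex"
  assumes s: "s > 0" and v: "is_L_star s w v" and v': "is_L_star s w v'"
  shows "v = v'"
proof -
  from v v' obtain V V' where V: "V \<in> weighted_L2 CARD('n) s" "v = Phi_star s V"
    and V': "V' \<in> weighted_L2 CARD('n) s" "v' = Phi_star s V'"
    by (auto simp: is_L_star_def L2ddag_def)
  have "Phi_star s V u = Phi_star s V' u" if "u \<in> dom_L s" for u :: "'n dist"
    using v v' that by (simp add: is_L_star_def V(2) V'(2))
  from Phi_star_cong_AE[OF s V(1) V'(1) Phi_star_inj_AE[OF s V(1) V'(1) this]] show ?thesis unfolding V(2) V'(2) .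
qed

theorem theorem1p3:
  fixes s :: real
  assumes "0 < s" and "s < 1" and "real CARD('n::finite) \<ge> 2 * s"
  shows "\<exists>\<omega> :: nat \<Rightarrow> 'n dist \<Rightarrow> complex.
    orthonormal_basis (L2ddag s) (inner_ddag s) \<omega> \<and>
    (\<forall>k. \<omega> k \<in> dom_L_star s \<and> L_star s (\<omega> k) = (\<lambda>u. of_nat k * \<omega> k u)) \<and>
    (\<forall>k. \<exists>c. c \<noteq> 0 \<and> \<omega> k = (\<lambda>u. c * Phi_star s
       (\<lambda>r. of_real (2 * s / Gamma (real k + real CARD('n) / 2) *
             laguerre k ((real CARD('n) - 2) / 2) (r powr (2 * s) / 4))) u))"
proof -
  let ?n = "real CARD('n)"
  have s: "s > 0" by fact
  have n: "CARD('n) > 0" and n0: "?n > 0" by simp_all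
  note V = poly_weight_weighted_L2[OF n s]
  let ?l = "\<lambda>k. laguerre_poly k ((?n - 2) / 2)"
  \<comment> \<open>The squared norm of the functional of the \<open>k\<close>-th Laguerre
    polynomial: the Laguerre integral times the constant \<open>1 / (s * n)\<close> of the scalar
    product.\<close>
  define N where "N k = 1 / (s * ?n) * (?n / 2 * 4 powr (?n / 2) * Gamma (real k + ?n / 2) / fact k)" for k
  have G: "Gamma (real k + ?n / 2) > 0" for k by (rule Gamma_real_pos) (auto intro: add_nonneg_pos)
  have N: "N k > 0" for k unfolding N_def using s G[of k] by (intro mult_pos_pos divide_pos_pos) auto
  define q where "q k = 1 / sqrt (N k)" for k
  have q: "q k > 0" "(q k)\<^sup>2 * N k = 1" for k using N[of k] by (simp_all add: q_def power_divide)
  define Q where "Q k = smult (complex_of_real (q k)) (?l k)" for k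
  define \<omega> where "\<omega> k = (Phi_star s (poly_weight s (Q k)) :: 'n dist \<Rightarrow> complex)" for k
  have \<omega>: "\<omega> k \<in> L2ddag s" for k unfolding \<omega>_def L2ddag_def using V by blast
  have Qx: "poly (Q k) (of_real x) = of_real (q k * laguerre k ((?n - 2) / 2) (x / 4))" for k x
    by (simp add: Q_def poly_laguerre_poly)
  have orth: "inner_ddag s (\<omega> j) (\<omega> k) = (if j = k then 1 else 0)" for j k
  proof -
    have "inner_ddag s (\<omega> j) (\<omega> k) = of_real (1 / (s * ?n)) * (LINT \<rho>|gauss_meas ?n.
        of_real (q j * q k * (laguerre j ((?n - 2) / 2) (\<rho>\<^sup>2 / 4) * laguerre k ((?n - 2) / 2) (\<rho>\<^sup>2 / 4))))"
      unfolding \<omega>_def inner_ddag_poly_weight[OF s] Qx complex_cnj_complex_of_real by (simp only: of_real_mult mult_ac)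
    also have "\<dots> = of_real (1 / (s * ?n) * (q j * q k * (if j = k then ?n / 2 * 4 powr (?n / 2) * Gamma (real k + ?n / 2) / fact k else 0)))"
      unfolding integral_complex_of_real integral_mult_right_zero integral_laguerre_laguerre[OF n0] of_real_mult[symmetric] ..
    also have "\<dots> = of_real (if j = k then (q k)\<^sup>2 * N k else 0)"
      by (rule arg_cong[where f = of_real]) (simp add: N_def power2_eq_square mult_ac)
    finally show ?thesis by (simp add: q(2))
  qed
  have deg: "degree (Q k) \<le> k" for k
    by (rule degree_le) (simp add: Q_def coeff_laguerre_poly)
  have lead: "coeff (Q k) k \<noteq> 0" for k using q(1)[of k] by (simp add: Q_def coeff_laguerre_poly)
  have complete: "\<exists>N a. sqrt (Re (inner_ddag s (\<lambda>u. w u - (\<Sum>k<N. a k * \<omega> k u)) (\<lambda>u. w u - (\<Sum>k<N. a k * \<omega> k u)))) < \<epsilon>"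
    if w: "w \<in> L2ddag s" and \<epsilon>: "\<epsilon> > 0" for w \<epsilon>
  proof -
    obtain P where P: "sqrt (Re (inner_ddag s (\<lambda>u. w u - Phi_star s (poly_weight s P) u) (\<lambda>u. w u - Phi_star s (poly_weight s P) u))) < \<epsilon>"
      by (rule Phi_star_poly_weight_dense[OF s w \<epsilon>])
    \<comment> \<open>The \<open>Q k\<close> have degree exactly \<open>k\<close>, so the
      approximating polynomial is a combination of the first \<open>degree P + 1\<close> of
      them.\<close>
    have "\<forall>i\<ge>Suc (degree P). coeff P i = 0" by (auto intro: coeff_eq_0)
    from poly_span[OF deg lead this] obtain a where a: "P = (\<Sum>k<Suc (degree P). smult (a k) (Q k))" by blast
    have e: "Phi_star s (poly_weight s P) u = (\<Sum>k<Suc (degree P). a k * \<omega> k u)" for u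
      by (subst a) (simp only: Phi_star_poly_weight_sum[OF s] \<omega>_def)
    show ?thesis using P unfolding e by blast
  qed
  have eigen: "is_L_star s (\<omega> k) (\<lambda>u. of_nat k * \<omega> k u)" for k
    unfolding is_L_star_def
  proof
    \<comment> \<open>The summand with coefficient 0 only puts the scalar multiple into the two-term
      form of \<open>Phi_star_lincomb\<close>.\<close>
    have "(\<lambda>u. of_nat k * \<omega> k u) = Phi_star s (\<lambda>r. of_nat k * poly_weight s (Q k) r + 0 * poly_weight s (Q k) r)"
      unfolding fun_eq_iff Phi_star_lincomb[OF s V V] by (simp add: \<omega>_def)
    then show "(\<lambda>u. of_nat k * \<omega> k u) \<in> L2ddag s"
      unfolding L2ddag_def using weighted_L2_lincomb[OF n s V V] by blast
    show "\<forall>u\<in>dom_L s. of_nat k * \<omega> k u = \<omega> k (L_op s u)"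
      unfolding \<omega>_def Q_def by (simp add: Phi_star_laguerre_poly_L_op[OF s])
  qed
  have basis: "orthonormal_basis (L2ddag s) (inner_ddag s) \<omega>"
    unfolding orthonormal_basis_def Let_def
  proof (intro conjI allI ballI impI)
    show "\<omega> k \<in> L2ddag s" "inner_ddag s (\<omega> j) (\<omega> k) = (if j = k then 1 else 0)" for j k by (rule \<omega> orth)+
  qed (rule complete)
  have dom: "\<omega> k \<in> dom_L_star s" for k unfolding dom_L_star_def using \<omega> eigen by blast
  have L: "L_star s (\<omega> k) = (\<lambda>u. of_nat k * \<omega> k u)" for k
    unfolding L_star_def by (rule the_equality, rule eigen, rule is_L_star_unique[OF s _ eigen])
  have expr: "\<exists>c. c \<noteq> 0 \<and> \<omega> k = (\<lambda>u. c * Phi_star s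
       (\<lambda>r. of_real (2 * s / Gamma (real k + ?n / 2) * laguerre k ((?n - 2) / 2) (r powr (2 * s) / 4))) u)" for k
  proof -
    define b where "b = 2 * s / Gamma (real k + ?n / 2)"
    have b: "b \<noteq> 0" using s G[of k] by (simp add: b_def)
    let ?B = "smult (complex_of_real b) (?l k)"
    have e: "poly_weight s ?B = (\<lambda>r. of_real (b * laguerre k ((?n - 2) / 2) (r powr (2 * s) / 4)))"
      by (simp add: poly_weight_def fun_eq_iff poly_laguerre_poly)
    \<comment> \<open>The stated profile is a nonzero multiple of the normalised one; the
      multiplicative constant of the statement is \<open>q k / b\<close>.\<close>
    have Qe: "poly_weight s (Q k) = (\<lambda>r. of_real (q k / b) * poly_weight s ?B r + 0 * poly_weight s ?B r)"
      using b by (simp add: poly_weight_def fun_eq_iff Q_def)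
    have "\<omega> k = (\<lambda>u. of_real (q k / b) * Phi_star s (poly_weight s ?B) u)"
      unfolding \<omega>_def Qe fun_eq_iff Phi_star_lincomb[OF s V V] by simp
    moreover have "complex_of_real (q k / b) \<noteq> 0" using b q(1)[of k] by simp
    ultimately show ?thesis unfolding e b_def[symmetric] by (intro exI[of _ "of_real (q k / b)"] conjI)
  qed
  show ?thesis
  proof (intro exI[of _ \<omega>] conjI allI)
    show "orthonormal_basis (L2ddag s) (inner_ddag s) \<omega>" by (rule basis)
    fix k
    show "\<omega> k \<in> dom_L_star s" "L_star s (\<omega> k) = (\<lambda>u. of_nat k * \<omega> k u)" by (rule dom L)+
    show "\<exists>c. c \<noteq> 0 \<and> \<omega> k = (\<lambda>u. c * Phi_star s
       (\<lambda>r. of_real (2 * s / Gamma (real k + ?n / 2) * laguerre k ((?n - 2) / 2) (r powr (2 * s) / 4))) u)"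
      by (rule expr)
  qed
qed

end
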